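(* Let $\tau\in\mathbb{R}$, let $\sigma\in S(m^{-\tau},g)$, and assume that for some $\kappa\in[1,2]$ the weight $m$ satisfies $$\langle\xi\rangle^{\kappa/2}\le C\, m(x,\xi)\qquad\text{for all }(x,\xi)\in\mathbb{R}^n\times\mathbb{R}^n$$ with a constant $C>0$ independent of $(x,\xi)$. Suppose that the system $\mathbb{X}=\{X_j:1\le j\le k\}$, with $A(x)=\sum_{j=1}^kX_j^*(x)X_j(x)$, satisfies the Uniform Hörmander Condition (UHC) at step $r\in\mathbb{N}$. Assume that $$\tau\ \ge\ \max\left\{\frac{n(4-\kappa^2)-r_0(4-2\kappa)}{2\kappa^2},\ \frac{n}{\kappa}\left(1-\frac{\kappa}{2r}\right)\right\}.$$ Then the pseudo-differential operator $\sigma(x,D)$ is bounded from $L^1(\mathbb{R}^n)$ to $L^{1,\infty}(\mathbb{R}^n)$ (i.e. it is of weak $(1,1)$ type).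
   Context: Notation: $\langle\xi\rangle=(1+|\xi|^2)^{1/2}$. Setting. $A(x)=(a_{ij}(x))$, $x\in\mathbb{R}^n$, is a positive semi-definite $n\times n$ matrix whose entries are smooth and uniformly bounded on $\mathbb{R}^n$ together with all their derivatives, with $\mathrm{rank}(A(x))\ge r_0\ge 1$ for all $x$. Put $a(x,\xi)=\sum_{i,j}a_{ij}(x)\xi_i\xi_j$, $$m(x,\xi)=\sqrt{a(x,\xi)+\langle\xi\rangle},\qquad g_{(x,\xi)}(dx,d\xi)=m(x,\xi)^{-2}\left(\langle\xi\rangle^2dx^2+d\xi^2\right).$$ One writes $A(x)=\sum_{j=1}^kX_j^*(x)X_j(x)$, where each $X_j$ is a smooth bounded vector field on $\mathbb{R}^n$. Uniform Hörmander Condition. Let $X^{(1)}=\{X_1,\dots,X_k\}$, $X^{(2)}=\{[X_i,X_j]:1\le i<j\le k\}$, and so on, so that $X^{(s)}$ consists of the commutators of length $s$; an element $Y_j\in X^{(s)}$ has degree $d_j=s$. The system satisfies the Hörmander Condition at step $r$ if the vector fields together with their commutators up to length $r$ span $\mathbb{R}^n$ at each point. It satisfies the Uniform Hörmander Condition (UHC) at step $r$ if moreover there is $c_0>0$ such that for any spanning subset of $n$ of these vector fields $Y_{j_1},\dots,Y_{j_n}$ one has $|\det(Y_{j_1},\dots,Y_{j_n})(x)|\ge c_0$ for every $x\in\mathbb{R}^n$. Symbol classes. For a positive weight $M$ on $\mathbb{R}^{2n}$, $S(M,g)$ is the set of smooth functions $\sigma$ on $\mathbb{R}^{2n}$ such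 that for every integer $k\geq 0$ there is $C_k>0$ with $$|\sigma^{(k)}(x,\xi)((t_1,\tau_1),\dots,(t_k,\tau_k))|\le C_kM(x,\xi)\prod_{j=1}^kg_{(x,\xi)}^{1/2}(t_j,\tau_j)$$ for all $(x,\xi),(t_j,\tau_j)\in\mathbb{R}^{2n}$, where $\sigma^{(k)}(x,\xi)(\cdot)$ denotes the $k$-th order directional derivative. Quantization: $\sigma(x,D)f(x)=\int_{\mathbb{R}^n}\int_{\mathbb{R}^n}e^{i(x-y)\cdot\xi}\sigma(x,\xi)f(y)\,d\xi\,dy$ (Kohn–Nirenberg). $L^{1,\infty}$ is the weak $L^1$ space, with quasi-norm $\sup_{\lambda>0}\lambda|\{x:|u(x)|>\lambda\}|$. *)

theory Defs
  imports "HOL-Analysis.Analysis"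
begin

section \<open>Smooth functions and iterated directional derivatives\<close>

text \<open>The \<open>k\<close>-th order derivative of \<open>f\<close> at \<open>x\<close> in the directions \<open>v\<^sub>1, \<dots>, v\<^sub>k\<close> is
  \<open>iter_deriv f [v\<^sub>1, \<dots>, v\<^sub>k] x\<close>.\<close>

fun iter_deriv ::
  "('a::real_normed_vector \<Rightarrow> 'b::real_normed_vector) \<Rightarrow> 'a list \<Rightarrow> 'a \<Rightarrow> 'b" where
  "iter_deriv f [] = f"
| "iter_deriv f (v # vs) = (\<lambda>x. frechet_derivative (iter_deriv f vs) (at x) v)"

text \<open>On a finite-dimensional domain this is the usual notion of \<open>C\<^sup>\<infinity>\<close>: each iterated directional
  derivative is Frechet differentiable, hence continuous. In particular \<open>frechet_derivative\<close> is
  never used above at a point of non-differentiability.\<close>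

definition smooth :: "('a::real_normed_vector \<Rightarrow> 'b::real_normed_vector) \<Rightarrow> bool" where
  "smooth f \<longleftrightarrow> (\<forall>vs x. iter_deriv f vs differentiable (at x))"

definition bounded_with_derivatives ::
  "('a::real_normed_vector \<Rightarrow> 'b::real_normed_vector) \<Rightarrow> bool" where
  "bounded_with_derivatives f \<longleftrightarrow> (\<forall>vs. bounded (range (iter_deriv f vs)))"

definition schwartz :: "('a::euclidean_space \<Rightarrow> complex) \<Rightarrow> bool" where
  "schwartz f \<longleftrightarrow> smooth f \<and>
     (\<forall>vs (N::nat). bounded (range (\<lambda>x. (1 + norm x) ^ N *\<^sub>R iter_deriv f vs x)))"


section \<open>Vector fields and the Uniform Hoermander Condition\<close>

definition lie_bracket :: "(real^'n \<Rightarrow> real^'n) \<Rightarrow> (real^'n \<Rightarrow> real^'n) \<Rightarrow> real^'n \<Rightarrow> real^'n" where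
  "lie_bracket Y Z x =
     frechet_derivative Z (at x) (Y x) - frechet_derivative Y (at x) (Z x)"

text \<open>\<open>commutator X k s Y\<close> says that \<open>Y\<close> is a commutator of length \<open>s\<close> of \<open>X\<^sub>1, \<dots>, X\<^sub>k\<close>, with any
  bracketing. Besides the brackets \<open>[X\<^sub>i, X\<^sub>j]\<close> with \<open>i < j\<close>, length two contains their
  negatives and zero. This is harmless below: a basis contains neither zero nor two opposite
  fields, and a change of sign does not affect the absolute value of a determinant.\<close>

inductive commutator ::
  "(nat \<Rightarrow> real^'n \<Rightarrow> real^'n) \<Rightarrow> nat \<Rightarrow> nat \<Rightarrow> (real^'n \<Rightarrow> real^'n) \<Rightarrow> bool"
  for X :: "nat \<Rightarrow> real^'n \<Rightarrow> real^'n" and k :: nat where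
  commutator_field: "j \<in> {1..k} \<Longrightarrow> commutator X k 1 (X j)"
| commutator_bracket:
    "commutator X k p Y \<Longrightarrow> commutator X k q Z \<Longrightarrow> commutator X k (p + q) (lie_bracket Y Z)"

definition commutators_upto ::
  "(nat \<Rightarrow> real^'n \<Rightarrow> real^'n) \<Rightarrow> nat \<Rightarrow> nat \<Rightarrow> (real^'n \<Rightarrow> real^'n) set" where
  "commutators_upto X k r = {Y. \<exists>s\<in>{1..r}. commutator X k s Y}"

definition hoermander :: "(nat \<Rightarrow> real^'n \<Rightarrow> real^'n) \<Rightarrow> nat \<Rightarrow> nat \<Rightarrow> bool" where
  "hoermander X k r \<longleftrightarrow> (\<forall>x. span ((\<lambda>Y. Y x) ` commutators_upto X k r) = UNIV)"

text \<open>A spanning subset of \<open>n\<close> fields is enumerated by the index type; "spanning" means spanning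
  \<open>\<real>\<^sup>n\<close> at each point, as in the Hoermander Condition. The fields are the rows of the matrix.\<close>

definition uniform_hoermander :: "(nat \<Rightarrow> real^'n \<Rightarrow> real^'n) \<Rightarrow> nat \<Rightarrow> nat \<Rightarrow> bool" where
  "uniform_hoermander X k r \<longleftrightarrow> hoermander X k r \<and>
     (\<exists>c\<^sub>0>0. \<forall>Y :: 'n \<Rightarrow> real^'n \<Rightarrow> real^'n.
        range Y \<subseteq> commutators_upto X k r \<and> (\<forall>x. span (range (\<lambda>i. Y i x)) = UNIV) \<longrightarrow>
        (\<forall>x. c\<^sub>0 \<le> \<bar>det (\<chi> i. Y i x)\<bar>))"


section \<open>The weight, the metric and the symbol classes\<close>

definition pos_semidef :: "real^'n^'n \<Rightarrow> bool" where
  "pos_semidef B \<longleftrightarrow> transpose B = B \<and> (\<forall>v. 0 \<le> v \<bullet> (B *v v))"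

definition japanese :: "'a::real_normed_vector \<Rightarrow> real" where
  "japanese \<xi> = sqrt (1 + (norm \<xi>)\<^sup>2)"

definition quad_form :: "(real^'n \<Rightarrow> real^'n^'n) \<Rightarrow> (real^'n) \<times> (real^'n) \<Rightarrow> real" where
  "quad_form A = (\<lambda>(x, \<xi>). \<Sum>i\<in>UNIV. \<Sum>j\<in>UNIV. A x $ i $ j * \<xi> $ i * \<xi> $ j)"

definition weight :: "(real^'n \<Rightarrow> real^'n^'n) \<Rightarrow> (real^'n) \<times> (real^'n) \<Rightarrow> real" where
  "weight A = (\<lambda>(x, \<xi>). sqrt (quad_form A (x, \<xi>) + japanese \<xi>))"

definition phase_metric ::
  "(real^'n \<Rightarrow> real^'n^'n) \<Rightarrow> (real^'n) \<times> (real^'n) \<Rightarrow> (real^'n) \<times> (real^'n) \<Rightarrow> real" where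
  "phase_metric A = (\<lambda>(x, \<xi>) (t, \<tau>).
     ((japanese \<xi>)\<^sup>2 * (norm t)\<^sup>2 + (norm \<tau>)\<^sup>2) / (weight A (x, \<xi>))\<^sup>2)"

definition symbol_class ::
  "((real^'n) \<times> (real^'n) \<Rightarrow> real) \<Rightarrow> ((real^'n) \<times> (real^'n) \<Rightarrow> (real^'n) \<times> (real^'n) \<Rightarrow> real) \<Rightarrow>
   ((real^'n) \<times> (real^'n) \<Rightarrow> complex) set" where
  "symbol_class M g = {\<sigma>. smooth \<sigma> \<and>
     (\<forall>k. \<exists>C>0. \<forall>p ts. length ts = k \<longrightarrow>
        norm (iter_deriv \<sigma> ts p) \<le> C * M p * (\<Prod>t\<leftarrow>ts. sqrt (g p t)))}"


section \<open>Pseudo-differential operators and weak type (1,1)\<close>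

text \<open>The double integral is read as usual for Schwartz functions \<open>f\<close>, with the integration in \<open>y\<close>
  carried out first; in the other order the integral need not converge absolutely.\<close>

definition pseudo_diff ::
  "((real^'n) \<times> (real^'n) \<Rightarrow> complex) \<Rightarrow> (real^'n \<Rightarrow> complex) \<Rightarrow> real^'n \<Rightarrow> complex" where
  "pseudo_diff \<sigma> f x =
     (LINT \<xi>|lborel. LINT y|lborel. exp (\<i> * of_real ((x - y) \<bullet> \<xi>)) * \<sigma> (x, \<xi>) * f y)"

definition weak_L1_qnorm :: "('a::euclidean_space \<Rightarrow> complex) \<Rightarrow> ennreal" where
  "weak_L1_qnorm u = (SUP s\<in>{0<..}. ennreal s * emeasure lborel {x. s < norm (u x)})"

text \<open>An operator \<open>P\<close> given on Schwartz functions is bounded from \<open>L\<^sup>1\<close> to \<open>L\<^sup>1\<^sup>,\<^sup>\<infinity>\<close> if it extends to a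
  bounded linear operator \<open>T\<close> between these spaces. Elements of \<open>L\<^sup>1\<close> and \<open>L\<^sup>1\<^sup>,\<^sup>\<infinity>\<close> are represented
  by functions, whence the almost-everywhere equalities. By linearity and the bound, \<open>T\<close>
  respects almost-everywhere equality and, Schwartz functions being dense in \<open>L\<^sup>1\<close>, it is unique.\<close>

definition bounded_L1_weak_L1 ::
  "(('a::euclidean_space \<Rightarrow> complex) \<Rightarrow> 'a \<Rightarrow> complex) \<Rightarrow> bool" where
  "bounded_L1_weak_L1 P \<longleftrightarrow>
     (\<exists>(T :: ('a \<Rightarrow> complex) \<Rightarrow> 'a \<Rightarrow> complex) (C :: real).
        (\<forall>f. schwartz f \<longrightarrow> (AE x in lborel. T f x = P f x)) \<and>
        (\<forall>f h. integrable lborel f \<longrightarrow> integrable lborel h \<longrightarrow>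
           (AE x in lborel. T (\<lambda>y. f y + h y) x = T f x + T h x)) \<and>
        (\<forall>f c. integrable lborel f \<longrightarrow> (AE x in lborel. T (\<lambda>y. c * f y) x = c * T f x)) \<and>
        (\<forall>f. integrable lborel f \<longrightarrow>
           T f \<in> borel_measurable lborel \<and>
           weak_L1_qnorm (T f) \<le> ennreal (C * (LINT x|lborel. norm (f x)))))"

end

(* From the lower bound on tau one gets m^(-tau) <= C <xi>^(-mu) with rho = kappa/2 and mu = n(1-rho)/2, so sigma is a
   Hoermander symbol of type (rho, 1-rho) and of the critical order -mu.
   The operator is cut into dyadic pieces T_l in frequency. Localising to windows of width 2^(-l(1-rho)) and integrating
   by parts shows that the T_l are almost orthogonal on L^2 and that their kernels satisfy the expected L^1 bounds.
   In a Calderon-Zygmund decomposition over dyadic cells, a bad part b_s at scale 2^(-s) is handled by cancellation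
   for l < s and by the decay of the kernel for s < rho l. In the middle range rho l <= s <= l neither works, and the
   bad parts are summed in L^2: the order -mu is exactly what compensates the loss there (Fefferman's argument).
   The weak type bound is uniform in the truncation of the dyadic sum, and T is the limit in measure. *)
theory Submission
  imports Defs
begin

section \<open>Smooth functions and uniform families\<close>

text \<open>All quadratic estimates are reduced to one inequality, whose right side is an energy
  \<open>EE\<close> that sees the input only through absolute values, at the scale 2^(-l). Inputs
  are general (\<open>datum\<close>: a density or a point mass), so the same inequality gives L^2
  bounds for functions, L^2 bounds for the columns of the kernel and from them their L^1 bounds, and
  the middle range, where the input varies with l. A window around q in x is transferred to the
  input by integrating by parts in \<xi> with the phase centred at q. This needs 1 - \<rho> <=
  \<rho>, that is \<kappa> >= 1. The middle range exists because a difference in y brings down a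
  factor \<xi> of size 2^l, while the kernel is concentrated at distance 2^(-\<rho> l). At \<kappa>
  = 2 the order is 0 and the L^2 norms of the pieces need not decay in l; the almost disjointness of
  the frequency shells replaces the decay. Frequencies start at l = 0, so cells of side 1 are the
  largest that occur; on them the decay of the kernel suffices for every l.\<close>

definition dird :: "'a::real_normed_vector => ('a => 'b::real_normed_vector) => 'a => 'b" where
  "dird v f = (%x. frechet_derivative f (at x) v)"

lemma iter_deriv_Cons: "iter_deriv f (v # vs) = dird v (iter_deriv f vs)"
  by (simp add: dird_def)

lemma iter_deriv_snoc: "iter_deriv f (vs @ [v]) = iter_deriv (dird v f) vs"
  by (induction vs) (simp_all add: dird_def)

declare iter_deriv.simps(2) [simp del]

lemma smooth_dird: "smooth f ==> smooth (dird v f)"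
  unfolding smooth_def by (metis iter_deriv_snoc)

lemma smooth_differentiable: "smooth f ==> f differentiable (at x)"
  unfolding smooth_def by (metis iter_deriv.simps(1))

lemma smooth_iter_deriv: "smooth f ==> smooth (iter_deriv f vs)"
  by (induction vs) (auto simp: iter_deriv_Cons smooth_dird)

lemma smooth_continuous_on: "smooth f ==> continuous_on A f"
  by (meson smooth_differentiable differentiable_imp_continuous_within continuous_at_imp_continuous_on)

text \<open>Iterated derivatives of \<open>f\<close> cannot leave \<open>S\<close>. This serves
  classes that are visibly closed under \<open>dird\<close>, such as constants, linear images and
  affine pullbacks; products and compositions go through \<open>C_diff\<close> instead.\<close>

lemma smooth_coinduct:
  assumes "f \<in> S" "\<And>g x. g \<in> S ==> g differentiable (at x)" "\<And>g v. g \<in> S ==> dird v g \<in> S"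
  shows "smooth f"
proof -
  have "iter_deriv f vs \<in> S" for vs
    by (induction vs) (auto simp: iter_deriv_Cons assms)
  then show ?thesis unfolding smooth_def using assms by blast
qed

text \<open>Counts derivatives, so that closure under products and compositions can be shown by
  induction on the order: the hypothesis of lower order applies to the factors that the product rule
  and the chain rule create.\<close>

fun C_diff :: "nat => ('a::real_normed_vector => 'b::real_normed_vector) => bool" where
  "C_diff 0 f = True"
| "C_diff (Suc k) f = ((\<forall>x. f differentiable (at x)) \<and> (\<forall>v. C_diff k (dird v f)))"

lemma smooth_iff_C_diff: "smooth f \<longleftrightarrow> (\<forall>k. C_diff k f)"
proof
  assume "smooth f"
  then have "C_diff k f" for k
    by (induction k arbitrary: f) (auto simp: smooth_dird smooth_differentiable)
  then show "\<forall>k. C_diff k f" by blast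
next
  assume "\<forall>k. C_diff k f"
  then show "smooth f"
  proof (intro smooth_coinduct[where S = "{f. \<forall>k. C_diff k f}"])
    fix g :: "'a => 'b" and x v assume "g \<in> {f. \<forall>k. C_diff k f}"
    then have "C_diff (Suc k) g" for k by blast
    then show "g differentiable (at x)" "dird v g \<in> {f. \<forall>k. C_diff k f}" by auto
  qed auto
qed

lemma C_diff_Suc_imp: "C_diff (Suc k) f ==> C_diff k f"
  by (induction k arbitrary: f) auto

lemma has_derivative_dird: "f differentiable (at x) ==> (f has_derivative (%v. dird v f x)) (at x)"
  using frechet_derivative_works[of f "at x"] by (simp add: dird_def)

lemma dird_eqI: "(\<And>x. (f has_derivative f' x) (at x)) ==> dird v f = (%x. f' x v)"
  unfolding dird_def by (metis frechet_derivative_at)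

lemma dird_add:
  assumes "\<And>x. f differentiable (at x)" "\<And>x. g differentiable (at x)"
  shows "dird v (%x. f x + g x) = (%x. dird v f x + dird v g x)"
  by (rule dird_eqI) (intro has_derivative_add has_derivative_dird assms)

lemma dird_mult:
  fixes f g :: "_ => 'b::real_normed_algebra"
  assumes "\<And>x. f differentiable (at x)" "\<And>x. g differentiable (at x)"
  shows "dird v (%x. f x * g x) = (%x. f x * dird v g x + dird v f x * g x)"
  by (rule dird_eqI) (intro has_derivative_mult has_derivative_dird assms)

lemma dird_linear_out:
  assumes "bounded_linear L" "\<And>x. f differentiable (at x)"
  shows "dird v (%x. L (f x)) = (%x. L (dird v f x))"
  by (rule dird_eqI) (intro bounded_linear.has_derivative[OF assms(1)] has_derivative_dird assms)

lemma has_derivative_affine_in: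
  assumes "bounded_linear L" "\<And>x. f differentiable (at x)"
  shows "((%x. f (L x + c)) has_derivative (%v. dird (L v) f (L x + c))) (at x)"
proof -
  have 1: "((%x. L x + c) has_derivative L) (at x)"
    using has_derivative_add[OF bounded_linear_imp_has_derivative[OF assms(1)] has_derivative_const[of c]]
    by simp
  show ?thesis
    using has_derivative_compose[OF 1 has_derivative_dird[OF assms(2)]] by (simp add: o_def)
qed

lemma dird_affine_in:
  assumes "bounded_linear L" "\<And>x. f differentiable (at x)"
  shows "dird v (%x. f (L x + c)) = (%x. dird (L v) f (L x + c))"
  by (rule dird_eqI) (rule has_derivative_affine_in[OF assms])

lemma dird_compose_real:
  fixes h :: "real => real"
  assumes "\<And>y. h differentiable (at y)" "\<And>x. g differentiable (at x)"
  shows "dird v (%x. h (g x)) = (%x. dird 1 h (g x) * dird v g x)"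
proof -
  have lin: "dird t h y = dird 1 h y * t" for t y
  proof -
    have "linear (%v. dird v h y)"
      using has_derivative_dird[OF assms(1)] has_derivative_linear by blast
    from linear_scale[OF this, of t 1] show ?thesis by (simp add: mult.commute)
  qed
  have "dird v (%x. h (g x)) = (%x. dird (dird v g x) h (g x))"
    by (rule dird_eqI)
      (rule has_derivative_compose[OF has_derivative_dird[OF assms(2)] has_derivative_dird[OF assms(1)]])
  also have "\<dots> = (%x. dird 1 h (g x) * dird v g x)" by (rule ext) (rule lin)
  finally show ?thesis .
qed

lemma C_diff_add: "C_diff k f ==> C_diff k g ==> C_diff k (%x. f x + g x)"
proof (induction k arbitrary: f g)
  case (Suc k)
  then have "dird v (%x. f x + g x) = (%x. dird v f x + dird v g x)" for v
    by (intro dird_add) auto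
  with Suc show ?case by simp
qed simp

lemma C_diff_mult:
  fixes f g :: "'a::real_normed_vector => 'b::real_normed_algebra"
  shows "C_diff k f ==> C_diff k g ==> C_diff k (%x. f x * g x)"
proof (induction k arbitrary: f g)
  case (Suc k)
  then have d: "dird v (%x. f x * g x) = (%x. f x * dird v g x + dird v f x * g x)" for v
    by (intro dird_mult) auto
  have "C_diff k (%x. f x * dird v g x + dird v f x * g x)" for v
    by (intro C_diff_add Suc.IH) (use C_diff_Suc_imp Suc.prems in auto)
  with Suc.prems d show ?case by simp
qed simp

lemma smooth_add: "smooth f ==> smooth g ==> smooth (%x. f x + g x)"
  by (simp add: smooth_iff_C_diff C_diff_add del: C_diff.simps)

lemma smooth_mult:
  fixes f g :: "'a::real_normed_vector => 'b::real_normed_algebra"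
  shows "smooth f ==> smooth g ==> smooth (%x. f x * g x)"
  by (simp add: smooth_iff_C_diff C_diff_mult del: C_diff.simps)

lemma smooth_const: "smooth (%x::'a::real_normed_vector. c::'b::real_normed_vector)"
proof (rule smooth_coinduct[where S = "range (%c x. c)"])
  fix g :: "'a => 'b" and v assume "g \<in> range (%c x. c)"
  then obtain c where "g = (%x. c)" by auto
  then show "dird v g \<in> range (%c x. c)" by (auto simp: dird_def)
qed auto

lemma smooth_linear_out:
  assumes "bounded_linear L" "smooth f" shows "smooth (%x. L (f x))"
proof (rule smooth_coinduct[where S = "{(%x. L (f x)) | f. smooth f}"])
  fix g x assume "g \<in> {(%x. L (f x)) | f. smooth f}"
  then show "g differentiable (at x)"
    using bounded_linear.has_derivative[OF assms(1) has_derivative_dird[OF smooth_differentiable]]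
    by (force simp: differentiable_def)
next
  fix g v assume "g \<in> {(%x. L (f x)) | f. smooth f}"
  then show "dird v g \<in> {(%x. L (f x)) | f. smooth f}"
    using dird_linear_out[OF assms(1) smooth_differentiable] smooth_dird by blast
qed (use assms in auto)

lemma iter_deriv_linear_out:
  assumes "bounded_linear L" "smooth f"
  shows "iter_deriv (%x. L (f x)) vs = (%x. L (iter_deriv f vs x))"
  by (induction vs)
    (simp_all add: iter_deriv_Cons dird_linear_out[OF assms(1)] smooth_differentiable smooth_iter_deriv assms)

lemma smooth_affine_in:
  assumes "bounded_linear L" "smooth f" shows "smooth (%x. f (L x + c))"
proof (rule smooth_coinduct[where S = "{(%x. f (L x + c)) | f. smooth f}"])
  fix g x assume "g \<in> {(%x. f (L x + c)) | f. smooth f}"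
  then show "g differentiable (at x)"
    using has_derivative_affine_in[OF assms(1) smooth_differentiable]
    by (force simp: differentiable_def)
next
  fix g v assume "g \<in> {(%x. f (L x + c)) | f. smooth f}"
  then show "dird v g \<in> {(%x. f (L x + c)) | f. smooth f}"
    using dird_affine_in[OF assms(1) smooth_differentiable] smooth_dird by blast
qed (use assms in auto)

lemma iter_deriv_affine_in:
  assumes "bounded_linear L" "smooth f"
  shows "iter_deriv (%x. f (L x + c)) vs = (%x. iter_deriv f (map L vs) (L x + c))"
  by (induction vs)
    (simp_all add: iter_deriv_Cons dird_affine_in[OF assms(1)] smooth_differentiable smooth_iter_deriv assms)

text \<open>The chain rule gives h' of \<open>g x\<close> times a derivative of \<open>g\<close>,
  and h' is again smooth; hence an induction on the order in which \<open>h\<close> is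
  generalised.\<close>

lemma smooth_compose_real:
  fixes h :: "real => real"
  assumes "smooth h" "smooth g" shows "smooth (%x. h (g x))"
proof -
  have "C_diff k (%x. h (g x))" if "smooth h" for k and h :: "real => real"
    using that
  proof (induction k arbitrary: h)
    case (Suc k)
    have "(%x. h (g x)) differentiable (at x)" for x
      using has_derivative_compose[OF has_derivative_dird[OF smooth_differentiable[OF assms(2)]]
          has_derivative_dird[OF smooth_differentiable[OF Suc.prems]]]
      by (auto simp: differentiable_def)
    moreover have "C_diff k (dird v (%x. h (g x)))" for v
    proof -
      have "C_diff k (%x. dird 1 h (g x))"
        by (rule Suc.IH) (rule smooth_dird[OF Suc.prems])
      moreover have "C_diff k (dird v g)"
        using smooth_dird[OF assms(2)] by (simp add: smooth_iff_C_diff del: C_diff.simps)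
      ultimately show ?thesis
        by (subst dird_compose_real) (auto simp: smooth_differentiable Suc.prems assms intro: C_diff_mult)
    qed
    ultimately show ?case by simp
  qed simp
  then show ?thesis using assms by (simp add: smooth_iff_C_diff del: C_diff.simps)
qed

lemma smooth_bounded_linear: "bounded_linear L ==> smooth L"
proof (rule smooth_coinduct[where S = "{L. bounded_linear L} \<union> range (%c x. c)"])
  fix g :: "'a => 'b" and v
  assume "g \<in> {L. bounded_linear L} \<union> range (%c x. c)"
  moreover have "dird v g = (%x. g v)" if "bounded_linear g"
    by (rule dird_eqI) (rule bounded_linear_imp_has_derivative[OF that])
  moreover have "dird v (%x. c) = (%x. 0::'b)" for c v
    by (simp add: dird_def)
  ultimately show "dird v g \<in> {L. bounded_linear L} \<union> range (%c x. c)"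
    by auto
qed (auto intro: bounded_linear_imp_differentiable)

lemma smooth_sum:
  assumes "\<And>b. b \<in> B ==> smooth (f b)" shows "smooth (%x. \<Sum>b\<in>B. f b x)"
  using assms by (induction B rule: infinite_finite_induct) (auto simp: smooth_const smooth_add)

lemma iter_deriv_add:
  assumes "smooth f" "smooth g"
  shows "iter_deriv (%x. f x + g x) vs = (%x. iter_deriv f vs x + iter_deriv g vs x)"
  by (induction vs)
    (simp_all add: iter_deriv_Cons dird_add smooth_differentiable smooth_iter_deriv assms)

lemma iter_deriv_zero_on_open:
  assumes "open U" "\<And>x. x \<in> U ==> f x = 0" "x \<in> U"
  shows "iter_deriv f vs x = 0"
  using assms(3)
proof (induction vs arbitrary: x)
  case (Cons v vs)
  have "(iter_deriv f vs has_derivative (%v. 0)) (at x)"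
    by (rule has_derivative_transform_within_open[OF has_derivative_const[of 0] assms(1) Cons.prems])
      (use Cons.IH in simp)
  from frechet_derivative_at[OF this] show ?case
    by (simp add: iter_deriv.simps(2) fun_eq_iff)
qed (use assms in auto)

text \<open>Leibniz rule at a single point: peeling off the innermost direction leaves two products
  of order k - 1, so 2^k terms arise. The bounds are assumed for all shorter lists from
  \<open>V\<close> because the induction hands each direction to one factor or the other.\<close>

lemma iter_deriv_mult_bound:
  fixes f g :: "'a::real_normed_vector => complex"
  assumes "smooth f" "smooth g"
    "\<And>us. length us <= k ==> set us \<subseteq> V ==> norm (iter_deriv f us p) <= A"
    "\<And>us. length us <= k ==> set us \<subseteq> V ==> norm (iter_deriv g us p) <= B"
    "length vs = k" "set vs \<subseteq> V"
  shows "norm (iter_deriv (%x. f x * g x) vs p) <= 2 ^ k * A * B"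
  using assms
proof (induction k arbitrary: f g vs)
  case 0
  then show ?case using mult_mono[OF 0(3)[of "[]"] 0(4)[of "[]"]]
    by (auto simp: norm_mult intro: order_trans[OF norm_ge_zero])
next
  case (Suc k)
  obtain ws v where vs: "vs = ws @ [v]" using Suc.prems(5)
    by (metis length_Suc_conv_rev)
  have len: "length ws = k" and sub: "set ws \<subseteq> V" and v: "v \<in> V" using Suc.prems vs by auto
  have d: "iter_deriv (%x. f x * g x) vs p =
     iter_deriv (%x. f x * dird v g x) ws p + iter_deriv (%x. dird v f x * g x) ws p"
    unfolding vs iter_deriv_snoc
    by (subst dird_mult) (auto simp: smooth_differentiable Suc.prems smooth_dird smooth_mult iter_deriv_add)
  have *: "norm (iter_deriv (%x. f x * dird v g x) ws p) <= 2 ^ k * A * B"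
    by (rule Suc.IH) (use Suc.prems len sub v smooth_dird in \<open>auto simp: iter_deriv_snoc[symmetric]\<close>)
  have "norm (iter_deriv (%x. dird v f x * g x) ws p) <= 2 ^ k * A * B"
    by (rule Suc.IH) (use Suc.prems len sub v smooth_dird in \<open>auto simp: iter_deriv_snoc[symmetric]\<close>)
  with * show ?case unfolding d using norm_triangle_ineq by (force simp: algebra_simps intro: order_trans)
qed

text \<open>Uniform symbol estimates: \<open>V i\<close> plays the part of the unit ball of the
  metric attached to the index \<open>i\<close>, \<open>R i\<close> is the region where the bounds
  are known and \<open>w i\<close> the size. The constant depends on the order k only, so that
  scale, frequency and window centre can all be put into the index. Outside \<open>R i\<close> only
  smoothness is claimed.\<close>

definition unif :: "'i set => ('i => 'v::real_normed_vector set) => ('i => 'v set) => ('i => real)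
    => ('i => 'v => complex) => bool" where
  "unif I V R w F \<longleftrightarrow> (\<forall>i\<in>I. smooth (F i) \<and> 0 <= w i) \<and>
     (\<forall>k. \<exists>C. \<forall>i\<in>I. \<forall>p\<in>R i. \<forall>vs. length vs = k --> set vs \<subseteq> V i -->
        norm (iter_deriv (F i) vs p) <= C * w i)"

lemma unif_smooth: "unif I V R w F ==> i \<in> I ==> smooth (F i)"
  and unif_nonneg: "unif I V R w F ==> i \<in> I ==> 0 <= w i"
  by (auto simp: unif_def)

lemma unif_bound:
  assumes "unif I V R w F"
  obtains C where "0 <= C" "\<And>i p vs. i \<in> I ==> p \<in> R i ==> length vs <= k ==> set vs \<subseteq> V i ==>
     norm (iter_deriv (F i) vs p) <= C * w i"
proof -
  obtain C where C: "\<And>k i p vs. i \<in> I ==> p \<in> R i ==> length vs = k ==> set vs \<subseteq> V i ==>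
     norm (iter_deriv (F i) vs p) <= C k * w i"
    using assms unfolding unif_def by metis
  show ?thesis
  proof (rule that[of "\<Sum>m\<le>k. \<bar>C m\<bar>"])
    fix i p vs assume *: "i \<in> I" "p \<in> R i" "length vs <= k" "set vs \<subseteq> V i"
    have "norm (iter_deriv (F i) vs p) <= C (length vs) * w i" using C * by blast
    also have "\<dots> <= (\<Sum>m\<le>k. \<bar>C m\<bar>) * w i"
      using unif_nonneg[OF assms *(1)] * member_le_sum[of "length vs" "{..k}" "%m. \<bar>C m\<bar>"]
      by (intro mult_right_mono) auto
    finally show "norm (iter_deriv (F i) vs p) <= (\<Sum>m\<le>k. \<bar>C m\<bar>) * w i" .
  qed (simp add: sum_nonneg)
qed

lemma unifI:
  assumes "\<And>i. i \<in> I ==> smooth (F i)" "\<And>i. i \<in> I ==> 0 <= w i"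
    "\<And>k. \<exists>C. \<forall>i\<in>I. \<forall>p\<in>R i. \<forall>vs. length vs = k --> set vs \<subseteq> V i -->
        norm (iter_deriv (F i) vs p) <= C * w i"
  shows "unif I V R w F"
  using assms by (auto simp: unif_def)

lemma unif_mult:
  assumes "unif I V R w F" "unif I V R u G"
  shows "unif I V R (%i. w i * u i) (%i p. F i p * G i p)"
proof (rule unifI)
  fix k
  obtain A where A: "0 <= A" "\<And>i p vs. i \<in> I ==> p \<in> R i ==> length vs <= k ==> set vs \<subseteq> V i ==>
     norm (iter_deriv (F i) vs p) <= A * w i" by (rule unif_bound[OF assms(1), where k=k]) blast
  obtain B where B: "0 <= B" "\<And>i p vs. i \<in> I ==> p \<in> R i ==> length vs <= k ==> set vs \<subseteq> V i ==>
     norm (iter_deriv (G i) vs p) <= B * u i" by (rule unif_bound[OF assms(2), where k=k]) blast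
  have "norm (iter_deriv (%p. F i p * G i p) vs p) <= (2 ^ k * A * B) * (w i * u i)"
    if "i \<in> I" "p \<in> R i" "length vs = k" "set vs \<subseteq> V i" for i p vs
    using iter_deriv_mult_bound[of "F i" "G i" k "V i" p "A * w i" "B * u i" vs] that A B
      unif_smooth[OF assms(1)] unif_smooth[OF assms(2)] by (simp add: algebra_simps)
  then show "\<exists>C. \<forall>i\<in>I. \<forall>p\<in>R i. \<forall>vs. length vs = k --> set vs \<subseteq> V i -->
        norm (iter_deriv (%p. F i p * G i p) vs p) <= C * (w i * u i)" by blast
qed (auto simp: unif_smooth[OF assms(1)] unif_smooth[OF assms(2)] unif_nonneg[OF assms(1)]
    unif_nonneg[OF assms(2)] smooth_mult)

lemma unif_add:
  assumes "unif I V R w F" "unif I V R w G"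
  shows "unif I V R w (%i p. F i p + G i p)"
proof (rule unifI)
  fix k
  obtain A where A: "0 <= A" "\<And>i p vs. i \<in> I ==> p \<in> R i ==> length vs <= k ==> set vs \<subseteq> V i ==>
     norm (iter_deriv (F i) vs p) <= A * w i" by (rule unif_bound[OF assms(1), where k=k]) blast
  obtain B where B: "0 <= B" "\<And>i p vs. i \<in> I ==> p \<in> R i ==> length vs <= k ==> set vs \<subseteq> V i ==>
     norm (iter_deriv (G i) vs p) <= B * w i" by (rule unif_bound[OF assms(2), where k=k]) blast
  have "norm (iter_deriv (%p. F i p + G i p) vs p) <= (A + B) * w i"
    if "i \<in> I" "p \<in> R i" "length vs = k" "set vs \<subseteq> V i" for i p vs
    using A(2)[of i p vs] B(2)[of i p vs] that
      unif_smooth[OF assms(1)] unif_smooth[OF assms(2)]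
    by (simp add: algebra_simps iter_deriv_add norm_triangle_le)
  then show "\<exists>C. \<forall>i\<in>I. \<forall>p\<in>R i. \<forall>vs. length vs = k --> set vs \<subseteq> V i -->
        norm (iter_deriv (%p. F i p + G i p) vs p) <= C * w i" by blast
qed (auto simp: unif_smooth[OF assms(1)] unif_smooth[OF assms(2)] unif_nonneg[OF assms(1)]
    smooth_add)

lemma iter_deriv_const_bound: "norm (iter_deriv (%x. c) vs p) <= norm c"
proof -
  have "iter_deriv (%x. c) vs = (%x. c) \<or> iter_deriv (%x. c) vs = (%x. 0)"
    by (induction vs) (auto simp: iter_deriv_Cons dird_def)
  then show ?thesis by auto
qed

lemma unif_const:
  assumes "\<And>i. i \<in> I ==> norm (c i) <= w i"
  shows "unif I V R w (%i p. c i)"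
proof (rule unifI)
  show "\<exists>C. \<forall>i\<in>I. \<forall>p\<in>R i. \<forall>vs. length vs = k --> set vs \<subseteq> V i -->
        norm (iter_deriv (%p. c i) vs p) <= C * w i" for k
    using order_trans[OF iter_deriv_const_bound assms] by (intro exI[of _ 1]) auto
qed (use assms order_trans[OF norm_ge_zero] in \<open>auto simp: smooth_const\<close>)

lemma unif_cmult:
  assumes "unif I V R w F" "\<And>i. i \<in> I ==> norm (c i) <= u i"
  shows "unif I V R (%i. u i * w i) (%i p. c i * F i p)"
  by (rule unif_mult[OF unif_const assms(1)]) (use assms in auto)

lemma unif_uminus: "unif I V R w F ==> unif I V R w (%i p. - F i p)"
  using unif_cmult[of I V R w F "%i. -1" "%i. 1"] by simp

lemma unif_diff: "unif I V R w F ==> unif I V R w G ==> unif I V R w (%i p. F i p - G i p)"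
  using unif_add[of I V R w F "%i p. - G i p"] unif_uminus[of I V R w G] by simp

lemma unif_sum:
  assumes "\<And>b. b \<in> B ==> unif I V R w (F b)" "\<And>i. i \<in> I ==> 0 <= w i"
  shows "unif I V R w (%i p. \<Sum>b\<in>B. F b i p)"
  using assms(1)
proof (induction B rule: infinite_finite_induct)
  case (insert b B)
  have "unif I V R w (%i p. F b i p + (\<Sum>b\<in>B. F b i p))"
    by (rule unif_add) (use insert in auto)
  then show ?case using insert by simp
qed (simp_all add: unif_const assms(2))

lemma unif_dird:
  assumes "unif I V R w F" "\<And>i. i \<in> I ==> v i \<in> V i"
  shows "unif I V R w (%i. dird (v i) (F i))"
proof (rule unifI)
  fix k
  obtain A where A: "0 <= A" "\<And>i p vs. i \<in> I ==> p \<in> R i ==> length vs <= Suc k ==> set vs \<subseteq> V i ==>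
     norm (iter_deriv (F i) vs p) <= A * w i" by (rule unif_bound[OF assms(1), where k="Suc k"]) blast
  show "\<exists>C. \<forall>i\<in>I. \<forall>p\<in>R i. \<forall>vs. length vs = k --> set vs \<subseteq> V i -->
        norm (iter_deriv (dird (v i) (F i)) vs p) <= C * w i"
    using A(2)[where vs="_ @ [v _]"] assms(2) by (intro exI[of _ A]) (auto simp: iter_deriv_snoc)
qed (auto simp: unif_smooth[OF assms(1)] unif_nonneg[OF assms(1)] smooth_dird)

text \<open>Substitution rule: \<open>L j\<close> carries the new directions into the old ones and
  the affine map carries the new region into the old one. Rescaling, translation, restriction to
  slices and reindexing are all instances.\<close>

lemma unif_affine:
  assumes "unif I V R w F" "\<And>j. j \<in> J ==> f j \<in> I" "\<And>j. j \<in> J ==> bounded_linear (L j)"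
    "\<And>j v. j \<in> J ==> v \<in> V' j ==> L j v \<in> V (f j)"
    "\<And>j p. j \<in> J ==> p \<in> R' j ==> L j p + c j \<in> R (f j)"
    "\<And>j. j \<in> J ==> w (f j) <= K * w' j" "\<And>j. j \<in> J ==> 0 <= w' j"
  shows "unif J V' R' w' (%j p. F (f j) (L j p + c j))"
proof (rule unifI)
  fix k
  obtain A where A: "0 <= A" "\<And>i p vs. i \<in> I ==> p \<in> R i ==> length vs <= k ==> set vs \<subseteq> V i ==>
     norm (iter_deriv (F i) vs p) <= A * w i" by (rule unif_bound[OF assms(1), where k=k]) blast
  have "norm (iter_deriv (%p. F (f j) (L j p + c j)) vs p) <= (A * K) * w' j"
    if j: "j \<in> J" "p \<in> R' j" "length vs = k" "set vs \<subseteq> V' j" for j p vs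
  proof -
    have "norm (iter_deriv (%p. F (f j) (L j p + c j)) vs p)
        = norm (iter_deriv (F (f j)) (map (L j) vs) (L j p + c j))"
      using iter_deriv_affine_in[OF assms(3) unif_smooth[OF assms(1) assms(2)]] j by simp
    also have "\<dots> <= A * w (f j)"
      by (rule A(2)) (use assms j in auto)
    also have "\<dots> <= A * (K * w' j)" using A(1) assms j by (intro mult_left_mono) auto
    finally show ?thesis by simp
  qed
  then show "\<exists>C. \<forall>i\<in>J. \<forall>p\<in>R' i. \<forall>vs. length vs = k --> set vs \<subseteq> V' i -->
        norm (iter_deriv (%p. F (f i) (L i p + c i)) vs p) <= C * w' i" by blast
next
  fix j assume "j \<in> J"
  then show "smooth (%p. F (f j) (L j p + c j))"
    using smooth_affine_in[OF assms(3) unif_smooth[OF assms(1) assms(2)]] by blast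
qed (rule assms(7))

lemma unif_reindex:
  assumes "unif I V R w F" "\<And>j. j \<in> J ==> f j \<in> I"
    "\<And>j. j \<in> J ==> V' j \<subseteq> V (f j)" "\<And>j. j \<in> J ==> R' j \<subseteq> R (f j)"
    "\<And>j. j \<in> J ==> w (f j) <= K * w' j" "\<And>j. j \<in> J ==> 0 <= w' j"
  shows "unif J V' R' w' (%j. F (f j))"
  using unif_affine[OF assms(1), of J f "%_ p. p" V' R' "%_. 0" K w'] assms
  by (auto simp: bounded_linear_ident subset_iff)

lemma unif_cnj:
  assumes "unif I V R w F" shows "unif I V R w (%i p. cnj (F i p))"
proof (rule unifI)
  fix k
  obtain A where A: "0 <= A" "\<And>i p vs. i \<in> I ==> p \<in> R i ==> length vs <= k ==> set vs \<subseteq> V i ==>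
     norm (iter_deriv (F i) vs p) <= A * w i" by (rule unif_bound[OF assms(1), where k=k]) blast
  show "\<exists>C. \<forall>i\<in>I. \<forall>p\<in>R i. \<forall>vs. length vs = k --> set vs \<subseteq> V i -->
        norm (iter_deriv (%p. cnj (F i p)) vs p) <= C * w i"
    using A(2) by (intro exI[of _ A])
      (auto simp: iter_deriv_linear_out[OF bounded_linear_cnj unif_smooth[OF assms]])
qed (auto simp: unif_smooth[OF assms] unif_nonneg[OF assms] smooth_linear_out[OF bounded_linear_cnj])

text \<open>Off the closed set \<open>K i\<close> the function vanishes on an open set, hence with
  all derivatives. This turns bounds near the support of a cutoff into global ones.\<close>

lemma unif_extend:
  assumes "unif I V R w F" "\<And>i. i \<in> I ==> closed (K i)" "\<And>i. i \<in> I ==> K i \<subseteq> R i"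
    "\<And>i p. i \<in> I ==> p \<notin> K i ==> F i p = 0"
  shows "unif I V (%_. UNIV) w F"
proof (rule unifI)
  fix k
  obtain A where A: "0 <= A" "\<And>i p vs. i \<in> I ==> p \<in> R i ==> length vs <= k ==> set vs \<subseteq> V i ==>
     norm (iter_deriv (F i) vs p) <= A * w i" by (rule unif_bound[OF assms(1), where k=k]) blast
  have "norm (iter_deriv (F i) vs p) <= A * w i"
    if i: "i \<in> I" "length vs = k" "set vs \<subseteq> V i" for i p vs
  proof (cases "p \<in> K i")
    case True then show ?thesis using A i assms by (metis order_refl subsetD)
  next
    case False
    have "iter_deriv (F i) vs p = 0"
      by (rule iter_deriv_zero_on_open[of "- K i"]) (use assms i False in \<open>auto intro: open_Compl\<close>)
    then show ?thesis using A(1) unif_nonneg[OF assms(1) i(1)] by simp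
  qed
  then show "\<exists>C. \<forall>i\<in>I. \<forall>p\<in>UNIV. \<forall>vs. length vs = k --> set vs \<subseteq> V i -->
        norm (iter_deriv (F i) vs p) <= C * w i" by blast
qed (auto simp: unif_smooth[OF assms(1)] unif_nonneg[OF assms(1)])

section \<open>Bump functions, oscillating exponentials and weights\<close>

text \<open>t^(-m) exp(-1/t) on the positive axis. The power m is carried along because the linear
  span of this family is closed under differentiation.\<close>

fun flat_exp :: "nat => real => real" where
  "flat_exp m t = (if 0 < t then (1 / t) ^ m * exp (- (1 / t)) else 0)"

declare flat_exp.simps [simp del]

lemma flat_exp_tendsto_0: "(flat_exp m \<longlongrightarrow> 0) (at 0)"
proof -
  have "((%t. inverse t ^ m / exp (inverse t)) \<longlongrightarrow> 0) (at_right (0::real))"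
    by (rule filterlim_compose[OF tendsto_power_div_exp_0 filterlim_inverse_at_top_right])
  then have "(flat_exp m \<longlongrightarrow> 0) (at_right 0)"
    by (rule Lim_transform_eventually)
      (auto simp: flat_exp.simps eventually_at_right_field field_simps exp_minus intro!: exI[of _ 1])
  moreover have "(flat_exp m \<longlongrightarrow> 0) (at_left 0)"
    by (rule Lim_transform_eventually[OF tendsto_const])
      (auto simp: flat_exp.simps eventually_at_left_field intro!: exI[of _ "-1"])
  ultimately show ?thesis by (simp add: filterlim_at_split)
qed

lemma flat_exp_deriv:
  "(flat_exp m has_real_derivative (flat_exp (m + 2) t - real m * flat_exp (m + 1) t)) (at t)"
proof -
  consider "t > 0" | "t < 0" | "t = 0" by linarith
  then show ?thesis
  proof cases
    case 1
    have "((%t. (1 / t) ^ m * exp (- (1 / t))) has_real_derivative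
        (flat_exp (m + 2) t - real m * flat_exp (m + 1) t)) (at t)"
    proof (rule DERIV_cong)
      have "((%t. 1 / t) has_real_derivative - ((1 / t)\<^sup>2)) (at t)"
        using 1 by (auto intro!: derivative_eq_intros simp: power2_eq_square)
      then show "((%t. (1 / t) ^ m * exp (- (1 / t))) has_real_derivative
          (1 / t) ^ m * (exp (- (1 / t)) * - (- ((1 / t)\<^sup>2))) +
          (real m * (- ((1 / t)\<^sup>2) * (1 / t) ^ (m - Suc 0))) * exp (- (1 / t))) (at t)"
        by (intro DERIV_mult' DERIV_power DERIV_exp[THEN DERIV_chain2] DERIV_minus)
      have "u ^ m * (e * - (- u\<^sup>2)) + real m * (- u\<^sup>2 * u ^ (m - Suc 0)) * e
          = u ^ (m + 2) * e - real m * (u ^ (m + 1) * e)" for u e :: real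
        by (cases m) (simp_all add: power2_eq_square algebra_simps)
      then show "(1 / t) ^ m * (exp (- (1 / t)) * - (- ((1 / t)\<^sup>2))) +
          (real m * (- ((1 / t)\<^sup>2) * (1 / t) ^ (m - Suc 0))) * exp (- (1 / t))
          = flat_exp (m + 2) t - real m * flat_exp (m + 1) t"
        using 1 unfolding flat_exp.simps by simp
    qed
    then show ?thesis
      by (rule has_field_derivative_transform_within_open[where S="{0<..}"])
        (use 1 in \<open>auto simp: flat_exp.simps\<close>)
  next
    case 2
    have "((%t. 0) has_real_derivative (flat_exp (m + 2) t - real m * flat_exp (m + 1) t)) (at t)"
      using 2 by (auto simp: flat_exp.simps)
    then show ?thesis
      by (rule has_field_derivative_transform_within_open[where S="{..<0}"])
        (use 2 in \<open>auto simp: flat_exp.simps\<close>)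
  next
    case 3
    \<comment> \<open>The difference quotient at 0 is \<open>flat_exp (Suc m)\<close>, which tends
      to 0.\<close>
    have "((%h. (flat_exp m h - flat_exp m 0) / (h - 0)) \<longlongrightarrow> 0) (at 0)"
      by (rule Lim_transform_eventually[OF flat_exp_tendsto_0[of "Suc m"]])
        (auto simp: flat_exp.simps eventually_at intro!: exI[of _ 1])
    with 3 show ?thesis
      by (auto simp: has_field_derivative_iff flat_exp.simps)
  qed
qed

lemma smooth_flat_exp: "smooth (flat_exp m)"
proof -
  have d: "(flat_exp m has_derivative (*) (flat_exp (m + 2) x - real m * flat_exp (m + 1) x)) (at x)" for m x
    using flat_exp_deriv[of m x] by (simp add: has_field_derivative_def)
  have dd: "dird v (flat_exp m) = (%x. v * flat_exp (m + 2) x + (- (v * real m)) * flat_exp (m + 1) x)" for v m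
    using dird_eqI[OF d] by (simp add: algebra_simps fun_eq_iff)
  have "C_diff k (flat_exp m)" for k
  proof (induction k arbitrary: m)
    case (Suc k)
    have c: "C_diff k (%x::real. c::real)" for c
      using smooth_const[of c, unfolded smooth_iff_C_diff] by blast
    have "C_diff k (dird v (flat_exp m))" for v
      unfolding dd by (intro C_diff_add C_diff_mult c Suc.IH)
    moreover have "flat_exp m differentiable (at x)" for x using d differentiable_def by blast
    ultimately show ?case by simp
  qed simp
  then show ?thesis by (simp add: smooth_iff_C_diff del: C_diff.simps)
qed

lemma flat_exp_mono: "s <= t ==> flat_exp 0 s <= flat_exp 0 t"
  by (auto simp: flat_exp.simps frac_le)

text \<open>A radial cutoff, 1 on the unit ball and 0 outside the ball of radius 2. The inner
  \<open>flat_exp 0\<close> vanishes for |x| <= 1 and reaches exp(-1/3) =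
  \<open>flat_exp 0 3\<close> at |x| = 2, where |x|^2 - 1 = 3; from there on the argument of the
  outer one is not positive.\<close>

definition bump :: "'a::euclidean_space => real" where
  "bump x = flat_exp 0 (exp (- (1/3)) - flat_exp 0 (x \<bullet> x - 1)) / flat_exp 0 (exp (- (1/3)))"

lemma bump_denom: "flat_exp 0 (exp (- (1/3))) > 0"
  by (simp add: flat_exp.simps)

lemma bump_range: "0 <= bump x" "bump x <= 1"
proof -
  have "flat_exp 0 t \<ge> 0" for t by (simp add: flat_exp.simps)
  then show "0 <= bump x" by (simp add: bump_def)
  have "flat_exp 0 (exp (- (1/3)) - flat_exp 0 (x \<bullet> x - 1)) <= flat_exp 0 (exp (- (1/3)))"
    by (rule flat_exp_mono) (simp add: flat_exp.simps)
  then show "bump x <= 1" using bump_denom by (simp add: bump_def)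
qed

lemma bump_eq_1: "norm x <= 1 ==> bump x = 1"
  using bump_denom power_le_one[of "norm x" 2]
  by (simp add: bump_def dot_square_norm flat_exp.simps[of 0 "_ - 1"])

lemma bump_eq_0: assumes "2 <= norm x" shows "bump x = 0"
proof -
  have "3 <= x \<bullet> x - 1"
    using assms power_mono[of 2 "norm x" 2] by (simp add: dot_square_norm)
  then have "flat_exp 0 3 <= flat_exp 0 (x \<bullet> x - 1)" by (rule flat_exp_mono)
  then show ?thesis by (simp add: bump_def flat_exp.simps)
qed

lemma smooth_bump: "smooth (%x::'a::euclidean_space. bump x)"
proof -
  have "smooth (%x::'a. \<Sum>b\<in>Basis. (x \<bullet> b) * (x \<bullet> b))"
    by (intro smooth_sum smooth_mult smooth_bounded_linear bounded_linear_inner_left)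
  then have q: "smooth (%x::'a. x \<bullet> x + - 1)"
    by (intro smooth_add smooth_const) (simp add: euclidean_inner[symmetric])
  have "smooth (%x::'a. exp (- (1/3)) + (- 1) * flat_exp 0 (x \<bullet> x + - 1))"
    by (intro smooth_add smooth_mult smooth_const smooth_compose_real[OF smooth_flat_exp] q)
  then have "smooth (%x::'a. flat_exp 0 (exp (- (1/3)) + (- 1) * flat_exp 0 (x \<bullet> x + - 1)) *
      (1 / flat_exp 0 (exp (- (1/3)))))"
    by (intro smooth_mult smooth_const smooth_compose_real[OF smooth_flat_exp])
  then show ?thesis by (simp add: bump_def)
qed

lemma smooth_of_real: "smooth f ==> smooth (%x. of_real (f x) :: complex)"
  by (rule smooth_linear_out[OF bounded_linear_of_real])

lemma iter_deriv_sum: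
  assumes "\<And>b. b \<in> B ==> smooth (f b)"
  shows "iter_deriv (%x. \<Sum>b\<in>B. f b x) vs = (%x. \<Sum>b\<in>B. iter_deriv (f b) vs x)"
  using assms
proof (induction B rule: infinite_finite_induct)
  case (insert b B)
  then show ?case by (simp add: iter_deriv_add smooth_sum)
qed (induction vs; simp add: iter_deriv_Cons dird_def)+

lemma dird_Basis:
  fixes f :: "'a::euclidean_space => 'b::real_normed_vector"
  assumes "\<And>x. f differentiable (at x)"
  shows "dird v f = (%x. \<Sum>b\<in>Basis. (v \<bullet> b) *\<^sub>R dird b f x)"
proof
  fix x
  have lin: "linear (%v. dird v f x)"
    using has_derivative_dird[OF assms] has_derivative_linear by blast
  have "dird (\<Sum>b\<in>Basis. (v \<bullet> b) *\<^sub>R b) f x = (\<Sum>b\<in>Basis. (v \<bullet> b) *\<^sub>R dird b f x)"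
    by (simp only: linear_sum[OF lin] linear_scale[OF lin])
  then show "dird v f x = (\<Sum>b\<in>Basis. (v \<bullet> b) *\<^sub>R dird b f x)" by (simp add: euclidean_representation)
qed

text \<open>Each list of directions comes with its own bound. Expanding directions in the basis
  reduces all lists of vectors of norm at most 1 to the finitely many lists of basis
  vectors.\<close>

lemma smooth_bounded_derivs:
  fixes f :: "'a::euclidean_space => 'b::real_normed_vector"
  assumes "smooth f" "\<And>vs. bounded (range (iter_deriv f vs))"
  shows "\<exists>C. \<forall>vs x. length vs = k --> (\<forall>v\<in>set vs. norm v <= 1) --> norm (iter_deriv f vs x) <= C"
  using assms
proof (induction k arbitrary: f)
  case 0
  from 0(2)[of "[]"] show ?case by (auto simp: bounded_iff)
next
  case (Suc k)
  have "\<forall>b\<in>Basis. \<exists>C. \<forall>vs x. length vs = k --> (\<forall>v\<in>set vs. norm v <= 1) --> norm (iter_deriv (dird b f) vs x) <= C"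
    using Suc.IH[OF smooth_dird[OF Suc.prems(1)]] Suc.prems(2) by (metis iter_deriv_snoc)
  then obtain C where C: "\<And>b vs x. b \<in> Basis ==> length vs = k ==> (\<forall>v\<in>set vs. norm v <= 1) ==>
      norm (iter_deriv (dird b f) vs x) <= C b" by metis
  have "norm (iter_deriv f vs x) <= (\<Sum>b\<in>Basis. C b)"
    if vs: "length vs = Suc k" "\<forall>v\<in>set vs. norm v <= 1" for vs x
  proof -
    obtain ws v where ws: "vs = ws @ [v]" using vs(1) by (metis length_Suc_conv_rev)
    have "iter_deriv f vs x = (\<Sum>b\<in>Basis. (v \<bullet> b) *\<^sub>R iter_deriv (dird b f) ws x)"
      unfolding ws iter_deriv_snoc
      by (subst dird_Basis[OF smooth_differentiable[OF Suc.prems(1)]])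
        (simp add: iter_deriv_sum iter_deriv_linear_out[OF bounded_linear_scaleR_right]
          smooth_linear_out[OF bounded_linear_scaleR_right] smooth_dird Suc.prems)
    also have "norm \<dots> <= (\<Sum>b\<in>Basis. C b)"
    proof (rule sum_norm_le)
      fix b :: 'a assume b: "b \<in> Basis"
      have "\<bar>v \<bullet> b\<bar> <= 1" using Basis_le_norm[OF b, of v] vs(2) ws by auto
      then have "norm ((v \<bullet> b) *\<^sub>R iter_deriv (dird b f) ws x) <= 1 * C b"
        unfolding norm_scaleR by (intro mult_mono C) (use b vs ws in auto)
      then show "norm ((v \<bullet> b) *\<^sub>R iter_deriv (dird b f) ws x) <= C b" by simp
    qed
    finally show ?thesis .
  qed
  then show ?case by blast
qed

lemma smooth_compact_support_bounded:
  fixes f :: "'a::euclidean_space => 'b::real_normed_vector"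
  assumes "smooth f" "\<And>x. r < norm x ==> f x = 0"
  shows "bounded (range (iter_deriv f vs))"
proof -
  have z: "iter_deriv f vs x = 0" if "r < norm x" for x
    by (rule iter_deriv_zero_on_open[of "{x. r < norm x}"])
      (use assms that in \<open>auto intro: open_Collect_less continuous_intros\<close>)
  have "bounded (iter_deriv f vs ` cball 0 r)"
    by (intro compact_imp_bounded compact_continuous_image smooth_continuous_on smooth_iter_deriv assms) auto
  moreover have "range (iter_deriv f vs) \<subseteq> insert 0 (iter_deriv f vs ` cball 0 r)"
    using z by (force simp: not_less)
  ultimately show ?thesis by (meson bounded_insert bounded_subset)
qed

section \<open>Oscillating exponentials and integration by parts\<close>

definition ee :: "'a::real_inner => 'a => complex" where "ee z x = cis (z \<bullet> x)"

lemma norm_ee [simp]: "norm (ee z x) = 1" by (simp add: ee_def)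

lemma ee_has_derivative: "(ee z has_derivative (%v. \<i> * of_real (z \<bullet> v) * ee z x)) (at x)"
proof -
  have g: "((%x. \<i> * of_real (z \<bullet> x)) has_derivative (%v. \<i> * of_real (z \<bullet> v))) (at x)"
    by (auto intro!: derivative_eq_intros)
  have "((%x. exp (\<i> * of_real (z \<bullet> x))) has_derivative
      (%v. exp (\<i> * of_real (z \<bullet> x)) * (\<i> * of_real (z \<bullet> v)))) (at x)"
    using has_derivative_compose[OF g DERIV_exp[unfolded has_field_derivative_def]] by simp
  moreover have "ee z = (%x. exp (\<i> * of_real (z \<bullet> x)))"
    by (simp add: ee_def cis_conv_exp fun_eq_iff)
  ultimately show ?thesis by (simp add: mult_ac)
qed

lemma dird_ee: "dird v (ee z) = (%x. \<i> * of_real (z \<bullet> v) * ee z x)"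
  by (rule dird_eqI) (rule ee_has_derivative)

lemma smooth_ee: "smooth (ee z)"
proof -
  have "C_diff k (ee z)" for k
  proof (induction k)
    case (Suc k)
    have c: "C_diff k (%x::'a. c::complex)" for c
      using smooth_const[of c, unfolded smooth_iff_C_diff] by blast
    have "C_diff k (dird v (ee z))" for v
      unfolding dird_ee by (intro C_diff_mult Suc c)
    then show ?case using ee_has_derivative by (auto simp: differentiable_def)
  qed simp
  then show ?thesis by (simp add: smooth_iff_C_diff del: C_diff.simps)
qed

lemma iter_deriv_ee: "iter_deriv (ee z) vs = (%x. (\<Prod>v\<leftarrow>vs. \<i> * of_real (z \<bullet> v)) * ee z x)"
proof (induction vs)
  case (Cons v vs)
  have "dird v (%x. c * ee z x) = (%x. c * (\<i> * of_real (z \<bullet> v) * ee z x))" for c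
    using dird_linear_out[OF bounded_linear_mult_right[of c] smooth_differentiable[OF smooth_ee[of z]]]
    by (simp add: dird_ee)
  then show ?case by (simp only: iter_deriv_Cons Cons.IH) (simp add: mult_ac)
qed simp

lemma borel_measurable_smooth: "smooth f ==> f \<in> borel_measurable borel"
  by (intro borel_measurable_continuous_onI smooth_continuous_on)

lemma integrable_translate_iff:
  fixes F :: "'a::euclidean_space => 'b::{banach, second_countable_topology}"
  assumes [measurable]: "F \<in> borel_measurable borel"
  shows "integrable lborel (%x. F (x + c)) \<longleftrightarrow> integrable lborel F"
  using integrable_distr_eq[of "(+) c" lborel borel F] by (simp add: lborel_distr_plus add.commute)

lemma integral_translate:
  fixes F :: "'a::euclidean_space => 'b::{banach, second_countable_topology}"
  assumes [measurable]: "F \<in> borel_measurable borel"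
  shows "(LINT x|lborel. F (x + c)) = (LINT x|lborel. F x)"
  using integral_distr[of "(+) c" lborel borel F] by (simp add: lborel_distr_plus add.commute)

text \<open>Translation invariance takes the place of boundary terms: F(x + v) - F(x) is the
  integral of the derivative over a segment, it integrates to 0 in x, and by Fubini that integral is
  also the one of \<open>dird v F\<close>. Integrability suffices, so the result covers compact
  supports and Schwartz functions alike.\<close>

lemma integral_dird_eq_0:
  fixes F :: "'a::euclidean_space => complex"
  assumes F: "smooth F" and int: "integrable lborel F" and int': "integrable lborel (dird v F)"
  shows "(LINT x|lborel. dird v F x) = 0"
proof -
  define D where "D = dird v F"
  have [measurable]: "F \<in> borel_measurable borel" "D \<in> borel_measurable borel"
    using F by (auto simp: D_def smooth_dird intro!: borel_measurable_smooth)
  have cont: "continuous_on A D" for A unfolding D_def by (intro smooth_continuous_on smooth_dird F)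
  define G :: "real => 'a => complex" where "G t x = indicator {0..1} t *\<^sub>R D (x + t *\<^sub>R v)" for t x
  have m[measurable]: "(%(t, x). G t x) \<in> borel_measurable (lborel \<Otimes>\<^sub>M lborel)"
    unfolding G_def by measurable
  have iG: "integrable lborel (G t)" for t
    unfolding G_def using int' by (intro integrable_scaleR_right) (simp add: integrable_translate_iff D_def[symmetric])
  have nG: "(LINT x|lborel. norm (G t x)) = indicator {0..1} t * (LINT x|lborel. norm (D x))" for t
    using integral_translate[of "%x. norm (D x)" "t *\<^sub>R v"] by (simp add: G_def)
  have Gi: "integrable (lborel \<Otimes>\<^sub>M lborel) (%(t, x). G t x)"
  proof (rule lborel_pair.Fubini_integrable)
    show "integrable lborel (%t. LINT x|lborel. norm (case (t, x) of (t, x) => G t x))"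
      by (simp add: nG)
  qed (use iG in simp_all)
  have t: "(LINT t|lborel. G t x) = F (x + v) - F x" for x
  proof -
    have "(LINT t|lborel. indicator {0..1} t *\<^sub>R D (x + t *\<^sub>R v)) = F (x + 1 *\<^sub>R v) - F (x + 0 *\<^sub>R v)"
    proof (rule integral_FTC_Icc)
      fix t :: real
      have "((%t. F (x + t *\<^sub>R v)) has_derivative (%s. dird (s *\<^sub>R v) F (x + t *\<^sub>R v))) (at t within {0..1})"
        by (rule has_derivative_compose[of "%t. x + t *\<^sub>R v" "%s. s *\<^sub>R v" t "{0..1}" F])
          (auto intro!: derivative_eq_intros has_derivative_dird smooth_differentiable F)
      moreover have "dird (s *\<^sub>R v) F y = s *\<^sub>R D y" for s y
        using linear_scale[OF has_derivative_linear[OF has_derivative_dird[OF smooth_differentiable[OF F]]]]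
        by (simp add: D_def)
      ultimately show "((%t. F (x + t *\<^sub>R v)) has_vector_derivative D (x + t *\<^sub>R v)) (at t within {0..1})"
        by (simp add: has_vector_derivative_def)
    qed (auto intro!: continuous_intros continuous_on_compose2[OF cont])
    then show ?thesis by (simp add: G_def)
  qed
  have one: "(LINT t|lborel. indicator {0..1::real} t *\<^sub>R c) = c" for c :: complex
    by (subst Bochner_Integration.integral_scaleR_left) auto
  have "(LINT x|lborel. F (x + v) - F x) = (LINT x|lborel. LINT t|lborel. G t x)" by (simp add: t)
  also have "\<dots> = (LINT t|lborel. LINT x|lborel. G t x)"
    using lborel_pair.Fubini_integral[OF Gi] by simp
  also have "\<dots> = (LINT t|lborel. indicator {0..1::real} t *\<^sub>R (LINT x|lborel. D x))"
  proof -
    have "(LINT x|lborel. G t x) = indicator {0..1} t *\<^sub>R (LINT x|lborel. D x)" for t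
      using integral_translate[of D "t *\<^sub>R v"] by (simp add: G_def)
    then show ?thesis by (simp only:)
  qed
  also have "\<dots> = (LINT x|lborel. D x)" by (rule one)
  also have "(LINT x|lborel. F (x + v) - F x) = 0"
    using int by (subst Bochner_Integration.integral_diff) (simp_all add: integrable_translate_iff integral_translate)
  finally show ?thesis by (simp add: D_def)
qed

lemma measurable_ee [measurable]: "ee z \<in> borel_measurable borel"
  by (rule borel_measurable_smooth[OF smooth_ee])

lemma integrable_ee_mult:
  fixes G :: "'a::euclidean_space => complex"
  assumes "integrable lborel G" shows "integrable lborel (%x. ee z x * G x)"
proof -
  have [measurable]: "G \<in> borel_measurable borel" using borel_measurable_integrable[OF assms] by simp
  show ?thesis
    by (rule Bochner_Integration.integrable_bound[OF assms]) (auto simp: norm_mult)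
qed

lemma fourier_dird:
  fixes G :: "'a::euclidean_space => complex"
  assumes "smooth G" "integrable lborel G" "integrable lborel (dird v G)"
  shows "(LINT x|lborel. ee z x * dird v G x) = - (\<i> * of_real (z \<bullet> v)) * (LINT x|lborel. ee z x * G x)"
proof -
  have d: "dird v (%x. ee z x * G x) = (%x. ee z x * dird v G x + (\<i> * of_real (z \<bullet> v)) * (ee z x * G x))"
    by (subst dird_mult) (auto simp: smooth_differentiable smooth_ee assms dird_ee algebra_simps)
  have "(LINT x|lborel. dird v (%x. ee z x * G x) x) = 0"
    by (rule integral_dird_eq_0)
      (auto simp: d intro!: smooth_mult smooth_ee assms integrable_ee_mult)
  then show ?thesis
    unfolding d using assms by (simp add: integrable_ee_mult eq_neg_iff_add_eq_0)
qed

text \<open>For e b = h b this is 1 - h^2 times the Laplacian. The directions are a parameter so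
  that the same operator can act on phase space along (0, h b), as in
  \<open>amp_lap\<close>.\<close>

definition lap :: "('a::euclidean_space => 'v::real_normed_vector) => ('v => complex) => 'v => complex" where
  "lap e f = (%p. f p - (\<Sum>b\<in>Basis. dird (e b) (dird (e b) f) p))"

lemma smooth_lap: "smooth f ==> smooth (lap e f)"
  unfolding lap_def diff_conv_add_uminus
  by (intro smooth_add smooth_linear_out[OF bounded_linear_minus[OF bounded_linear_ident]] smooth_sum smooth_dird)

lemma smooth_lap_funpow: "smooth f ==> smooth ((lap e ^^ L) f)"
  by (induction L) (auto simp: smooth_lap)

lemma unif_lap:
  assumes "unif I V R w F" "\<And>i b. i \<in> I ==> b \<in> Basis ==> e i b \<in> V i"
  shows "unif I V R w (%i. lap (e i) (F i))"
  unfolding lap_def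
  by (intro unif_diff[OF assms(1)] unif_sum unif_dird assms unif_nonneg[OF assms(1)])

lemma unif_lap_funpow:
  assumes "unif I V R w F" "\<And>i b. i \<in> I ==> b \<in> Basis ==> e i b \<in> V i"
  shows "unif I V R w (%i. (lap (e i) ^^ L) (F i))"
  by (induction L) (auto intro!: unif_lap assms)

lemma integrable_compact_support:
  fixes f :: "'a::euclidean_space => complex"
  assumes "smooth f" "\<And>x. x \<notin> cball q r ==> f x = 0"
  shows "integrable lborel f"
proof -
  have "integrable lborel (%x. indicator (cball q r) x *\<^sub>R f x)"
    using borel_integrable_compact[OF compact_cball smooth_continuous_on[OF assms(1)]] by auto
  also have "(%x. indicator (cball q r) x *\<^sub>R f x) = f"
    using assms(2) by (auto simp: indicator_def fun_eq_iff)
  finally show ?thesis .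
qed

lemma dird_zero_outside:
  fixes f :: "'a::real_normed_vector => 'b::real_normed_vector"
  assumes "\<And>x. x \<notin> cball q r ==> f x = 0" "x \<notin> cball q r" shows "dird v f x = 0"
  using iter_deriv_zero_on_open[of "- cball q r" f x "[v]"] assms by (auto simp: iter_deriv_Cons)

lemma lap_zero_outside:
  assumes "\<And>x. x \<notin> cball q r ==> f x = 0" "x \<notin> cball q r" shows "lap e f x = 0"
proof -
  have "dird (e b) (dird (e b) f) x = 0" for b
    by (rule dird_zero_outside[OF dird_zero_outside[OF assms(1)] assms(2)])
  then show ?thesis by (simp add: lap_def assms(1)[OF assms(2)])
qed

lemma lap_funpow_zero_outside:
  assumes "\<And>x. x \<notin> cball q r ==> f x = 0" "x \<notin> cball q r" shows "(lap e ^^ L) f x = 0"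
  using assms(2)
proof (induction L arbitrary: x)
  case (Suc L)
  show ?case by simp (rule lap_zero_outside[OF Suc.IH Suc.prems])
qed (use assms in simp)

text \<open>Integration by parts: the Fourier transform turns \<open>1 - h\<^sup>2\<Delta>\<close> into \<open>1 + h\<^sup>2|z|\<^sup>2\<close>.\<close>

lemma fourier_lap_funpow:
  fixes f :: "'a::euclidean_space => complex"
  assumes "smooth f" "\<And>x. x \<notin> cball q r ==> f x = 0"
  shows "(LINT x|lborel. ee z x * (lap (%b. h *\<^sub>R b) ^^ L) f x) =
     of_real ((1 + h\<^sup>2 * (norm z)\<^sup>2) ^ L) * (LINT x|lborel. ee z x * f x)"
proof (induction L)
  case (Suc L)
  define g where "g = (lap (%b. h *\<^sub>R b) ^^ L) f"
  have g: "smooth g" unfolding g_def by (rule smooth_lap_funpow[OF assms(1)])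
  have g0: "g x = 0" if "x \<notin> cball q r" for x
    unfolding g_def by (rule lap_funpow_zero_outside[where f=f, OF _ that]) (rule assms(2))
  note dz = dird_zero_outside[where f=g, OF g0]
  have ig: "integrable lborel g" "integrable lborel (dird v g)" "integrable lborel (dird u (dird v g))" for u v
    using g g0 dz dird_zero_outside[OF dz]
    by (auto intro!: integrable_compact_support[where q=q and r=r] smooth_dird)
  have 2: "(LINT x|lborel. ee z x * dird v (dird v g) x) = - of_real ((z \<bullet> v)\<^sup>2) * (LINT x|lborel. ee z x * g x)" for v
    by (subst fourier_dird, simp_all add: ig g smooth_dird, subst fourier_dird)
      (simp_all add: ig g smooth_dird power2_eq_square algebra_simps)
  have "(LINT x|lborel. ee z x * lap (%b. h *\<^sub>R b) g x) =
      (LINT x|lborel. ee z x * g x - (\<Sum>b\<in>Basis. ee z x * dird (h *\<^sub>R b) (dird (h *\<^sub>R b) g) x))"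
    by (simp add: lap_def algebra_simps sum_distrib_left)
  also have "\<dots> = (LINT x|lborel. ee z x * g x) -
      (\<Sum>b\<in>Basis. LINT x|lborel. ee z x * dird (h *\<^sub>R b) (dird (h *\<^sub>R b) g) x)"
    by (subst Bochner_Integration.integral_diff)
      (auto intro!: integrable_ee_mult ig Bochner_Integration.integrable_sum Bochner_Integration.integral_sum)
  also have "\<dots> = (1 + of_real (\<Sum>b\<in>Basis. (h * (z \<bullet> b))\<^sup>2)) * (LINT x|lborel. ee z x * g x)"
    by (simp add: 2 sum_negf algebra_simps sum_distrib_left sum_distrib_right)
  also have "(\<Sum>b\<in>Basis. (h * (z \<bullet> b))\<^sup>2) = h\<^sup>2 * (norm z)\<^sup>2"
  proof -
    have "(norm z)\<^sup>2 = (\<Sum>b\<in>Basis. (z \<bullet> b)\<^sup>2)"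
      unfolding power2_norm_eq_inner euclidean_inner[of z z] by (simp add: power2_eq_square)
    then show ?thesis by (simp add: power_mult_distrib sum_distrib_left)
  qed
  finally show ?case using Suc by (simp add: g_def)
qed simp

section \<open>Polynomial weights\<close>

definition jw :: "nat => 'a::real_normed_vector => real" where
  "jw L x = 1 / (1 + (norm x)\<^sup>2) ^ L"

lemma jw_pos: "0 < jw L x" and jw_nonneg [simp]: "0 <= jw L x" and jw_le_1: "jw L x <= 1"
proof -
  have "0 < 1 + (norm x)\<^sup>2" by (simp add: add_pos_nonneg)
  then show "0 < jw L x" by (simp add: jw_def)
  then show "0 <= jw L x" by simp
  have "1 <= (1 + (norm x)\<^sup>2) ^ L" by (rule one_le_power) simp
  then have "1 / (1 + (norm x)\<^sup>2) ^ L <= 1 / 1"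
    by (intro divide_left_mono) (simp_all add: add_pos_nonneg)
  then show "jw L x <= 1" by (simp add: jw_def)
qed

lemma jw_mono: "norm x <= norm y ==> jw L y <= jw L x"
  unfolding jw_def
  by (intro divide_left_mono power_mono add_left_mono mult_pos_pos zero_less_power)
    (auto simp: add_pos_nonneg)

lemma jw_add: "jw (L + M) x = jw L x * jw M x"
  by (simp add: jw_def power_add)

lemma jw_antimono: "L <= M ==> jw M x <= jw L x"
  using jw_add[of L "M - L" x] mult_left_mono[OF jw_le_1[of "M - L" x] jw_nonneg[of L x]] by simp

lemma borel_measurable_jw [measurable]: "jw L \<in> borel_measurable borel"
  unfolding jw_def by measurable

lemma nn_integral_affine:
  fixes f :: "'a::euclidean_space => ennreal"
  assumes [measurable]: "f \<in> borel_measurable borel" and "0 < c"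
  shows "(\<integral>\<^sup>+x. f ((x - q) /\<^sub>R c) \<partial>lborel) = ennreal (c ^ DIM('a)) * (\<integral>\<^sup>+x. f x \<partial>lborel)"
  using assms(2)
  by (subst lborel_affine[of c q])
    (simp_all add: nn_integral_density nn_integral_distr nn_integral_cmult)

lemma term_le_suminf_ennreal: "f k <= suminf f" for f :: "nat => ennreal"
  using sum_le_suminf[of f "{k}"] by simp

text \<open>Sum over dyadic balls. At the first k with |x| <= 2^k the weight is at most 4^L 4^(-kL),
  while the ball has volume at most 2^n 2^(kn). Since L >= n >= 1 implies 2L >= n + 1, the k-th term
  is at most a constant times 2^(-k).\<close>

lemma jw_integral_finite:
  assumes "DIM('a::euclidean_space) <= L"
  shows "(\<integral>\<^sup>+x. ennreal (jw L (x::'a)) \<partial>lborel) < \<infinity>"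
proof -
  define n where "n = DIM('a)"
  have n: "1 <= n" unfolding n_def by (simp add: DIM_positive Suc_leI)
  define B where "B k = {x::'a. norm x <= 2 ^ k}" for k
  have Bm[measurable]: "B k \<in> sets borel" for k unfolding B_def by measurable
  have pw: "ennreal (jw L x) <= (\<Sum>k. ennreal (4 ^ L / 4 ^ (k * L)) * indicator (B k) x)" for x :: 'a
  proof -
    obtain m where "norm x < 2 ^ m" using real_arch_pow[of 2 "norm x"] by auto
    define k where "k = (LEAST m. norm x <= 2 ^ m)"
    have k: "norm x <= 2 ^ k" unfolding k_def by (rule LeastI[of _ m]) (use \<open>norm x < 2 ^ m\<close> in simp)
    have "jw L x <= 4 ^ L / 4 ^ (k * L)"
    proof (cases k)
      case 0
      have "1 <= (4::real) ^ L" by (rule one_le_power) simp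
      then show ?thesis using order_trans[OF jw_le_1[of L x]] 0 by simp
    next
      case (Suc j)
      have "2 ^ j <= norm x"
        using not_less_Least[of j "%m. norm x <= 2 ^ m"] Suc unfolding k_def by simp
      then have "(2 ^ j)\<^sup>2 <= (norm x)\<^sup>2" by (intro power_mono) auto
      then have "4 ^ j <= 1 + (norm x)\<^sup>2" by (simp add: power_mult[symmetric] mult.commute[of j] power_mult)
      then have "(4 ^ j) ^ L <= (1 + (norm x)\<^sup>2) ^ L" by (intro power_mono) auto
      then have "jw L x <= 1 / (4 ^ j) ^ L" unfolding jw_def by (intro divide_left_mono) (auto intro!: mult_pos_pos zero_less_power add_pos_nonneg)
      also have "\<dots> = 4 ^ L / 4 ^ (k * L)" using Suc by (simp add: power_mult[symmetric] power_add)
      finally show ?thesis .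
    qed
    then have "ennreal (jw L x) <= ennreal (4 ^ L / 4 ^ (k * L)) * indicator (B k) x"
      using k by (simp add: B_def ennreal_leI)
    also have "\<dots> <= (\<Sum>k. ennreal (4 ^ L / 4 ^ (k * L)) * indicator (B k) x)"
      by (rule term_le_suminf_ennreal[of "%k. ennreal (4 ^ L / 4 ^ (k * L)) * indicator (B k) x"])
    finally show ?thesis .
  qed
  have em: "emeasure lborel (B k) <= ennreal (2 ^ n * 2 ^ (k * n))" for k
  proof -
    have "B k \<subseteq> cbox (- (2 ^ k *\<^sub>R One)) (2 ^ k *\<^sub>R One)"
    proof
      fix x assume "x \<in> B k"
      then have "\<bar>x \<bullet> b\<bar> <= 2 ^ k" if "b \<in> Basis" for b
        using Basis_le_norm[OF that, of x] by (simp add: B_def)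
      then show "x \<in> cbox (- (2 ^ k *\<^sub>R One)) (2 ^ k *\<^sub>R One)"
        by (force simp: mem_box abs_le_iff)
    qed
    then have "emeasure lborel (B k) <= emeasure lborel (cbox (- (2 ^ k *\<^sub>R One)) (2 ^ k *\<^sub>R One :: 'a))"
      by (rule emeasure_mono) simp
    also have "\<dots> = ennreal (\<Prod>b\<in>(Basis::'a set). 2 * 2 ^ k)"
    proof (subst emeasure_lborel_cbox)
      show "ennreal (\<Prod>b\<in>(Basis::'a set). (2 ^ k *\<^sub>R One - - (2 ^ k *\<^sub>R One)) \<bullet> b) = ennreal (\<Prod>b\<in>(Basis::'a set). 2 * 2 ^ k)"
        by (intro arg_cong[where f=ennreal] prod.cong refl) (simp add: inner_add_left)
    qed simp
    finally show ?thesis by (simp add: n_def power_mult_distrib power_mult)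
  qed
  have "(\<integral>\<^sup>+x. ennreal (jw L (x::'a)) \<partial>lborel) <= (\<integral>\<^sup>+x. (\<Sum>k. ennreal (4 ^ L / 4 ^ (k * L)) * indicator (B k) x) \<partial>lborel)"
    by (rule nn_integral_mono) (rule pw)
  also have "\<dots> = (\<Sum>k. ennreal (4 ^ L / 4 ^ (k * L)) * emeasure lborel (B k))"
    by (subst nn_integral_suminf) (auto simp: nn_integral_cmult)
  also have "\<dots> <= (\<Sum>k. ennreal (4 ^ L * 2 ^ n * (1 / 2) ^ k))"
  proof (rule suminf_le)
    fix k
    have "ennreal (4 ^ L / 4 ^ (k * L)) * emeasure lborel (B k) <= ennreal (4 ^ L / 4 ^ (k * L)) * ennreal (2 ^ n * 2 ^ (k * n))"
      by (intro mult_left_mono em) auto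
    also have "\<dots> = ennreal (4 ^ L / 4 ^ (k * L) * (2 ^ n * 2 ^ (k * n)))" by (rule ennreal_mult[symmetric]) simp_all
    also have "\<dots> <= ennreal (4 ^ L * 2 ^ n * (1 / 2) ^ k)"
    proof (rule ennreal_leI)
      have "(2::real) ^ (k * n) * 2 ^ k <= 2 ^ (2 * (k * L))"
      proof -
        have "k * n <= k * L" "k * 1 <= k * L"
          by (rule mult_le_mono2, use assms order_trans[OF n] in \<open>simp add: n_def\<close>)+
        then have "k * n + k <= 2 * (k * L)" by linarith
        then show ?thesis unfolding power_add[symmetric] by (rule power_increasing) simp
      qed
      then have "(2::real) ^ (k * n) * 2 ^ k <= 4 ^ (k * L)" by (simp add: power_mult)
      then have "(2::real) ^ (k * n) / 4 ^ (k * L) <= 1 / 2 ^ k" by (simp add: field_simps)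
      then have "4 ^ L * 2 ^ n * ((2::real) ^ (k * n) / 4 ^ (k * L)) <= 4 ^ L * 2 ^ n * (1 / 2 ^ k)"
        by (intro mult_left_mono) auto
      then show "4 ^ L / 4 ^ (k * L) * (2 ^ n * 2 ^ (k * n)) <= (4 ^ L * 2 ^ n * (1 / 2) ^ k :: real)"
        by (simp add: power_divide mult_ac)
    qed
    finally show "ennreal (4 ^ L / 4 ^ (k * L)) * emeasure lborel (B k) <= ennreal (4 ^ L * 2 ^ n * (1 / 2) ^ k)" .
  qed auto
  also have "\<dots> = ennreal (\<Sum>k. 4 ^ L * 2 ^ n * (1 / 2) ^ k)"
    by (intro suminf_ennreal2 summable_mult summable_geometric) auto
  finally show ?thesis by (simp add: le_less_trans)
qed

lemma jw_integrable:
  assumes "DIM('a::euclidean_space) <= L" shows "integrable lborel (jw L :: 'a => real)"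
  using jw_integral_finite[OF assms] by (intro integrableI_bounded) auto

section \<open>Operators with compactly supported amplitudes\<close>

lemma measurable_ee2 [measurable (raw)]:
  fixes f g :: "'m => 'a::euclidean_space"
  assumes [measurable]: "f \<in> borel_measurable M" "g \<in> borel_measurable M"
  shows "(%x. ee (f x) (g x)) \<in> borel_measurable M"
proof -
  have [measurable]: "cis \<in> borel_measurable borel"
    by (intro borel_measurable_continuous_onI continuous_intros)
  show ?thesis unfolding ee_def by measurable
qed

lemma ee_diff: "ee (x - y) z = ee x z * ee (- y) z"
  by (simp add: ee_def cis_mult inner_diff_left)

lemma cnj_ee: "cnj (ee x y) = ee (- x) y"
  by (simp add: ee_def cis_cnj)

text \<open>A triple (M, Y, u) stands for the complex measure that puts the mass u dM at the points
  Y, and \<open>ft\<close> is its Fourier transform. With \<open>lborel\<close> and the identity it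
  is an integrable function; with a one-point space it is a point mass, for which \<open>opT\<close>
  returns a column of the kernel.\<close>

definition datum :: "'m measure => ('m => 'a::euclidean_space) => ('m => complex) => bool" where
  "datum M Y u \<longleftrightarrow> sigma_finite_measure M \<and> Y \<in> borel_measurable M \<and> integrable M u"

definition ft :: "'m measure => ('m => 'a::euclidean_space) => ('m => complex) => 'a => complex" where
  "ft M Y u \<xi> = (LINT m|M. ee (- Y m) \<xi> * u m)"

definition opT :: "('a \<times> 'a => complex) => ('a => complex) => 'a::euclidean_space => complex" where
  "opT a w x = (LINT \<xi>|lborel. ee x \<xi> * a (x, \<xi>) * w \<xi>)"

text \<open>The input damped away from q at scale h. The damping is a power weight and not a cutoff,
  because powers of y - q are what integration by parts in \<xi> produces.\<close>

definition wdat :: "nat => ('m => 'a::euclidean_space) => 'a => real => ('m => complex) => 'm => complex" where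
  "wdat L Y q h u m = of_real (jw L ((Y m - q) /\<^sub>R h)) * u m"

lemma datum_wdat:
  assumes "datum M Y u" shows "datum M Y (wdat L Y q h u)"
proof -
  have [measurable]: "Y \<in> borel_measurable M" "u \<in> borel_measurable M" and "integrable M u"
    using assms by (auto simp: datum_def)
  have "integrable M (wdat L Y q h u)"
    by (rule Bochner_Integration.integrable_bound[OF \<open>integrable M u\<close>])
      (auto simp: wdat_def[abs_def] norm_mult jw_le_1 intro!: mult_left_le_one_le)
  then show ?thesis using assms by (simp add: datum_def)
qed

lemma ft_measurable:
  assumes "datum M Y u" shows "ft M Y u \<in> borel_measurable borel"
proof -
  interpret sigma_finite_measure M using assms by (simp add: datum_def)
  have [measurable]: "Y \<in> borel_measurable M" "u \<in> borel_measurable M"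
    using assms by (auto simp: datum_def)
  show ?thesis unfolding ft_def[abs_def] by measurable
qed

lemma ft_bound:
  assumes "datum M Y u" shows "norm (ft M Y u \<xi>) <= (LINT m|M. norm (u m))"
  unfolding ft_def by (rule order_trans[OF integral_norm_bound]) (simp add: norm_mult)

text \<open>Fubini: the exponentials have modulus 1, so integrability of \<open>a\<close> in \<xi>
  and of \<open>u\<close> suffices. It turns the definition on the frequency side into a kernel
  representation.\<close>

lemma opT_swap:
  assumes d: "datum M Y u" and a: "integrable lborel (%\<xi>. a (x, \<xi>))"
  shows "opT a (ft M Y u) x = (LINT m|M. u m * (LINT \<xi>|lborel. ee (x - Y m) \<xi> * a (x, \<xi>)))"
proof -
  interpret sigma_finite_measure M using d by (simp add: datum_def)
  interpret P: pair_sigma_finite lborel M ..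
  have [measurable]: "Y \<in> borel_measurable M" "u \<in> borel_measurable M" and iu: "integrable M u"
    using d by (auto simp: datum_def)
  have [measurable]: "(%\<xi>. a (x, \<xi>)) \<in> borel_measurable borel"
    using borel_measurable_integrable[OF a] by simp
  define f where "f \<xi> m = ee x \<xi> * a (x, \<xi>) * (ee (- Y m) \<xi> * u m)" for \<xi> m
  have f[measurable]: "(%(\<xi>, m). f \<xi> m) \<in> borel_measurable (lborel \<Otimes>\<^sub>M M)"
    unfolding f_def by measurable
  have fi: "integrable (lborel \<Otimes>\<^sub>M M) (%(\<xi>, m). f \<xi> m)"
  proof (rule P.Fubini_integrable)
    have "(%\<xi>. LINT m|M. norm (f \<xi> m)) = (%\<xi>. norm (a (x, \<xi>)) * (LINT m|M. norm (u m)))"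
      by (simp add: f_def norm_mult)
    then show "integrable lborel (%\<xi>. LINT m|M. norm (case (\<xi>, m) of (\<xi>, m) => f \<xi> m))"
      using a by simp
    have "integrable M (%m. ee (- Y m) \<xi> * u m)" for \<xi>
      by (rule Bochner_Integration.integrable_bound[OF iu]) (auto simp: norm_mult)
    then show "AE \<xi> in lborel. integrable M (%m. case (\<xi>, m) of (\<xi>, m) => f \<xi> m)"
      by (simp add: f_def)
  qed simp
  have "opT a (ft M Y u) x = (LINT \<xi>|lborel. LINT m|M. f \<xi> m)"
    by (simp add: opT_def ft_def f_def)
  also have "\<dots> = (LINT m|M. LINT \<xi>|lborel. f \<xi> m)"
    using P.Fubini_integral[OF fi] by simp
  also have "(%m. LINT \<xi>|lborel. f \<xi> m) = (%m. u m * (LINT \<xi>|lborel. ee (x - Y m) \<xi> * a (x, \<xi>)))"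
  proof
    fix m
    have "(LINT \<xi>|lborel. f \<xi> m) = (LINT \<xi>|lborel. u m * (ee (x - Y m) \<xi> * a (x, \<xi>)))"
      by (simp add: f_def ee_diff mult_ac)
    then show "(LINT \<xi>|lborel. f \<xi> m) = u m * (LINT \<xi>|lborel. ee (x - Y m) \<xi> * a (x, \<xi>))" by simp
  qed
  finally show ?thesis .
qed

section \<open>Integration by parts centred at a window\<close>

text \<open>With the factor \<open>exp (\<i> (x - q) \<cdot> \<xi>)\<close> split off, this is the partial derivative in \<open>\<xi>\<close>;
  integration by parts therefore produces powers of \<open>y - q\<close> instead of \<open>y - x\<close>.\<close>

definition cder :: "'a => real => 'a => ('a \<times> 'a => complex) => 'a::euclidean_space \<times> 'a => complex" where
  "cder q h b F = (%p. dird (0, b /\<^sub>R h) F p + \<i> * of_real ((fst p - q) \<bullet> (b /\<^sub>R h)) * F p)"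

definition clap :: "'a => real => ('a \<times> 'a => complex) => 'a::euclidean_space \<times> 'a => complex" where
  "clap q h F = (%p. F p - (\<Sum>b\<in>Basis. cder q h b (cder q h b F) p))"

lemma bounded_linear_snd_emb: "bounded_linear (%\<xi>. (0::'b::real_normed_vector, \<xi>::'a::real_normed_vector))"
  by (intro bounded_linear_Pair bounded_linear_zero bounded_linear_ident)

lemma bounded_linear_fst_emb: "bounded_linear (%\<xi>. (\<xi>::'a::real_normed_vector, 0::'b::real_normed_vector))"
  by (intro bounded_linear_Pair bounded_linear_zero bounded_linear_ident)

lemma smooth_slice_snd: "smooth F ==> smooth (%\<xi>. F (x, \<xi>))"
  using smooth_affine_in[OF bounded_linear_snd_emb, of F "(x, 0)"] by simp

lemma dird_slice_snd: "smooth F ==> dird (0, v) F (x, \<xi>) = dird v (%\<xi>. F (x, \<xi>)) \<xi>"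
  using dird_affine_in[OF bounded_linear_snd_emb smooth_differentiable, of F v "(x, 0)"]
  by (simp add: fun_eq_iff)

lemma smooth_linear_coeff: "smooth (%p::'a::euclidean_space \<times> 'a. \<i> * of_real ((fst p - q) \<bullet> v) :: complex)"
proof -
  have "bounded_linear (%p::'a \<times> 'a. \<i> * of_real (fst p \<bullet> v) :: complex)"
    by (intro bounded_linear_mult_right[THEN bounded_linear_compose] bounded_linear_of_real[THEN bounded_linear_compose]
        bounded_linear_inner_left[THEN bounded_linear_compose] bounded_linear_fst)
  from smooth_add[OF smooth_bounded_linear[OF this] smooth_const[of "- \<i> * of_real (q \<bullet> v)"]]
  show ?thesis by (simp add: inner_diff_left algebra_simps)
qed

lemma smooth_cder: "smooth F ==> smooth (cder q h b F)"
  unfolding cder_def by (intro smooth_add smooth_mult smooth_linear_coeff smooth_dird)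

lemma smooth_clap: "smooth F ==> smooth (clap q h F)"
  unfolding clap_def diff_conv_add_uminus
  by (intro smooth_add smooth_linear_out[OF bounded_linear_minus[OF bounded_linear_ident]] smooth_sum smooth_cder)

lemma smooth_clap_funpow: "smooth F ==> smooth ((clap q h ^^ L) F)"
  by (induction L) (auto simp: smooth_clap)

definition xsupp :: "'a set => ('a::euclidean_space \<times> 'a => complex) => bool" where
  "xsupp S F \<longleftrightarrow> (\<forall>x \<xi>. \<xi> \<notin> S --> F (x, \<xi>) = 0)"

lemma dird_support:
  assumes "closed S" "xsupp S F" shows "xsupp S (dird v F)"
proof -
  have "open {p::'a \<times> 'a. snd p \<notin> S}"
    using open_vimage_snd[OF open_Compl[OF assms(1)]] by (simp add: vimage_def)
  from iter_deriv_zero_on_open[OF this, of F _ "[v]"] show ?thesis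
    using assms by (auto simp: iter_deriv_Cons xsupp_def)
qed

lemma cder_support: "closed S ==> xsupp S F ==> xsupp S (cder q h b F)"
  using dird_support[of S F "(0, b /\<^sub>R h)"] by (simp add: xsupp_def cder_def)

lemma clap_support: "closed S ==> xsupp S F ==> xsupp S (clap q h F)"
  using cder_support[OF _ cder_support, of S F] by (simp add: xsupp_def clap_def)

lemma clap_funpow_support: "closed S ==> xsupp S F ==> xsupp S ((clap q h ^^ L) F)"
  by (induction L) (simp_all add: clap_support)

lemma integrable_slice:
  fixes F :: "'a::euclidean_space \<times> 'a => complex"
  assumes "smooth F" "xsupp S F" "bounded S"
  shows "integrable lborel (%\<xi>. F (x, \<xi>))"
proof -
  obtain r where r: "\<And>\<xi>. \<xi> \<in> S ==> norm \<xi> <= r"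
    using assms(3) unfolding bounded_iff by blast
  show ?thesis
  proof (rule integrable_compact_support[of _ 0 r])
    show "smooth (%\<xi>. F (x, \<xi>))" by (rule smooth_slice_snd[OF assms(1)])
    show "F (x, \<xi>) = 0" if "\<xi> \<notin> cball 0 r" for \<xi>
      using that r[of \<xi>] assms(2) by (auto simp: xsupp_def)
  qed
qed

text \<open>The partial derivative contributes -(x - y) and the extra term of \<open>cder\<close>
  contributes x - q; in the sum y - q the variable x no longer occurs.\<close>

lemma fourier_cder:
  fixes F :: "'a::euclidean_space \<times> 'a => complex"
  assumes F: "smooth F" "xsupp S F" and S: "closed S" "bounded S"
  shows "(LINT \<xi>|lborel. ee (x - y) \<xi> * cder q h b F (x, \<xi>)) =
    \<i> * of_real ((y - q) \<bullet> (b /\<^sub>R h)) * (LINT \<xi>|lborel. ee (x - y) \<xi> * F (x, \<xi>))"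
proof -
  define v where "v = b /\<^sub>R h"
  have i1: "integrable lborel (%\<xi>. F (x, \<xi>))"
    by (rule integrable_slice[OF F S(2)])
  have i2: "integrable lborel (%\<xi>. dird (0, v) F (x, \<xi>))"
    by (rule integrable_slice[OF smooth_dird[OF F(1)] dird_support[OF S(1) F(2)] S(2)])
  have "(LINT \<xi>|lborel. ee (x - y) \<xi> * cder q h b F (x, \<xi>)) =
    (LINT \<xi>|lborel. ee (x - y) \<xi> * dird v (%\<xi>. F (x, \<xi>)) \<xi> + \<i> * of_real ((x - q) \<bullet> v) * (ee (x - y) \<xi> * F (x, \<xi>)))"
    by (simp add: cder_def dird_slice_snd[OF F(1)] v_def[symmetric] algebra_simps)
  also have "\<dots> = (LINT \<xi>|lborel. ee (x - y) \<xi> * dird v (%\<xi>. F (x, \<xi>)) \<xi>) +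
      \<i> * of_real ((x - q) \<bullet> v) * (LINT \<xi>|lborel. ee (x - y) \<xi> * F (x, \<xi>))"
    using i1 i2 by (subst Bochner_Integration.integral_add)
      (auto intro!: integrable_ee_mult simp: dird_slice_snd[OF F(1)])
  also have "(LINT \<xi>|lborel. ee (x - y) \<xi> * dird v (%\<xi>. F (x, \<xi>)) \<xi>) =
      - (\<i> * of_real ((x - y) \<bullet> v)) * (LINT \<xi>|lborel. ee (x - y) \<xi> * F (x, \<xi>))"
    using i1 i2 by (intro fourier_dird smooth_slice_snd[OF F(1)]) (simp_all add: dird_slice_snd[OF F(1)])
  finally show ?thesis by (simp add: v_def[symmetric] inner_diff_left algebra_simps)
qed

lemma fourier_clap_funpow:
  fixes F :: "'a::euclidean_space \<times> 'a => complex"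
  assumes F: "smooth F" "xsupp S F" and S: "closed S" "bounded S"
  shows "(LINT \<xi>|lborel. ee (x - y) \<xi> * F (x, \<xi>)) =
    of_real (jw L ((y - q) /\<^sub>R h)) * (LINT \<xi>|lborel. ee (x - y) \<xi> * (clap q h ^^ L) F (x, \<xi>))"
proof -
  have "(LINT \<xi>|lborel. ee (x - y) \<xi> * (clap q h ^^ L) F (x, \<xi>)) =
    of_real ((1 + (norm ((y - q) /\<^sub>R h))\<^sup>2) ^ L) * (LINT \<xi>|lborel. ee (x - y) \<xi> * F (x, \<xi>))"
  proof (induction L)
    case (Suc L)
    define G where "G = (clap q h ^^ L) F"
    have G: "smooth G" "xsupp S G"
      unfolding G_def using smooth_clap_funpow[OF F(1)] clap_funpow_support[OF S(1) F(2)] by auto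
    have c1: "smooth (cder q h b G)" "xsupp S (cder q h b G)" for b
      using smooth_cder[OF G(1)] cder_support[OF S(1) G(2)] by auto
    have c2: "smooth (cder q h b (cder q h b G))" "xsupp S (cder q h b (cder q h b G))" for b
      using smooth_cder[OF c1(1)] cder_support[OF S(1) c1(2)] by auto
    note ig = integrable_ee_mult[OF integrable_slice[OF G S(2)]] integrable_ee_mult[OF integrable_slice[OF c2 S(2)]]
    have "(LINT \<xi>|lborel. ee (x - y) \<xi> * clap q h G (x, \<xi>)) =
      (LINT \<xi>|lborel. ee (x - y) \<xi> * G (x, \<xi>) - (\<Sum>b\<in>Basis. ee (x - y) \<xi> * cder q h b (cder q h b G) (x, \<xi>)))"
      by (simp add: clap_def algebra_simps sum_distrib_left)
    also have "\<dots> = (LINT \<xi>|lborel. ee (x - y) \<xi> * G (x, \<xi>)) -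
        (\<Sum>b\<in>Basis. LINT \<xi>|lborel. ee (x - y) \<xi> * cder q h b (cder q h b G) (x, \<xi>))"
      by (subst Bochner_Integration.integral_diff)
        (auto intro!: ig Bochner_Integration.integrable_sum Bochner_Integration.integral_sum)
    also have "(%b. LINT \<xi>|lborel. ee (x - y) \<xi> * cder q h b (cder q h b G) (x, \<xi>)) =
       (%b. - of_real (((y - q) \<bullet> (b /\<^sub>R h))\<^sup>2) * (LINT \<xi>|lborel. ee (x - y) \<xi> * G (x, \<xi>)))"
      by (simp add: fourier_cder[OF c1 S] fourier_cder[OF G S] power2_eq_square fun_eq_iff algebra_simps)
    also have "(LINT \<xi>|lborel. ee (x - y) \<xi> * G (x, \<xi>)) -
        (\<Sum>b\<in>Basis. - of_real (((y - q) \<bullet> (b /\<^sub>R h))\<^sup>2) * (LINT \<xi>|lborel. ee (x - y) \<xi> * G (x, \<xi>))) =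
        (1 + of_real (\<Sum>b\<in>Basis. ((y - q) \<bullet> (b /\<^sub>R h))\<^sup>2)) * (LINT \<xi>|lborel. ee (x - y) \<xi> * G (x, \<xi>))"
      by (simp add: sum_negf algebra_simps sum_distrib_left sum_distrib_right)
    also have "(\<Sum>b\<in>Basis. ((y - q) \<bullet> (b /\<^sub>R h))\<^sup>2) = (norm ((y - q) /\<^sub>R h))\<^sup>2"
      unfolding power2_norm_eq_inner euclidean_inner[of "(y - q) /\<^sub>R h" "(y - q) /\<^sub>R h"]
      by (simp add: power2_eq_square)
    finally show ?case using Suc by (simp add: G_def)
  qed simp
  moreover have "of_real (jw L ((y - q) /\<^sub>R h)) * of_real ((1 + (norm ((y - q) /\<^sub>R h))\<^sup>2) ^ L) = (1::complex)"
  proof -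
    have "0 < 1 + (norm ((y - q) /\<^sub>R h))\<^sup>2" by (simp add: add_pos_nonneg)
    then have "jw L ((y - q) /\<^sub>R h) * (1 + (norm ((y - q) /\<^sub>R h))\<^sup>2) ^ L = 1" by (simp add: jw_def)
    then show ?thesis by (metis of_real_1 of_real_mult)
  qed
  ultimately show ?thesis by (simp add: mult.assoc[symmetric])
qed

text \<open>The factor \<open>jw\<close> produced by integration by parts depends on y only and is
  absorbed by the input. The price is growth of the new amplitude in (x - q)/h, which is harmless
  for x in a window of width comparable to h around q.\<close>

lemma opT_weighted:
  assumes d: "datum M Y u" and F: "smooth F" "xsupp S F" and S: "closed S" "bounded S"
  shows "opT F (ft M Y u) x = opT ((clap q h ^^ L) F) (ft M Y (wdat L Y q h u)) x"
proof -
  have G: "smooth ((clap q h ^^ L) F)" "xsupp S ((clap q h ^^ L) F)"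
    using smooth_clap_funpow[OF F(1)] clap_funpow_support[OF S(1) F(2)] by auto
  show ?thesis
    unfolding opT_swap[OF d integrable_slice[OF F S(2)]] opT_swap[OF datum_wdat[OF d] integrable_slice[OF G S(2)]]
    unfolding fourier_clap_funpow[OF F S, where L=L and q=q and h=h] by (simp add: wdat_def mult_ac)
qed

lemma unif_base:
  fixes f :: "'a::euclidean_space => complex"
  assumes "smooth f" "\<And>vs. bounded (range (iter_deriv f vs))"
  shows "unif (UNIV::unit set) (%_. cball 0 1) (%_. UNIV) (%_. 1) (%_. f)"
proof (rule unifI)
  show "\<exists>C. \<forall>i\<in>UNIV. \<forall>p\<in>UNIV. \<forall>vs. length vs = k --> set vs \<subseteq> cball 0 1 -->
        norm (iter_deriv f vs p) <= C * 1" for k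
  proof -
    obtain C where "\<And>vs x. length vs = k ==> (\<forall>v\<in>set vs. norm v <= 1) ==> norm (iter_deriv f vs x) <= C"
      using smooth_bounded_derivs[OF assms, of k] by blast
    then show ?thesis by (intro exI[of _ C]) (auto simp: subset_iff)
  qed
qed (use assms in auto)

lemma unif_id:
  assumes "0 <= r"
  shows "unif (UNIV::unit set) (%_. cball 0 1) (%_. cball 0 r) (%_. 1) (%_ z. z :: complex)"
proof (rule unifI)
  fix k
  have "norm (iter_deriv (%z. z) vs p) <= max r 1" if "norm p <= r" "set vs \<subseteq> cball 0 1" for vs and p :: complex
  proof -
    have *: "iter_deriv (%z::complex. z) vs = (%z. z) \<or> (\<exists>c. norm c <= 1 \<and> iter_deriv (%z. z) vs = (%z. c))"
      using that(2)
    proof (induction vs)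
      case (Cons v vs)
      then have v: "norm v <= 1" by auto
      from Cons have "iter_deriv (%z::complex. z) vs = (%z. z) \<or> (\<exists>c. norm c <= 1 \<and> iter_deriv (%z. z) vs = (%z. c))" by auto
      then show ?case
      proof (elim disjE exE conjE)
        assume "iter_deriv (%z::complex. z) vs = (%z. z)"
        then show ?thesis using v by (intro disjI2 exI[of _ v]) (simp add: iter_deriv_Cons dird_def)
      next
        fix c assume "iter_deriv (%z. z) vs = (%z. c)"
        then show ?thesis by (auto simp: iter_deriv_Cons dird_def intro!: exI[of _ 0])
      qed
    qed simp
    then show ?thesis using that(1) by auto
  qed
  then show "\<exists>C. \<forall>i\<in>UNIV. \<forall>p\<in>cball 0 r. \<forall>vs. length vs = k --> set vs \<subseteq> cball 0 1 -->
        norm (iter_deriv (%z::complex. z) vs p) <= C * 1" by (intro exI[of _ "max r 1"]) auto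
qed (auto intro: smooth_bounded_linear bounded_linear_ident)

section \<open>Almost orthogonality by windowed integration by parts\<close>

text \<open>For |x - q| < 3h the coefficient (x - q)/h of \<open>cder\<close> is bounded, and its
  derivative along an admissible direction is at most 1 because the x-components have length at most
  h. The centre q is part of the index.\<close>

lemma unif_linear_coeff:
  fixes h :: "'i => real" and b :: "'a::euclidean_space" and V :: "'i => ('a \<times> 'a) set"
  assumes h: "\<And>i. i \<in> I ==> 0 < h i" and V: "\<And>i v. i \<in> I ==> v \<in> V i ==> norm (fst v) <= h i"
    and b: "b \<in> Basis"
  shows "unif (I \<times> UNIV) (%z. V (fst z)) (%z. {p. norm (fst p - snd z) < 3 * h (fst z)}) (%_. 1)
    (%z p. \<i> * of_real ((fst p - snd z) \<bullet> (b /\<^sub>R h (fst z))))"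
proof -
  have bd: "\<bar>t \<bullet> (b /\<^sub>R h i)\<bar> <= r" if "i \<in> I" "norm t <= r * h i" for t :: 'a and i r
    using Basis_le_norm[OF b, of t] that h[OF that(1)] by (simp add: field_simps abs_mult)
  have "unif (I \<times> UNIV) (%z. V (fst z)) (%z. {p. norm (fst p - snd z) < 3 * h (fst z)}) (%_. 1)
    (%(z::'i \<times> 'a) (p::'a \<times> 'a). \<i> * of_real (fst p \<bullet> (b /\<^sub>R h (fst z))) + - \<i> * of_real (snd z \<bullet> (b /\<^sub>R h (fst z))))"
  proof (rule unif_affine[OF unif_id[of 3], where f="%_. ()" and K=1])
    fix z :: "'i \<times> 'a" assume z: "z \<in> I \<times> UNIV"
    then have i: "fst z \<in> I" by auto
    show "bounded_linear (%p::'a \<times> 'a. \<i> * of_real (fst p \<bullet> (b /\<^sub>R h (fst z))))"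
      by (intro bounded_linear_mult_right[THEN bounded_linear_compose] bounded_linear_of_real[THEN bounded_linear_compose]
        bounded_linear_inner_left[THEN bounded_linear_compose] bounded_linear_fst)
    show "\<i> * of_real (fst v \<bullet> (b /\<^sub>R h (fst z))) \<in> cball 0 1" if "v \<in> V (fst z)" for v :: "'a \<times> 'a"
      using bd[OF i, of "fst v" 1] V[OF i that] by (simp add: norm_mult del: inner_scaleR_right)
    show "\<i> * of_real (fst p \<bullet> (b /\<^sub>R h (fst z))) + - \<i> * of_real (snd z \<bullet> (b /\<^sub>R h (fst z))) \<in> cball 0 3"
      if "p \<in> {p. norm (fst p - snd z) < 3 * h (fst z)}" for p :: "'a \<times> 'a"
    proof -
      have "\<i> * of_real (fst p \<bullet> (b /\<^sub>R h (fst z))) + - \<i> * of_real (snd z \<bullet> (b /\<^sub>R h (fst z)))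
        = \<i> * of_real ((fst p - snd z) \<bullet> (b /\<^sub>R h (fst z)))"
        by (simp add: inner_diff_left algebra_simps)
      then show ?thesis
        using bd[OF i, of "fst p - snd z" 3] that by (simp add: norm_mult del: inner_scaleR_right)
    qed
  qed auto
  then show ?thesis by (simp add: inner_diff_left algebra_simps)
qed

text \<open>The admissibility of (0, b/h) says that frequency steps of size 1/h are allowed: this
  form of the uncertainty principle ties the window width to the metric. The radius 3h leaves an
  open margin around the window, which is supported in radius 2h.\<close>

lemma unif_clap_funpow:
  fixes F :: "'i => 'a::euclidean_space \<times> 'a => complex"
  assumes F: "unif I V (%_. UNIV) w F" and h: "\<And>i. i \<in> I ==> 0 < h i"
    and V: "\<And>i v. i \<in> I ==> v \<in> V i ==> norm (fst v) <= h i"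
    and V': "\<And>i b. i \<in> I ==> b \<in> Basis ==> (0, b /\<^sub>R h i) \<in> V i"
  shows "unif (I \<times> UNIV) (%z. V (fst z)) (%z. {p. norm (fst p - snd z) < 3 * h (fst z)}) (%z. w (fst z))
    (%z. (clap (snd z) (h (fst z)) ^^ L) (F (fst z)))" (is "unif ?I ?V ?R ?w _")
proof (induction L)
  case 0
  show ?case
    using unif_reindex[OF F, of ?I fst ?V ?R 1 ?w] unif_nonneg[OF F] by auto
next
  case (Suc L)
  define G where "G z = (clap (snd z) (h (fst z)) ^^ L) (F (fst z))" for z :: "'i \<times> 'a"
  have c: "unif ?I ?V ?R ?w (%z. cder (snd z) (h (fst z)) b (G' z))"
    if "unif ?I ?V ?R ?w G'" "b \<in> Basis" for G' and b
  proof -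
    have "unif ?I ?V ?R ?w (%z p. \<i> * of_real ((fst p - snd z) \<bullet> (b /\<^sub>R h (fst z))) * G' z p)"
      using unif_mult[OF unif_linear_coeff[OF h V that(2)] that(1)] by simp
    then show ?thesis
      unfolding cder_def by (intro unif_add unif_dird that(1)) (use V' that(2) in auto)
  qed
  have G: "unif ?I ?V ?R ?w G" using Suc by (simp add: G_def[abs_def])
  have "unif ?I ?V ?R ?w (%z. clap (snd z) (h (fst z)) (G z))"
    unfolding clap_def
    by (intro unif_diff[OF G] unif_sum c G unif_nonneg[OF G])
  then show ?case by (simp add: G_def)
qed

section \<open>Windows in the output variable\<close>

definition wnd :: "real => 'a::euclidean_space => 'a => real" where
  "wnd h q x = (bump ((x - q) /\<^sub>R h))\<^sup>2"

lemma wnd_zero: assumes "0 < h" "x \<notin> cball q (2 * h)" shows "wnd h q x = 0"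
proof -
  have "2 <= norm ((x - q) /\<^sub>R h)"
    unfolding norm_scaleR using assms by (simp add: dist_norm norm_minus_commute field_simps)
  then show ?thesis by (simp add: wnd_def bump_eq_0 del: norm_scaleR)
qed

lemma wnd_nonneg [simp]: "0 <= wnd h q x" and wnd_le_1: "wnd h q x <= 1"
  by (simp_all add: wnd_def bump_range power_le_one)

lemma borel_measurable_bump [measurable]: "(bump :: 'a::euclidean_space => real) \<in> borel_measurable borel"
  by (rule borel_measurable_smooth[OF smooth_bump])

lemma borel_measurable_wnd [measurable (raw)]:
  fixes f g :: "'m => 'a::euclidean_space"
  assumes [measurable]: "f \<in> borel_measurable M" "g \<in> borel_measurable M"
  shows "(%x. wnd h (f x) (g x)) \<in> borel_measurable M"
  unfolding wnd_def by measurable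

lemma unif_bump: "unif (UNIV::unit set) (%_. cball 0 1) (%_. UNIV) (%_. 1) (%_ x::'a::euclidean_space. of_real (bump x))"
proof (rule unif_base)
  show s: "smooth (%x::'a. complex_of_real (bump x))" by (rule smooth_of_real[OF smooth_bump])
  show "bounded (range (iter_deriv (%x::'a. complex_of_real (bump x)) vs))" for vs
    by (rule smooth_compact_support_bounded[OF s, of 2]) (simp add: bump_eq_0)
qed

lemma unif_scaled_bump:
  fixes q :: "'j => 'a::euclidean_space"
  assumes "\<And>j. j \<in> J ==> 0 < h j" "\<And>j v. j \<in> J ==> v \<in> V j ==> norm v <= h j"
  shows "unif J V R (%_. 1) (%j x. of_real (bump ((x - q j) /\<^sub>R h j)))"
proof -
  have "unif J V R (%_. 1) (%j x. of_real (bump (x /\<^sub>R h j + - (q j /\<^sub>R h j))))"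
    by (rule unif_affine[OF unif_bump, where f="%_. ()" and K=1])
      (use assms in \<open>auto intro!: bounded_linear_scaleR_right simp: divide_simps abs_of_pos\<close>)
  then show ?thesis by (simp add: scaleR_diff_right)
qed

lemma cball_measure_scaled:
  "measure lborel (cball (q::'a::euclidean_space) (2 * h)) = measure lborel (cball (0::'a) 2) * h ^ DIM('a)"
  if "0 < h"
  using that by (simp add: content_cball power_mult_distrib mult_ac)

lemma
  fixes f g :: "'a::euclidean_space => complex"
  assumes f: "integrable lborel f" and g: "integrable lborel g"
  shows integrable_prod_mult: "integrable (lborel \<Otimes>\<^sub>M lborel) (%\<zeta>. f (fst \<zeta>) * g (snd \<zeta>))"
    and integral_prod_mult: "(LINT \<zeta>|(lborel \<Otimes>\<^sub>M lborel). f (fst \<zeta>) * g (snd \<zeta>)) = (LINT x|lborel. f x) * (LINT x|lborel. g x)"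
proof -
  have [measurable]: "f \<in> borel_measurable borel" "g \<in> borel_measurable borel"
    using borel_measurable_integrable[OF f] borel_measurable_integrable[OF g] by simp_all
  show i: "integrable (lborel \<Otimes>\<^sub>M lborel) (%\<zeta>. f (fst \<zeta>) * g (snd \<zeta>))"
  proof (rule lborel_pair.Fubini_integrable)
    show "integrable lborel (%x. LINT y|lborel. norm (f (fst (x, y)) * g (snd (x, y))))"
      using f g by (simp add: norm_mult)
  qed (use g in simp_all)
  show "(LINT \<zeta>|(lborel \<Otimes>\<^sub>M lborel). f (fst \<zeta>) * g (snd \<zeta>)) = (LINT x|lborel. f x) * (LINT x|lborel. g x)"
    using lborel_pair.integral_fst'[OF i] by simp
qed

lemma ee_mult_cnj: "ee x \<xi> * cnj (ee x \<xi>') = ee (\<xi> - \<xi>') x"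
  by (simp add: ee_def cis_cnj cis_mult inner_diff_left inner_diff_right inner_commute)

lemma borel_measurable_cnj' [measurable (raw)]:
  assumes [measurable]: "f \<in> borel_measurable M" shows "(%x. cnj (f x)) \<in> borel_measurable M"
proof -
  have [measurable]: "cnj \<in> borel_measurable borel"
    by (intro borel_measurable_continuous_onI continuous_intros)
  show ?thesis by measurable
qed

lemma integrable_opT:
  fixes F :: "'a::euclidean_space \<times> 'a => complex"
  assumes F: "smooth F" "xsupp S F" "bounded S" and W[measurable]: "W \<in> borel_measurable borel"
    and "\<And>\<xi>. norm (W \<xi>) <= CW"
  shows "integrable lborel (%\<xi>. ee x \<xi> * F (x, \<xi>) * W \<xi>)"
proof -
  note i = integrable_slice[OF F(1-3), of x]
  have [measurable]: "(%\<xi>. F (x, \<xi>)) \<in> borel_measurable borel"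
    using borel_measurable_integrable[OF i] by simp
  have "integrable lborel (%\<xi>. of_real CW * F (x, \<xi>))" using i by simp
  then show ?thesis
  proof (rule Bochner_Integration.integrable_bound)
    have "norm (F (x, \<xi>)) * norm (W \<xi>) <= \<bar>CW\<bar> * norm (F (x, \<xi>))" for \<xi>
      using mult_left_mono[OF order_trans[OF assms(5)[of \<xi>] abs_ge_self] norm_ge_zero[of "F (x, \<xi>)"]]
      by (simp add: mult.commute)
    then show "AE \<xi> in lborel. norm (ee x \<xi> * F (x, \<xi>) * W \<xi>) <= norm (of_real CW * F (x, \<xi>))"
      by (simp add: norm_mult)
  qed simp
qed

lemma measurable_opT:
  fixes F :: "'a::euclidean_space \<times> 'a => complex"
  assumes F: "smooth F" and W[measurable]: "W \<in> borel_measurable borel"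
  shows "opT F W \<in> borel_measurable borel"
proof -
  have [measurable]: "F \<in> borel_measurable (borel \<Otimes>\<^sub>M borel)"
    using borel_measurable_smooth[OF F] by (simp add: borel_prod)
  show ?thesis unfolding opT_def[abs_def] by measurable
qed

text \<open>The window and the bounded frequency supports confine the triple integral to a product
  of balls, so Fubini applies and the integral over x can be made the innermost one. What remains is
  a bilinear form in frequency whose kernel is an oscillatory integral over the window.\<close>

lemma window_product:
  fixes F G :: "'a::euclidean_space \<times> 'a => complex" and W V :: "'a => complex" and \<psi> :: "'a => real"
  assumes F: "smooth F" "xsupp S F" "bounded S" and G: "smooth G" "xsupp S' G" "bounded S'"
    and W[measurable]: "W \<in> borel_measurable borel" and CW: "\<And>\<xi>. norm (W \<xi>) <= CW"
    and V[measurable]: "V \<in> borel_measurable borel" and CV: "\<And>\<xi>. norm (V \<xi>) <= CV"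
    and p[measurable]: "\<psi> \<in> borel_measurable borel" and p1: "\<And>x. \<bar>\<psi> x\<bar> <= 1" "\<And>x. x \<notin> cball q r ==> \<psi> x = 0"
    and CF: "\<And>x \<xi>. dist q x <= r ==> norm (F (x, \<xi>)) <= CF" and CG: "\<And>x \<xi>. dist q x <= r ==> norm (G (x, \<xi>)) <= CG"
  shows "(LINT x|lborel. of_real (\<psi> x) * (opT F W x * cnj (opT G V x))) =
    (LINT \<zeta>|(lborel \<Otimes>\<^sub>M lborel). W (fst \<zeta>) * cnj (V (snd \<zeta>)) *
      (LINT x|lborel. ee (fst \<zeta> - snd \<zeta>) x * (of_real (\<psi> x) * F (x, fst \<zeta>) * cnj (G (x, snd \<zeta>)))))"
proof -
  have [measurable]: "F \<in> borel_measurable (borel \<Otimes>\<^sub>M borel)" "G \<in> borel_measurable (borel \<Otimes>\<^sub>M borel)"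
    using borel_measurable_smooth[OF F(1)] borel_measurable_smooth[OF G(1)] by (simp_all add: borel_prod)
  define P where "P x \<zeta> = of_real (\<psi> x) * ((ee x (fst \<zeta>) * F (x, fst \<zeta>) * W (fst \<zeta>)) * cnj (ee x (snd \<zeta>) * G (x, snd \<zeta>) * V (snd \<zeta>)))"
    for x and \<zeta> :: "'a \<times> 'a"
  have P[measurable]: "(%(x, \<zeta>). P x \<zeta>) \<in> borel_measurable (lborel \<Otimes>\<^sub>M (lborel \<Otimes>\<^sub>M lborel))"
    unfolding P_def by measurable
  obtain s s' where s: "\<And>\<xi>. \<xi> \<in> S ==> norm \<xi> <= s" "\<And>\<xi>. \<xi> \<in> S' ==> norm \<xi> <= s'"
    using F(3) G(3) unfolding bounded_iff by blast
  have P0: "P x \<zeta> = 0" if "(x, \<zeta>) \<notin> cball q r \<times> (cball 0 s \<times> cball 0 s')" for x \<zeta>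
  proof -
    have "x \<notin> cball q r \<or> fst \<zeta> \<notin> S \<or> snd \<zeta> \<notin> S'"
      using that s by (cases \<zeta>) auto
    then show ?thesis using F(2) G(2) p1(2)[of x] unfolding P_def xsupp_def by force
  qed
  have Pb: "norm (P x \<zeta>) <= CF * CW * (CG * CV)" if "x \<in> cball q r" for x \<zeta>
  proof -
    have 1: "norm (F (x, fst \<zeta>)) * norm (W (fst \<zeta>)) <= CF * CW"
      using that by (intro mult_mono CF CW order_trans[OF norm_ge_zero CF]) auto
    have 2: "norm (G (x, snd \<zeta>)) * norm (V (snd \<zeta>)) <= CG * CV"
      using that by (intro mult_mono CG CV order_trans[OF norm_ge_zero CG]) auto
    have "(norm (F (x, fst \<zeta>)) * norm (W (fst \<zeta>))) * (norm (G (x, snd \<zeta>)) * norm (V (snd \<zeta>))) <= CF * CW * (CG * CV)"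
      by (rule mult_mono[OF 1 2 order_trans[OF _ 1]]) auto
    then have "\<bar>\<psi> x\<bar> * ((norm (F (x, fst \<zeta>)) * norm (W (fst \<zeta>))) * (norm (G (x, snd \<zeta>)) * norm (V (snd \<zeta>)))) <= CF * CW * (CG * CV)"
      using mult_left_le_one_le[OF _ abs_ge_zero p1(1)[of x]] by (meson mult_nonneg_nonneg norm_ge_zero order_trans)
    then show ?thesis by (simp add: P_def norm_mult)
  qed
  have iP: "integrable (lborel \<Otimes>\<^sub>M (lborel \<Otimes>\<^sub>M lborel)) (%(x, \<zeta>). P x \<zeta>)"
  proof (rule integrableI_bounded_set[where A = "cball q r \<times> (cball 0 s \<times> cball 0 s')" and B = "CF * CW * (CG * CV)"])
    show "cball q r \<times> (cball 0 s \<times> cball 0 s') \<in> sets (lborel \<Otimes>\<^sub>M (lborel \<Otimes>\<^sub>M (lborel :: 'a measure)))"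
      by (intro pair_measureI) auto
    have "emeasure lborel (cball q r \<times> (cball 0 s \<times> cball (0::'a) s')) < \<infinity>"
      by (intro emeasure_bounded_finite bounded_Times bounded_cball)
    then show "emeasure (lborel \<Otimes>\<^sub>M (lborel \<Otimes>\<^sub>M lborel)) (cball q r \<times> (cball 0 s \<times> cball (0::'a) s')) < \<infinity>"
      by (simp add: lborel_prod)
    have "(case p of (x, \<zeta>) => P x \<zeta>) = 0" if "p \<notin> cball q r \<times> (cball 0 s \<times> cball 0 s')" for p
      using P0[of "fst p" "snd p"] that by (simp add: case_prod_beta)
    then show "AE p in lborel \<Otimes>\<^sub>M (lborel \<Otimes>\<^sub>M lborel). p \<notin> cball q r \<times> (cball 0 s \<times> cball 0 s') --> (case p of (x, \<zeta>) => P x \<zeta>) = 0"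
      by (intro AE_I2 impI)
    show "AE p in lborel \<Otimes>\<^sub>M (lborel \<Otimes>\<^sub>M lborel). p \<in> cball q r \<times> (cball 0 s \<times> cball 0 s') --> norm (case p of (x, \<zeta>) => P x \<zeta>) <= CF * CW * (CG * CV)"
      by (intro AE_I2 impI) (use Pb in auto)
  qed simp
  interpret Q: pair_sigma_finite "lborel :: 'a measure" "lborel \<Otimes>\<^sub>M lborel :: ('a \<times> 'a) measure"
    unfolding lborel_prod ..
  have "(LINT x|lborel. of_real (\<psi> x) * (opT F W x * cnj (opT G V x))) = (LINT x|lborel. LINT \<zeta>|(lborel \<Otimes>\<^sub>M lborel). P x \<zeta>)"
  proof (intro Bochner_Integration.integral_cong refl)
    fix x
    define f g where "f \<xi> = ee x \<xi> * F (x, \<xi>) * W \<xi>" and "g \<xi> = cnj (ee x \<xi> * G (x, \<xi>) * V \<xi>)" for \<xi>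
    have if': "integrable lborel f" unfolding f_def[abs_def] by (rule integrable_opT[OF F W CW])
    have ig: "integrable lborel g" unfolding g_def[abs_def]
      by (intro integrable_cnj integrable_opT[OF G V CV])
    have "(LINT \<zeta>|(lborel \<Otimes>\<^sub>M lborel). P x \<zeta>) = of_real (\<psi> x) * (LINT \<zeta>|(lborel \<Otimes>\<^sub>M lborel). f (fst \<zeta>) * g (snd \<zeta>))"
      unfolding P_def f_def g_def by (rule integral_mult_right_zero)
    also have "\<dots> = of_real (\<psi> x) * (opT F W x * cnj (opT G V x))"
      unfolding integral_prod_mult[OF if' ig]
      by (simp add: f_def[abs_def] g_def[abs_def] opT_def del: complex_cnj_mult)
    finally show "of_real (\<psi> x) * (opT F W x * cnj (opT G V x)) = (LINT \<zeta>|(lborel \<Otimes>\<^sub>M lborel). P x \<zeta>)" by simp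
  qed
  also have "\<dots> = (LINT \<zeta>|(lborel \<Otimes>\<^sub>M lborel). LINT x|lborel. P x \<zeta>)"
    using Q.Fubini_integral[OF iP] by simp
  also have "\<dots> = (LINT \<zeta>|(lborel \<Otimes>\<^sub>M lborel). W (fst \<zeta>) * cnj (V (snd \<zeta>)) *
      (LINT x|lborel. ee (fst \<zeta> - snd \<zeta>) x * (of_real (\<psi> x) * F (x, fst \<zeta>) * cnj (G (x, snd \<zeta>)))))"
  proof (intro Bochner_Integration.integral_cong refl)
    fix \<zeta> :: "'a \<times> 'a"
    have "P x \<zeta> = W (fst \<zeta>) * cnj (V (snd \<zeta>)) * (ee (fst \<zeta> - snd \<zeta>) x * (of_real (\<psi> x) * F (x, fst \<zeta>) * cnj (G (x, snd \<zeta>))))" for x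
      by (simp add: P_def ee_mult_cnj[symmetric] mult_ac)
    then show "(LINT x|lborel. P x \<zeta>) = W (fst \<zeta>) * cnj (V (snd \<zeta>)) *
      (LINT x|lborel. ee (fst \<zeta> - snd \<zeta>) x * (of_real (\<psi> x) * F (x, fst \<zeta>) * cnj (G (x, snd \<zeta>))))"
      by (simp only: integral_mult_right_zero)
  qed
  finally show ?thesis .
qed

lemma nn_integral_jw_affine:
  fixes \<xi> :: "'a::euclidean_space"
  assumes "0 < h" "DIM('a) <= n"
  shows "(\<integral>\<^sup>+\<xi>'. ennreal (jw n (h *\<^sub>R (\<xi> - \<xi>'))) \<partial>lborel) = ennreal (1 / h ^ DIM('a) * (LINT \<xi>|lborel. jw n (\<xi>::'a)))"
proof -
  have "jw n (h *\<^sub>R (\<xi> - \<xi>')) = jw n ((\<xi>' - \<xi>) /\<^sub>R (1 / h))" for \<xi>'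
    using assms by (simp add: jw_def norm_minus_commute)
  then have "(\<integral>\<^sup>+\<xi>'. ennreal (jw n (h *\<^sub>R (\<xi> - \<xi>'))) \<partial>lborel) = ennreal ((1 / h) ^ DIM('a)) * (\<integral>\<^sup>+\<xi>. ennreal (jw n (\<xi>::'a)) \<partial>lborel)"
    using nn_integral_affine[of "%\<xi>. ennreal (jw n \<xi>)" "1 / h" \<xi>] assms(1) by simp
  also have "(\<integral>\<^sup>+\<xi>. ennreal (jw n (\<xi>::'a)) \<partial>lborel) = ennreal (LINT \<xi>|lborel. jw n (\<xi>::'a))"
    by (rule nn_integral_eq_integral[OF jw_integrable[OF assms(2)]]) simp
  finally show ?thesis using assms(1) by (simp add: ennreal_mult[symmetric] power_one_over)
qed

text \<open>Square integral over S of the transform of the input damped around q, integrated over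
  all window centres q. It remembers the frequency set S, which matters when shells are
  summed.\<close>

definition NN :: "nat => 'm measure => ('m => 'a::euclidean_space) => ('m => complex) => real => 'a set => ennreal" where
  "NN L M Y u h S = (\<integral>\<^sup>+q. \<integral>\<^sup>+\<xi>. indicator S \<xi> * ennreal ((norm (ft M Y (wdat L Y q h u) \<xi>))\<^sup>2) \<partial>lborel \<partial>lborel)"

lemma measurable_ft_wdat:
  assumes "datum M Y u"
  shows "(%(q, \<xi>). ft M Y (wdat L Y q h u) \<xi>) \<in> borel_measurable (lborel \<Otimes>\<^sub>M lborel)"
proof -
  interpret sigma_finite_measure M using assms by (simp add: datum_def)
  have [measurable]: "Y \<in> borel_measurable M" "u \<in> borel_measurable M"
    using assms by (auto simp: datum_def)
  show ?thesis unfolding ft_def wdat_def by measurable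
qed

lemma bump_minus: "bump (- x) = bump x"
  by (simp add: bump_def)

lemma bump2_integral:
  "integrable lborel (%x::'a::euclidean_space. (bump x)\<^sup>2)" "0 < (LINT x|lborel. (bump (x::'a))\<^sup>2)"
proof -
  show i: "integrable lborel (%x::'a. (bump x)\<^sup>2)"
  proof (rule integrableI_bounded_set[where A="cball 0 2" and B=1])
    show "emeasure lborel (cball (0::'a) 2) < \<infinity>" by (rule emeasure_bounded_finite[OF bounded_cball])
  qed (auto intro!: AE_I2 simp: bump_range power_le_one bump_eq_0)
  have "0 < measure lborel (cball (0::'a) 1)" by (simp add: content_cball_pos)
  also have "\<dots> = (LINT x|lborel. indicator (cball (0::'a) 1) x)" by simp
  also have "\<dots> <= (LINT x|lborel. (bump (x::'a))\<^sup>2)"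
    using emeasure_bounded_finite[OF bounded_cball, of "0::'a" 1]
    by (intro integral_mono i integrable_real_indicator) (auto simp: indicator_def bump_eq_1)
  finally show "0 < (LINT x|lborel. (bump (x::'a))\<^sup>2)" .
qed

definition bmass :: "'a::euclidean_space itself => real" where
  "bmass _ = (LINT x|lborel. (bump (x::'a))\<^sup>2)"

lemma bmass_pos: "0 < bmass TYPE('a::euclidean_space)"
  unfolding bmass_def by (rule bump2_integral)

lemma wnd_nn_integral:
  fixes x :: "'a::euclidean_space"
  assumes "0 < h"
  shows "(\<integral>\<^sup>+q. ennreal (wnd h q x) \<partial>lborel) = ennreal (h ^ DIM('a) * bmass TYPE('a))"
proof -
  have "wnd h q x = (bump ((q - x) /\<^sub>R h))\<^sup>2" for q
    using bump_minus[of "(q - x) /\<^sub>R h"] by (simp add: wnd_def scaleR_diff_right)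
  then have "(\<integral>\<^sup>+q. ennreal (wnd h q x) \<partial>lborel) = ennreal (h ^ DIM('a)) * (\<integral>\<^sup>+q. ennreal ((bump (q::'a))\<^sup>2) \<partial>lborel)"
    using nn_integral_affine[of "%q. ennreal ((bump (q::'a))\<^sup>2)" h x] assms by simp
  also have "(\<integral>\<^sup>+q. ennreal ((bump (q::'a))\<^sup>2) \<partial>lborel) = ennreal (bmass TYPE('a))"
    unfolding bmass_def by (rule nn_integral_eq_integral[OF bump2_integral(1)]) simp
  finally show ?thesis using assms by (simp add: ennreal_mult[symmetric] bmass_pos less_imp_le)
qed

text \<open>Up to the factor h^n \<open>bmass\<close>, the windows with all centres q form a
  continuous partition of unity, which takes the place of a discrete covering.\<close>

lemma wnd_average_nn:
  fixes F :: "'a::euclidean_space => ennreal"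
  assumes [measurable]: "F \<in> borel_measurable borel" and "0 < h"
  shows "(\<integral>\<^sup>+q. \<integral>\<^sup>+x. ennreal (wnd h q x) * F x \<partial>lborel \<partial>lborel) = ennreal (h ^ DIM('a) * bmass TYPE('a)) * (\<integral>\<^sup>+x. F x \<partial>lborel)"
proof -
  have "(\<integral>\<^sup>+q. \<integral>\<^sup>+x. ennreal (wnd h q x) * F x \<partial>lborel \<partial>lborel) = (\<integral>\<^sup>+x. \<integral>\<^sup>+q. ennreal (wnd h q x) * F x \<partial>lborel \<partial>lborel)"
    by (rule lborel_pair.Fubini') measurable
  also have "\<dots> = (\<integral>\<^sup>+x. ennreal (h ^ DIM('a) * bmass TYPE('a)) * F x \<partial>lborel)"
    by (simp add: nn_integral_multc wnd_nn_integral[OF assms(2)])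
  finally show ?thesis by (simp add: nn_integral_cmult)
qed

lemma norm_integral_le_wnd:
  fixes F :: "'a::euclidean_space => complex"
  assumes F: "integrable lborel F" and h: "0 < h"
  shows "ennreal (h ^ DIM('a) * bmass TYPE('a)) * ennreal (norm (LINT x|lborel. F x)) <=
     (\<integral>\<^sup>+q. ennreal (norm (LINT x|lborel. of_real (wnd h q x) * F x)) \<partial>lborel)"
proof -
  have [measurable]: "F \<in> borel_measurable borel" using borel_measurable_integrable[OF F] by simp
  define P where "P x q = of_real (wnd h q x) * F x" for x q
  have wr: "(LINT q|lborel. wnd h q x) = h ^ DIM('a) * bmass TYPE('a)" for x :: 'a
    using wnd_nn_integral[OF h, of x] h by (intro integral_eq_nn_integral[THEN trans]) (auto simp: bmass_pos less_imp_le)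
  have wi: "integrable lborel (%q. wnd h q x)" for x :: 'a
    by (rule integrableI_nonneg) (auto simp: wnd_nn_integral[OF h])
  have "integrable (lborel \<Otimes>\<^sub>M lborel) (%(x, q). P x q)"
  proof (rule lborel_pair.Fubini_integrable)
    show "(%(x, q). P x q) \<in> borel_measurable (lborel \<Otimes>\<^sub>M lborel)" unfolding P_def by measurable
    have "(%x. LINT q|lborel. norm (P x q)) = (%x. (h ^ DIM('a) * bmass TYPE('a)) * norm (F x))"
      by (simp add: P_def norm_mult wr)
    then show "integrable lborel (%x. LINT q|lborel. norm (case (x, q) of (x, q) => P x q))" using F by simp
    show "AE x in lborel. integrable lborel (%q. case (x, q) of (x, q) => P x q)"
      using wi by (simp add: P_def)
  qed
  then have "(LINT q|lborel. LINT x|lborel. P x q) = (LINT x|lborel. LINT q|lborel. P x q)"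
    using lborel_pair.Fubini_integral[where f=P] by simp
  also have "\<dots> = (LINT x|lborel. of_real (h ^ DIM('a) * bmass TYPE('a)) * F x)"
    by (simp add: P_def wr)
  finally have "of_real (h ^ DIM('a) * bmass TYPE('a)) * (LINT x|lborel. F x) = (LINT q|lborel. LINT x|lborel. P x q)" by simp
  then have "ennreal (h ^ DIM('a) * bmass TYPE('a)) * ennreal (norm (LINT x|lborel. F x)) = ennreal (norm (LINT q|lborel. LINT x|lborel. P x q))"
  proof -
    define k where "k = h ^ DIM('a) * bmass TYPE('a)"
    have "0 <= k" unfolding k_def using h bmass_pos[where 'a='a] by simp
    moreover have "of_real k * (LINT x|lborel. F x) = (LINT q|lborel. LINT x|lborel. P x q)"
      using \<open>of_real (h ^ DIM('a) * bmass TYPE('a)) * (LINT x|lborel. F x) = (LINT q|lborel. LINT x|lborel. P x q)\<close>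
      by (simp add: k_def)
    ultimately show ?thesis
      unfolding k_def[symmetric] by (metis abs_of_nonneg ennreal_mult norm_ge_zero norm_mult norm_of_real)
  qed
  also have "\<dots> <= (\<integral>\<^sup>+q. ennreal (norm (LINT x|lborel. P x q)) \<partial>lborel)"
    by (cases "integrable lborel (%q. LINT x|lborel. P x q)")
      (auto intro!: integral_norm_bound_ennreal simp: not_integrable_integral_eq)
  finally show ?thesis by (simp add: P_def)
qed

text \<open>Two amplitudes at possibly different frequencies. \<open>hB\<close> is the common window
  width; \<open>hA\<close>, which is at most \<open>hB\<close>, is the step for integrating by parts
  in x, where both amplitudes get differentiated. \<open>L\<close> is the power of the damping in y,
  and \<open>G\<close> bounds what \<open>P\<close> spare powers gain when the frequency supports
  \<open>SA\<close> and \<open>SB\<close> are apart.\<close>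

locale symbol_pair =
  fixes I :: "'i set" and hA hB wa wb :: "'i => real" and a b :: "'i => 'a::euclidean_space \<times> 'a => complex"
    and Va Vb :: "'i => ('a \<times> 'a) set" and L P :: nat
    and SA SB :: "'i => 'a set" and G :: "'i => real"
  assumes a: "unif I Va (%_. UNIV) wa a" and b: "unif I Vb (%_. UNIV) wb b"
    and SA: "\<And>i. i \<in> I ==> closed (SA i)" "\<And>i. i \<in> I ==> bounded (SA i)" "\<And>i. i \<in> I ==> xsupp (SA i) (a i)"
    and SB: "\<And>i. i \<in> I ==> closed (SB i)" "\<And>i. i \<in> I ==> bounded (SB i)" "\<And>i. i \<in> I ==> xsupp (SB i) (b i)"
    and G: "\<And>i \<xi> \<xi>'. i \<in> I ==> \<xi> \<in> SA i ==> \<xi>' \<in> SB i ==> jw P (hA i *\<^sub>R (\<xi> - \<xi>')) <= G i" "\<And>i. i \<in> I ==> 0 <= G i"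
    and hA_pos: "\<And>i. i \<in> I ==> 0 < hA i" and hA_le: "\<And>i. i \<in> I ==> hA i <= hB i"
    and Va: "\<And>i v. i \<in> I ==> v \<in> Va i ==> norm (fst v) <= hB i" "\<And>i c. i \<in> I ==> c \<in> Basis ==> (0, c /\<^sub>R hB i) \<in> Va i"
      "\<And>i t. i \<in> I ==> norm t <= hA i ==> (t, 0) \<in> Va i"
    and Vb: "\<And>i v. i \<in> I ==> v \<in> Vb i ==> norm (fst v) <= hB i" "\<And>i c. i \<in> I ==> c \<in> Basis ==> (0, c /\<^sub>R hB i) \<in> Vb i"
      "\<And>i t. i \<in> I ==> norm t <= hA i ==> (t, 0) \<in> Vb i"
begin

lemmas h = hA_pos hA_le

definition "wa_sym i q = (clap q (hB i) ^^ L) (a i)"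
definition "wb_sym i q = (clap q (hB i) ^^ L) (b i)"

lemma hB: "i \<in> I ==> 0 < hB i" using h by force

lemma window_symbol_bound:
  "\<exists>C\<ge>0. \<forall>i\<in>I. \<forall>(q::'a) x \<xi>. dist q x <= 2 * hB i --> norm (wa_sym i q (x, \<xi>)) <= C * wa i \<and> norm (wb_sym i q (x, \<xi>)) <= C * wb i"
proof -
  obtain A where A: "0 <= A" "\<And>z p vs. z \<in> I \<times> UNIV ==> p \<in> {p. norm (fst p - snd z) < 3 * hB (fst z)} ==> length vs <= 0 ==> set vs \<subseteq> Va (fst z) ==>
     norm (iter_deriv ((clap (snd z) (hB (fst z)) ^^ L) (a (fst z))) vs p) <= A * wa (fst z)"
    using unif_bound[OF unif_clap_funpow[OF a hB Va(1,2), where L=L], where k=0] by blast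
  obtain B where B: "0 <= B" "\<And>z p vs. z \<in> I \<times> UNIV ==> p \<in> {p. norm (fst p - snd z) < 3 * hB (fst z)} ==> length vs <= 0 ==> set vs \<subseteq> Vb (fst z) ==>
     norm (iter_deriv ((clap (snd z) (hB (fst z)) ^^ L) (b (fst z))) vs p) <= B * wb (fst z)"
    using unif_bound[OF unif_clap_funpow[OF b hB Vb(1,2), where L=L], where k=0] by blast
  show ?thesis
  proof (intro exI[of _ "max A B"] conjI ballI allI impI)
    fix i and q x \<xi> :: 'a assume i: "i \<in> I" and d: "dist q x <= 2 * hB i"
    have x: "(x, \<xi>) \<in> {p. norm (fst p - snd (i, q)) < 3 * hB (fst (i, q))}"
      using d hB[OF i] by (simp add: dist_norm norm_minus_commute)
    have "norm (wa_sym i q (x, \<xi>)) <= A * wa i"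
      using A(2)[OF _ x, of "[]"] i by (simp add: wa_sym_def)
    also have "\<dots> <= max A B * wa i" using unif_nonneg[OF a i] by (intro mult_right_mono) auto
    finally show "norm (wa_sym i q (x, \<xi>)) <= max A B * wa i" .
    have "norm (wb_sym i q (x, \<xi>)) <= B * wb i"
      using B(2)[OF _ x, of "[]"] i by (simp add: wb_sym_def)
    also have "\<dots> <= max A B * wb i" using unif_nonneg[OF b i] by (intro mult_right_mono) auto
    finally show "norm (wb_sym i q (x, \<xi>)) <= max A B * wb i" .
  qed (use A in auto)
qed

text \<open>Steps of length \<open>hA\<close> in x are admissible for both amplitudes, and for the
  window as well because \<open>hA\<close> <= \<open>hB\<close>. Each integration by parts gains a
  factor 1 + |hA(\<xi> - \<xi>')|^2, and the volume of the window contributes hB^n.\<close>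

lemma window_kernel_bound:
  "\<exists>C\<ge>0. \<forall>i\<in>I. \<forall>q (\<xi>::'a) \<xi>'. norm (LINT x|lborel. ee (\<xi> - \<xi>') x * (of_real (wnd (hB i) q x) * wa_sym i q (x, \<xi>) * cnj (wb_sym i q (x, \<xi>'))))
     <= C * wa i * wb i * hB i ^ DIM('a) * jw N (hA i *\<^sub>R (\<xi> - \<xi>'))"
proof -
  define g where "g z x = of_real (wnd (hB (fst z)) (fst (snd z)) x) * wa_sym (fst z) (fst (snd z)) (x, fst (snd (snd z)))
      * cnj (wb_sym (fst z) (fst (snd z)) (x, snd (snd (snd z))))" for z :: "'i \<times> 'a \<times> 'a \<times> 'a" and x
  let ?J = "I \<times> (UNIV :: ('a \<times> 'a \<times> 'a) set)"
  let ?V = "%z::'i \<times> 'a \<times> 'a \<times> 'a. cball (0::'a) (hA (fst z))"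
  let ?R = "%z::'i \<times> 'a \<times> 'a \<times> 'a. {x. norm (x - fst (snd z)) < 3 * hB (fst z)}"
  let ?W = "%z. wa (fst z) * wb (fst z)"
  have ub: "unif ?J ?V ?R (%_. 1) (%z x. of_real (bump ((x - fst (snd z)) /\<^sub>R hB (fst z))))"
    by (rule unif_scaled_bump) (use hB h in \<open>force\<close>)+
  have ua: "unif ?J ?V ?R (%z. wa (fst z)) (%z x. wa_sym (fst z) (fst (snd z)) (x, fst (snd (snd z))))"
    using unif_affine[OF unif_clap_funpow[OF a hB Va(1,2), where L=L], of ?J "%z. (fst z, fst (snd z))"
        "%_ x. (x, 0)" ?V ?R "%z. (0, fst (snd (snd z)))" 1 "%z. wa (fst z)"] unif_nonneg[OF a] Va(3)
    by (force simp: wa_sym_def intro: bounded_linear_fst_emb)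
  have uc: "unif ?J ?V ?R (%z. wb (fst z)) (%z x. wb_sym (fst z) (fst (snd z)) (x, snd (snd (snd z))))"
    using unif_affine[OF unif_clap_funpow[OF b hB Vb(1,2), where L=L], of ?J "%z. (fst z, fst (snd z))"
        "%_ x. (x, 0)" ?V ?R "%z. (0, snd (snd (snd z)))" 1 "%z. wb (fst z)"] unif_nonneg[OF b] Vb(3)
    by (force simp: wb_sym_def intro: bounded_linear_fst_emb)
  have "unif ?J ?V ?R (%z. 1 * 1 * wa (fst z) * wb (fst z)) (%z x. of_real (bump ((x - fst (snd z)) /\<^sub>R hB (fst z))) *
     of_real (bump ((x - fst (snd z)) /\<^sub>R hB (fst z))) * wa_sym (fst z) (fst (snd z)) (x, fst (snd (snd z))) *
     cnj (wb_sym (fst z) (fst (snd z)) (x, snd (snd (snd z)))))"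
    by (rule unif_mult[OF unif_mult[OF unif_mult[OF ub ub] ua] unif_cnj[OF uc]])
  then have "unif ?J ?V ?R ?W g"
    by (simp add: g_def[abs_def] wnd_def power2_eq_square)
  then have ug: "unif ?J ?V (%_. UNIV) ?W g"
    by (rule unif_extend[where K="%z. cball (fst (snd z)) (2 * hB (fst z))"])
      (use hB in \<open>auto simp: g_def wnd_zero dist_norm norm_minus_commute less_imp_le intro: le_less_trans\<close>)
  obtain C where C: "0 <= C" "\<And>z p vs. z \<in> ?J ==> p \<in> UNIV ==> length vs <= 0 ==> set vs \<subseteq> ?V z ==>
     norm (iter_deriv ((lap (%b. hA (fst z) *\<^sub>R b) ^^ N) (g z)) vs p) <= C * (wa (fst z) * wb (fst z))"
    by (rule unif_bound[OF unif_lap_funpow[OF ug, where e="%z b. hA (fst z) *\<^sub>R b" and L=N], where k=0])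
      (use h in \<open>auto simp: less_imp_le\<close>)
  show ?thesis
  proof (intro exI[of _ "C * measure lborel (cball (0::'a) 2)"] conjI ballI allI)
    fix i and q \<xi> \<xi>' :: 'a assume i: "i \<in> I"
    define z where "z = (i, q, \<xi>, \<xi>')"
    define l where "l = (lap (%b. hA i *\<^sub>R b) ^^ N) (g z)"
    have g0: "g z x = 0" if "x \<notin> cball q (2 * hB i)" for x
      using wnd_zero[OF hB[OF i] that] by (simp add: g_def z_def)
    have sg: "smooth (g z)" using unif_smooth[OF ug] i by (simp add: z_def)
    have l0: "l x = 0" if "x \<notin> cball q (2 * hB i)" for x
      unfolding l_def by (rule lap_funpow_zero_outside[where f="g z", OF _ that]) (rule g0)
    have l1: "norm (l x) <= C * (wa i * wb i)" for x
      using C(2)[of z x "[]"] i by (simp add: l_def z_def)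
    have sl: "smooth l" unfolding l_def by (rule smooth_lap_funpow[OF sg])
    have "norm (LINT x|lborel. ee (\<xi> - \<xi>') x * l x) <= (LINT x|lborel. norm (ee (\<xi> - \<xi>') x * l x))"
      by (rule integral_norm_bound)
    also have "\<dots> <= (LINT x|lborel. C * (wa i * wb i) * indicator (cball q (2 * hB i)) x)"
    proof (rule integral_mono)
      show "integrable lborel (%x. norm (ee (\<xi> - \<xi>') x * l x))"
        by (intro integrable_norm integrable_ee_mult integrable_compact_support[of l q "2 * hB i", OF sl l0])
      show "integrable lborel (%x. C * (wa i * wb i) * indicator (cball q (2 * hB i)) x)"
        using emeasure_bounded_finite[OF bounded_cball, of q "2 * hB i"]
        by (intro integrable_mult_right integrable_real_indicator) auto
    qed (use l0 l1 in \<open>auto simp: norm_mult indicator_def\<close>)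
    also have "\<dots> = C * (wa i * wb i) * (measure lborel (cball (0::'a) 2) * hB i ^ DIM('a))"
      by (simp add: cball_measure_scaled[OF hB[OF i]])
    finally have 1: "norm (LINT x|lborel. ee (\<xi> - \<xi>') x * l x) <= C * (wa i * wb i) * (measure lborel (cball (0::'a) 2) * hB i ^ DIM('a))" .
    define J where "J = (LINT x|lborel. ee (\<xi> - \<xi>') x * g z x)"
    have "(LINT x|lborel. ee (\<xi> - \<xi>') x * l x) = of_real ((1 + (hA i)\<^sup>2 * (norm (\<xi> - \<xi>'))\<^sup>2) ^ N) * J"
      unfolding l_def J_def by (rule fourier_lap_funpow[OF sg]) (rule g0)
    moreover have pos: "0 < (1 + (hA i)\<^sup>2 * (norm (\<xi> - \<xi>'))\<^sup>2) ^ N" by (intro zero_less_power add_pos_nonneg) auto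
    ultimately have "norm J * (1 + (hA i)\<^sup>2 * (norm (\<xi> - \<xi>'))\<^sup>2) ^ N <= C * (wa i * wb i) * (measure lborel (cball (0::'a) 2) * hB i ^ DIM('a))"
      using 1 by (simp only: norm_mult norm_of_real) (simp add: mult.commute)
    then have "norm J <= C * (wa i * wb i) * (measure lborel (cball (0::'a) 2) * hB i ^ DIM('a)) * jw N (hA i *\<^sub>R (\<xi> - \<xi>'))"
      using pos by (simp add: jw_def power_mult_distrib pos_le_divide_eq del: scaleR_diff_right)
    then show "norm (LINT x|lborel. ee (\<xi> - \<xi>') x * (of_real (wnd (hB i) q x) * wa_sym i q (x, \<xi>) * cnj (wb_sym i q (x, \<xi>'))))
     <= C * measure lborel (cball (0::'a) 2) * wa i * wb i * hB i ^ DIM('a) * jw N (hA i *\<^sub>R (\<xi> - \<xi>'))"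
      by (simp add: J_def g_def z_def mult_ac)
  qed (use C in simp)
qed

text \<open>Schur test in frequency. Of the n + P powers of \<open>jw\<close>, n make the kernel
  integrable with integral of order hA^(-n), and P are replaced by \<open>G\<close>. The product of
  the two inputs is split by AB <= A^2 + B^2, which keeps the bound additive.\<close>

lemma window_form_bound:
  "\<exists>C\<ge>0. \<forall>i\<in>I. \<forall>(q::'a) W V CW CV. W \<in> borel_measurable borel --> V \<in> borel_measurable borel -->
     (\<forall>\<xi>. norm (W \<xi>) <= CW) --> (\<forall>\<xi>. norm (V \<xi>) <= CV) -->
    ennreal (norm (LINT x|lborel. of_real (wnd (hB i) q x) * (opT (wa_sym i q) W x * cnj (opT (wb_sym i q) V x)))) <=
    ennreal (C * G i * (hB i / hA i) ^ DIM('a)) *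
     ((\<integral>\<^sup>+\<xi>. indicator (SA i) \<xi> * ennreal ((wa i * norm (W \<xi>))\<^sup>2) \<partial>lborel) +
      (\<integral>\<^sup>+\<xi>. indicator (SB i) \<xi> * ennreal ((wb i * norm (V \<xi>))\<^sup>2) \<partial>lborel))"
proof -
  define n where "n = DIM('a)"
  obtain C0 where C0: "0 <= C0" and K: "\<And>i q \<xi> \<xi>'. i \<in> I ==>
     norm (LINT x|lborel. ee (\<xi> - \<xi>') x * (of_real (wnd (hB i) q x) * wa_sym i q (x, \<xi>) * cnj (wb_sym i q (x, \<xi>'))))
     <= C0 * wa i * wb i * hB i ^ DIM('a) * jw (n + P) (hA i *\<^sub>R (\<xi> - \<xi>'))"
    using window_kernel_bound[of "n + P"] by blast
  obtain C1 where C1: "0 <= C1" "\<And>i q x \<xi>. i \<in> I ==> dist q x <= 2 * hB i ==> norm (wa_sym i q (x, \<xi>)) <= C1 * wa i"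
    "\<And>i q x \<xi>. i \<in> I ==> dist q x <= 2 * hB i ==> norm (wb_sym i q (x, \<xi>)) <= C1 * wb i"
    using window_symbol_bound by blast
  define Jr where "Jr = (LINT \<xi>|lborel. jw n (\<xi>::'a))"
  have Jr: "0 <= Jr" unfolding Jr_def by (rule integral_nonneg_AE) simp
  show ?thesis
  proof (intro exI[of _ "C0 * Jr"] conjI ballI allI impI)
    show "0 <= C0 * Jr" using C0 Jr by simp
    fix i and q :: 'a and W V :: "'a => complex" and CW CV :: real assume i: "i \<in> I" and W[measurable]: "W \<in> borel_measurable borel" and V[measurable]: "V \<in> borel_measurable borel"
      and CW: "\<forall>\<xi>. norm (W \<xi>) <= CW" and CV: "\<forall>\<xi>. norm (V \<xi>) <= CV"
    note [measurable] = borel_closed[OF SA(1)[OF i]] borel_closed[OF SB(1)[OF i]]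
    have supp: "xsupp (SA i) (wa_sym i q)" "xsupp (SB i) (wb_sym i q)"
      unfolding wa_sym_def wb_sym_def using SA SB i by (auto intro!: clap_funpow_support)
    have sm: "smooth (wa_sym i q)" "smooth (wb_sym i q)"
      unfolding wa_sym_def wb_sym_def using unif_smooth[OF a i] unif_smooth[OF b i] by (auto intro!: smooth_clap_funpow)
    define H where "H = (LINT x|lborel. of_real (wnd (hB i) q x) * (opT (wa_sym i q) W x * cnj (opT (wb_sym i q) V x)))"
    define Kf where "Kf \<zeta> = (LINT x|lborel. ee (fst \<zeta> - snd \<zeta>) x * (of_real (wnd (hB i) q x) * wa_sym i q (x, fst \<zeta>) * cnj (wb_sym i q (x, snd \<zeta>))))" for \<zeta>
    have H: "H = (LINT \<zeta>|(lborel \<Otimes>\<^sub>M lborel). W (fst \<zeta>) * cnj (V (snd \<zeta>)) * Kf \<zeta>)"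
      unfolding H_def Kf_def
      by (rule window_product[OF sm(1) supp(1) SA(2)[OF i] sm(2) supp(2) SB(2)[OF i] W CW[rule_format] V CV[rule_format], where q=q and r="2 * hB i" and CF="C1 * wa i" and CG="C1 * wb i"])
        (use C1(2,3)[OF i] wnd_zero[OF hB[OF i]] wnd_le_1 in \<open>auto simp: abs_of_nonneg\<close>)
    define D where "D = C0 * G i * hB i ^ n"
    have nj: "(\<integral>\<^sup>+\<xi>'. ennreal (jw n (hA i *\<^sub>R (\<xi> - \<xi>'))) \<partial>lborel) = ennreal (1 / hA i ^ n * Jr)" for \<xi> :: 'a
      unfolding Jr_def n_def by (rule nn_integral_jw_affine[OF h(1)[OF i] order_refl])
    have D: "0 <= D" unfolding D_def using C0 G(2)[OF i] hB[OF i] by simp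
    have pw: "norm (W \<xi> * cnj (V \<xi>') * Kf (\<xi>, \<xi>')) <= D * jw n (hA i *\<^sub>R (\<xi> - \<xi>')) *
       (indicator (SA i) \<xi> * (wa i * norm (W \<xi>))\<^sup>2 + indicator (SB i) \<xi>' * (wb i * norm (V \<xi>'))\<^sup>2)" for \<xi> \<xi>'
    proof (cases "\<xi> \<in> SA i \<and> \<xi>' \<in> SB i")
      case True
      define A B where "A = wa i * norm (W \<xi>)" and "B = wb i * norm (V \<xi>')"
      have AB: "0 <= A" "0 <= B" unfolding A_def B_def using unif_nonneg[OF a i] unif_nonneg[OF b i] by auto
      have "norm (W \<xi> * cnj (V \<xi>') * Kf (\<xi>, \<xi>')) <= norm (W \<xi>) * norm (V \<xi>') * (C0 * wa i * wb i * hB i ^ n * jw (n + P) (hA i *\<^sub>R (\<xi> - \<xi>')))"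
        using K[OF i, of \<xi> \<xi>' q] by (auto simp: norm_mult Kf_def n_def intro!: mult_left_mono)
      also have "\<dots> = A * B * (C0 * hB i ^ n * jw n (hA i *\<^sub>R (\<xi> - \<xi>'))) * jw P (hA i *\<^sub>R (\<xi> - \<xi>'))"
        by (simp add: jw_add A_def B_def mult_ac)
      also have "\<dots> <= A * B * (C0 * hB i ^ n * jw n (hA i *\<^sub>R (\<xi> - \<xi>'))) * G i"
        using AB C0 hB[OF i] True G(1)[OF i] by (intro mult_left_mono mult_nonneg_nonneg) auto
      also have "\<dots> = (A * B) * (D * jw n (hA i *\<^sub>R (\<xi> - \<xi>')))" by (simp add: D_def mult_ac)
      also have "\<dots> <= (A\<^sup>2 + B\<^sup>2) * (D * jw n (hA i *\<^sub>R (\<xi> - \<xi>')))"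
        using sum_squares_bound[of A B] AB D by (intro mult_right_mono mult_nonneg_nonneg) (auto intro: order_trans[OF _ sum_squares_bound])
      finally show ?thesis using True by (simp add: A_def B_def mult_ac)
    next
      case False
      then have "Kf (\<xi>, \<xi>') = 0" using supp by (auto simp: Kf_def xsupp_def)
      then show ?thesis using D by (simp add: add_nonneg_nonneg)
    qed
    have "ennreal (norm H) <= (\<integral>\<^sup>+\<zeta>. ennreal (norm (W (fst \<zeta>) * cnj (V (snd \<zeta>)) * Kf \<zeta>)) \<partial>(lborel \<Otimes>\<^sub>M lborel))"
      unfolding H
      by (cases "integrable (lborel \<Otimes>\<^sub>M lborel) (%\<zeta>. W (fst \<zeta>) * cnj (V (snd \<zeta>)) * Kf \<zeta>)")
        (auto intro!: integral_norm_bound_ennreal simp: not_integrable_integral_eq)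
    also have "\<dots> <= (\<integral>\<^sup>+\<zeta>. ennreal (D * jw n (hA i *\<^sub>R (fst \<zeta> - snd \<zeta>))) * (indicator (SA i) (fst \<zeta>) * ennreal ((wa i * norm (W (fst \<zeta>)))\<^sup>2)) +
         ennreal (D * jw n (hA i *\<^sub>R (fst \<zeta> - snd \<zeta>))) * (indicator (SB i) (snd \<zeta>) * ennreal ((wb i * norm (V (snd \<zeta>)))\<^sup>2)) \<partial>(lborel \<Otimes>\<^sub>M lborel))"
    proof (rule nn_integral_mono)
      fix \<zeta> :: "'a \<times> 'a"
      have e: "indicator S \<xi> * ennreal t = ennreal (indicator S \<xi> * t)" for S and \<xi> :: 'a and t by (simp add: indicator_def)
      show "ennreal (norm (W (fst \<zeta>) * cnj (V (snd \<zeta>)) * Kf \<zeta>)) <= ennreal (D * jw n (hA i *\<^sub>R (fst \<zeta> - snd \<zeta>))) * (indicator (SA i) (fst \<zeta>) * ennreal ((wa i * norm (W (fst \<zeta>)))\<^sup>2)) +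
         ennreal (D * jw n (hA i *\<^sub>R (fst \<zeta> - snd \<zeta>))) * (indicator (SB i) (snd \<zeta>) * ennreal ((wb i * norm (V (snd \<zeta>)))\<^sup>2))"
        using pw[of "fst \<zeta>" "snd \<zeta>"] D
        by (simp add: e ennreal_mult[symmetric] ennreal_plus[symmetric] distrib_left ennreal_leI del: ennreal_plus)
    qed
    also have "\<dots> = (\<integral>\<^sup>+\<zeta>. ennreal (D * jw n (hA i *\<^sub>R (fst \<zeta> - snd \<zeta>))) * (indicator (SA i) (fst \<zeta>) * ennreal ((wa i * norm (W (fst \<zeta>)))\<^sup>2)) \<partial>(lborel \<Otimes>\<^sub>M lborel)) +
         (\<integral>\<^sup>+\<zeta>. ennreal (D * jw n (hA i *\<^sub>R (fst \<zeta> - snd \<zeta>))) * (indicator (SB i) (snd \<zeta>) * ennreal ((wb i * norm (V (snd \<zeta>)))\<^sup>2)) \<partial>(lborel \<Otimes>\<^sub>M lborel))"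
      by (rule nn_integral_add) measurable
    also have "(\<integral>\<^sup>+\<zeta>. ennreal (D * jw n (hA i *\<^sub>R (fst \<zeta> - snd \<zeta>))) * (indicator (SA i) (fst \<zeta>) * ennreal ((wa i * norm (W (fst \<zeta>)))\<^sup>2)) \<partial>(lborel \<Otimes>\<^sub>M lborel))
       = (\<integral>\<^sup>+\<xi>. \<integral>\<^sup>+\<xi>'. ennreal D * ennreal (jw n (hA i *\<^sub>R (\<xi> - \<xi>'))) * (indicator (SA i) \<xi> * ennreal ((wa i * norm (W \<xi>))\<^sup>2)) \<partial>lborel \<partial>lborel)"
      by (subst lborel.nn_integral_fst[symmetric]) (simp_all add: ennreal_mult D)
    also have "\<dots> = (\<integral>\<^sup>+\<xi>. ennreal D * ennreal (1 / hA i ^ n * Jr) * (indicator (SA i) \<xi> * ennreal ((wa i * norm (W \<xi>))\<^sup>2)) \<partial>lborel)"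
      by (simp add: nn_integral_cmult nn_integral_multc nj del: times_divide_eq_left mult_1_left)
    also have "\<dots> = ennreal D * ennreal (1 / hA i ^ n * Jr) * (\<integral>\<^sup>+\<xi>. indicator (SA i) \<xi> * ennreal ((wa i * norm (W \<xi>))\<^sup>2) \<partial>lborel)"
      by (rule nn_integral_cmult) measurable
    also have "(\<integral>\<^sup>+\<zeta>. ennreal (D * jw n (hA i *\<^sub>R (fst \<zeta> - snd \<zeta>))) * (indicator (SB i) (snd \<zeta>) * ennreal ((wb i * norm (V (snd \<zeta>)))\<^sup>2)) \<partial>(lborel \<Otimes>\<^sub>M lborel))
       = (\<integral>\<^sup>+\<xi>'. \<integral>\<^sup>+\<xi>. ennreal D * ennreal (jw n (hA i *\<^sub>R (\<xi>' - \<xi>))) * (indicator (SB i) \<xi>' * ennreal ((wb i * norm (V \<xi>'))\<^sup>2)) \<partial>lborel \<partial>lborel)"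
    proof -
      have sym: "jw n (hA i *\<^sub>R (\<xi>' - \<xi>)) = jw n (hA i *\<^sub>R (\<xi> - \<xi>'))" for \<xi> \<xi>'
        by (simp add: jw_def norm_minus_commute)
      show ?thesis
        by (subst lborel_pair.nn_integral_snd[symmetric]) (simp_all add: ennreal_mult D sym)
    qed
    also have "\<dots> = (\<integral>\<^sup>+\<xi>'. ennreal D * ennreal (1 / hA i ^ n * Jr) * (indicator (SB i) \<xi>' * ennreal ((wb i * norm (V \<xi>'))\<^sup>2)) \<partial>lborel)"
      by (simp add: nn_integral_cmult nn_integral_multc nj del: times_divide_eq_left mult_1_left)
    also have "\<dots> = ennreal D * ennreal (1 / hA i ^ n * Jr) * (\<integral>\<^sup>+\<xi>. indicator (SB i) \<xi> * ennreal ((wb i * norm (V \<xi>))\<^sup>2) \<partial>lborel)"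
      by (rule nn_integral_cmult) measurable
    also have "ennreal D * ennreal (1 / hA i ^ n * Jr) = ennreal (C0 * Jr * G i * (hB i / hA i) ^ DIM('a))"
      using D Jr h(1)[OF i] by (simp add: ennreal_mult[symmetric] D_def n_def power_divide mult_ac)
    finally show "ennreal (norm H) <= ennreal (C0 * Jr * G i * (hB i / hA i) ^ DIM('a)) *
     ((\<integral>\<^sup>+\<xi>. indicator (SA i) \<xi> * ennreal ((wa i * norm (W \<xi>))\<^sup>2) \<partial>lborel) +
      (\<integral>\<^sup>+\<xi>. indicator (SB i) \<xi> * ennreal ((wb i * norm (V \<xi>))\<^sup>2) \<partial>lborel))"
      by (simp add: distrib_left)
  qed
qed


text \<open>The previous bound admits any bounded measurable frequency functions for each q, so it
  can be applied to the transforms of the inputs damped around that same q. Integration over q turns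
  the right side into \<open>NN\<close>.\<close>

lemma window_form_weighted:
  "\<exists>C\<ge>0. \<forall>i\<in>I. \<forall>(M::'m measure) (Y::'m => 'a) u (M'::'n measure) (Y'::'n => 'a) v. datum M Y u --> datum M' Y' v -->
    (\<integral>\<^sup>+q. ennreal (norm (LINT x|lborel. of_real (wnd (hB i) q x) * (opT (a i) (ft M Y u) x * cnj (opT (b i) (ft M' Y' v) x)))) \<partial>lborel) <=
    ennreal (C * G i * (hB i / hA i) ^ DIM('a)) *
     (ennreal ((wa i)\<^sup>2) * NN L M Y u (hB i) (SA i) + ennreal ((wb i)\<^sup>2) * NN L M' Y' v (hB i) (SB i))"
proof -
  obtain C where C: "0 <= C" "\<And>i (q::'a) W V CW CV. i \<in> I ==> W \<in> borel_measurable borel ==> V \<in> borel_measurable borel ==>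
     (\<forall>\<xi>. norm (W \<xi>) <= CW) ==> (\<forall>\<xi>. norm (V \<xi>) <= CV) ==>
    ennreal (norm (LINT x|lborel. of_real (wnd (hB i) q x) * (opT (wa_sym i q) W x * cnj (opT (wb_sym i q) V x)))) <=
    ennreal (C * G i * (hB i / hA i) ^ DIM('a)) *
     ((\<integral>\<^sup>+\<xi>. indicator (SA i) \<xi> * ennreal ((wa i * norm (W \<xi>))\<^sup>2) \<partial>lborel) +
      (\<integral>\<^sup>+\<xi>. indicator (SB i) \<xi> * ennreal ((wb i * norm (V \<xi>))\<^sup>2) \<partial>lborel))"
    using window_form_bound by blast
  show ?thesis
  proof (intro exI[of _ C] conjI ballI allI impI C(1))
    fix i and M :: "'m measure" and Y :: "'m => 'a" and u and M' :: "'n measure" and Y' :: "'n => 'a" and v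
    assume i: "i \<in> I" and d: "datum M Y u" and d': "datum M' Y' v"
    note [measurable] = borel_closed[OF SA(1)[OF i]] borel_closed[OF SB(1)[OF i]]
      measurable_ft_wdat[OF d, unfolded split_beta'] measurable_ft_wdat[OF d', unfolded split_beta']
    have "ennreal (norm (LINT x|lborel. of_real (wnd (hB i) q x) * (opT (a i) (ft M Y u) x * cnj (opT (b i) (ft M' Y' v) x)))) <=
      ennreal (C * G i * (hB i / hA i) ^ DIM('a)) *
      (ennreal ((wa i)\<^sup>2) * (\<integral>\<^sup>+\<xi>. indicator (SA i) \<xi> * ennreal ((norm (ft M Y (wdat L Y q (hB i) u) \<xi>))\<^sup>2) \<partial>lborel) +
       ennreal ((wb i)\<^sup>2) * (\<integral>\<^sup>+\<xi>. indicator (SB i) \<xi> * ennreal ((norm (ft M' Y' (wdat L Y' q (hB i) v) \<xi>))\<^sup>2) \<partial>lborel))" for q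
    proof -
      have m[measurable]: "ft M Y (wdat L Y q (hB i) u) \<in> borel_measurable borel" "ft M' Y' (wdat L Y' q (hB i) v) \<in> borel_measurable borel"
        by (rule ft_measurable[OF datum_wdat[OF d]] ft_measurable[OF datum_wdat[OF d']])+
      have e: "opT (a i) (ft M Y u) x = opT (wa_sym i q) (ft M Y (wdat L Y q (hB i) u)) x"
        "opT (b i) (ft M' Y' v) x = opT (wb_sym i q) (ft M' Y' (wdat L Y' q (hB i) v)) x" for x
        unfolding wa_sym_def wb_sym_def
        using opT_weighted[OF d unif_smooth[OF a i] SA(3,1,2)[OF i]] opT_weighted[OF d' unif_smooth[OF b i] SB(3,1,2)[OF i]]
        by blast+
      have "(\<integral>\<^sup>+\<xi>. indicator S \<xi> * ennreal ((c * norm (w \<xi>))\<^sup>2) \<partial>lborel) = ennreal (c\<^sup>2) * (\<integral>\<^sup>+\<xi>. indicator S \<xi> * ennreal ((norm (w \<xi>))\<^sup>2) \<partial>lborel)"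
        if [measurable]: "w \<in> borel_measurable borel" "S \<in> sets borel" for c S and w :: "'a => complex"
        by (subst nn_integral_cmult[symmetric]) (auto simp: power_mult_distrib ennreal_mult mult_ac)
      from this[OF m(1)] this[OF m(2)] show ?thesis
        using C(2)[OF i m allI[OF ft_bound[OF datum_wdat[OF d]]] allI[OF ft_bound[OF datum_wdat[OF d']]], of q]
        unfolding e by simp
    qed
    then have "(\<integral>\<^sup>+q. ennreal (norm (LINT x|lborel. of_real (wnd (hB i) q x) * (opT (a i) (ft M Y u) x * cnj (opT (b i) (ft M' Y' v) x)))) \<partial>lborel) <=
      (\<integral>\<^sup>+q. ennreal (C * G i * (hB i / hA i) ^ DIM('a)) *
      (ennreal ((wa i)\<^sup>2) * (\<integral>\<^sup>+\<xi>. indicator (SA i) \<xi> * ennreal ((norm (ft M Y (wdat L Y q (hB i) u) \<xi>))\<^sup>2) \<partial>lborel) +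
       ennreal ((wb i)\<^sup>2) * (\<integral>\<^sup>+\<xi>. indicator (SB i) \<xi> * ennreal ((norm (ft M' Y' (wdat L Y' q (hB i) v) \<xi>))\<^sup>2) \<partial>lborel)) \<partial>lborel)"
      by (intro nn_integral_mono)
    also have "\<dots> = ennreal (C * G i * (hB i / hA i) ^ DIM('a)) *
      (ennreal ((wa i)\<^sup>2) * NN L M Y u (hB i) (SA i) + ennreal ((wb i)\<^sup>2) * NN L M' Y' v (hB i) (SB i))"
      unfolding NN_def by (simp add: nn_integral_cmult nn_integral_add)
    finally show "(\<integral>\<^sup>+q. ennreal (norm (LINT x|lborel. of_real (wnd (hB i) q x) * (opT (a i) (ft M Y u) x * cnj (opT (b i) (ft M' Y' v) x)))) \<partial>lborel) <=
      ennreal (C * G i * (hB i / hA i) ^ DIM('a)) *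
      (ennreal ((wa i)\<^sup>2) * NN L M Y u (hB i) (SA i) + ennreal ((wb i)\<^sup>2) * NN L M' Y' v (hB i) (SB i))" .
  qed
qed

lemma cancel_window_volume:
  assumes "ennreal (hB i ^ DIM('a) * bmass TYPE('a)) * x <= ennreal (C * G i * (hB i / hA i) ^ DIM('a)) * y" "i \<in> I" "0 <= C"
  shows "x <= ennreal (C / bmass TYPE('a) * G i / hA i ^ DIM('a)) * y"
proof -
  define k where "k = hB i ^ DIM('a) * bmass TYPE('a)"
  have k: "0 < k" unfolding k_def using hB[OF assms(2)] bmass_pos[where 'a='a] by simp
  have "x = ennreal (1 / k) * (ennreal k * x)"
    using k by (simp add: mult.assoc[symmetric] ennreal_mult[symmetric])
  also have "\<dots> <= ennreal (1 / k) * (ennreal (C * G i * (hB i / hA i) ^ DIM('a)) * y)"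
    using assms(1) by (intro mult_left_mono) (simp_all add: k_def)
  also have "\<dots> = ennreal (1 / k * (C * G i * (hB i / hA i) ^ DIM('a))) * y"
    using k assms G(2)[OF assms(2)] h(1)[OF assms(2)] hB[OF assms(2)]
    by (simp add: mult.assoc[symmetric] ennreal_mult[symmetric])
  also have "1 / k * (C * G i * (hB i / hA i) ^ DIM('a)) = C / bmass TYPE('a) * G i / hA i ^ DIM('a)"
    using hB[OF assms(2)] by (simp add: k_def power_divide)
  finally show ?thesis .
qed

lemma cross_bound:
  "\<exists>C\<ge>0. \<forall>i\<in>I. \<forall>(M::'m measure) (Y::'m => 'a) u (M'::'n measure) (Y'::'n => 'a) v. datum M Y u --> datum M' Y' v -->
    integrable lborel (%x. opT (a i) (ft M Y u) x * cnj (opT (b i) (ft M' Y' v) x)) -->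
    ennreal (norm (LINT x|lborel. opT (a i) (ft M Y u) x * cnj (opT (b i) (ft M' Y' v) x))) <=
    ennreal (C * G i / hA i ^ DIM('a)) *
     (ennreal ((wa i)\<^sup>2) * NN L M Y u (hB i) (SA i) + ennreal ((wb i)\<^sup>2) * NN L M' Y' v (hB i) (SB i))"
proof -
  obtain C where C: "0 <= C" "\<And>i (M::'m measure) (Y::'m => 'a) u (M'::'n measure) (Y'::'n => 'a) v. i \<in> I ==> datum M Y u ==> datum M' Y' v ==>
    (\<integral>\<^sup>+q. ennreal (norm (LINT x|lborel. of_real (wnd (hB i) q x) * (opT (a i) (ft M Y u) x * cnj (opT (b i) (ft M' Y' v) x)))) \<partial>lborel) <=
    ennreal (C * G i * (hB i / hA i) ^ DIM('a)) *
     (ennreal ((wa i)\<^sup>2) * NN L M Y u (hB i) (SA i) + ennreal ((wb i)\<^sup>2) * NN L M' Y' v (hB i) (SB i))"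
    using window_form_weighted[where 'm='m and 'n='n] by blast
  show ?thesis
    by (intro exI[of _ "C / bmass TYPE('a)"] conjI ballI allI impI
        cancel_window_volume[OF order_trans[OF norm_integral_le_wnd C(2)]])
      (use C(1) bmass_pos[where 'a='a] hB in auto)
qed

end

text \<open>For a single operator the windowed integrals are those of a nonnegative function, so
  averaging over q is Tonelli and finiteness of the L^2 norm can be a conclusion;
  \<open>cross_bound\<close> presupposes integrability of the product.\<close>

lemma (in symbol_pair) diagonal_bound:
  assumes "b = a" "wb = wa" "SB = SA"
  shows "\<exists>C\<ge>0. \<forall>i\<in>I. \<forall>(M::'m measure) (Y::'m => 'a) u. datum M Y u -->
    (\<integral>\<^sup>+x. ennreal ((norm (opT (a i) (ft M Y u) x))\<^sup>2) \<partial>lborel) <=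
    ennreal (C * G i / hA i ^ DIM('a)) * (ennreal ((wa i)\<^sup>2) * NN L M Y u (hB i) (SA i))"
proof -
  obtain C where C: "0 <= C" "\<And>i (M::'m measure) (Y::'m => 'a) u. i \<in> I ==> datum M Y u ==>
    (\<integral>\<^sup>+q. ennreal (norm (LINT x|lborel. of_real (wnd (hB i) q x) * (opT (a i) (ft M Y u) x * cnj (opT (a i) (ft M Y u) x)))) \<partial>lborel) <=
    ennreal (C * G i * (hB i / hA i) ^ DIM('a)) *
     (ennreal ((wa i)\<^sup>2) * NN L M Y u (hB i) (SA i) + ennreal ((wa i)\<^sup>2) * NN L M Y u (hB i) (SA i))"
    using window_form_weighted[where 'm='m and 'n='m] unfolding assms by blast
  show ?thesis
  proof (intro exI[of _ "2 * C / bmass TYPE('a)"] conjI ballI allI impI)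
    fix i and M :: "'m measure" and Y :: "'m => 'a" and u assume i: "i \<in> I" and d: "datum M Y u"
    define T where "T = opT (a i) (ft M Y u)"
    have [measurable]: "T \<in> borel_measurable borel"
      unfolding T_def by (rule measurable_opT[OF unif_smooth[OF a i] ft_measurable[OF d]])
    \<comment> \<open>A bounded \<open>T\<close> makes every windowed integral finite, without any
      knowledge about its L^2 norm; boundedness comes from the bounded frequency support.\<close>
    obtain B where B: "\<And>x. norm (T x) <= B"
    proof -
      obtain A where A: "0 <= A" "\<And>p. norm (a i p) <= A * wa i"
        using unif_bound[OF a, where k=0] i by (metis UNIV_I empty_subsetI iter_deriv.simps(1) le_refl list.set(1) list.size(3))
      define U where "U = (LINT m|M. norm (u m))"
      have "norm (T x) <= (LINT \<xi>|lborel. A * wa i * U * indicator (SA i) \<xi>)" for x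
        unfolding T_def opT_def
      proof (rule order_trans[OF integral_norm_bound integral_mono])
        show "integrable lborel (%\<xi>. norm (ee x \<xi> * a i (x, \<xi>) * ft M Y u \<xi>))"
          by (intro integrable_norm integrable_opT[OF unif_smooth[OF a i] SA(3,2)[OF i] ft_measurable[OF d] ft_bound[OF d]])
        show "integrable lborel (%\<xi>. A * wa i * U * indicator (SA i) \<xi>)"
          using emeasure_bounded_finite[OF SA(2)[OF i]] borel_closed[OF SA(1)[OF i]] by auto
        have "norm (a i (x, \<xi>)) * norm (ft M Y u \<xi>) <= A * wa i * U" for \<xi>
          unfolding U_def using A unif_nonneg[OF a i] by (intro mult_mono ft_bound[OF d]) auto
        then show "norm (ee x \<xi> * a i (x, \<xi>) * ft M Y u \<xi>) <= A * wa i * U * indicator (SA i) \<xi>" for \<xi>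
          using SA(3)[OF i] by (auto simp: norm_mult indicator_def xsupp_def)
      qed
      then show ?thesis using that by blast
    qed
    have B0: "0 <= B" using order_trans[OF norm_ge_zero B] .
    have q: "(\<integral>\<^sup>+x. ennreal (wnd (hB i) q x) * ennreal ((norm (T x))\<^sup>2) \<partial>lborel) =
      ennreal (norm (LINT x|lborel. of_real (wnd (hB i) q x) * (T x * cnj (T x))))" for q
    proof -
      have "integrable lborel (%x. wnd (hB i) q x * (norm (T x))\<^sup>2)"
      proof (rule integrableI_bounded_set[where A="cball q (2 * hB i)" and B="1 * B\<^sup>2"])
        show "emeasure lborel (cball q (2 * hB i)) < \<infinity>" by (rule emeasure_bounded_finite[OF bounded_cball])
        have "wnd (hB i) q x * (norm (T x))\<^sup>2 <= 1 * B\<^sup>2" for x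
          by (intro mult_mono wnd_le_1 power_mono B) auto
        then show "AE x in lborel. x \<in> cball q (2 * hB i) --> norm (wnd (hB i) q x * (norm (T x))\<^sup>2) <= 1 * B\<^sup>2"
          by simp
      qed (use wnd_zero[OF hB[OF i]] in auto)
      then have "(\<integral>\<^sup>+x. ennreal (wnd (hB i) q x * (norm (T x))\<^sup>2) \<partial>lborel) = ennreal (LINT x|lborel. wnd (hB i) q x * (norm (T x))\<^sup>2)"
        by (intro nn_integral_eq_integral) auto
      moreover have "(LINT x|lborel. of_real (wnd (hB i) q x) * (T x * cnj (T x))) = of_real (LINT x|lborel. wnd (hB i) q x * (norm (T x))\<^sup>2)"
      proof -
        have "of_real (wnd (hB i) q x) * (T x * cnj (T x)) = complex_of_real (wnd (hB i) q x * (norm (T x))\<^sup>2)" for x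
          by (simp only: of_real_mult complex_norm_square)
        then show ?thesis by (simp only: integral_complex_of_real)
      qed
      ultimately show ?thesis by (simp add: ennreal_mult abs_of_nonneg integral_nonneg_AE)
    qed
    have "ennreal (hB i ^ DIM('a) * bmass TYPE('a)) * (\<integral>\<^sup>+x. ennreal ((norm (T x))\<^sup>2) \<partial>lborel)
      = (\<integral>\<^sup>+q. ennreal (norm (LINT x|lborel. of_real (wnd (hB i) q x) * (T x * cnj (T x)))) \<partial>lborel)"
      by (subst wnd_average_nn[symmetric]) (use hB i q in auto)
    also have "\<dots> <= ennreal (C * G i * (hB i / hA i) ^ DIM('a)) *
     (ennreal ((wa i)\<^sup>2) * NN L M Y u (hB i) (SA i) + ennreal ((wa i)\<^sup>2) * NN L M Y u (hB i) (SA i))"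
      unfolding T_def by (rule C(2)[OF i d])
    finally have "(\<integral>\<^sup>+x. ennreal ((norm (T x))\<^sup>2) \<partial>lborel) <= ennreal (C / bmass TYPE('a) * G i / hA i ^ DIM('a)) *
      (ennreal ((wa i)\<^sup>2) * NN L M Y u (hB i) (SA i) + ennreal ((wa i)\<^sup>2) * NN L M Y u (hB i) (SA i))"
      by (rule cancel_window_volume[OF _ i C(1)])
    also have "\<dots> = ennreal (C / bmass TYPE('a) * G i / hA i ^ DIM('a)) * (2 * (ennreal ((wa i)\<^sup>2) * NN L M Y u (hB i) (SA i)))"
      by (simp add: mult_2)
    also have "\<dots> = ennreal (2 * C / bmass TYPE('a) * G i / hA i ^ DIM('a)) * (ennreal ((wa i)\<^sup>2) * NN L M Y u (hB i) (SA i))"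
    proof -
      have "0 <= C / bmass TYPE('a) * G i / hA i ^ DIM('a)"
        using C(1) bmass_pos[where 'a='a] G(2)[OF i] h(1)[OF i] by simp
      then have "ennreal (2 * (C / bmass TYPE('a) * G i / hA i ^ DIM('a))) = ennreal 2 * ennreal (C / bmass TYPE('a) * G i / hA i ^ DIM('a))"
        by (intro ennreal_mult) auto
      moreover have "2 * C / bmass TYPE('a) * G i / hA i ^ DIM('a) = 2 * (C / bmass TYPE('a) * G i / hA i ^ DIM('a))" by simp
      ultimately have "ennreal (2 * C / bmass TYPE('a) * G i / hA i ^ DIM('a)) = 2 * ennreal (C / bmass TYPE('a) * G i / hA i ^ DIM('a))"
        by (simp only: ennreal_numeral)
      then show ?thesis by (simp only: mult_ac)
    qed
    finally show "(\<integral>\<^sup>+x. ennreal ((norm (opT (a i) (ft M Y u) x))\<^sup>2) \<partial>lborel) <=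
      ennreal (2 * C / bmass TYPE('a) * G i / hA i ^ DIM('a)) * (ennreal ((wa i)\<^sup>2) * NN L M Y u (hB i) (SA i))"
      by (simp add: T_def)
  qed (use C(1) bmass_pos[where 'a='a] in auto)
qed

section \<open>Dyadic amplitudes\<close>

lemma bump_fourier_bound:
  "\<exists>C\<ge>0. \<forall>R>0. \<forall>z. norm (LINT \<xi>|lborel. ee z \<xi> * of_real (bump ((\<xi>::'a::euclidean_space) /\<^sub>R R))) <= C * R ^ DIM('a) * jw K (R *\<^sub>R z)"
proof -
  let ?f = "%(R::real) (\<xi>::'a). complex_of_real (bump ((\<xi> - 0) /\<^sub>R R))"
  have u: "unif {0<..} (%R. cball 0 R) (%_. UNIV) (%_. 1) ?f"
    by (rule unif_scaled_bump) auto
  obtain C where C: "0 <= C" "\<And>R p vs. R \<in> {0<..} ==> p \<in> UNIV ==> length vs <= 0 ==> set vs \<subseteq> cball (0::'a) R ==>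
     norm (iter_deriv ((lap (%b. R *\<^sub>R b) ^^ K) (?f R)) vs p) <= C * 1"
    by (rule unif_bound[OF unif_lap_funpow[OF u, where e="%R b. R *\<^sub>R b" and L=K], where k=0]) auto
  show ?thesis
  proof (intro exI[of _ "C * measure lborel (cball (0::'a) 2)"] conjI allI impI)
    fix R :: real and z :: 'a assume R: "0 < R"
    define l where "l = (lap (%b. R *\<^sub>R b) ^^ K) (?f R)"
    have f0: "?f R \<xi> = 0" if "\<xi> \<notin> cball 0 (2 * R)" for \<xi>
      using wnd_zero[OF R that] by (simp add: wnd_def)
    have sf: "smooth (?f R)" using unif_smooth[OF u] R by simp
    have l0: "l x = 0" if "x \<notin> cball 0 (2 * R)" for x
      unfolding l_def by (rule lap_funpow_zero_outside[where f="?f R", OF _ that]) (rule f0)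
    have l1: "norm (l x) <= C" for x
      using C(2)[of R x "[]"] R by (simp add: l_def)
    have sl: "smooth l" unfolding l_def by (rule smooth_lap_funpow[OF sf])
    have "norm (LINT x|lborel. ee z x * l x) <= (LINT x|lborel. norm (ee z x * l x))"
      by (rule integral_norm_bound)
    also have "\<dots> <= (LINT x|lborel. C * indicator (cball (0::'a) (2 * R)) x)"
    proof (rule integral_mono)
      show "integrable lborel (%x. norm (ee z x * l x))"
        by (intro integrable_norm integrable_ee_mult integrable_compact_support[of l 0 "2 * R", OF sl l0])
      show "integrable lborel (%x. C * indicator (cball (0::'a) (2 * R)) x)"
        using emeasure_bounded_finite[OF bounded_cball, of "0::'a" "2 * R"]
        by (intro integrable_mult_right integrable_real_indicator) auto
    qed (use l0 l1 in \<open>auto simp: norm_mult indicator_def\<close>)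
    also have "\<dots> = C * (measure lborel (cball (0::'a) 2) * R ^ DIM('a))"
      by (simp add: cball_measure_scaled[OF R])
    finally have 1: "norm (LINT x|lborel. ee z x * l x) <= C * (measure lborel (cball (0::'a) 2) * R ^ DIM('a))" .
    define J where "J = (LINT x|lborel. ee z x * ?f R x)"
    have "(LINT x|lborel. ee z x * l x) = of_real ((1 + R\<^sup>2 * (norm z)\<^sup>2) ^ K) * J"
      unfolding l_def J_def by (rule fourier_lap_funpow[OF sf]) (rule f0)
    moreover have pos: "0 < (1 + R\<^sup>2 * (norm z)\<^sup>2) ^ K" by (intro zero_less_power add_pos_nonneg) auto
    ultimately have "norm J * (1 + R\<^sup>2 * (norm z)\<^sup>2) ^ K <= C * (measure lborel (cball (0::'a) 2) * R ^ DIM('a))"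
      using 1 by (simp only: norm_mult norm_of_real) (simp add: mult.commute)
    then have "norm J <= C * (measure lborel (cball (0::'a) 2) * R ^ DIM('a)) * jw K (R *\<^sub>R z)"
      using pos by (simp add: jw_def power_mult_distrib pos_le_divide_eq)
    then show "norm (LINT \<xi>|lborel. ee z \<xi> * of_real (bump ((\<xi>::'a) /\<^sub>R R))) <= C * measure lborel (cball (0::'a) 2) * R ^ DIM('a) * jw K (R *\<^sub>R z)"
      by (simp add: J_def mult_ac)
  qed (use C in simp)
qed

text \<open>Controls the L^2 mass of the transform on |\<xi>| <= R by absolute values of the input,
  through a kernel concentrated at distance 1/R. Cancellation inside the input is given up; what
  counts is how its mass is spread at that scale.\<close>

definition EE :: "nat => 'm measure => ('m => 'a::euclidean_space) => ('m => complex) => real => ennreal" where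
  "EE K M Y u R = (\<integral>\<^sup>+m'. \<integral>\<^sup>+m. ennreal (norm (u m') * norm (u m) * (R ^ DIM('a) * jw K (R *\<^sub>R (Y m' - Y m)))) \<partial>M \<partial>M)"

text \<open>The indicator of the ball is majorised by the cutoff at radius R, and the squared
  transform is expanded into a double integral over the input. The integral over \<xi> is then the
  transform of the cutoff at Y m' - Y m, which \<open>B\<close> bounds.\<close>

lemma bump_quadratic_form:
  fixes Y :: "'m => 'a::euclidean_space"
  assumes d: "datum M Y w" and R: "0 < R"
    and B: "\<And>z. norm (LINT \<xi>|lborel. ee z \<xi> * of_real (bump ((\<xi>::'a) /\<^sub>R R))) <= B z" and [measurable]: "B \<in> borel_measurable borel"
  shows "(\<integral>\<^sup>+\<xi>. indicator (cball 0 R) \<xi> * ennreal ((norm (ft M Y w \<xi>))\<^sup>2) \<partial>lborel) <=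
     (\<integral>\<^sup>+m'. \<integral>\<^sup>+m. ennreal (norm (w m') * norm (w m) * B (Y m' - Y m)) \<partial>M \<partial>M)"
proof -
  interpret sigma_finite_measure M using d by (simp add: datum_def)
  have [measurable]: "Y \<in> borel_measurable M" "w \<in> borel_measurable M" and iw: "integrable M w"
    using d by (auto simp: datum_def)
  define \<Gamma> where "\<Gamma> \<xi> = complex_of_real (bump (\<xi> /\<^sub>R R))" for \<xi> :: 'a
  define W where "W = ft M Y w"
  have W[measurable]: "W \<in> borel_measurable borel" unfolding W_def by (rule ft_measurable[OF d])
  define U where "U = (LINT m|M. norm (w m))"
  have WU: "norm (W \<xi>) <= U" for \<xi> unfolding W_def U_def by (rule ft_bound[OF d])
  have [measurable]: "\<Gamma> \<in> borel_measurable borel" unfolding \<Gamma>_def by measurable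
  have bz: "bump (\<xi> /\<^sub>R R) = 0" if "\<xi> \<notin> cball 0 (2 * R)" for \<xi> :: 'a
    using wnd_zero[OF R that] by (simp add: wnd_def)
  have U0: "0 <= U" using order_trans[OF norm_ge_zero WU] .
  have fin: "emeasure lborel (cball (0::'a) (2 * R)) < \<infinity>" by (rule emeasure_bounded_finite[OF bounded_cball])
  have i1: "integrable lborel \<Gamma>"
    by (rule integrableI_bounded_set[where A="cball 0 (2 * R)" and B=1])
      (use fin bz in \<open>auto intro!: AE_I2 simp: \<Gamma>_def bump_range\<close>)
  have i2: "integrable lborel (%\<xi>. \<Gamma> \<xi> * W \<xi>)"
  proof (rule integrableI_bounded_set[where A="cball 0 (2 * R)" and B="1 * U"])
    have "norm (\<Gamma> \<xi> * W \<xi>) <= 1 * U" for \<xi>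
      unfolding norm_mult by (rule mult_mono[OF _ WU]) (simp_all add: \<Gamma>_def bump_range)
    then show "AE \<xi> in lborel. \<xi> \<in> cball 0 (2 * R) --> norm (\<Gamma> \<xi> * W \<xi>) <= 1 * U" by simp
  qed (use fin bz in \<open>auto intro!: AE_I2 simp: \<Gamma>_def\<close>)
  have i3: "integrable lborel (%\<xi>. bump (\<xi> /\<^sub>R R) * (norm (W \<xi>))\<^sup>2)"
  proof (rule integrableI_bounded_set[where A="cball 0 (2 * R)" and B="1 * U\<^sup>2"])
    have "bump (\<xi> /\<^sub>R R) * (norm (W \<xi>))\<^sup>2 <= 1 * U\<^sup>2" for \<xi>
      by (intro mult_mono power_mono WU bump_range) auto
    then show "AE \<xi> in lborel. \<xi> \<in> cball 0 (2 * R) --> norm (bump (\<xi> /\<^sub>R R) * (norm (W \<xi>))\<^sup>2) <= 1 * U\<^sup>2"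
      by (simp add: bump_range abs_of_nonneg)
  qed (use fin bz in auto)
  \<comment> \<open>Reflected points and conjugated values give an input whose transform is the
    conjugate of \<open>W\<close>. The quadratic form becomes the value at 0 of an operator applied
    to it, and \<open>opT_swap\<close> opens the two factors one after the other.\<close>
  have d2: "datum M (%m. - Y m) (%m. cnj (w m))" using d by (auto simp: datum_def)
  have ftc: "ft M (%m. - Y m) (%m. cnj (w m)) = (%\<xi>. cnj (W \<xi>))"
  proof
    fix \<xi>
    have "ee (- (- Y m)) \<xi> * cnj (w m) = cnj (ee (- Y m) \<xi> * w m)" for m by (simp add: cnj_ee)
    then show "ft M (%m. - Y m) (%m. cnj (w m)) \<xi> = cnj (W \<xi>)"
      unfolding ft_def W_def by (simp only: Bochner_Integration.integral_cnj)
  qed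
  have "complex_of_real (LINT \<xi>|lborel. bump (\<xi> /\<^sub>R R) * (norm (W \<xi>))\<^sup>2) = opT (%(x, \<xi>). \<Gamma> \<xi> * W \<xi>) (%\<xi>. cnj (W \<xi>)) 0"
  proof -
    have "ee 0 \<xi> * (\<Gamma> \<xi> * W \<xi>) * cnj (W \<xi>) = complex_of_real (bump (\<xi> /\<^sub>R R) * (norm (W \<xi>))\<^sup>2)" for \<xi>
      by (simp only: of_real_mult complex_norm_square) (simp add: ee_def \<Gamma>_def)
    then show ?thesis by (simp only: opT_def prod.case integral_complex_of_real)
  qed
  also have "\<dots> = (LINT m'|M. cnj (w m') * (LINT \<xi>|lborel. ee (0 - - Y m') \<xi> * (\<Gamma> \<xi> * W \<xi>)))"
    unfolding ftc[symmetric] using i2 by (subst opT_swap[OF d2]) simp_all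
  also have "\<dots> = (LINT m'|M. cnj (w m') * opT (%(x, \<xi>). \<Gamma> \<xi>) W (Y m'))"
    by (simp add: opT_def mult.assoc)
  also have "\<dots> = (LINT m'|M. cnj (w m') * (LINT m|M. w m * (LINT \<xi>|lborel. ee (Y m' - Y m) \<xi> * \<Gamma> \<xi>)))"
    unfolding W_def using i1 by (subst opT_swap[OF d]) simp_all
  finally have eq: "complex_of_real (LINT \<xi>|lborel. bump (\<xi> /\<^sub>R R) * (norm (W \<xi>))\<^sup>2) =
     (LINT m'|M. cnj (w m') * (LINT m|M. w m * (LINT \<xi>|lborel. ee (Y m' - Y m) \<xi> * \<Gamma> \<xi>)))" .
  have nb: "ennreal (norm (integral\<^sup>L N f)) <= (\<integral>\<^sup>+x. ennreal (norm (f x)) \<partial>N)" for N and f :: "_ => complex"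
    by (cases "integrable N f") (auto intro!: integral_norm_bound_ennreal simp: not_integrable_integral_eq)
  have "(\<integral>\<^sup>+\<xi>. indicator (cball 0 R) \<xi> * ennreal ((norm (ft M Y w \<xi>))\<^sup>2) \<partial>lborel) <=
     (\<integral>\<^sup>+\<xi>. ennreal (bump (\<xi> /\<^sub>R R) * (norm (W \<xi>))\<^sup>2) \<partial>lborel)"
    using R by (intro nn_integral_mono) (auto simp: indicator_def W_def bump_eq_1 field_simps)
  also have "\<dots> = ennreal (LINT \<xi>|lborel. bump (\<xi> /\<^sub>R R) * (norm (W \<xi>))\<^sup>2)"
    by (rule nn_integral_eq_integral[OF i3]) (simp add: bump_range)
  also have "\<dots> <= ennreal (norm (complex_of_real (LINT \<xi>|lborel. bump (\<xi> /\<^sub>R R) * (norm (W \<xi>))\<^sup>2)))"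
    by (intro ennreal_leI) simp
  also have "\<dots> <= (\<integral>\<^sup>+m'. ennreal (norm (w m')) * (\<integral>\<^sup>+m. ennreal (norm (w m) * B (Y m' - Y m)) \<partial>M) \<partial>M)"
    unfolding eq
  proof (rule order_trans[OF nb nn_integral_mono])
    fix m'
    have "ennreal (norm (LINT m|M. w m * (LINT \<xi>|lborel. ee (Y m' - Y m) \<xi> * \<Gamma> \<xi>))) <= (\<integral>\<^sup>+m. ennreal (norm (w m) * B (Y m' - Y m)) \<partial>M)"
      by (rule order_trans[OF nb nn_integral_mono])
        (auto simp: norm_mult \<Gamma>_def intro!: ennreal_leI mult_left_mono B)
    then show "ennreal (norm (cnj (w m') * (LINT m|M. w m * (LINT \<xi>|lborel. ee (Y m' - Y m) \<xi> * \<Gamma> \<xi>)))) <=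
       ennreal (norm (w m')) * (\<integral>\<^sup>+m. ennreal (norm (w m) * B (Y m' - Y m)) \<partial>M)"
      by (simp add: norm_mult ennreal_mult mult_left_mono)
  qed
  also have "\<dots> = (\<integral>\<^sup>+m'. \<integral>\<^sup>+m. ennreal (norm (w m') * norm (w m) * B (Y m' - Y m)) \<partial>M \<partial>M)"
  proof -
    have B0: "0 <= B z" for z using order_trans[OF norm_ge_zero B] .
    show ?thesis by (simp add: nn_integral_cmult[symmetric] ennreal_mult[symmetric] B0 mult_ac)
  qed
  finally show ?thesis .
qed

text \<open>Two damping weights appear after squaring; one is estimated by 1, the other is
  integrated over q and yields h^n.\<close>

lemma NN_le_EE:
  fixes K L :: nat
  assumes L: "DIM('a::euclidean_space) <= L"
  shows "\<exists>C\<ge>0. \<forall>(M::'m measure) (Y::'m => 'a) u h R. datum M Y u --> 0 < h --> 0 < R -->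
    NN L M Y u h (cball 0 R) <= ennreal (C * h ^ DIM('a)) * EE K M Y u R"
proof -
  obtain C where C: "0 <= C" "\<And>R (z::'a). 0 < R ==> norm (LINT \<xi>|lborel. ee z \<xi> * of_real (bump (\<xi> /\<^sub>R R))) <= C * R ^ DIM('a) * jw K (R *\<^sub>R z)"
    using bump_fourier_bound[where 'a='a and K=K] by blast
  define Jr where "Jr = (LINT \<xi>|lborel. jw L (\<xi>::'a))"
  have Jr: "0 <= Jr" unfolding Jr_def by (rule integral_nonneg_AE) simp
  show ?thesis
  proof (intro exI[of _ "C * Jr"] conjI allI impI)
    show "0 <= C * Jr" using C Jr by simp
    fix M :: "'m measure" and Y :: "'m => 'a" and u and h R :: real
    assume d: "datum M Y u" and h: "0 < h" and R: "0 < R"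
    interpret sigma_finite_measure M using d by (simp add: datum_def)
    interpret PM: pair_sigma_finite "lborel :: 'a measure" M ..
    have [measurable]: "Y \<in> borel_measurable M" "u \<in> borel_measurable M"
      using d by (auto simp: datum_def)
    define B where "B z = C * R ^ DIM('a) * jw K (R *\<^sub>R z)" for z :: 'a
    have B0: "0 <= B z" for z unfolding B_def using C R by simp
    have [measurable]: "B \<in> borel_measurable borel" unfolding B_def by measurable
    have "NN L M Y u h (cball 0 R) <= (\<integral>\<^sup>+q. (\<integral>\<^sup>+m'. \<integral>\<^sup>+m. ennreal (norm (wdat L Y q h u m') * norm (wdat L Y q h u m) * B (Y m' - Y m)) \<partial>M \<partial>M) \<partial>lborel)"
      unfolding NN_def B_def
      by (intro nn_integral_mono bump_quadratic_form datum_wdat d R C(2)) measurable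
    also have "\<dots> <= (\<integral>\<^sup>+q. (\<integral>\<^sup>+m'. \<integral>\<^sup>+m. ennreal (jw L ((Y m' - q) /\<^sub>R h)) * ennreal (norm (u m') * norm (u m) * B (Y m' - Y m)) \<partial>M \<partial>M) \<partial>lborel)"
    proof (intro nn_integral_mono)
      fix q m m'
      have "norm (wdat L Y q h u m') * norm (wdat L Y q h u m) * B (Y m' - Y m) =
        (jw L ((Y m' - q) /\<^sub>R h) * (norm (u m') * norm (u m) * B (Y m' - Y m))) * jw L ((Y m - q) /\<^sub>R h)"
        by (simp add: wdat_def norm_mult mult_ac)
      also have "\<dots> <= (jw L ((Y m' - q) /\<^sub>R h) * (norm (u m') * norm (u m) * B (Y m' - Y m))) * 1"
        by (intro mult_left_mono jw_le_1 mult_nonneg_nonneg B0) auto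
      finally show "ennreal (norm (wdat L Y q h u m') * norm (wdat L Y q h u m) * B (Y m' - Y m)) <=
        ennreal (jw L ((Y m' - q) /\<^sub>R h)) * ennreal (norm (u m') * norm (u m) * B (Y m' - Y m))"
        by (simp add: ennreal_mult[symmetric] B0 ennreal_leI)
    qed
    also have "\<dots> = (\<integral>\<^sup>+q. (\<integral>\<^sup>+m'. ennreal (jw L ((Y m' - q) /\<^sub>R h)) * (\<integral>\<^sup>+m. ennreal (norm (u m') * norm (u m) * B (Y m' - Y m)) \<partial>M) \<partial>M) \<partial>lborel)"
      by (simp add: nn_integral_cmult)
    also have "\<dots> = (\<integral>\<^sup>+m'. (\<integral>\<^sup>+q. ennreal (jw L ((Y m' - q) /\<^sub>R h)) * (\<integral>\<^sup>+m. ennreal (norm (u m') * norm (u m) * B (Y m' - Y m)) \<partial>M) \<partial>lborel) \<partial>M)"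
      by (rule PM.Fubini'[symmetric]) measurable
    also have "\<dots> = (\<integral>\<^sup>+m'. ennreal (h ^ DIM('a) * Jr) * (\<integral>\<^sup>+m. ennreal (norm (u m') * norm (u m) * B (Y m' - Y m)) \<partial>M) \<partial>M)"
    proof -
      have "(\<integral>\<^sup>+q. ennreal (jw L ((y - q) /\<^sub>R h)) \<partial>lborel) = ennreal (h ^ DIM('a) * Jr)" for y :: 'a
        using nn_integral_jw_affine[of "1 / h" L y] h L by (simp add: Jr_def power_one_over divide_inverse power_inverse)
      then show ?thesis by (simp add: nn_integral_multc)
    qed
    also have "\<dots> = ennreal (h ^ DIM('a) * Jr) * (\<integral>\<^sup>+m'. (\<integral>\<^sup>+m. ennreal C * ennreal (norm (u m') * norm (u m) * (R ^ DIM('a) * jw K (R *\<^sub>R (Y m' - Y m)))) \<partial>M) \<partial>M)"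
    proof -
      have "ennreal (norm (u m') * norm (u m) * B (Y m' - Y m)) = ennreal C * ennreal (norm (u m') * norm (u m) * (R ^ DIM('a) * jw K (R *\<^sub>R (Y m' - Y m))))" for m m'
        using C(1) R by (simp add: B_def ennreal_mult[symmetric] mult_ac)
      then show ?thesis by (simp add: nn_integral_cmult)
    qed
    also have "\<dots> = ennreal (h ^ DIM('a) * Jr) * (ennreal C * EE K M Y u R)"
      unfolding EE_def by (simp add: nn_integral_cmult)
    also have "\<dots> = ennreal (C * Jr * h ^ DIM('a)) * EE K M Y u R"
    proof -
      have "C * Jr * h ^ DIM('a) = h ^ DIM('a) * Jr * C" by simp
      moreover have "ennreal (h ^ DIM('a) * Jr * C) = ennreal (h ^ DIM('a) * Jr) * ennreal C"
        using C(1) h Jr by (intro ennreal_mult) auto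
      ultimately show ?thesis by (simp only: mult.assoc)
    qed
    finally show "NN L M Y u h (cball 0 R) <= ennreal (C * Jr * h ^ DIM('a)) * EE K M Y u R" .
  qed
qed

section \<open>Frequency shells and amplitudes of type (\<rho>, 1 - \<rho>)\<close>

definition hs :: "real => nat => real" where "hs \<rho> l = 2 powr (- (1 - \<rho>) * real l)"

text \<open>The unit ball, up to constants, of the metric <\<xi>>^(-2\<rho>) (<\<xi>>^2 dx^2 +
  d\<xi>^2) frozen at |\<xi>| = 2^l: steps \<open>hs \<rho> l\<close> = 2^(-(1 - \<rho>)l) in x and
  2^(\<rho> l) in \<xi>.\<close>

definition Vl :: "real => nat => ('a::euclidean_space \<times> 'a) set" where
  "Vl \<rho> l = {v. norm (fst v) <= hs \<rho> l \<and> norm (snd v) <= 2 powr (\<rho> * real l)}"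

definition shell :: "nat => 'a::euclidean_space set" where
  "shell l = {\<xi>. norm \<xi> <= 2 * 2 ^ l \<and> (l = 0 \<or> 2 ^ l / 2 <= norm \<xi>)}"

definition amp :: "real => real => 'i set => ('i => nat) => ('i => 'a::euclidean_space \<times> 'a => complex) => bool" where
  "amp \<rho> \<mu> I lv a \<longleftrightarrow> unif I (%i. Vl \<rho> (lv i)) (%_. UNIV) (%i. 2 powr (- \<mu> * real (lv i))) a \<and> (\<forall>i\<in>I. xsupp (shell (lv i)) (a i))"

lemma hs_pos [simp]: "0 < hs \<rho> l" by (simp add: hs_def)

lemma hs_antimono: "\<rho> <= 1 ==> k <= l ==> hs \<rho> l <= hs \<rho> k"
  unfolding hs_def by (intro powr_mono) (simp_all add: mult_left_mono_neg)

lemma closed_shell: "closed (shell l)"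
proof -
  have "closed {\<xi>::'a. norm \<xi> <= 2 * 2 ^ l}" "closed {\<xi>::'a. l = 0 \<or> 2 ^ l / 2 <= norm \<xi>}"
    by (auto intro!: closed_Collect_le closed_Collect_disj continuous_intros)
  then show ?thesis unfolding shell_def by (rule closed_Collect_conj)
qed

lemma shell_subset: "shell l \<subseteq> cball 0 (2 * 2 ^ l)" by (auto simp: shell_def)

lemma bounded_shell: "bounded (shell l)"
  by (rule bounded_subset[OF bounded_cball shell_subset])

text \<open>Here \<rho> >= 1/2 enters: 1 - \<rho> <= \<rho>, so the frequency dual to the window
  width is an admissible step, also for the wider windows of a lower frequency k.\<close>

lemma hs_freq: assumes "1 / 2 <= \<rho>" "k <= l" shows "1 / hs \<rho> k <= 2 powr (\<rho> * real l)"
proof -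
  have "(1 - \<rho>) * real k <= \<rho> * real k" using assms by (intro mult_right_mono) auto
  also have "\<dots> <= \<rho> * real l" using assms by (intro mult_left_mono) auto
  finally have "2 powr ((1 - \<rho>) * real k) <= 2 powr (\<rho> * real l)" by simp
  moreover have "hs \<rho> k = 2 powr (- ((1 - \<rho>) * real k))" by (simp add: hs_def algebra_simps)
  ultimately show ?thesis by (simp only: powr_minus_divide) simp
qed

definition sep_gain :: "nat => nat => nat => real" where
  "sep_gain P l k = 16 ^ P * (1 / 2) ^ (P * (l - k))"

text \<open>For l >= k + 3 the shells are at least 2^l/4 apart, and \<open>hs \<rho> l\<close> times
  2^l is 2^(\<rho> l) >= 2^(l/2); one power of the weight thus gains 16/2^l. For l <= k + 2 the
  factor 16^P makes the right side at least 1.\<close>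

lemma shell_separation:
  fixes \<xi> \<xi>' :: "'a::euclidean_space"
  assumes \<rho>: "1 / 2 <= \<rho>" "\<rho> <= 1" and kl: "k <= l" and \<xi>: "\<xi> \<in> shell l" "\<xi>' \<in> shell k"
  shows "jw P (hs \<rho> l *\<^sub>R (\<xi> - \<xi>')) <= sep_gain P l k"
proof (cases "k + 3 <= l")
  case False
  then have "(4::real) ^ P * (1 / 4) ^ P <= 16 ^ P * (1 / 2) ^ (P * (l - k))"
  proof -
    have "(1 / 4 :: real) ^ P = (1 / 2) ^ (P * 2)" by (simp add: power_mult power2_eq_square mult.commute[of P])
    also have "\<dots> <= (1 / 2) ^ (P * (l - k))" using False by (intro power_decreasing mult_le_mono2) auto
    finally show ?thesis by (intro mult_mono power_mono) auto
  qed
  moreover have "(4::real) ^ P * (1 / 4) ^ P = 1" by (simp add: power_mult_distrib[symmetric])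
  ultimately show ?thesis using jw_le_1[of P "hs \<rho> l *\<^sub>R (\<xi> - \<xi>')"] by (simp add: sep_gain_def)
next
  case True
  have "2 * 2 ^ k <= (2::real) ^ l / 4"
  proof -
    have "(2::real) ^ (k + 3) <= 2 ^ l" using True by (intro power_increasing) auto
    then show ?thesis by (simp add: power_add)
  qed
  then have d: "2 ^ l / 4 <= norm (\<xi> - \<xi>')"
    using \<xi> True norm_triangle_ineq2[of \<xi> \<xi>'] by (simp add: shell_def)
  have "2 powr (real l / 2) <= hs \<rho> l * 2 ^ l"
  proof -
    have "real l / 2 <= \<rho> * real l" using \<rho> mult_right_mono[of "1/2" \<rho> "real l"] by simp
    then have "2 powr (real l / 2) <= 2 powr (\<rho> * real l)" by simp
    also have "\<dots> = hs \<rho> l * 2 powr (real l)" by (simp add: hs_def powr_add[symmetric] algebra_simps)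
    finally show ?thesis by (simp add: powr_realpow)
  qed
  then have "2 powr (real l / 2) / 4 <= hs \<rho> l * (2 ^ l / 4)" by simp
  also have "\<dots> <= norm (hs \<rho> l *\<^sub>R (\<xi> - \<xi>'))"
    using d by (simp add: less_imp_le mult_left_mono del: times_divide_eq_right)
  finally have "(2 powr (real l / 2) / 4)\<^sup>2 <= (norm (hs \<rho> l *\<^sub>R (\<xi> - \<xi>')))\<^sup>2"
    by (intro power_mono) auto
  moreover have "(2 powr (real l / 2) / 4)\<^sup>2 = 2 ^ l / 16"
    by (simp add: power_divide powr_power powr_realpow)
  ultimately have "2 ^ l / 16 <= 1 + (norm (hs \<rho> l *\<^sub>R (\<xi> - \<xi>')))\<^sup>2" by simp
  then have "jw P (hs \<rho> l *\<^sub>R (\<xi> - \<xi>')) <= 1 / (2 ^ l / 16) ^ P"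
    unfolding jw_def by (intro divide_left_mono power_mono) (auto intro!: mult_pos_pos zero_less_power add_pos_nonneg)
  also have "\<dots> = 16 ^ P * (1 / 2) ^ (P * l)"
    by (simp add: power_divide power_mult[symmetric] mult.commute)
  also have "\<dots> <= sep_gain P l k"
    unfolding sep_gain_def by (intro mult_left_mono power_decreasing mult_le_mono2) auto
  finally show ?thesis .
qed

lemma Vl_properties:
  assumes "1 / 2 <= \<rho>" "\<rho> <= 1" "k <= l"
  shows "v \<in> Vl \<rho> l ==> norm (fst v) <= hs \<rho> k" "c \<in> Basis ==> (0, c /\<^sub>R hs \<rho> k) \<in> Vl \<rho> l"
    "norm t <= hs \<rho> l ==> (t, 0) \<in> Vl \<rho> k"
  using hs_antimono[OF assms(2,3)] hs_freq[OF assms(1,3)]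
  by (auto simp: Vl_def divide_inverse abs_of_pos less_imp_le intro: order_trans)

lemma ennreal_mult_assoc3:
  "0 <= x ==> 0 <= y ==> 0 <= z ==> ennreal x * (ennreal y * (ennreal z * e)) = ennreal (x * (y * z)) * e"
  by (simp add: ennreal_mult mult.assoc)

text \<open>With hA = hB = h the factor h^(-n) of the Schur test cancels the h^n from averaging the
  damped input, so the window width disappears from the bound.\<close>

lemma amp_diagonal:
  fixes a :: "'i => 'a::euclidean_space \<times> 'a => complex"
  assumes a: "amp \<rho> \<mu> I lv a" and \<rho>: "1 / 2 <= \<rho>" "\<rho> <= 1"
  shows "\<exists>C\<ge>0. \<forall>i\<in>I. \<forall>(M::'m measure) (Y::'m => 'a) u. datum M Y u -->
    (\<integral>\<^sup>+x. ennreal ((norm (opT (a i) (ft M Y u) x))\<^sup>2) \<partial>lborel) <= ennreal (C * 2 powr (- 2 * \<mu> * lv i)) * EE K M Y u (2 * 2 ^ lv i)"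
proof -
  have ua: "unif I (%i. Vl \<rho> (lv i)) (%_. UNIV) (%i. 2 powr (- \<mu> * real (lv i))) a"
    and sa: "\<And>i. i \<in> I ==> xsupp (shell (lv i)) (a i)" using a by (auto simp: amp_def)
  interpret symbol_pair I "%i. hs \<rho> (lv i)" "%i. hs \<rho> (lv i)" "%i. 2 powr (- \<mu> * real (lv i))" "%i. 2 powr (- \<mu> * real (lv i))"
     a a "%i. Vl \<rho> (lv i)" "%i. Vl \<rho> (lv i)" "DIM('a)" 0 "%i. shell (lv i)" "%i. shell (lv i)" "%_. 1"
    by unfold_locales (use ua sa Vl_properties[OF \<rho> order_refl] in \<open>auto simp: closed_shell bounded_shell jw_def\<close>)
  obtain C where C: "0 <= C" "\<And>i (M::'m measure) (Y::'m => 'a) u. i \<in> I ==> datum M Y u ==>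
    (\<integral>\<^sup>+x. ennreal ((norm (opT (a i) (ft M Y u) x))\<^sup>2) \<partial>lborel) <=
    ennreal (C * 1 / hs \<rho> (lv i) ^ DIM('a)) * (ennreal ((2 powr (- \<mu> * real (lv i)))\<^sup>2) * NN DIM('a) M Y u (hs \<rho> (lv i)) (shell (lv i)))"
    using diagonal_bound[where 'm='m] by blast
  obtain D where D: "0 <= D" "\<And>(M::'m measure) (Y::'m => 'a) u h R. datum M Y u ==> 0 < h ==> 0 < R ==>
    NN DIM('a) M Y u h (cball 0 R) <= ennreal (D * h ^ DIM('a)) * EE K M Y u R"
    using NN_le_EE[where 'a='a and 'm='m and L="DIM('a)" and K=K] by blast
  show ?thesis
  proof (intro exI[of _ "C * D"] conjI ballI allI impI)
    show "0 <= C * D" using C D by simp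
    fix i and M :: "'m measure" and Y :: "'m => 'a" and u assume i: "i \<in> I" and d: "datum M Y u"
    define h where "h = hs \<rho> (lv i)"
    have h: "0 < h" by (simp add: h_def)
    define E where "E = EE K M Y u (2 * 2 ^ lv i)"
    have "NN DIM('a) M Y u h (shell (lv i)) <= NN DIM('a) M Y u h (cball 0 (2 * 2 ^ lv i))"
      unfolding NN_def using shell_subset[of "lv i"]
      by (intro nn_integral_mono mult_right_mono) (auto simp: indicator_def split: if_splits)
    also have "\<dots> <= ennreal (D * h ^ DIM('a)) * E" unfolding E_def by (rule D(2)[OF d]) (simp_all add: h)
    finally have "ennreal (C / h ^ DIM('a)) * (ennreal ((2 powr (- \<mu> * real (lv i)))\<^sup>2) * NN DIM('a) M Y u h (shell (lv i))) <=
      ennreal (C / h ^ DIM('a)) * (ennreal ((2 powr (- \<mu> * real (lv i)))\<^sup>2) * (ennreal (D * h ^ DIM('a)) * E))"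
      by (intro mult_left_mono) auto
    also have "\<dots> = ennreal (C / h ^ DIM('a) * ((2 powr (- \<mu> * real (lv i)))\<^sup>2 * (D * h ^ DIM('a)))) * E"
      using C(1) D(1) h by (intro ennreal_mult_assoc3) auto
    also have "C / h ^ DIM('a) * ((2 powr (- \<mu> * real (lv i)))\<^sup>2 * (D * h ^ DIM('a))) = C * D * 2 powr (- 2 * \<mu> * lv i)"
    proof -
      have "(2 powr (- \<mu> * real (lv i)))\<^sup>2 = 2 powr (- 2 * \<mu> * lv i)"
        by (simp add: power2_eq_square powr_add[symmetric] mult.assoc)
      then show ?thesis using h by simp
    qed
    finally show "(\<integral>\<^sup>+x. ennreal ((norm (opT (a i) (ft M Y u) x))\<^sup>2) \<partial>lborel) <= ennreal (C * D * 2 powr (- 2 * \<mu> * lv i)) * EE K M Y u (2 * 2 ^ lv i)"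
      using C(2)[OF i d] by (simp add: h_def[symmetric] E_def[symmetric])
  qed
qed

lemma hs_ratio:
  assumes "1 / 2 <= \<rho>" "\<rho> <= 1" "k <= l"
  shows "1 / hs \<rho> l ^ n <= 2 ^ ((l - k) * n) / hs \<rho> k ^ n"
proof -
  have "hs \<rho> k = hs \<rho> l * 2 powr ((1 - \<rho>) * real (l - k))"
    using assms(3) by (simp add: hs_def powr_add[symmetric] of_nat_diff algebra_simps)
  also have "\<dots> <= hs \<rho> l * 2 powr (1 * real (l - k))"
    using assms by (intro mult_left_mono powr_mono mult_right_mono) (auto simp: less_imp_le)
  finally have "hs \<rho> k <= hs \<rho> l * 2 ^ (l - k)" by (simp add: powr_realpow)
  then have "hs \<rho> k ^ n <= (hs \<rho> l * 2 ^ (l - k)) ^ n" by (intro power_mono) (auto simp: less_imp_le)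
  then have "hs \<rho> k ^ n <= hs \<rho> l ^ n * 2 ^ ((l - k) * n)" by (simp only: power_mult_distrib power_mult)
  then show ?thesis by (simp add: field_simps)
qed

text \<open>Windows have the width belonging to the lower frequency k, steps in x the one belonging
  to the higher frequency l. Replacing hs l by hs k in the Schur factor costs at most 2^((l - k)n).
  The separation is used with n + 1 powers: n pay for this and one leaves (1/2)^(l - k).\<close>

lemma amp_cross_NN:
  fixes a :: "'i => 'a::euclidean_space \<times> 'a => complex"
  assumes a: "amp \<rho> \<mu> I lv a" and \<rho>: "1 / 2 <= \<rho>" "\<rho> <= 1"
  shows "\<exists>C\<ge>0. \<forall>i\<in>I. \<forall>k\<in>I. lv k <= lv i --> (\<forall>(M::'m measure) (Y::'m => 'a) u (M'::'n measure) (Y'::'n => 'a) v.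
    datum M Y u --> datum M' Y' v --> integrable lborel (%x. opT (a i) (ft M Y u) x * cnj (opT (a k) (ft M' Y' v) x)) -->
    ennreal (norm (LINT x|lborel. opT (a i) (ft M Y u) x * cnj (opT (a k) (ft M' Y' v) x))) <=
    ennreal (C * (1 / 2) ^ (lv i - lv k) / hs \<rho> (lv k) ^ DIM('a)) *
      (ennreal (2 powr (- 2 * \<mu> * lv i)) * NN DIM('a) M Y u (hs \<rho> (lv k)) (shell (lv i)) +
       ennreal (2 powr (- 2 * \<mu> * lv k)) * NN DIM('a) M' Y' v (hs \<rho> (lv k)) (shell (lv k))))"
proof -
  have ua: "unif I (%i. Vl \<rho> (lv i)) (%_. UNIV) (%i. 2 powr (- \<mu> * real (lv i))) a"
    and sa: "\<And>i. i \<in> I ==> xsupp (shell (lv i)) (a i)" using a by (auto simp: amp_def)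
  define J where "J = {z \<in> I \<times> I. lv (snd z) <= lv (fst z)}"
  define n where "n = DIM('a)"
  have u1: "unif J (%z. Vl \<rho> (lv (fst z))) (%_. UNIV) (%z. 2 powr (- \<mu> * real (lv (fst z)))) (%z. a (fst z))"
    and u2: "unif J (%z. Vl \<rho> (lv (snd z))) (%_. UNIV) (%z. 2 powr (- \<mu> * real (lv (snd z)))) (%z. a (snd z))"
    by (rule unif_reindex[OF ua, where K=1]; auto simp: J_def)+
  interpret symbol_pair J "%z. hs \<rho> (lv (fst z))" "%z. hs \<rho> (lv (snd z))" "%z. 2 powr (- \<mu> * real (lv (fst z)))" "%z. 2 powr (- \<mu> * real (lv (snd z)))"
     "%z. a (fst z)" "%z. a (snd z)" "%z. Vl \<rho> (lv (fst z))" "%z. Vl \<rho> (lv (snd z))" "DIM('a)" "Suc n" "%z. shell (lv (fst z))" "%z. shell (lv (snd z))"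
     "%z. sep_gain (Suc n) (lv (fst z)) (lv (snd z))"
  proof unfold_locales
    fix z and \<xi> \<xi>' :: 'a assume "z \<in> J" "\<xi> \<in> shell (lv (fst z))" "\<xi>' \<in> shell (lv (snd z))"
    then show "jw (Suc n) (hs \<rho> (lv (fst z)) *\<^sub>R (\<xi> - \<xi>')) <= sep_gain (Suc n) (lv (fst z)) (lv (snd z))"
      by (intro shell_separation[OF \<rho>]) (auto simp: J_def)
  next
    fix z v assume "z \<in> J" "v \<in> Vl \<rho> (lv (fst z))"
    then show "norm (fst v) <= hs \<rho> (lv (snd z))" by (intro Vl_properties(1)[OF \<rho>]) (auto simp: J_def)
  next
    fix z and c :: 'a assume "z \<in> J" "c \<in> Basis"
    then show "(0, c /\<^sub>R hs \<rho> (lv (snd z))) \<in> Vl \<rho> (lv (fst z))" using Vl_properties(2)[OF \<rho>] by (auto simp: J_def)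
  next
    fix z and t :: 'a assume "z \<in> J" "norm t <= hs \<rho> (lv (fst z))"
    then show "(t, 0) \<in> Vl \<rho> (lv (fst z))" "(t, 0) \<in> Vl \<rho> (lv (snd z))" using Vl_properties(3)[OF \<rho>] by (auto simp: J_def)
  qed (use u1 u2 sa hs_antimono[OF \<rho>(2)] Vl_properties[OF \<rho> order_refl] in \<open>auto simp: J_def closed_shell bounded_shell sep_gain_def\<close>)
  obtain C where C: "0 <= C" "\<And>z (M::'m measure) (Y::'m => 'a) u (M'::'n measure) (Y'::'n => 'a) v. z \<in> J ==> datum M Y u ==> datum M' Y' v ==>
    integrable lborel (%x. opT (a (fst z)) (ft M Y u) x * cnj (opT (a (snd z)) (ft M' Y' v) x)) ==>
    ennreal (norm (LINT x|lborel. opT (a (fst z)) (ft M Y u) x * cnj (opT (a (snd z)) (ft M' Y' v) x))) <=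
    ennreal (C * sep_gain (Suc n) (lv (fst z)) (lv (snd z)) / hs \<rho> (lv (fst z)) ^ DIM('a)) *
     (ennreal ((2 powr (- \<mu> * real (lv (fst z))))\<^sup>2) * NN DIM('a) M Y u (hs \<rho> (lv (snd z))) (shell (lv (fst z))) +
      ennreal ((2 powr (- \<mu> * real (lv (snd z))))\<^sup>2) * NN DIM('a) M' Y' v (hs \<rho> (lv (snd z))) (shell (lv (snd z))))"
    using cross_bound[where 'm='m and 'n='n] by blast
  have p2: "(2 powr (- \<mu> * real l))\<^sup>2 = 2 powr (- 2 * \<mu> * l)" for l
    by (simp add: power2_eq_square powr_add[symmetric] mult.assoc)
  have g: "C * sep_gain (Suc n) l k / hs \<rho> l ^ n <= C * 16 ^ Suc n * (1 / 2) ^ (l - k) / hs \<rho> k ^ n" if "k <= l" for l k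
  proof -
    have "C * sep_gain (Suc n) l k / hs \<rho> l ^ n = C * sep_gain (Suc n) l k * (1 / hs \<rho> l ^ n)" by simp
    also have "\<dots> <= C * sep_gain (Suc n) l k * (2 ^ ((l - k) * n) / hs \<rho> k ^ n)"
      using C(1) by (intro mult_left_mono hs_ratio[OF \<rho> that]) (simp add: sep_gain_def)
    also have "\<dots> = C * 16 ^ Suc n * (1 / 2) ^ (l - k) / hs \<rho> k ^ n"
    proof -
      have "Suc n * (l - k) = (l - k) + (l - k) * n" by (simp add: mult.commute)
      then have "(1 / 2 :: real) ^ (Suc n * (l - k)) = (1 / 2) ^ (l - k) * (1 / 2) ^ ((l - k) * n)"
        by (simp only: power_add)
      then have "sep_gain (Suc n) l k = 16 ^ Suc n * (1 / 2) ^ (l - k) / 2 ^ ((l - k) * n)"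
        by (simp only: sep_gain_def) (simp add: power_one_over)
      then show ?thesis by (simp add: mult_ac)
    qed
    finally show ?thesis .
  qed
  show ?thesis
  proof (intro exI[of _ "C * 16 ^ Suc n"] conjI ballI allI impI)
    fix i k and M :: "'m measure" and Y :: "'m => 'a" and u and M' :: "'n measure" and Y' :: "'n => 'a" and v
    assume *: "i \<in> I" "k \<in> I" "lv k <= lv i" "datum M Y u" "datum M' Y' v"
      "integrable lborel (%x. opT (a i) (ft M Y u) x * cnj (opT (a k) (ft M' Y' v) x))"
    then have "(i, k) \<in> J" by (simp add: J_def)
    note c = C(2)[OF this, unfolded fst_conv snd_conv p2, OF *(4-6)]
    show "ennreal (norm (LINT x|lborel. opT (a i) (ft M Y u) x * cnj (opT (a k) (ft M' Y' v) x))) <=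
    ennreal (C * 16 ^ Suc n * (1 / 2) ^ (lv i - lv k) / hs \<rho> (lv k) ^ DIM('a)) *
      (ennreal (2 powr (- 2 * \<mu> * lv i)) * NN DIM('a) M Y u (hs \<rho> (lv k)) (shell (lv i)) +
       ennreal (2 powr (- 2 * \<mu> * lv k)) * NN DIM('a) M' Y' v (hs \<rho> (lv k)) (shell (lv k)))"
      unfolding n_def
      by (rule order_trans[OF c[unfolded n_def] mult_right_mono[OF ennreal_leI[OF g[OF *(3), unfolded n_def]]]])
        simp
  qed (use C(1) in simp)
qed

text \<open>Shells are enlarged to balls and the h^n of \<open>NN_le_EE\<close> cancels the
  remaining window factor. The bound is a sum of two energies, each belonging to one of the
  operators, so it can be summed over all pairs directly.\<close>

lemma amp_cross_EE:
  fixes a :: "'i => 'a::euclidean_space \<times> 'a => complex"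
  assumes a: "amp \<rho> \<mu> I lv a" and \<rho>: "1 / 2 <= \<rho>" "\<rho> <= 1"
  shows "\<exists>C\<ge>0. \<forall>i\<in>I. \<forall>k\<in>I. lv k <= lv i --> (\<forall>(M::'m measure) (Y::'m => 'a) u (M'::'n measure) (Y'::'n => 'a) v.
    datum M Y u --> datum M' Y' v --> integrable lborel (%x. opT (a i) (ft M Y u) x * cnj (opT (a k) (ft M' Y' v) x)) -->
    ennreal (norm (LINT x|lborel. opT (a i) (ft M Y u) x * cnj (opT (a k) (ft M' Y' v) x))) <=
    ennreal (C * (1 / 2) ^ (lv i - lv k)) *
      (ennreal (2 powr (- 2 * \<mu> * lv i)) * EE K M Y u (2 * 2 ^ lv i) +
       ennreal (2 powr (- 2 * \<mu> * lv k)) * EE K M' Y' v (2 * 2 ^ lv k)))"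
proof -
  obtain C where C: "0 <= C" "\<And>i k (M::'m measure) (Y::'m => 'a) u (M'::'n measure) (Y'::'n => 'a) v. i \<in> I ==> k \<in> I ==> lv k <= lv i ==>
    datum M Y u ==> datum M' Y' v ==> integrable lborel (%x. opT (a i) (ft M Y u) x * cnj (opT (a k) (ft M' Y' v) x)) ==>
    ennreal (norm (LINT x|lborel. opT (a i) (ft M Y u) x * cnj (opT (a k) (ft M' Y' v) x))) <=
    ennreal (C * (1 / 2) ^ (lv i - lv k) / hs \<rho> (lv k) ^ DIM('a)) *
      (ennreal (2 powr (- 2 * \<mu> * lv i)) * NN DIM('a) M Y u (hs \<rho> (lv k)) (shell (lv i)) +
       ennreal (2 powr (- 2 * \<mu> * lv k)) * NN DIM('a) M' Y' v (hs \<rho> (lv k)) (shell (lv k)))"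
    using amp_cross_NN[OF a \<rho>, where 'm='m and 'n='n] by blast
  obtain D where D: "0 <= D" "\<And>(M::'m measure) (Y::'m => 'a) u h R. datum M Y u ==> 0 < h ==> 0 < R ==>
    NN DIM('a) M Y u h (cball 0 R) <= ennreal (D * h ^ DIM('a)) * EE K M Y u R"
    using NN_le_EE[where 'a='a and 'm='m and L="DIM('a)" and K=K] by blast
  obtain D' where D': "0 <= D'" "\<And>(M::'n measure) (Y::'n => 'a) u h R. datum M Y u ==> 0 < h ==> 0 < R ==>
    NN DIM('a) M Y u h (cball 0 R) <= ennreal (D' * h ^ DIM('a)) * EE K M Y u R"
    using NN_le_EE[where 'a='a and 'm='n and L="DIM('a)" and K=K] by blast
  define D0 where "D0 = max D D'"
  have D0: "0 <= D0" using D by (simp add: D0_def)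
  have mono: "NN DIM('a) M Y u h (shell l) <= NN DIM('a) M Y u h (cball 0 (2 * 2 ^ l))" for M :: "'p measure" and Y :: "'p => 'a" and u h l
    unfolding NN_def using shell_subset[of l]
    by (intro nn_integral_mono mult_right_mono) (auto simp: indicator_def split: if_splits)
  show ?thesis
  proof (intro exI[of _ "C * D0"] conjI ballI allI impI)
    fix i k and M :: "'m measure" and Y :: "'m => 'a" and u and M' :: "'n measure" and Y' :: "'n => 'a" and v
    assume *: "i \<in> I" "k \<in> I" "lv k <= lv i" "datum M Y u" "datum M' Y' v"
      "integrable lborel (%x. opT (a i) (ft M Y u) x * cnj (opT (a k) (ft M' Y' v) x))"
    define h where "h = hs \<rho> (lv k)"
    have h: "0 < h" by (simp add: h_def)
    have 1: "NN DIM('a) M Y u h (shell (lv i)) <= ennreal (D0 * h ^ DIM('a)) * EE K M Y u (2 * 2 ^ lv i)"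
      by (rule order_trans[OF mono order_trans[OF D(2)[OF *(4) h]]])
        (use h in \<open>auto intro!: mult_right_mono ennreal_leI simp: D0_def\<close>)
    have 2: "NN DIM('a) M' Y' v h (shell (lv k)) <= ennreal (D0 * h ^ DIM('a)) * EE K M' Y' v (2 * 2 ^ lv k)"
      by (rule order_trans[OF mono order_trans[OF D'(2)[OF *(5) h]]])
        (use h in \<open>auto intro!: mult_right_mono ennreal_leI simp: D0_def\<close>)
    define e1 e2 where "e1 = EE K M Y u (2 * 2 ^ lv i)" and "e2 = EE K M' Y' v (2 * 2 ^ lv k)"
    have "ennreal (norm (LINT x|lborel. opT (a i) (ft M Y u) x * cnj (opT (a k) (ft M' Y' v) x))) <=
      ennreal (C * (1 / 2) ^ (lv i - lv k) / h ^ DIM('a)) *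
      (ennreal (2 powr (- 2 * \<mu> * lv i)) * (ennreal (D0 * h ^ DIM('a)) * e1) +
       ennreal (2 powr (- 2 * \<mu> * lv k)) * (ennreal (D0 * h ^ DIM('a)) * e2))"
      unfolding e1_def e2_def
      by (rule order_trans[OF C(2)[OF *]]) (use 1 2 in \<open>auto simp: h_def[symmetric] intro!: mult_left_mono add_mono\<close>)
    also have "\<dots> = (ennreal (C * (1 / 2) ^ (lv i - lv k) / h ^ DIM('a)) * ennreal (D0 * h ^ DIM('a))) *
      (ennreal (2 powr (- 2 * \<mu> * lv i)) * e1 + ennreal (2 powr (- 2 * \<mu> * lv k)) * e2)"
      by (simp only: distrib_left mult_ac)
    also have "ennreal (C * (1 / 2) ^ (lv i - lv k) / h ^ DIM('a)) * ennreal (D0 * h ^ DIM('a)) = ennreal (C * D0 * (1 / 2) ^ (lv i - lv k))"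
      using C(1) D0 h by (simp add: ennreal_mult[symmetric] mult_ac)
    finally show "ennreal (norm (LINT x|lborel. opT (a i) (ft M Y u) x * cnj (opT (a k) (ft M' Y' v) x))) <=
      ennreal (C * D0 * (1 / 2) ^ (lv i - lv k)) *
      (ennreal (2 powr (- 2 * \<mu> * lv i)) * EE K M Y u (2 * 2 ^ lv i) +
       ennreal (2 powr (- 2 * \<mu> * lv k)) * EE K M' Y' v (2 * 2 ^ lv k))"
      unfolding e1_def e2_def .
  qed (use C(1) D0 in simp)
qed

section \<open>Kernel estimates and dyadic pieces of a symbol\<close>

lemma sum_half_inj:
  assumes "finite A" "inj_on g A" shows "(\<Sum>k\<in>A. (1 / 2 :: real) ^ g k) <= 2"
proof -
  have "(\<Sum>k\<in>A. (1 / 2 :: real) ^ g k) = (\<Sum>i\<in>g ` A. (1 / 2) ^ i)"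
    by (simp add: sum.reindex[OF assms(2)])
  also have "\<dots> <= (\<Sum>i. (1 / 2) ^ i)" using assms by (intro sum_le_suminf) (auto intro: summable_geometric)
  also have "\<dots> = 2" by (subst suminf_geometric) auto
  finally show ?thesis .
qed

lemma sum_half_dist:
  assumes "finite A" shows "(\<Sum>k\<in>A. (1 / 2 :: real) ^ ((j - k) + (k - j))) <= 4"
proof -
  have "(\<Sum>k\<in>A. (1 / 2 :: real) ^ ((j - k) + (k - j))) <=
     (\<Sum>k\<in>{k\<in>A. k <= j} \<union> {k\<in>A. j <= k}. (1 / 2) ^ ((j - k) + (k - j)))"
    by (rule eq_refl) (intro sum.cong, auto)
  also have "\<dots> <= (\<Sum>k\<in>{k\<in>A. k <= j}. (1 / 2) ^ ((j - k) + (k - j))) + (\<Sum>k\<in>{k\<in>A. j <= k}. (1 / 2) ^ ((j - k) + (k - j)))"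
  proof -
    have "0 <= (\<Sum>k\<in>{k\<in>A. k <= j} \<inter> {k\<in>A. j <= k}. (1 / 2 :: real) ^ ((j - k) + (k - j)))"
      by (rule sum_nonneg) simp
    then show ?thesis
      using sum.union_inter[of "{k\<in>A. k <= j}" "{k\<in>A. j <= k}" "%k. (1 / 2 :: real) ^ ((j - k) + (k - j))"] assms by simp
  qed
  also have "(\<Sum>k\<in>{k\<in>A. k <= j}. (1 / 2 :: real) ^ ((j - k) + (k - j))) <= 2"
    using assms by (intro sum_half_inj) (auto simp: inj_on_def)
  also have "(\<Sum>k\<in>{k\<in>A. j <= k}. (1 / 2 :: real) ^ ((j - k) + (k - j))) <= 2"
    using assms by (intro sum_half_inj) (auto simp: inj_on_def)
  finally show ?thesis by simp
qed

lemma integrable_product_L2: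
  fixes f g :: "'a::euclidean_space => complex"
  assumes [measurable]: "f \<in> borel_measurable borel" "g \<in> borel_measurable borel"
    and f: "(\<integral>\<^sup>+x. ennreal ((norm (f x))\<^sup>2) \<partial>lborel) < \<infinity>" and g: "(\<integral>\<^sup>+x. ennreal ((norm (g x))\<^sup>2) \<partial>lborel) < \<infinity>"
  shows "integrable lborel (%x. f x * cnj (g x))"
proof -
  have "integrable lborel (%x. (norm (f x))\<^sup>2 + (norm (g x))\<^sup>2)"
    using f g by (intro Bochner_Integration.integrable_add integrableI_nonneg) auto
  then show ?thesis
  proof (rule Bochner_Integration.integrable_bound)
    have "norm (f x) * norm (g x) <= (norm (f x))\<^sup>2 + (norm (g x))\<^sup>2" for x
      using sum_squares_bound[of "norm (f x)" "norm (g x)"] zero_le_power2[of "norm (f x)"] zero_le_power2[of "norm (g x)"]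
        mult_nonneg_nonneg[OF norm_ge_zero[of "f x"] norm_ge_zero[of "g x"]] by linarith
    then show "AE x in lborel. norm (f x * cnj (g x)) <= norm ((norm (f x))\<^sup>2 + (norm (g x))\<^sup>2)"
      by (simp add: norm_mult)
  qed simp
qed

text \<open>The square is expanded and the pairs are summed by the geometric decay in |j - k|: each
  e j occurs with total weight at most 4 in either position, which gives 8. Nothing links the
  functions \<open>F j\<close> to a common input.\<close>

lemma almost_orthogonal_sum:
  fixes F :: "nat => 'a::euclidean_space => complex" and e :: "nat => real"
  assumes A: "finite A" and m[measurable]: "\<And>j. j \<in> A ==> F j \<in> borel_measurable borel"
    and fin: "\<And>j. j \<in> A ==> (\<integral>\<^sup>+x. ennreal ((norm (F j x))\<^sup>2) \<partial>lborel) < \<infinity>"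
    and b: "\<And>j k. j \<in> A ==> k \<in> A ==> k <= j ==> norm (LINT x|lborel. F j x * cnj (F k x)) <= c * (1 / 2) ^ (j - k) * (e j + e k)"
    and e: "\<And>j. j \<in> A ==> 0 <= e j" and c: "0 <= c"
  shows "(\<integral>\<^sup>+x. ennreal ((norm (\<Sum>j\<in>A. F j x))\<^sup>2) \<partial>lborel) <= ennreal (8 * c * (\<Sum>j\<in>A. e j))"
proof -
  have i: "integrable lborel (%x. F j x * cnj (F k x))" if "j \<in> A" "k \<in> A" for j k
    by (rule integrable_product_L2) (use m fin that in auto)
  have b': "norm (LINT x|lborel. F j x * cnj (F k x)) <= c * (1 / 2) ^ ((j - k) + (k - j)) * (e j + e k)"
    if "j \<in> A" "k \<in> A" for j k
  proof (cases "k <= j")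
    case True then show ?thesis using b[OF that] by simp
  next
    case False
    have "(LINT x|lborel. F j x * cnj (F k x)) = cnj (LINT x|lborel. F k x * cnj (F j x))"
      by (simp only: Bochner_Integration.integral_cnj[symmetric]) (simp add: mult.commute)
    then show ?thesis using b[OF that(2,1)] False by (simp add: add.commute)
  qed
  have sq: "complex_of_real ((norm (\<Sum>j\<in>A. F j x))\<^sup>2) = (\<Sum>j\<in>A. \<Sum>k\<in>A. F j x * cnj (F k x))" for x
    by (simp only: complex_norm_square cnj_sum sum_product)
  have ic: "integrable lborel (%x. complex_of_real ((norm (\<Sum>j\<in>A. F j x))\<^sup>2))"
    unfolding sq by (intro Bochner_Integration.integrable_sum i)
  then have ir: "integrable lborel (%x. (norm (\<Sum>j\<in>A. F j x))\<^sup>2)"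
    by (simp only: complex_of_real_integrable_eq)
  have "(LINT x|lborel. (norm (\<Sum>j\<in>A. F j x))\<^sup>2) = Re (LINT x|lborel. complex_of_real ((norm (\<Sum>j\<in>A. F j x))\<^sup>2))"
    by (simp only: integral_complex_of_real Re_complex_of_real)
  also have "\<dots> <= norm (LINT x|lborel. complex_of_real ((norm (\<Sum>j\<in>A. F j x))\<^sup>2))" by (rule complex_Re_le_cmod)
  also have "(LINT x|lborel. complex_of_real ((norm (\<Sum>j\<in>A. F j x))\<^sup>2)) = (\<Sum>j\<in>A. \<Sum>k\<in>A. LINT x|lborel. F j x * cnj (F k x))"
    unfolding sq by (simp add: Bochner_Integration.integral_sum i Bochner_Integration.integrable_sum)
  also have "norm \<dots> <= (\<Sum>j\<in>A. \<Sum>k\<in>A. c * (1 / 2) ^ ((j - k) + (k - j)) * (e j + e k))"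
    by (intro sum_norm_le b')
  also have "\<dots> = c * ((\<Sum>j\<in>A. \<Sum>k\<in>A. (1 / 2) ^ ((j - k) + (k - j)) * e j) + (\<Sum>j\<in>A. \<Sum>k\<in>A. (1 / 2) ^ ((j - k) + (k - j)) * e k))"
    by (simp add: sum.distrib sum_distrib_left distrib_left mult.assoc)
  also have "(\<Sum>j\<in>A. \<Sum>k\<in>A. (1 / 2) ^ ((j - k) + (k - j)) * e k) = (\<Sum>j\<in>A. \<Sum>k\<in>A. (1 / 2) ^ ((j - k) + (k - j)) * e j)"
    by (subst sum.swap) (simp add: add.commute)
  also have "(\<Sum>j\<in>A. \<Sum>k\<in>A. (1 / 2) ^ ((j - k) + (k - j)) * e j) <= (\<Sum>j\<in>A. 4 * e j)"
    unfolding sum_distrib_right[symmetric] by (intro sum_mono mult_right_mono sum_half_dist A e)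
  finally have "(LINT x|lborel. (norm (\<Sum>j\<in>A. F j x))\<^sup>2) <= 8 * c * (\<Sum>j\<in>A. e j)"
    using c by (simp add: sum_distrib_left[symmetric] mult_left_mono)
  moreover have "(\<integral>\<^sup>+x. ennreal ((norm (\<Sum>j\<in>A. F j x))\<^sup>2) \<partial>lborel) = ennreal (LINT x|lborel. (norm (\<Sum>j\<in>A. F j x))\<^sup>2)"
    by (rule nn_integral_eq_integral[OF ir]) simp
  ultimately show ?thesis by (simp add: ennreal_leI)
qed

section \<open>Kernels and their L^1 bounds\<close>

definition ker :: "('a \<times> 'a => complex) => 'a::euclidean_space => 'a => complex" where
  "ker a x y = (LINT \<xi>|lborel. ee (x - y) \<xi> * a (x, \<xi>))"

text \<open>A column of the kernel is the operator applied to a unit mass at y, so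
  \<open>amp_diagonal\<close> bounds its L^2 norm; the energy of the unit mass is R^n by
  \<open>EE_point\<close>.\<close>

lemma ker_eq_opT:
  "ker a x y = opT a (ft (count_space (UNIV :: unit set)) (%_. y) (%_. 1)) x"
  by (simp add: ker_def opT_def ft_def lebesgue_integral_count_space_finite ee_diff mult_ac)

lemma datum_point: "datum (count_space (UNIV :: unit set)) (%_. y) (%_. 1)"
  unfolding datum_def by (auto intro!: sigma_finite_measure_count_space_finite integrable_count_space)

lemma EE_point: "EE K (count_space (UNIV :: unit set)) (%_. y::'a::euclidean_space) (%_. 1) R = ennreal (R ^ DIM('a))"
  by (simp add: EE_def nn_integral_count_space_finite jw_def)

lemma measurable_ker:
  fixes a :: "'a::euclidean_space \<times> 'a => complex"
  assumes "smooth a"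
  shows "(%(x, y). ker a x y) \<in> borel_measurable (lborel \<Otimes>\<^sub>M lborel)"
proof -
  have [measurable]: "a \<in> borel_measurable (borel \<Otimes>\<^sub>M borel)"
    using borel_measurable_smooth[OF assms] by (simp add: borel_prod)
  show ?thesis unfolding ker_def by measurable
qed

lemma measurable_ker_fst:
  assumes "smooth a" shows "(%x. ker a x y) \<in> borel_measurable borel"
  using measurable_Pair2'[of y lborel lborel, THEN measurable_compose, OF _ measurable_ker[OF assms]] by simp

lemma lap_snd_slice:
  assumes "smooth F"
  shows "(lap (%b. (0, h *\<^sub>R b)) ^^ K) F (x, \<xi>) = (lap (%b. h *\<^sub>R b) ^^ K) (%\<xi>. F (x, \<xi>)) \<xi>"
proof -
  have "(%\<xi>. (lap (%b. (0, h *\<^sub>R b)) ^^ K) F (x, \<xi>)) = (lap (%b. h *\<^sub>R b) ^^ K) (%\<xi>. F (x, \<xi>))"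
  proof (induction K)
    case (Suc K)
    define G where "G = (lap (%b. (0, h *\<^sub>R b)) ^^ K) F"
    have G: "smooth G" unfolding G_def by (rule smooth_lap_funpow[OF assms])
    have "lap (%b. (0, h *\<^sub>R b)) G (x, \<xi>) = lap (%b. h *\<^sub>R b) (%\<xi>. G (x, \<xi>)) \<xi>" for \<xi>
      unfolding lap_def dird_slice_snd[OF smooth_dird[OF G]] dird_slice_snd[OF G] by simp
    with Suc show ?case by (simp add: G_def)
  qed simp
  then show ?thesis by (rule fun_cong)
qed

lemma lap_support: "closed S ==> xsupp S F ==> xsupp S (lap e F)"
  using dird_support[OF _ dird_support, of S F] by (simp add: xsupp_def lap_def)

lemma lap_funpow_support: "closed S ==> xsupp S F ==> xsupp S ((lap e ^^ K) F)"
  by (induction K) (simp_all add: lap_support)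

text \<open>Steps 2^(\<rho> l) in \<xi> are admissible, so these powers stay in the class;
  \<open>ker_lap\<close> trades them for decay of the kernel beyond distance 2^(-\<rho> l).\<close>

lemma amp_lap:
  assumes "amp \<rho> \<mu> I lv a"
  shows "amp \<rho> \<mu> I lv (%i. (lap (%b. (0, (2 powr (\<rho> * lv i)) *\<^sub>R b)) ^^ K) (a i))"
  using assms unfolding amp_def
  by (auto intro!: unif_lap_funpow lap_funpow_support closed_shell simp: Vl_def less_imp_le)

lemma ker_lap:
  assumes "smooth a" "xsupp (shell l) a"
  shows "ker a x y = of_real (jw K (h *\<^sub>R (x - y))) * ker ((lap (%b. (0, h *\<^sub>R b)) ^^ K) a) x y"
proof -
  have "ker ((lap (%b. (0, h *\<^sub>R b)) ^^ K) a) x y = of_real ((1 + h\<^sup>2 * (norm (x - y))\<^sup>2) ^ K) * ker a x y"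
    unfolding ker_def lap_snd_slice[OF assms(1)]
    by (rule fourier_lap_funpow[OF smooth_slice_snd[OF assms(1)], of 0 "2 * 2 ^ l"])
      (use assms(2) shell_subset[of l] in \<open>unfold xsupp_def, blast\<close>)
  moreover have "0 < 1 + h\<^sup>2 * (norm (x - y))\<^sup>2" by (intro add_pos_nonneg) auto
  then have "jw K (h *\<^sub>R (x - y)) * (1 + h\<^sup>2 * (norm (x - y))\<^sup>2) ^ K = 1"
    by (simp add: jw_def power_mult_distrib)
  then have "complex_of_real (jw K (h *\<^sub>R (x - y))) * of_real ((1 + h\<^sup>2 * (norm (x - y))\<^sup>2) ^ K) = 1"
    by (metis of_real_1 of_real_mult)
  ultimately show ?thesis by (simp add: mult.assoc[symmetric])
qed

lemma amp_smooth: "amp \<rho> \<mu> I lv a ==> i \<in> I ==> smooth (a i)"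
  and amp_support: "amp \<rho> \<mu> I lv a ==> i \<in> I ==> xsupp (shell (lv i)) (a i)"
  by (auto simp: amp_def unif_smooth)

text \<open>For the critical order, 2^(-2\<mu>l) times the energy 2^(ln) of a point mass is h^n with
  h = 2^(\<rho> l). A column therefore has L^2 size h^(n/2) and is concentrated at distance 1/h, so
  its L^1 norm is bounded. Of the n + 1 powers of decay, n serve the L^1 norm and the last one gives
  the tail bound 1/(hr).\<close>

lemma kernel_L1:
  fixes a :: "'i => 'a::euclidean_space \<times> 'a => complex" and \<rho> \<mu> :: real
  assumes a: "amp \<rho> \<mu> I lv a" and \<rho>: "1 / 2 <= \<rho>" "\<rho> <= 1" and \<mu>: "\<mu> = DIM('a) * (1 - \<rho>) / 2"
  shows "\<exists>C\<ge>0. \<forall>i\<in>I. \<forall>y. (\<integral>\<^sup>+x. ennreal (norm (ker (a i) x y)) \<partial>lborel) <= ennreal C \<and>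
    (\<forall>r>0. (\<integral>\<^sup>+x. indicator {x. r <= norm (x - y)} x * ennreal (norm (ker (a i) x y)) \<partial>lborel) <= ennreal (C / (2 powr (\<rho> * lv i) * r)))"
proof -
  define n where "n = DIM('a)"
  define h where "h i = 2 powr (\<rho> * real (lv i))" for i
  have h: "0 < h i" for i by (simp add: h_def)
  define a' where "a' = (%i. (lap (%b. (0, h i *\<^sub>R b)) ^^ Suc n) (a i))"
  have a': "amp \<rho> \<mu> I lv a'" unfolding a'_def h_def by (rule amp_lap[OF a])
  obtain C where C: "0 <= C" "\<And>i (M::unit measure) (Y::unit => 'a) u. i \<in> I ==> datum M Y u ==>
    (\<integral>\<^sup>+x. ennreal ((norm (opT (a' i) (ft M Y u) x))\<^sup>2) \<partial>lborel) <= ennreal (C * 2 powr (- 2 * \<mu> * lv i)) * EE 0 M Y u (2 * 2 ^ lv i)"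
    using amp_diagonal[OF a' \<rho>, where 'm=unit and K=0] by blast
  have k2: "(\<integral>\<^sup>+x. ennreal ((norm (ker (a' i) x y))\<^sup>2) \<partial>lborel) <= ennreal (C * 2 ^ n * h i ^ n)" if "i \<in> I" for i y
  proof -
    have "(\<integral>\<^sup>+x. ennreal ((norm (ker (a' i) x y))\<^sup>2) \<partial>lborel) <= ennreal (C * 2 powr (- 2 * \<mu> * lv i)) * ennreal ((2 * 2 ^ lv i) ^ n)"
      using C(2)[OF that datum_point[of y]] by (simp only: ker_eq_opT[symmetric] EE_point n_def)
    also have "\<dots> = ennreal (C * 2 powr (- 2 * \<mu> * lv i) * (2 * 2 ^ lv i) ^ n)"
      using C(1) by (intro ennreal_mult[symmetric]) auto
    also have "2 powr (- 2 * \<mu> * lv i) * (2 ^ lv i) ^ n = h i ^ n"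
    proof -
      have "(2 ^ lv i :: real) ^ n = 2 powr (real n * real (lv i))"
      proof -
        have "(2 ^ lv i :: real) ^ n = 2 ^ (lv i * n)" by (simp only: power_mult)
        also have "\<dots> = 2 powr real (lv i * n)" by (rule powr_realpow[symmetric]) simp
        also have "real (lv i * n) = real n * real (lv i)" by simp
        finally show ?thesis .
      qed
      then have "2 powr (- 2 * \<mu> * lv i) * (2 ^ lv i) ^ n = 2 powr (- 2 * \<mu> * lv i + real n * real (lv i))"
        by (simp only: powr_add)
      also have "- 2 * \<mu> * lv i + real n * real (lv i) = real n * (\<rho> * real (lv i))"
        by (simp add: \<mu> n_def field_simps)
      finally show ?thesis by (simp add: h_def powr_power mult.commute)
    qed
    then have "C * 2 powr (- 2 * \<mu> * lv i) * (2 * 2 ^ lv i) ^ n = C * 2 ^ n * h i ^ n"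
      by (simp add: power_mult_distrib)
    finally show ?thesis .
  qed
  define Jr where "Jr = (LINT \<xi>|lborel. jw (2 * n) (\<xi>::'a))"
  have Jr: "0 <= Jr" unfolding Jr_def by (rule integral_nonneg_AE) simp
  have main: "(\<integral>\<^sup>+x. ennreal (jw n (h i *\<^sub>R (x - y)) * norm (ker (a' i) x y)) \<partial>lborel) <= ennreal (Jr + C * 2 ^ n)" if i: "i \<in> I" for i y
  proof -
    note [measurable] = measurable_ker_fst[OF amp_smooth[OF a' i], of y]
    have "(\<integral>\<^sup>+x. ennreal (jw n (h i *\<^sub>R (x - y)) * norm (ker (a' i) x y)) \<partial>lborel) <=
      (\<integral>\<^sup>+x. ennreal (h i ^ n) * ennreal (jw (2 * n) (h i *\<^sub>R (y - x))) + ennreal (1 / h i ^ n) * ennreal ((norm (ker (a' i) x y))\<^sup>2) \<partial>lborel)"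
    proof (rule nn_integral_mono)
      fix x
      define s t where "s = jw n (h i *\<^sub>R (x - y))" and "t = norm (ker (a' i) x y)"
      \<comment> \<open>Weighted mean inequality, balanced so that both terms integrate to constants
        independent of i.\<close>
      have "s * t <= h i ^ n * s\<^sup>2 + 1 / h i ^ n * t\<^sup>2"
      proof -
        have "0 <= (h i ^ n * s - t)\<^sup>2 + (h i ^ n * s)\<^sup>2 + t\<^sup>2" by simp
        then have "h i ^ n * (s * t) <= h i ^ n * (h i ^ n * s\<^sup>2) + t\<^sup>2" by (simp add: power2_eq_square algebra_simps)
        then show ?thesis using h[of i] by (simp add: field_simps)
      qed
      moreover have "s\<^sup>2 = jw (2 * n) (h i *\<^sub>R (y - x))"
      proof -
        have "norm (h i *\<^sub>R (x - y)) = norm (h i *\<^sub>R (y - x))" by (simp only: norm_scaleR norm_minus_commute)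
        then have "s = jw n (h i *\<^sub>R (y - x))" by (simp only: s_def jw_def)
        then show ?thesis by (simp only: power2_eq_square jw_add[symmetric] mult_2)
      qed
      ultimately show "ennreal (jw n (h i *\<^sub>R (x - y)) * norm (ker (a' i) x y)) <=
        ennreal (h i ^ n) * ennreal (jw (2 * n) (h i *\<^sub>R (y - x))) + ennreal (1 / h i ^ n) * ennreal ((norm (ker (a' i) x y))\<^sup>2)"
        using h[of i] by (simp add: s_def[symmetric] t_def[symmetric] ennreal_mult[symmetric] ennreal_plus[symmetric] less_imp_le ennreal_leI del: ennreal_plus)
    qed
    also have "\<dots> = ennreal (h i ^ n) * (\<integral>\<^sup>+x. ennreal (jw (2 * n) (h i *\<^sub>R (y - x))) \<partial>lborel) + ennreal (1 / h i ^ n) * (\<integral>\<^sup>+x. ennreal ((norm (ker (a' i) x y))\<^sup>2) \<partial>lborel)"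
      by (simp add: nn_integral_add nn_integral_cmult)
    also have "\<dots> <= ennreal (h i ^ n) * ennreal (1 / h i ^ n * Jr) + ennreal (1 / h i ^ n) * ennreal (C * 2 ^ n * h i ^ n)"
      unfolding Jr_def n_def by (subst nn_integral_jw_affine[OF h]) (auto intro!: add_mono mult_left_mono k2[OF i, unfolded n_def])
    also have "\<dots> = ennreal (Jr + C * 2 ^ n)"
      using h[of i] C(1) Jr by (simp add: ennreal_mult[symmetric] ennreal_plus[symmetric] less_imp_le del: ennreal_plus)
    finally show ?thesis .
  qed
  have kn: "norm (ker (a i) x y) = jw (Suc n) (h i *\<^sub>R (x - y)) * norm (ker (a' i) x y)" if i: "i \<in> I" for i x y
    unfolding a'_def by (subst ker_lap[OF amp_smooth[OF a i] amp_support[OF a i], where K="Suc n" and h="h i"]) (simp add: norm_mult)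
  show ?thesis
  proof (intro exI[of _ "Jr + C * 2 ^ n"] conjI ballI allI impI)
    fix i and y :: 'a assume i: "i \<in> I"
    have "jw (Suc n) z <= jw n z" for z :: 'a by (rule jw_antimono) simp
    then have "(\<integral>\<^sup>+x. ennreal (norm (ker (a i) x y)) \<partial>lborel) <= (\<integral>\<^sup>+x. ennreal (jw n (h i *\<^sub>R (x - y)) * norm (ker (a' i) x y)) \<partial>lborel)"
      unfolding kn[OF i] by (intro nn_integral_mono ennreal_leI mult_right_mono) auto
    then show "(\<integral>\<^sup>+x. ennreal (norm (ker (a i) x y)) \<partial>lborel) <= ennreal (Jr + C * 2 ^ n)"
      using main[OF i] by (rule order_trans)
    fix r :: real assume r: "0 < r"
    note [measurable] = measurable_ker_fst[OF amp_smooth[OF a' i], of y]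
    have "(\<integral>\<^sup>+x. indicator {x. r <= norm (x - y)} x * ennreal (norm (ker (a i) x y)) \<partial>lborel) <=
      (\<integral>\<^sup>+x. ennreal (1 / (h i * r)) * ennreal (jw n (h i *\<^sub>R (x - y)) * norm (ker (a' i) x y)) \<partial>lborel)"
    proof (rule nn_integral_mono)
      fix x
      show "indicator {x. r <= norm (x - y)} x * ennreal (norm (ker (a i) x y)) <= ennreal (1 / (h i * r)) * ennreal (jw n (h i *\<^sub>R (x - y)) * norm (ker (a' i) x y))"
      proof (cases "r <= norm (x - y)")
        case True
        define s where "s = norm (h i *\<^sub>R (x - y))"
        have s: "h i * r <= s" using True h[of i] by (simp add: s_def less_imp_le)
        have "0 <= s" by (simp add: s_def)
        then have "s <= 1 + s\<^sup>2" using sum_squares_bound[of 1 s] by simp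
        then have "h i * r <= 1 + s\<^sup>2" using s by linarith
        then have "1 / (1 + s\<^sup>2) <= 1 / (h i * r)" using h[of i] r by (intro divide_left_mono) (auto intro!: mult_pos_pos add_pos_nonneg)
        then have "jw 1 (h i *\<^sub>R (x - y)) <= 1 / (h i * r)" by (simp add: jw_def s_def)
        then have "jw n (h i *\<^sub>R (x - y)) * norm (ker (a' i) x y) * jw 1 (h i *\<^sub>R (x - y)) <= jw n (h i *\<^sub>R (x - y)) * norm (ker (a' i) x y) * (1 / (h i * r))"
          by (intro mult_left_mono) auto
        then have "norm (ker (a i) x y) <= 1 / (h i * r) * (jw n (h i *\<^sub>R (x - y)) * norm (ker (a' i) x y))"
          using jw_add[of n 1 "h i *\<^sub>R (x - y)"] by (simp add: kn[OF i] mult_ac)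
        then show ?thesis using True h[of i] r by (simp add: ennreal_mult[symmetric] ennreal_leI del: times_divide_eq_left)
      qed simp
    qed
    also have "\<dots> = ennreal (1 / (h i * r)) * (\<integral>\<^sup>+x. ennreal (jw n (h i *\<^sub>R (x - y)) * norm (ker (a' i) x y)) \<partial>lborel)"
      by (rule nn_integral_cmult) measurable
    also have "\<dots> <= ennreal (1 / (h i * r)) * ennreal (Jr + C * 2 ^ n)" by (intro mult_left_mono main[OF i]) auto
    also have "\<dots> = ennreal ((Jr + C * 2 ^ n) / (2 powr (\<rho> * lv i) * r))"
      using h[of i] r C(1) Jr by (simp add: ennreal_mult[symmetric] h_def del: ennreal_plus)
    finally show "(\<integral>\<^sup>+x. indicator {x. r <= norm (x - y)} x * ennreal (norm (ker (a i) x y)) \<partial>lborel) <= ennreal ((Jr + C * 2 ^ n) / (2 powr (\<rho> * lv i) * r))" .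
  qed (use C(1) Jr in simp)
qed

lemma iter_deriv_const: "iter_deriv (%x. c) vs = (%x. if vs = [] then c else 0)"
  by (induction vs) (auto simp: iter_deriv_Cons dird_def)

lemma iter_deriv_affine_ee:
  "iter_deriv (%p. k + c * ee z p) vs p = (if vs = [] then k else 0) + c * ((\<Prod>v\<leftarrow>vs. \<i> * of_real (z \<bullet> v)) * ee z p)"
  by (subst iter_deriv_add[OF smooth_const smooth_mult[OF smooth_const smooth_ee]])
    (simp add: iter_deriv_const iter_deriv_linear_out[OF bounded_linear_mult_right smooth_ee] iter_deriv_ee)

lemma prod_list_norm_le_1:
  fixes f :: "'v => complex"
  assumes "\<And>v. v \<in> set vs ==> norm (f v) <= d" "d <= 1" "vs \<noteq> []" "0 <= d"
  shows "norm (\<Prod>v\<leftarrow>vs. f v) <= d"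
proof -
  obtain v ws where vs: "vs = v # ws" using assms(3) by (cases vs) auto
  have "norm (\<Prod>v\<leftarrow>ws. f v) <= 1"
    using assms(1) unfolding vs
  proof (induction ws)
    case (Cons w ws)
    then show ?case using assms(2,4)
      by (auto simp: norm_mult intro!: mult_le_one order_trans[OF Cons.prems assms(2)])
  qed simp
  then have "norm (f v) * norm (\<Prod>v\<leftarrow>ws. f v) <= d * 1"
    using assms(1)[of v] vs assms(4) by (intro mult_mono) auto
  then show ?thesis by (simp add: vs norm_mult)
qed

text \<open>The amplitude of the difference of two columns whose points differ by e, divided by its
  expected size 2^l |e|. On the shell the phase e . \<xi> has at most that size up to a constant,
  and every derivative of the exponential along an admissible direction brings a factor of at most
  2^l |e| <= 1. So the class does not change, uniformly in e.\<close>

lemma amp_difference: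
  fixes a :: "nat => 'a::euclidean_space \<times> 'a => complex"
  assumes a: "amp \<rho> \<mu> UNIV (%l. l) a" and \<rho>: "\<rho> <= 1"
  defines "I \<equiv> {(l, e). e \<noteq> 0 \<and> 2 ^ l * norm e <= 1}"
  shows "amp \<rho> \<mu> I fst (%(l, e) p. (1 - ee (0, e) p) / of_real (2 ^ l * norm e) * a l p)"
proof -
  let ?V = "%z::nat \<times> 'a. Vl \<rho> (fst z) :: ('a \<times> 'a) set"
  let ?R = "%z::nat \<times> 'a. {p::'a \<times> 'a. norm (snd p) < 4 * 2 ^ fst z}"
  define E where "E z p = (1 - ee (0, snd z) p) / of_real (2 ^ fst z * norm (snd z))" for z :: "nat \<times> 'a" and p :: "'a \<times> 'a"
  have E: "E z = (%p. 1 / of_real (2 ^ fst z * norm (snd z)) + (- 1 / of_real (2 ^ fst z * norm (snd z))) * ee (0, snd z) p)" for z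
    by (simp add: E_def fun_eq_iff diff_divide_distrib)
  have sE: "smooth (E z)" for z unfolding E by (intro smooth_add smooth_mult smooth_const smooth_ee)
  have uE: "unif I ?V ?R (%_. 1) E"
  proof (rule unifI)
    fix k
    \<comment> \<open>The 4 comes from order 0 and |\<xi>| < 4 * 2^l; from order 1 on the bound is
      1, one factor 2^l |e| being used up by the denominator.\<close>
    have "norm (iter_deriv (E z) vs p) <= 4 * 1" if z: "z \<in> I" "p \<in> ?R z" "set vs \<subseteq> ?V z" for z :: "nat \<times> 'a" and p vs
    proof -
      define l e where "l = fst z" and "e = snd z"
      have e: "0 < norm e" "2 ^ l * norm e <= 1" using z(1) by (auto simp: I_def l_def e_def)
      define d where "d = 2 ^ l * norm e"
      have d: "0 < d" "d <= 1" using e by (auto simp: d_def)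
      have i: "iter_deriv (E z) vs p = (if vs = [] then 1 / of_real d else 0) + (- 1 / of_real d) * ((\<Prod>v\<leftarrow>vs. \<i> * of_real ((0, e) \<bullet> v)) * ee (0, e) p)"
        unfolding E iter_deriv_affine_ee d_def l_def e_def ..
      show ?thesis
      proof (cases "vs = []")
        case True
        have "norm (1 - ee (0, e) p) = norm (exp (\<i> * of_real (e \<bullet> snd p)) - 1)"
          by (cases p) (simp add: ee_def cis_conv_exp norm_minus_commute)
        also have "\<dots> <= \<bar>e \<bullet> snd p\<bar>" by (simp add: dist_exp_i_1 abs_sin_le_one[THEN order_trans]
            order_trans[OF mult_left_mono[OF abs_sin_x_le_abs_x]])
        also have "\<dots> <= norm e * norm (snd p)" by (rule Cauchy_Schwarz_ineq2)
        also have "\<dots> <= norm e * (4 * 2 ^ l)" using z(2) by (intro mult_left_mono) (auto simp: l_def)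
        also have "\<dots> = 4 * d" by (simp add: d_def)
        finally have "norm (1 - ee (0, e) p) / d <= 4" using d by (simp add: pos_divide_le_eq)
        then show ?thesis using True d by (simp add: E_def norm_divide d_def l_def e_def abs_of_pos norm_mult norm_power)
      next
        case False
        have "norm (\<Prod>v\<leftarrow>vs. \<i> * of_real ((0, e) \<bullet> v)) <= d"
        proof (rule prod_list_norm_le_1[OF _ d(2) False])
          fix v assume "v \<in> set vs"
          then have "norm (snd v) <= 2 powr (\<rho> * real l)" using z(3) by (auto simp: Vl_def l_def)
          also have "\<dots> <= 2 powr (1 * real l)" using \<rho> by (intro powr_mono mult_right_mono) auto
          finally have "norm (snd v) <= 2 ^ l" by (simp add: powr_realpow)
          then have "norm e * norm (snd v) <= d" unfolding d_def by (simp add: mult.commute mult_left_mono)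
          then show "norm (\<i> * of_real ((0, e) \<bullet> v)) <= d"
            using Cauchy_Schwarz_ineq2[of e "snd v"] by (cases v) (simp add: norm_mult)
        qed (use d in simp)
        then have "norm (iter_deriv (E z) vs p) <= 1" unfolding i using False d by (simp add: norm_mult norm_divide)
        then show ?thesis by simp
      qed
    qed
    then show "\<exists>C. \<forall>z\<in>I. \<forall>p\<in>?R z. \<forall>vs. length vs = k --> set vs \<subseteq> ?V z --> norm (iter_deriv (E z) vs p) <= C * 1"
      by blast
  qed (use sE in auto)
  have ua: "unif I ?V ?R (%z. 2 powr (- \<mu> * real (fst z))) (%z. a (fst z))"
    using a by (intro unif_reindex[of UNIV "Vl \<rho>" "%_. UNIV" "%l. 2 powr (- \<mu> * real l)" a I fst ?V ?R 1]) (auto simp: amp_def)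
  have u: "unif I ?V ?R (%z. 2 powr (- \<mu> * real (fst z))) (%z p. E z p * a (fst z) p)"
    using unif_mult[OF uE ua] by simp
  have s: "xsupp (shell (fst z)) (%p. E z p * a (fst z) p)" for z
    using amp_support[OF a, of "fst z"] by (simp add: xsupp_def)
  have "unif I ?V (%_. UNIV) (%z. 2 powr (- \<mu> * real (fst z))) (%z p. E z p * a (fst z) p)"
  proof (rule unif_extend[OF u, where K="%z. {p. norm (snd p) <= 2 * 2 ^ fst z}"])
    fix z :: "nat \<times> 'a" and p :: "'a \<times> 'a" assume "p \<notin> {p. norm (snd p) <= 2 * 2 ^ fst z}"
    then have "snd p \<notin> shell (fst z)" by (auto simp: shell_def)
    then show "E z p * a (fst z) p = 0" using s[of z] by (cases p) (simp add: xsupp_def)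
  next
    fix z :: "nat \<times> 'a"
    have "(0::real) < 2 ^ fst z" by simp
    then have "t < 4 * 2 ^ fst z" if "t <= 2 * 2 ^ fst z" for t :: real using that by linarith
    then show "{p. norm (snd p) <= 2 * 2 ^ fst z} \<subseteq> ?R z" by blast
  qed (auto intro!: closed_Collect_le continuous_intros)
  with s have "amp \<rho> \<mu> I fst (%z p. E z p * a (fst z) p)" by (simp add: amp_def)
  then show ?thesis by (simp add: E_def case_prod_beta')
qed

text \<open>For 2^l |y - y'| <= 1 the difference is 2^l |y - y'| times a kernel from
  \<open>amp_difference\<close>; otherwise the two columns are estimated separately. The factor is
  2^l and not 2^(\<rho> l), since a difference in y brings down \<xi>.\<close>

lemma kernel_difference:
  fixes a :: "nat => 'a::euclidean_space \<times> 'a => complex" and \<rho> \<mu> :: real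
  assumes a: "amp \<rho> \<mu> UNIV (%l. l) a" and \<rho>: "1 / 2 <= \<rho>" "\<rho> <= 1" and \<mu>: "\<mu> = DIM('a) * (1 - \<rho>) / 2"
  shows "\<exists>C\<ge>0. \<forall>l y y'. (\<integral>\<^sup>+x. ennreal (norm (ker (a l) x y - ker (a l) x y')) \<partial>lborel) <= ennreal (C * 2 ^ l * norm (y - y'))"
proof -
  define I where "I = {(l::nat, e::'a). e \<noteq> 0 \<and> 2 ^ l * norm e <= 1}"
  obtain C where C: "0 <= C" "\<And>l y. (\<integral>\<^sup>+x. ennreal (norm (ker (a l) x y)) \<partial>lborel) <= ennreal C"
    using kernel_L1[OF a \<rho> \<mu>] by auto
  define b where "b = (%(l, e::'a) p. (1 - ee (0, e) p) / of_real (2 ^ l * norm e) * a l p)"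
  have b: "amp \<rho> \<mu> I fst b" unfolding I_def b_def by (rule amp_difference[OF a \<rho>(2)])
  obtain D where D: "0 <= D" "\<And>l e y. (l, e) \<in> I ==> (\<integral>\<^sup>+x. ennreal (norm (ker (b (l, e)) x y)) \<partial>lborel) <= ennreal D"
    using kernel_L1[OF b \<rho> \<mu>] by auto
  show ?thesis
  proof (intro exI[of _ "2 * C + D"] conjI allI)
    fix l and y y' :: 'a
    define e where "e = y - y'"
    have m[measurable]: "(%x. ker (a l) x y) \<in> borel_measurable borel" for y
      by (rule measurable_ker_fst[OF amp_smooth[OF a]]) simp
    consider "e = 0" | "e \<noteq> 0" "2 ^ l * norm e <= 1" | "1 < 2 ^ l * norm e" by linarith
    then show "(\<integral>\<^sup>+x. ennreal (norm (ker (a l) x y - ker (a l) x y')) \<partial>lborel) <= ennreal ((2 * C + D) * 2 ^ l * norm (y - y'))"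
    proof cases
      case 1
      then show ?thesis by (simp add: e_def)
    next
      case 2
      then have I: "(l, e) \<in> I" by (simp add: I_def)
      define d where "d = 2 ^ l * norm e"
      have d: "0 < d" using 2 by (simp add: d_def)
      have i: "integrable lborel (%\<xi>. ee z \<xi> * a l (x, \<xi>))" for x z
        using amp_smooth[OF a, of l] amp_support[OF a, of l]
        by (auto intro!: integrable_ee_mult integrable_slice[where S="shell l"] bounded_shell)
      have "ker (a l) x y - ker (a l) x y' = of_real d * ker (b (l, e)) x y" for x
      proof -
        have "ker (a l) x y - ker (a l) x y' = (LINT \<xi>|lborel. ee (x - y) \<xi> * a l (x, \<xi>) - ee (x - y') \<xi> * a l (x, \<xi>))"
          unfolding ker_def by (rule Bochner_Integration.integral_diff[OF i i, symmetric])
        also have "\<dots> = (LINT \<xi>|lborel. of_real d * (ee (x - y) \<xi> * b (l, e) (x, \<xi>)))"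
        proof (intro Bochner_Integration.integral_cong refl)
          fix \<xi>
          have "ee (x - y') \<xi> = ee (x - y) \<xi> * ee e \<xi>"
            by (simp add: ee_def cis_mult e_def inner_diff_left)
          moreover have "ee (0, e) (x, \<xi>) = ee e \<xi>" by (simp add: ee_def)
          ultimately show "ee (x - y) \<xi> * a l (x, \<xi>) - ee (x - y') \<xi> * a l (x, \<xi>) = of_real d * (ee (x - y) \<xi> * b (l, e) (x, \<xi>))"
          proof -
            assume 1: "ee (x - y') \<xi> = ee (x - y) \<xi> * ee e \<xi>" and "ee (0, e) (x, \<xi>) = ee e \<xi>"
            then have 2: "b (l, e) (x, \<xi>) = (1 - ee e \<xi>) / of_real d * a l (x, \<xi>)"
              by (simp add: b_def d_def)
            show ?thesis
              unfolding 1 2 using d by (simp add: right_diff_distrib left_diff_distrib diff_divide_distrib)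
          qed
        qed
        finally show ?thesis by (simp add: ker_def)
      qed
      then have "(\<integral>\<^sup>+x. ennreal (norm (ker (a l) x y - ker (a l) x y')) \<partial>lborel) = (\<integral>\<^sup>+x. ennreal d * ennreal (norm (ker (b (l, e)) x y)) \<partial>lborel)"
        using d by (simp add: norm_mult ennreal_mult)
      also have "\<dots> = ennreal d * (\<integral>\<^sup>+x. ennreal (norm (ker (b (l, e)) x y)) \<partial>lborel)"
        using measurable_ker_fst[OF amp_smooth[OF b I]] by (intro nn_integral_cmult) auto
      also have "\<dots> <= ennreal d * ennreal D" by (intro mult_left_mono D I) auto
      also have "\<dots> <= ennreal ((2 * C + D) * 2 ^ l * norm (y - y'))"
        using d C(1) D(1) by (simp add: ennreal_mult[symmetric] d_def e_def ennreal_leI algebra_simps)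
      finally show ?thesis .
    next
      case 3
      have "(\<integral>\<^sup>+x. ennreal (norm (ker (a l) x y - ker (a l) x y')) \<partial>lborel) <= (\<integral>\<^sup>+x. ennreal (norm (ker (a l) x y)) + ennreal (norm (ker (a l) x y')) \<partial>lborel)"
        by (intro nn_integral_mono) (simp add: ennreal_plus[symmetric] ennreal_leI norm_triangle_ineq4 del: ennreal_plus)
      also have "\<dots> = (\<integral>\<^sup>+x. ennreal (norm (ker (a l) x y)) \<partial>lborel) + (\<integral>\<^sup>+x. ennreal (norm (ker (a l) x y')) \<partial>lborel)"
        by (rule nn_integral_add) measurable
      also have "\<dots> <= ennreal C + ennreal C" by (intro add_mono C)
      also have "\<dots> = ennreal (2 * C * 1)" using C(1) by (simp add: ennreal_plus[symmetric] del: ennreal_plus)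
      also have "\<dots> <= ennreal ((2 * C + D) * (2 ^ l * norm (y - y')))"
        using C(1) D(1) 3 by (intro ennreal_leI mult_mono) (auto simp: e_def)
      finally show ?thesis by (simp add: mult.assoc)
    qed
  qed (use C D in simp)
qed

section \<open>Dyadic decomposition of a symbol\<close>

definition dyadic :: "nat => 'a::euclidean_space => real" where
  "dyadic l \<xi> = (if l = 0 then bump \<xi> else bump (\<xi> /\<^sub>R 2 ^ l) - bump (2 *\<^sub>R (\<xi> /\<^sub>R 2 ^ l)))"

lemma sum_dyadic: "(\<Sum>l\<le>J. dyadic l \<xi>) = bump (\<xi> /\<^sub>R 2 ^ J)"
proof (induction J)
  case (Suc J)
  have "2 *\<^sub>R (\<xi> /\<^sub>R 2 ^ Suc J) = \<xi> /\<^sub>R 2 ^ J" by simp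
  with Suc show ?case by (simp add: dyadic_def)
qed (simp add: dyadic_def)

lemma dyadic_support: "\<xi> \<notin> shell l ==> dyadic l \<xi> = 0"
proof -
  assume *: "\<xi> \<notin> shell l"
  have "2 * 2 ^ l < norm \<xi> \<or> l \<noteq> 0 \<and> norm \<xi> < 2 ^ l / 2"
    using * by (force simp: shell_def)
  define y where "y = \<xi> /\<^sub>R 2 ^ l"
  have y2: "norm (2 *\<^sub>R y) = 2 * norm y" by simp
  have yn: "norm y = norm \<xi> / 2 ^ l" by (simp add: y_def divide_inverse)
  from \<open>2 * 2 ^ l < norm \<xi> \<or> l \<noteq> 0 \<and> norm \<xi> < 2 ^ l / 2\<close> show ?thesis
  proof (elim disjE conjE)
    assume "2 * 2 ^ l < norm \<xi>"
    then have "2 <= norm y" unfolding yn by (simp add: field_simps)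
    then have "bump y = 0" "bump (2 *\<^sub>R y) = 0" by (auto intro!: bump_eq_0 simp: y2 simp del: norm_scaleR)
    moreover have "bump \<xi> = 0" if "l = 0" using \<open>bump y = 0\<close> that by (simp add: y_def)
    ultimately show ?thesis by (auto simp: dyadic_def y_def[symmetric])
  next
    assume "l \<noteq> 0" "norm \<xi> < 2 ^ l / 2"
    then have "norm y <= 1 / 2" unfolding yn by (simp add: field_simps)
    then have "bump y = 1" "bump (2 *\<^sub>R y) = 1" by (auto intro!: bump_eq_1 simp: y2 simp del: norm_scaleR)
    then show ?thesis using \<open>l \<noteq> 0\<close> by (simp add: dyadic_def y_def[symmetric])
  qed
qed

lemma unif_scaled_compact:
  fixes f :: "'a::euclidean_space => real"
  assumes f: "smooth f" "\<And>x. r < norm x ==> f x = 0" and h: "\<And>j. j \<in> J ==> 0 < h j"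
    and V: "\<And>j v. j \<in> J ==> v \<in> V j ==> norm (snd v) <= h j"
  shows "unif J V R (%_. 1) (%j p::'a \<times> 'a. of_real (f (snd p /\<^sub>R h j)))"
proof -
  have u: "unif (UNIV::unit set) (%_. cball 0 1) (%_. UNIV) (%_. 1) (%_ x. complex_of_real (f x))"
  proof (rule unif_base)
    show s: "smooth (%x. complex_of_real (f x))" by (rule smooth_of_real[OF f(1)])
    show "bounded (range (iter_deriv (%x. complex_of_real (f x)) vs))" for vs
      by (rule smooth_compact_support_bounded[OF s, of r]) (simp add: f(2))
  qed
  have "unif J V R (%_. 1) (%j p. of_real (f (snd p /\<^sub>R h j + 0)))"
    by (rule unif_affine[OF u, where f="%_. ()" and K=1])
      (use h V in \<open>auto intro!: bounded_linear_scaleR_right[THEN bounded_linear_compose] bounded_linear_snd simp: divide_simps abs_of_pos\<close>)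
  then show ?thesis by simp
qed

text \<open>The Hoermander class of order -\<mu> and type (\<rho>, 1 - \<rho>), written with a
  metric: a derivative in x costs <\<xi>>^(1 - \<rho>), a derivative in \<xi> gains
  <\<xi>>^(-\<rho>).\<close>

definition symb :: "real => real => ('a::euclidean_space \<times> 'a => complex) => bool" where
  "symb \<rho> \<mu> \<sigma> \<longleftrightarrow> smooth \<sigma> \<and> (\<forall>k. \<exists>C. \<forall>p vs. length vs = k --> norm (iter_deriv \<sigma> vs p) <= C * japanese (snd p) powr (- \<mu>) *
     (\<Prod>v\<leftarrow>vs. japanese (snd p) powr (- \<rho>) * sqrt ((japanese (snd p))\<^sup>2 * (norm (fst v))\<^sup>2 + (norm (snd v))\<^sup>2)))"

definition piece :: "('a::euclidean_space \<times> 'a => complex) => nat => 'a \<times> 'a => complex" where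
  "piece \<sigma> l p = \<sigma> p * of_real (dyadic l (snd p))"

lemma japanese_ge_1: "1 <= japanese x"
  by (simp add: japanese_def)

lemma prod_list_le_power:
  fixes f :: "'v => real"
  assumes "\<And>v. v \<in> set vs ==> 0 <= f v \<and> f v <= B" "0 <= B"
  shows "0 <= (\<Prod>v\<leftarrow>vs. f v) \<and> (\<Prod>v\<leftarrow>vs. f v) <= B ^ length vs"
  using assms by (induction vs) (auto intro!: mult_mono)

lemma amp_piece:
  fixes \<sigma> :: "'a::euclidean_space \<times> 'a => complex"
  assumes \<sigma>: "symb \<rho> \<mu> \<sigma>" and \<rho>: "0 <= \<rho>" "\<rho> <= 1" and \<mu>: "0 <= \<mu>"
  shows "amp \<rho> \<mu> UNIV (%l. l) (piece \<sigma>)"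
proof -
  let ?V = "%l. Vl \<rho> l :: ('a \<times> 'a) set"
  let ?R = "%l. {p::'a \<times> 'a. norm (snd p) < 4 * 2 ^ l \<and> (l = 0 \<or> 2 ^ l / 4 < norm (snd p))}"
  have freq: "norm (snd v) <= 2 ^ l" if "v \<in> Vl \<rho> l" for v :: "'a \<times> 'a" and l
  proof -
    have "norm (snd v) <= 2 powr (\<rho> * real l)" using that by (simp add: Vl_def)
    also have "\<dots> <= 2 powr (1 * real l)" using \<rho> by (intro powr_mono mult_right_mono) auto
    finally show ?thesis by (simp add: powr_realpow)
  qed
  have s2: "smooth (%x::'a. bump (2 *\<^sub>R x))"
    using smooth_affine_in[OF bounded_linear_scaleR_right smooth_bump, of 2 0] by simp
  have b1: "unif UNIV ?V ?R (%_. 1) (%l p. of_real (bump (snd p /\<^sub>R 2 ^ l)))"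
    by (rule unif_scaled_compact[OF smooth_bump, of 2]) (use freq in \<open>auto simp: bump_eq_0\<close>)
  have b2: "unif UNIV ?V ?R (%_. 1) (%l p. of_real (bump (2 *\<^sub>R (snd p /\<^sub>R 2 ^ l))))"
    by (rule unif_scaled_compact[OF s2, of 1]) (use freq in \<open>auto simp: bump_eq_0\<close>)
  have b3: "unif UNIV ?V ?R (%_. 1) (%l p. (if l = 0 then 0 else 1) * complex_of_real (bump (2 *\<^sub>R (snd p /\<^sub>R 2 ^ l))))"
    using unif_cmult[OF b2, of "%l. if l = 0 then 0 else 1" "%_. 1"] by simp
  have ud: "unif UNIV ?V ?R (%_. 1) (%l p. complex_of_real (dyadic l (snd p)))"
  proof -
    have "complex_of_real (dyadic l \<xi>) = of_real (bump (\<xi> /\<^sub>R 2 ^ l)) - (if l = 0 then 0 else 1) * complex_of_real (bump (2 *\<^sub>R (\<xi> /\<^sub>R 2 ^ l)))" for l and \<xi> :: 'a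
      by (simp add: dyadic_def)
    then show ?thesis using unif_diff[OF b1 b3] by (simp only:)
  qed
  have us: "unif UNIV ?V ?R (%l. 2 powr (- \<mu> * real l)) (%l. \<sigma>)"
  proof (rule unifI)
    fix k
    obtain C where C: "\<And>p vs. length vs = k ==> norm (iter_deriv \<sigma> vs p) <= C * japanese (snd p) powr (- \<mu>) *
     (\<Prod>v\<leftarrow>vs. japanese (snd p) powr (- \<rho>) * sqrt ((japanese (snd p))\<^sup>2 * (norm (fst v))\<^sup>2 + (norm (snd v))\<^sup>2))"
      using \<sigma> unfolding symb_def by blast
    have "norm (iter_deriv \<sigma> vs p) <= (\<bar>C\<bar> * 4 powr \<mu> * (4 powr \<rho> * 6) ^ k) * 2 powr (- \<mu> * real l)"
      if p: "p \<in> ?R l" and vs: "length vs = k" "set vs \<subseteq> ?V l" for l p vs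
    proof -
      define \<xi> where "\<xi> = snd p"
      define j where "j = japanese \<xi>"
      have j1: "1 <= j" unfolding j_def by (rule japanese_ge_1)
      have jl: "2 ^ l / 4 <= j"
      proof (cases "l = 0")
        case False
        then have "2 ^ l / 4 <= norm \<xi>" using p by (simp add: \<xi>_def)
        also have "\<dots> = sqrt ((norm \<xi>)\<^sup>2)" by simp
        also have "\<dots> <= j" unfolding j_def japanese_def by (intro real_sqrt_le_mono) simp
        finally show ?thesis .
      qed (use j1 in simp)
      have ju: "j <= 5 * 2 ^ l"
      proof -
        have "(norm \<xi>)\<^sup>2 <= (4 * 2 ^ l)\<^sup>2" using p by (intro power_mono) (auto simp: \<xi>_def)
        then have 1: "(norm \<xi>)\<^sup>2 <= 16 * (2 ^ l)\<^sup>2" by (simp add: power_mult_distrib)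
        have 2: "(1::real) <= (2 ^ l)\<^sup>2" by (intro one_le_power) simp
        have "1 + (norm \<xi>)\<^sup>2 <= 25 * (2 ^ l)\<^sup>2" using 1 2 by linarith
        also have "\<dots> = (5 * 2 ^ l)\<^sup>2" by (simp add: power_mult_distrib)
        finally have "1 + (norm \<xi>)\<^sup>2 <= (5 * 2 ^ l)\<^sup>2" .
        then have "j <= sqrt ((5 * 2 ^ l)\<^sup>2)" unfolding j_def japanese_def by (rule real_sqrt_le_mono)
        then show ?thesis unfolding real_sqrt_abs by simp
      qed
      have pw: "j powr (- s) <= 4 powr s * 2 powr (- s * real l)" if "0 <= s" for s
      proof -
        have "j powr (- s) <= (2 ^ l / 4) powr (- s)" using jl that by (intro powr_mono2') auto
        also have "\<dots> = 4 powr s * 2 powr (- s * real l)"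
          by (simp add: powr_divide powr_realpow[symmetric] powr_powr powr_minus field_simps)
        finally show ?thesis .
      qed
      have f: "0 <= j powr (- \<rho>) * sqrt (j\<^sup>2 * (norm (fst v))\<^sup>2 + (norm (snd v))\<^sup>2) \<and>
          j powr (- \<rho>) * sqrt (j\<^sup>2 * (norm (fst v))\<^sup>2 + (norm (snd v))\<^sup>2) <= 4 powr \<rho> * 6" if "v \<in> set vs" for v
      proof
        have v: "norm (fst v) <= hs \<rho> l" "norm (snd v) <= 2 powr (\<rho> * real l)" using vs(2) that by (auto simp: Vl_def)
        have "sqrt (j\<^sup>2 * (norm (fst v))\<^sup>2 + (norm (snd v))\<^sup>2) <= j * norm (fst v) + norm (snd v)"
          using sqrt_sum_squares_le_sum[of "j * norm (fst v)" "norm (snd v)"] j1 by (simp add: power_mult_distrib)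
        also have "\<dots> <= (5 * 2 ^ l) * hs \<rho> l + 2 powr (\<rho> * real l)"
          using v ju j1 by (intro add_mono mult_mono) auto
        also have "(5 * 2 ^ l) * hs \<rho> l = 5 * 2 powr (\<rho> * real l)"
          by (simp add: hs_def powr_realpow[symmetric] powr_add[symmetric] algebra_simps)
        finally have "sqrt (j\<^sup>2 * (norm (fst v))\<^sup>2 + (norm (snd v))\<^sup>2) <= 6 * 2 powr (\<rho> * real l)" by simp
        then have "j powr (- \<rho>) * sqrt (j\<^sup>2 * (norm (fst v))\<^sup>2 + (norm (snd v))\<^sup>2) <= (4 powr \<rho> * 2 powr (- \<rho> * real l)) * (6 * 2 powr (\<rho> * real l))"
          by (intro mult_mono pw \<rho>) auto
        also have "\<dots> = 4 powr \<rho> * 6 * (2 powr (- \<rho> * real l) * 2 powr (\<rho> * real l))" by simp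
        also have "2 powr (- \<rho> * real l) * 2 powr (\<rho> * real l) = 1" by (simp add: powr_add[symmetric])
        finally show "j powr (- \<rho>) * sqrt (j\<^sup>2 * (norm (fst v))\<^sup>2 + (norm (snd v))\<^sup>2) <= 4 powr \<rho> * 6" by simp
      qed simp
      have pr: "0 <= (\<Prod>v\<leftarrow>vs. j powr (- \<rho>) * sqrt (j\<^sup>2 * (norm (fst v))\<^sup>2 + (norm (snd v))\<^sup>2))"
         "(\<Prod>v\<leftarrow>vs. j powr (- \<rho>) * sqrt (j\<^sup>2 * (norm (fst v))\<^sup>2 + (norm (snd v))\<^sup>2)) <= (4 powr \<rho> * 6) ^ k"
        using prod_list_le_power[of vs "%v. j powr (- \<rho>) * sqrt (j\<^sup>2 * (norm (fst v))\<^sup>2 + (norm (snd v))\<^sup>2)" "4 powr \<rho> * 6", OF f] vs(1) by auto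
      have "norm (iter_deriv \<sigma> vs p) <= C * j powr (- \<mu>) * (\<Prod>v\<leftarrow>vs. j powr (- \<rho>) * sqrt (j\<^sup>2 * (norm (fst v))\<^sup>2 + (norm (snd v))\<^sup>2))"
        using C[OF vs(1)] by (simp add: j_def \<xi>_def)
      also have "\<dots> <= (\<bar>C\<bar> * (4 powr \<mu> * 2 powr (- \<mu> * real l))) * (4 powr \<rho> * 6) ^ k"
        by (intro mult_mono pw \<mu> pr abs_ge_self) auto
      finally show ?thesis by (simp add: mult_ac)
    qed
    then show "\<exists>C. \<forall>l\<in>UNIV. \<forall>p\<in>?R l. \<forall>vs. length vs = k --> set vs \<subseteq> ?V l --> norm (iter_deriv \<sigma> vs p) <= C * 2 powr (- \<mu> * real l)"
      by blast
  qed (use \<sigma> in \<open>auto simp: symb_def\<close>)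
  have u: "unif UNIV ?V ?R (%l. 2 powr (- \<mu> * real l)) (piece \<sigma>)"
    using unif_mult[OF us ud] by (simp add: piece_def[abs_def])
  have s: "xsupp (shell l) (piece \<sigma> l)" for l
    by (simp add: xsupp_def piece_def dyadic_support)
  have "unif UNIV ?V (%_. UNIV) (%l. 2 powr (- \<mu> * real l)) (piece \<sigma>)"
  proof (rule unif_extend[OF u, where K="%l. {p. snd p \<in> shell l}"])
    show "closed {p::'a \<times> 'a. snd p \<in> shell l}" for l
      using closed_vimage_snd[OF closed_shell, of l] by (simp add: vimage_def)
    show "{p::'a \<times> 'a. snd p \<in> shell l} \<subseteq> ?R l" for l
    proof
      fix p :: "'a \<times> 'a" assume "p \<in> {p. snd p \<in> shell l}"
      moreover have "(0::real) < 2 ^ l" by simp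
      ultimately show "p \<in> ?R l" unfolding shell_def mem_Collect_eq by linarith
    qed
    show "piece \<sigma> l p = 0" if "p \<notin> {p. snd p \<in> shell l}" for l p
      using that by (simp add: piece_def dyadic_support)
  qed
  with s show ?thesis by (simp add: amp_def)
qed

section \<open>The dyadic operators\<close>

lemma ft_add:
  assumes "datum M Y u" "datum M Y v"
  shows "ft M Y (%m. u m + v m) = (%\<xi>. ft M Y u \<xi> + ft M Y v \<xi>)"
proof
  fix \<xi>
  have i: "integrable M (%m. ee (- Y m) \<xi> * w m)" if "datum M Y w" for w
  proof -
    have [measurable]: "Y \<in> borel_measurable M" "w \<in> borel_measurable M" and "integrable M w"
      using that by (auto simp: datum_def)
    show ?thesis by (rule Bochner_Integration.integrable_bound[OF \<open>integrable M w\<close>]) (auto simp: norm_mult)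
  qed
  show "ft M Y (%m. u m + v m) \<xi> = ft M Y u \<xi> + ft M Y v \<xi>"
    unfolding ft_def distrib_left by (rule Bochner_Integration.integral_add[OF i[OF assms(1)] i[OF assms(2)]])
qed

lemma ft_cmult: "ft M Y (%m. c * u m) = (%\<xi>. c * ft M Y u \<xi>)"
proof
  fix \<xi>
  have "ee (- Y m) \<xi> * (c * u m) = c * (ee (- Y m) \<xi> * u m)" for m by simp
  then show "ft M Y (%m. c * u m) \<xi> = c * ft M Y u \<xi>"
    unfolding ft_def by (simp only: integral_mult_right_zero)
qed

lemma datum_lborel: "integrable lborel f ==> datum lborel (%y. y) f"
  by (simp add: datum_def lborel.sigma_finite_measure_axioms)

text \<open>Schur test: the kernel R^n \<open>jw\<close> (R z) has an integral independent of R, so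
  at every scale the energy of a function is at most a constant times its squared L^2 norm.\<close>

lemma EE_le_L2:
  fixes f :: "'a::euclidean_space => complex"
  assumes [measurable]: "f \<in> borel_measurable borel" and R: "0 < R"
  shows "EE DIM('a) lborel (%y. y) f R <= ennreal (2 * (LINT z|lborel. jw DIM('a) (z::'a))) * (\<integral>\<^sup>+y. ennreal ((norm (f y))\<^sup>2) \<partial>lborel)"
proof -
  define n where "n = DIM('a)"
  define Jr where "Jr = (LINT z|lborel. jw n (z::'a))"
  have Jr: "0 <= Jr" unfolding Jr_def by (rule integral_nonneg_AE) simp
  define I where "I = (\<integral>\<^sup>+y. ennreal ((norm (f y))\<^sup>2) \<partial>lborel)"
  have nj: "(\<integral>\<^sup>+y. ennreal (R ^ n * jw n (R *\<^sub>R (y' - y))) \<partial>lborel) = ennreal Jr" for y' :: 'a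
  proof -
    have "(\<integral>\<^sup>+y. ennreal (R ^ n * jw n (R *\<^sub>R (y' - y))) \<partial>lborel) = ennreal (R ^ n) * (\<integral>\<^sup>+y. ennreal (jw n (R *\<^sub>R (y' - y))) \<partial>lborel)"
      using R by (simp add: ennreal_mult nn_integral_cmult)
    also have "\<dots> = ennreal (R ^ n) * ennreal (1 / R ^ n * Jr)"
      unfolding Jr_def n_def by (subst nn_integral_jw_affine[OF R order_refl]) simp
    also have "\<dots> = ennreal (R ^ n * (1 / R ^ n * Jr))" using R Jr by (intro ennreal_mult[symmetric]) auto
    also have "R ^ n * (1 / R ^ n * Jr) = Jr" using R by simp
    finally show ?thesis .
  qed
  have sym: "jw n (R *\<^sub>R (y' - y)) = jw n (R *\<^sub>R (y - y'))" for y y' :: 'a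
    by (simp only: jw_def norm_scaleR norm_minus_commute)
  have "EE n lborel (%y. y) f R <= (\<integral>\<^sup>+y'. \<integral>\<^sup>+y. ennreal ((norm (f y'))\<^sup>2) * ennreal (R ^ n * jw n (R *\<^sub>R (y' - y))) + ennreal ((norm (f y))\<^sup>2) * ennreal (R ^ n * jw n (R *\<^sub>R (y' - y))) \<partial>lborel \<partial>lborel)"
    unfolding EE_def n_def[symmetric]
  proof (intro nn_integral_mono)
    fix y y'
    have "norm (f y') * norm (f y) <= (norm (f y'))\<^sup>2 + (norm (f y))\<^sup>2"
      using sum_squares_bound[of "norm (f y')" "norm (f y)"] mult_nonneg_nonneg[OF norm_ge_zero[of "f y'"] norm_ge_zero[of "f y"]] by linarith
    then have "norm (f y') * norm (f y) * (R ^ n * jw n (R *\<^sub>R (y' - y))) <= ((norm (f y'))\<^sup>2 + (norm (f y))\<^sup>2) * (R ^ n * jw n (R *\<^sub>R (y' - y)))"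
      using R by (intro mult_right_mono) auto
    then show "ennreal (norm (f y') * norm (f y) * (R ^ n * jw n (R *\<^sub>R (y' - y)))) <=
       ennreal ((norm (f y'))\<^sup>2) * ennreal (R ^ n * jw n (R *\<^sub>R (y' - y))) + ennreal ((norm (f y))\<^sup>2) * ennreal (R ^ n * jw n (R *\<^sub>R (y' - y)))"
      using R by (simp add: ennreal_mult[symmetric] ennreal_plus[symmetric] distrib_right ennreal_leI del: ennreal_plus)
  qed
  also have "\<dots> = (\<integral>\<^sup>+y'. \<integral>\<^sup>+y. ennreal ((norm (f y'))\<^sup>2) * ennreal (R ^ n * jw n (R *\<^sub>R (y' - y))) \<partial>lborel \<partial>lborel) +
     (\<integral>\<^sup>+y'. \<integral>\<^sup>+y. ennreal ((norm (f y))\<^sup>2) * ennreal (R ^ n * jw n (R *\<^sub>R (y' - y))) \<partial>lborel \<partial>lborel)"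
    by (simp add: nn_integral_add)
  also have "(\<integral>\<^sup>+y'. \<integral>\<^sup>+y. ennreal ((norm (f y))\<^sup>2) * ennreal (R ^ n * jw n (R *\<^sub>R (y' - y))) \<partial>lborel \<partial>lborel) =
     (\<integral>\<^sup>+y. \<integral>\<^sup>+y'. ennreal ((norm (f y))\<^sup>2) * ennreal (R ^ n * jw n (R *\<^sub>R (y' - y))) \<partial>lborel \<partial>lborel)"
    by (rule lborel_pair.Fubini') measurable
  also have "(\<integral>\<^sup>+y'. \<integral>\<^sup>+y. ennreal ((norm (f y'))\<^sup>2) * ennreal (R ^ n * jw n (R *\<^sub>R (y' - y))) \<partial>lborel \<partial>lborel) = I * ennreal Jr"
    by (simp add: nn_integral_cmult nj nn_integral_multc I_def)
  also have "(\<integral>\<^sup>+y. \<integral>\<^sup>+y'. ennreal ((norm (f y))\<^sup>2) * ennreal (R ^ n * jw n (R *\<^sub>R (y' - y))) \<partial>lborel \<partial>lborel) = I * ennreal Jr"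
    unfolding sym by (simp add: nn_integral_cmult nj nn_integral_multc I_def)
  also have "I * ennreal Jr + I * ennreal Jr = ennreal (2 * Jr) * I"
    using Jr by (simp add: ennreal_mult mult_2[symmetric] mult_ac)
  finally show ?thesis by (simp add: n_def Jr_def I_def)
qed

text \<open>One amplitude per frequency shell, of exactly the order for which
  \<open>kernel_L1\<close> holds. Up to the extension to L^1 a symbol is seen only through such a
  sequence.\<close>

locale sing =
  fixes \<rho> \<mu> :: real and a :: "nat => 'a::euclidean_space \<times> 'a => complex"
  assumes amp: "amp \<rho> \<mu> UNIV (%l. l) a" and \<rho>: "1 / 2 <= \<rho>" "\<rho> <= 1" and \<mu>: "\<mu> = DIM('a) * (1 - \<rho>) / 2"
begin

definition Tl :: "nat => ('a => complex) => 'a => complex" where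
  "Tl l f = opT (a l) (ft lborel (%y. y) f)"

lemma smooth_a: "smooth (a l)" using amp_smooth[OF amp] by simp
lemma supp_a: "xsupp (shell l) (a l)" using amp_support[OF amp] by simp

lemma Tl_measurable [measurable]: "integrable lborel f ==> Tl l f \<in> borel_measurable borel"
  unfolding Tl_def by (intro measurable_opT smooth_a ft_measurable datum_lborel)

lemma Tl_ker: "integrable lborel f ==> Tl l f x = (LINT y|lborel. f y * ker (a l) x y)"
  unfolding Tl_def ker_def
  by (rule opT_swap[OF datum_lborel integrable_slice[OF smooth_a supp_a bounded_shell]])

lemma integrable_Tl_integrand: "integrable lborel f ==> integrable lborel (%\<xi>. ee x \<xi> * a l (x, \<xi>) * ft lborel (%y. y) f \<xi>)"
  by (rule integrable_opT[OF smooth_a supp_a bounded_shell ft_measurable[OF datum_lborel] ft_bound[OF datum_lborel]])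

lemma Tl_add:
  assumes "integrable lborel f" "integrable lborel g"
  shows "Tl l (%y. f y + g y) x = Tl l f x + Tl l g x"
  unfolding Tl_def ft_add[OF datum_lborel[OF assms(1)] datum_lborel[OF assms(2)]] opT_def distrib_left
  by (rule Bochner_Integration.integral_add[OF integrable_Tl_integrand[OF assms(1)] integrable_Tl_integrand[OF assms(2)]])

lemma Tl_cmult: "Tl l (%y. c * f y) x = c * Tl l f x"
proof -
  have "ee x \<xi> * a l (x, \<xi>) * (c * w) = c * (ee x \<xi> * a l (x, \<xi>) * w)" for \<xi> w by simp
  then show ?thesis unfolding Tl_def ft_cmult opT_def by (simp only: integral_mult_right_zero)
qed

lemma Tl_sum:
  assumes "finite A" "\<And>s. s \<in> A ==> integrable lborel (f s)"
  shows "Tl l (%y. \<Sum>s\<in>A. f s y) x = (\<Sum>s\<in>A. Tl l (f s) x)"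
  using assms
proof (induction A rule: finite_induct)
  case empty
  show ?case using Tl_cmult[of l 0 "%_. 0" x] by simp
next
  case (insert s A)
  have "integrable lborel (%y. \<Sum>s\<in>A. f s y)" using insert.prems by (intro Bochner_Integration.integrable_sum) auto
  then show ?case using insert Tl_add[of "f s" "%y. \<Sum>s\<in>A. f s y"] by simp
qed

text \<open>The inputs \<open>u l\<close> may vary with l: in the middle range each frequency meets
  its own set of bad parts.\<close>

lemma orthogonality_EE:
  "\<exists>C\<ge>0. \<forall>A (u :: nat => 'a => complex) e. finite A --> (\<forall>l\<in>A. integrable lborel (u l)) --> (\<forall>l\<in>A. 0 <= e l) -->
     (\<forall>l\<in>A. ennreal (2 powr (- 2 * \<mu> * l)) * EE K lborel (%y. y) (u l) (2 * 2 ^ l) <= ennreal (e l)) -->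
     (\<integral>\<^sup>+x. ennreal ((norm (\<Sum>l\<in>A. Tl l (u l) x))\<^sup>2) \<partial>lborel) <= ennreal (C * (\<Sum>l\<in>A. e l))"
proof -
  obtain C where C: "0 <= C" "\<And>i k (M::'a measure) (Y::'a => 'a) u (M'::'a measure) (Y'::'a => 'a) v. k <= i ==>
    datum M Y u ==> datum M' Y' v ==> integrable lborel (%x. opT (a i) (ft M Y u) x * cnj (opT (a k) (ft M' Y' v) x)) ==>
    ennreal (norm (LINT x|lborel. opT (a i) (ft M Y u) x * cnj (opT (a k) (ft M' Y' v) x))) <=
    ennreal (C * (1 / 2) ^ (i - k)) *
      (ennreal (2 powr (- 2 * \<mu> * i)) * EE K M Y u (2 * 2 ^ i) +
       ennreal (2 powr (- 2 * \<mu> * k)) * EE K M' Y' v (2 * 2 ^ k))"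
    using amp_cross_EE[OF amp \<rho>, where 'm='a and 'n='a and K=K] by auto
  obtain D where D: "0 <= D" "\<And>i (M::'a measure) (Y::'a => 'a) u. datum M Y u ==>
    (\<integral>\<^sup>+x. ennreal ((norm (opT (a i) (ft M Y u) x))\<^sup>2) \<partial>lborel) <= ennreal (D * 2 powr (- 2 * \<mu> * i)) * EE K M Y u (2 * 2 ^ i)"
    using amp_diagonal[OF amp \<rho>, where 'm='a and K=K] by auto
  show ?thesis
  proof (intro exI[of _ "8 * C"] conjI allI impI)
    fix A and u :: "nat => 'a => complex" and e
    assume A: "finite A" and u: "\<forall>l\<in>A. integrable lborel (u l)" and e: "\<forall>l\<in>A. 0 <= e l"
      and E: "\<forall>l\<in>A. ennreal (2 powr (- 2 * \<mu> * l)) * EE K lborel (%y. y) (u l) (2 * 2 ^ l) <= ennreal (e l)"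
    have fin: "(\<integral>\<^sup>+x. ennreal ((norm (Tl l (u l) x))\<^sup>2) \<partial>lborel) < \<infinity>" if l: "l \<in> A" for l
    proof -
      have "(\<integral>\<^sup>+x. ennreal ((norm (Tl l (u l) x))\<^sup>2) \<partial>lborel) <= ennreal (D * 2 powr (- 2 * \<mu> * l)) * EE K lborel (%y. y) (u l) (2 * 2 ^ l)"
        unfolding Tl_def using D(2) datum_lborel u l by blast
      also have "\<dots> = ennreal D * (ennreal (2 powr (- 2 * \<mu> * l)) * EE K lborel (%y. y) (u l) (2 * 2 ^ l))"
        using D(1) by (simp add: ennreal_mult mult.assoc)
      also have "\<dots> <= ennreal D * ennreal (e l)" using E l by (intro mult_left_mono) auto
      also have "\<dots> < \<infinity>" by (simp add: ennreal_mult_less_top)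
      finally show ?thesis .
    qed
    show "(\<integral>\<^sup>+x. ennreal ((norm (\<Sum>l\<in>A. Tl l (u l) x))\<^sup>2) \<partial>lborel) <= ennreal (8 * C * (\<Sum>l\<in>A. e l))"
    proof (rule almost_orthogonal_sum[OF A _ fin _ _ C(1)])
      show "Tl l (u l) \<in> borel_measurable borel" if "l \<in> A" for l using u that by (intro Tl_measurable) auto
      show "0 <= e l" if "l \<in> A" for l using e that by auto
      fix j k assume jk: "j \<in> A" "k \<in> A" "k <= j"
      have "integrable lborel (%x. Tl j (u j) x * cnj (Tl k (u k) x))"
        using jk u fin by (intro integrable_product_L2 Tl_measurable) auto
      then have "ennreal (norm (LINT x|lborel. Tl j (u j) x * cnj (Tl k (u k) x))) <= ennreal (C * (1 / 2) ^ (j - k)) *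
         (ennreal (2 powr (- 2 * \<mu> * j)) * EE K lborel (%y. y) (u j) (2 * 2 ^ j) + ennreal (2 powr (- 2 * \<mu> * k)) * EE K lborel (%y. y) (u k) (2 * 2 ^ k))"
        unfolding Tl_def using jk u by (intro C(2) datum_lborel) auto
      also have "\<dots> <= ennreal (C * (1 / 2) ^ (j - k)) * (ennreal (e j) + ennreal (e k))"
        using E jk by (intro mult_left_mono add_mono) auto
      also have "\<dots> = ennreal (C * (1 / 2) ^ (j - k) * (e j + e k))"
        using C(1) e jk by (simp add: ennreal_plus[symmetric] ennreal_mult[symmetric] del: ennreal_plus)
      finally show "norm (LINT x|lborel. Tl j (u j) x * cnj (Tl k (u k) x)) <= C * (1 / 2) ^ (j - k) * (e j + e k)"
        using C(1) e jk by (subst (asm) ennreal_le_iff) auto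
    qed
  qed (use C in simp)
qed

text \<open>At \<rho> = 1 all windows have width 1 and \<mu> = 0, so the damped input is the same
  for every l and only the shells differ. Keeping \<open>NN\<close> on the shells instead of
  enlarging them to balls preserves their almost disjointness.\<close>

lemma orthogonality_NN:
  assumes "\<rho> = 1"
  shows "\<exists>C\<ge>0. \<forall>A (u :: 'a => complex) e. finite A --> integrable lborel u --> (\<forall>l\<in>A. 0 <= e l) -->
     (\<forall>l\<in>A. NN DIM('a) lborel (%y. y) u 1 (shell l) <= ennreal (e l)) -->
     (\<forall>l\<in>A. (\<integral>\<^sup>+x. ennreal ((norm (Tl l u x))\<^sup>2) \<partial>lborel) < \<infinity>) -->
     (\<integral>\<^sup>+x. ennreal ((norm (\<Sum>l\<in>A. Tl l u x))\<^sup>2) \<partial>lborel) <= ennreal (C * (\<Sum>l\<in>A. e l))"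
proof -
  have h1: "hs \<rho> l = 1" for l by (simp add: hs_def assms)
  have \<mu>0: "\<mu> = 0" by (simp add: \<mu> assms)
  obtain C where C: "0 <= C" "\<And>i k (M::'a measure) (Y::'a => 'a) u (M'::'a measure) (Y'::'a => 'a) v. k <= i ==>
    datum M Y u ==> datum M' Y' v ==> integrable lborel (%x. opT (a i) (ft M Y u) x * cnj (opT (a k) (ft M' Y' v) x)) ==>
    ennreal (norm (LINT x|lborel. opT (a i) (ft M Y u) x * cnj (opT (a k) (ft M' Y' v) x))) <=
    ennreal (C * (1 / 2) ^ (i - k)) * (NN DIM('a) M Y u 1 (shell i) + NN DIM('a) M' Y' v 1 (shell k))"
    using amp_cross_NN[OF amp \<rho>, where 'm='a and 'n='a] by (auto simp: h1 \<mu>0)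
  show ?thesis
  proof (intro exI[of _ "8 * C"] conjI allI impI)
    fix A and u :: "'a => complex" and e
    assume A: "finite A" and u: "integrable lborel u" and e: "\<forall>l\<in>A. 0 <= e l"
      and E: "\<forall>l\<in>A. NN DIM('a) lborel (%y. y) u 1 (shell l) <= ennreal (e l)"
      and fin: "\<forall>l\<in>A. (\<integral>\<^sup>+x. ennreal ((norm (Tl l u x))\<^sup>2) \<partial>lborel) < \<infinity>"
    show "(\<integral>\<^sup>+x. ennreal ((norm (\<Sum>l\<in>A. Tl l u x))\<^sup>2) \<partial>lborel) <= ennreal (8 * C * (\<Sum>l\<in>A. e l))"
    proof (rule almost_orthogonal_sum[OF A _ _ _ _ C(1)])
      show "Tl l u \<in> borel_measurable borel" for l using u by (intro Tl_measurable) auto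
      show "0 <= e l" if "l \<in> A" for l using e that by auto
      show "(\<integral>\<^sup>+x. ennreal ((norm (Tl l u x))\<^sup>2) \<partial>lborel) < \<infinity>" if "l \<in> A" for l using fin that by auto
      fix j k assume jk: "j \<in> A" "k \<in> A" "k <= j"
      have "integrable lborel (%x. Tl j u x * cnj (Tl k u x))"
        using jk u fin by (intro integrable_product_L2 Tl_measurable) auto
      then have "ennreal (norm (LINT x|lborel. Tl j u x * cnj (Tl k u x))) <= ennreal (C * (1 / 2) ^ (j - k)) *
         (NN DIM('a) lborel (%y. y) u 1 (shell j) + NN DIM('a) lborel (%y. y) u 1 (shell k))"
        unfolding Tl_def using jk u by (intro C(2) datum_lborel) auto
      also have "\<dots> <= ennreal (C * (1 / 2) ^ (j - k)) * (ennreal (e j) + ennreal (e k))"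
        using E jk by (intro mult_left_mono add_mono) auto
      also have "\<dots> = ennreal (C * (1 / 2) ^ (j - k) * (e j + e k))"
        using C(1) e jk by (simp add: ennreal_plus[symmetric] ennreal_mult[symmetric] del: ennreal_plus)
      finally show "norm (LINT x|lborel. Tl j u x * cnj (Tl k u x)) <= C * (1 / 2) ^ (j - k) * (e j + e k)"
        using C(1) e jk by (subst (asm) ennreal_le_iff) auto
    qed
  qed (use C in simp)
qed

end

section \<open>Overlap of the shells and L^2 bounds for the dyadic sums\<close>

lemma shell_overlap: "(\<Sum>l\<in>A. indicator (shell l) \<xi> :: ennreal) <= 3" if "finite A"
proof -
  define B where "B = {l\<in>A. \<xi> \<in> shell l}"
  have fB: "finite B" using that by (simp add: B_def)
  \<comment> \<open>From 2^l'/2 <= |\<xi>| <= 2 * 2^l follows l' <= l + 2, so at most three shells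
    meet a point.\<close>
  have near: "l' <= l + 2" if "l \<in> B" "l' \<in> B" for l l'
  proof (cases "l' = 0")
    case False
    then have "2 ^ l' / 2 <= norm \<xi>" "norm \<xi> <= 2 * 2 ^ l" using that by (auto simp: B_def shell_def)
    then have "(2::real) ^ l' <= 4 * 2 ^ l" by linarith
    also have "4 * 2 ^ l = (2::real) ^ (l + 2)" by (simp add: power_add)
    finally show ?thesis by (simp only: power_increasing_iff)
  qed simp
  have "card B <= 3"
  proof (cases "B = {}")
    case False
    define m where "m = Min B"
    have "B \<subseteq> {m..m + 2}" using near[of m] Min_in[OF fB False] Min_le[OF fB] by (auto simp: m_def)
    then have "card B <= card {m..m + 2}" by (intro card_mono) auto
    then show ?thesis by simp
  qed simp
  have "(\<Sum>l\<in>A. indicator (shell l) \<xi> :: ennreal) = (\<Sum>l\<in>B. 1)"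
    using that by (intro sum.mono_neutral_cong_right) (auto simp: B_def)
  also have "\<dots> = of_nat (card B)" by simp
  also have "\<dots> <= of_nat 3" using \<open>card B <= 3\<close> by (intro of_nat_mono)
  finally show ?thesis by simp
qed

lemma NN_sum_shells:
  fixes u :: "'a::euclidean_space => complex"
  assumes u: "integrable lborel u" and A: "finite A" "\<And>l. l \<in> A ==> l <= N"
  shows "(\<Sum>l\<in>A. NN L lborel (%y. y) u h (shell l)) <= 3 * NN L lborel (%y. y) u h (cball 0 (2 * 2 ^ N))"
proof -
  note [measurable] = measurable_ft_wdat[OF datum_lborel[OF u], unfolded split_beta'] borel_closed[OF closed_shell]
    ft_measurable[OF datum_wdat[OF datum_lborel[OF u]]]
  have "(\<Sum>l\<in>A. NN L lborel (%y. y) u h (shell l)) =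
     (\<integral>\<^sup>+q. \<integral>\<^sup>+\<xi>. (\<Sum>l\<in>A. indicator (shell l) \<xi>) * ennreal ((norm (ft lborel (%y. y) (wdat L (%y. y) q h u) \<xi>))\<^sup>2) \<partial>lborel \<partial>lborel)"
    unfolding NN_def by (simp add: nn_integral_sum sum_distrib_right)
  also have "\<dots> <= (\<integral>\<^sup>+q. \<integral>\<^sup>+\<xi>. 3 * (indicator (cball 0 (2 * 2 ^ N)) \<xi> * ennreal ((norm (ft lborel (%y. y) (wdat L (%y. y) q h u) \<xi>))\<^sup>2)) \<partial>lborel \<partial>lborel)"
  proof (intro nn_integral_mono)
    fix q \<xi> :: 'a
    have "(\<Sum>l\<in>A. indicator (shell l) \<xi>) <= 3 * (indicator (cball 0 (2 * 2 ^ N)) \<xi> :: ennreal)"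
    proof (cases "\<xi> \<in> cball 0 (2 * 2 ^ N)")
      case True then show ?thesis using shell_overlap[OF A(1)] by simp
    next
      case False
      have "\<xi> \<notin> shell l" if "l \<in> A" for l
      proof
        assume "\<xi> \<in> shell l"
        then have "norm \<xi> <= 2 * 2 ^ l" by (simp add: shell_def)
        also have "\<dots> <= 2 * 2 ^ N" using A(2)[OF that] by simp
        finally show False using False by simp
      qed
      then show ?thesis by (simp add: sum_nonpos)
    qed
    then show "(\<Sum>l\<in>A. indicator (shell l) \<xi>) * ennreal ((norm (ft lborel (%y. y) (wdat L (%y. y) q h u) \<xi>))\<^sup>2) <=
      3 * (indicator (cball 0 (2 * 2 ^ N)) \<xi> * ennreal ((norm (ft lborel (%y. y) (wdat L (%y. y) q h u) \<xi>))\<^sup>2))"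
      unfolding mult.assoc[symmetric] by (rule mult_right_mono) simp
  qed
  also have "\<dots> = 3 * NN L lborel (%y. y) u h (cball 0 (2 * 2 ^ N))"
  proof -
    have [measurable]: "cball (0::'a) r \<in> sets borel" for r by simp
    have "(\<integral>\<^sup>+\<xi>. 3 * (indicator (cball 0 (2 * 2 ^ N)) \<xi> * ennreal ((norm (ft lborel (%y. y) (wdat L (%y. y) q h u) \<xi>))\<^sup>2)) \<partial>lborel) =
      3 * (\<integral>\<^sup>+\<xi>. indicator (cball 0 (2 * 2 ^ N)) \<xi> * ennreal ((norm (ft lborel (%y. y) (wdat L (%y. y) q h u) \<xi>))\<^sup>2) \<partial>lborel)" for q
      by (rule nn_integral_cmult) measurable
    then show ?thesis unfolding NN_def by (simp only:) (rule nn_integral_cmult, measurable)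
  qed
  finally show ?thesis .
qed

context sing
begin

definition Sq :: "('a => complex) => ennreal" where
  "Sq f = (\<integral>\<^sup>+x. ennreal ((norm (f x))\<^sup>2) \<partial>lborel)"

lemma Tl_L2_finite:
  assumes f: "integrable lborel f" and "Sq f < \<infinity>"
  shows "Sq (Tl l f) < \<infinity>"
proof -
  have [measurable]: "f \<in> borel_measurable borel" using borel_measurable_integrable[OF f] by simp
  obtain D where D: "0 <= D" "\<And>i (M::'a measure) (Y::'a => 'a) u. datum M Y u ==>
    (\<integral>\<^sup>+x. ennreal ((norm (opT (a i) (ft M Y u) x))\<^sup>2) \<partial>lborel) <= ennreal (D * 2 powr (- 2 * \<mu> * i)) * EE DIM('a) M Y u (2 * 2 ^ i)"
    using amp_diagonal[OF amp \<rho>, where 'm='a and K="DIM('a)"] by auto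
  have "Sq (Tl l f) <= ennreal (D * 2 powr (- 2 * \<mu> * l)) * EE DIM('a) lborel (%y. y) f (2 * 2 ^ l)"
    unfolding Sq_def Tl_def by (rule D(2)[OF datum_lborel[OF f]])
  also have "\<dots> <= ennreal (D * 2 powr (- 2 * \<mu> * l)) * (ennreal (2 * (LINT z|lborel. jw DIM('a) (z::'a))) * Sq f)"
    unfolding Sq_def by (intro mult_left_mono EE_le_L2) auto
  also have "\<dots> < \<infinity>" using assms(2) by (auto simp: ennreal_mult_less_top)
  finally show ?thesis .
qed

text \<open>For \<open>\<rho> < 1\<close> the order \<open>-\<mu>\<close> is negative and the dyadic pieces are summable in \<open>L\<^sup>2\<close>; for
  \<open>\<rho> = 1\<close> summability comes from the almost disjointness of the frequency shells.\<close>

lemma L2_dyadic: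
  "\<exists>C\<ge>0. \<forall>f. integrable lborel f --> Sq f < \<infinity> --> (\<exists>e. (\<forall>l. 0 <= e l) \<and>
     (\<forall>A. finite A --> (\<Sum>l\<in>A. e l) <= C * enn2real (Sq f)) \<and>
     (\<forall>A. finite A --> Sq (%x. \<Sum>l\<in>A. Tl l f x) <= ennreal (C * (\<Sum>l\<in>A. e l))))"
proof (cases "\<rho> = 1")
  case False
  then have mpos: "0 < \<mu>" using \<rho> by (simp add: \<mu>)
  define J where "J = 2 * (LINT z|lborel. jw DIM('a) (z::'a))"
  have J: "0 <= J" unfolding J_def by (intro mult_nonneg_nonneg integral_nonneg_AE) auto
  obtain C where C: "0 <= C" "\<And>A (u :: nat => 'a => complex) e. finite A ==> (\<forall>l\<in>A. integrable lborel (u l)) ==> (\<forall>l\<in>A. 0 <= e l) ==>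
     (\<forall>l\<in>A. ennreal (2 powr (- 2 * \<mu> * l)) * EE DIM('a) lborel (%y. y) (u l) (2 * 2 ^ l) <= ennreal (e l)) ==>
     (\<integral>\<^sup>+x. ennreal ((norm (\<Sum>l\<in>A. Tl l (u l) x))\<^sup>2) \<partial>lborel) <= ennreal (C * (\<Sum>l\<in>A. e l))"
    using orthogonality_EE[of "DIM('a)"] by blast
  define t where "t = 2 powr (- 2 * \<mu>)"
  have t: "0 < t" "t < 1" using mpos by (auto simp: t_def powr_less_one)
  have tl: "2 powr (- 2 * \<mu> * real l) = t ^ l" for l
    by (simp add: t_def powr_realpow[symmetric] powr_powr)
  define D where "D = J * (1 / (1 - t))"
  have D: "0 <= D" using J t by (simp add: D_def)
  show ?thesis
  proof (intro exI[of _ "max C D"] conjI allI impI)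
    fix f :: "'a => complex" assume f: "integrable lborel f" and S: "Sq f < \<infinity>"
    have [measurable]: "f \<in> borel_measurable borel" using borel_measurable_integrable[OF f] by simp
    define s where "s = enn2real (Sq f)"
    have s: "Sq f = ennreal s" "0 <= s" using S by (auto simp: s_def)
    \<comment> \<open>The claim asks for a majorant per frequency and not for one bound of the whole
      sum, because its tails later give the Cauchy property in measure. For \<rho> < 1 it is
      geometric with ratio 2^(-2\<mu>).\<close>
    define e where "e l = t ^ l * (J * s)" for l
    show "\<exists>e. (\<forall>l. 0 <= e l) \<and> (\<forall>A. finite A --> (\<Sum>l\<in>A. e l) <= max C D * enn2real (Sq f)) \<and>
     (\<forall>A. finite A --> Sq (%x. \<Sum>l\<in>A. Tl l f x) <= ennreal (max C D * (\<Sum>l\<in>A. e l)))"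
    proof (intro exI[of _ e] conjI allI impI)
      show e0: "0 <= e l" for l using t J s by (simp add: e_def)
      fix A :: "nat set" assume A: "finite A"
      have "(\<Sum>l\<in>A. t ^ l) <= (\<Sum>l. t ^ l)" using t A by (intro sum_le_suminf summable_geometric) auto
      also have "\<dots> = 1 / (1 - t)" using t by (intro suminf_geometric) auto
      finally have "(\<Sum>l\<in>A. t ^ l) * (J * s) <= 1 / (1 - t) * (J * s)" using J s by (intro mult_right_mono) auto
      moreover have "(\<Sum>l\<in>A. e l) = (\<Sum>l\<in>A. t ^ l) * (J * s)" unfolding e_def by (rule sum_distrib_right[symmetric])
      ultimately have "(\<Sum>l\<in>A. e l) <= D * s" by (simp add: D_def mult_ac)
      also have "\<dots> <= max C D * s" using s by (intro mult_right_mono) auto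
      finally show "(\<Sum>l\<in>A. e l) <= max C D * enn2real (Sq f)" by (simp add: s_def)
      have "Sq (%x. \<Sum>l\<in>A. Tl l f x) <= ennreal (C * (\<Sum>l\<in>A. e l))"
        unfolding Sq_def
      proof (rule C(2)[OF A])
        show "\<forall>l\<in>A. ennreal (2 powr (- 2 * \<mu> * l)) * EE DIM('a) lborel (%y. y) f (2 * 2 ^ l) <= ennreal (e l)"
        proof
          fix l
          have "ennreal (t ^ l) * EE DIM('a) lborel (%y. y) f (2 * 2 ^ l) <= ennreal (t ^ l) * (ennreal J * Sq f)"
            unfolding J_def Sq_def by (intro mult_left_mono EE_le_L2) auto
          also have "\<dots> = ennreal (e l)" using t J s by (simp add: e_def ennreal_mult)
          finally show "ennreal (2 powr (- 2 * \<mu> * l)) * EE DIM('a) lborel (%y. y) f (2 * 2 ^ l) <= ennreal (e l)" by (simp only: tl)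
        qed
      qed (use f e0 in auto)
      also have "\<dots> <= ennreal (max C D * (\<Sum>l\<in>A. e l))"
        using e0 by (intro ennreal_leI mult_right_mono sum_nonneg) auto
      finally show "Sq (%x. \<Sum>l\<in>A. Tl l f x) <= ennreal (max C D * (\<Sum>l\<in>A. e l))" .
    qed
  qed (use C in auto)
next
  case True
  obtain C where C: "0 <= C" "\<And>A (u :: 'a => complex) e. finite A ==> integrable lborel u ==> (\<forall>l\<in>A. 0 <= e l) ==>
     (\<forall>l\<in>A. NN DIM('a) lborel (%y. y) u 1 (shell l) <= ennreal (e l)) ==>
     (\<forall>l\<in>A. (\<integral>\<^sup>+x. ennreal ((norm (Tl l u x))\<^sup>2) \<partial>lborel) < \<infinity>) ==>
     (\<integral>\<^sup>+x. ennreal ((norm (\<Sum>l\<in>A. Tl l u x))\<^sup>2) \<partial>lborel) <= ennreal (C * (\<Sum>l\<in>A. e l))"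
    using orthogonality_NN[OF True] by blast
  obtain D where D: "0 <= D" "\<And>(M::'a measure) (Y::'a => 'a) u h R. datum M Y u ==> 0 < h ==> 0 < R ==>
    NN DIM('a) M Y u h (cball 0 R) <= ennreal (D * h ^ DIM('a)) * EE DIM('a) M Y u R"
    using NN_le_EE[where 'a='a and 'm='a and L="DIM('a)" and K="DIM('a)"] by blast
  define J where "J = 2 * (LINT z|lborel. jw DIM('a) (z::'a))"
  have J: "0 <= J" unfolding J_def by (intro mult_nonneg_nonneg integral_nonneg_AE) auto
  show ?thesis
  proof (intro exI[of _ "max C (3 * D * J)"] conjI allI impI)
    fix f :: "'a => complex" assume f: "integrable lborel f" and S: "Sq f < \<infinity>"
    have [measurable]: "f \<in> borel_measurable borel" using borel_measurable_integrable[OF f] by simp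
    define s where "s = enn2real (Sq f)"
    have s: "Sq f = ennreal s" "0 <= s" using S by (auto simp: s_def)
    \<comment> \<open>For \<rho> = 1 the majorant is the energy on the single shell; it need not
      decay at any rate, but its sums are bounded by the overlap count.\<close>
    define e where "e l = enn2real (NN DIM('a) lborel (%y. y) f 1 (shell l))" for l
    have sumN: "(\<Sum>l\<in>A. NN DIM('a) lborel (%y. y) f 1 (shell l)) <= ennreal (3 * D * J * s)" if A: "finite A" for A
    proof -
      obtain N where N: "\<And>l. l \<in> A ==> l <= N" using A finite_nat_set_iff_bounded_le by auto
      have "(\<Sum>l\<in>A. NN DIM('a) lborel (%y. y) f 1 (shell l)) <= 3 * NN DIM('a) lborel (%y. y) f 1 (cball 0 (2 * 2 ^ N))"
        by (rule NN_sum_shells[OF f A N])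
      also have "\<dots> <= 3 * (ennreal (D * 1 ^ DIM('a)) * EE DIM('a) lborel (%y. y) f (2 * 2 ^ N))"
        by (intro mult_left_mono D(2) datum_lborel f) auto
      also have "\<dots> <= 3 * (ennreal (D * 1 ^ DIM('a)) * (ennreal J * Sq f))"
        unfolding J_def Sq_def by (intro mult_left_mono EE_le_L2) auto
      also have "\<dots> = ennreal (3 * D * J * s)" using D(1) J s by (simp add: ennreal_mult mult.assoc)
      finally show ?thesis .
    qed
    have eN: "NN DIM('a) lborel (%y. y) f 1 (shell l) = ennreal (e l)" for l
    proof -
      have "NN DIM('a) lborel (%y. y) f 1 (shell l) <= ennreal (3 * D * J * s)" using sumN[of "{l}"] by simp
      then have "NN DIM('a) lborel (%y. y) f 1 (shell l) < top" by (rule le_less_trans) simp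
      then show ?thesis by (simp add: e_def)
    qed
    show "\<exists>e. (\<forall>l. 0 <= e l) \<and> (\<forall>A. finite A --> (\<Sum>l\<in>A. e l) <= max C (3 * D * J) * enn2real (Sq f)) \<and>
     (\<forall>A. finite A --> Sq (%x. \<Sum>l\<in>A. Tl l f x) <= ennreal (max C (3 * D * J) * (\<Sum>l\<in>A. e l)))"
    proof (intro exI[of _ e] conjI allI impI)
      show e0: "0 <= e l" for l by (simp add: e_def)
      fix A :: "nat set" assume A: "finite A"
      have "ennreal (\<Sum>l\<in>A. e l) <= ennreal (3 * D * J * s)"
        using sumN[OF A] by (simp add: eN e0 sum_nonneg)
      then have "(\<Sum>l\<in>A. e l) <= 3 * D * J * s" using D(1) J s by (subst (asm) ennreal_le_iff) auto
      also have "\<dots> <= max C (3 * D * J) * s" using s by (intro mult_right_mono) auto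
      finally show "(\<Sum>l\<in>A. e l) <= max C (3 * D * J) * enn2real (Sq f)" by (simp add: s_def)
      have "Sq (%x. \<Sum>l\<in>A. Tl l f x) <= ennreal (C * (\<Sum>l\<in>A. e l))"
        unfolding Sq_def
        by (rule C(2)[OF A f]) (use e0 eN Tl_L2_finite[OF f S] in \<open>auto simp: Sq_def\<close>)
      also have "\<dots> <= ennreal (max C (3 * D * J) * (\<Sum>l\<in>A. e l))"
        using e0 by (intro ennreal_leI mult_right_mono sum_nonneg) auto
      finally show "Sq (%x. \<Sum>l\<in>A. Tl l f x) <= ennreal (max C (3 * D * J) * (\<Sum>l\<in>A. e l))" .
    qed
  qed (use C in auto)
qed

text \<open>Tonelli. The kernel \<open>k\<close> has to represent \<open>T\<close> only for the
  given \<open>f\<close>, which allows subtracting a part that \<open>f\<close> integrates to 0; the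
  set \<open>E\<close> allows restricting the output to points away from the support of
  \<open>f\<close>.\<close>

lemma Tl_L1_gen:
  fixes k :: "'a => 'a => complex"
  assumes f: "integrable lborel f" and k[measurable]: "(%(x, y). k x y) \<in> borel_measurable (lborel \<Otimes>\<^sub>M lborel)"
    and [measurable]: "E \<in> sets borel"
    and T: "\<And>x. x \<in> E ==> T x = (LINT y|lborel. f y * k x y)"
    and B: "\<And>y. f y \<noteq> 0 ==> (\<integral>\<^sup>+x. indicator E x * ennreal (norm (k x y)) \<partial>lborel) <= ennreal B"
  shows "(\<integral>\<^sup>+x. indicator E x * ennreal (norm (T x)) \<partial>lborel) <= ennreal B * (\<integral>\<^sup>+y. ennreal (norm (f y)) \<partial>lborel)"
proof -
  have [measurable]: "f \<in> borel_measurable borel" using borel_measurable_integrable[OF f] by simp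
  have "(\<integral>\<^sup>+x. indicator E x * ennreal (norm (T x)) \<partial>lborel) <= (\<integral>\<^sup>+x. \<integral>\<^sup>+y. ennreal (norm (f y)) * (indicator E x * ennreal (norm (k x y))) \<partial>lborel \<partial>lborel)"
  proof (rule nn_integral_mono)
    fix x
    show "indicator E x * ennreal (norm (T x)) <= (\<integral>\<^sup>+y. ennreal (norm (f y)) * (indicator E x * ennreal (norm (k x y))) \<partial>lborel)"
    proof (cases "x \<in> E")
      case True
      have "ennreal (norm (LINT y|lborel. f y * k x y)) <= (\<integral>\<^sup>+y. ennreal (norm (f y * k x y)) \<partial>lborel)"
        by (cases "integrable lborel (%y. f y * k x y)")
          (auto intro!: integral_norm_bound_ennreal simp: not_integrable_integral_eq)
      then show ?thesis using T[OF True] True by (simp add: norm_mult ennreal_mult)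
    qed simp
  qed
  also have "\<dots> = (\<integral>\<^sup>+y. \<integral>\<^sup>+x. ennreal (norm (f y)) * (indicator E x * ennreal (norm (k x y))) \<partial>lborel \<partial>lborel)"
    by (rule lborel_pair.Fubini'[symmetric]) measurable
  also have "\<dots> <= (\<integral>\<^sup>+y. ennreal B * ennreal (norm (f y)) \<partial>lborel)"
  proof (rule nn_integral_mono)
    fix y
    have "(\<integral>\<^sup>+x. ennreal (norm (f y)) * (indicator E x * ennreal (norm (k x y))) \<partial>lborel) = ennreal (norm (f y)) * (\<integral>\<^sup>+x. indicator E x * ennreal (norm (k x y)) \<partial>lborel)"
      by (rule nn_integral_cmult) measurable
    also have "\<dots> <= ennreal (norm (f y)) * ennreal B"
      using B[of y] by (cases "f y = 0") (auto intro!: mult_left_mono)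
    finally show "(\<integral>\<^sup>+x. ennreal (norm (f y)) * (indicator E x * ennreal (norm (k x y))) \<partial>lborel) <= ennreal B * ennreal (norm (f y))"
      by (simp add: mult.commute)
  qed
  also have "\<dots> = ennreal B * (\<integral>\<^sup>+y. ennreal (norm (f y)) \<partial>lborel)" by (rule nn_integral_cmult) measurable
  finally show ?thesis .
qed

end

section \<open>Dyadic cells\<close>

text \<open>The lower corner of the half-open dyadic cube of side 2^(-s) containing x; cells are
  represented by their corners. As s is a natural number, the sides are at most 1.\<close>

definition cell :: "nat => 'a::euclidean_space => 'a" where
  "cell s x = (\<Sum>b\<in>Basis. (real_of_int \<lfloor>2 ^ s * (x \<bullet> b)\<rfloor> / 2 ^ s) *\<^sub>R b)"

lemma cell_inner: "b \<in> Basis ==> cell s x \<bullet> b = real_of_int \<lfloor>2 ^ s * (x \<bullet> b)\<rfloor> / 2 ^ s"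
  by (simp add: cell_def inner_sum_left_Basis)

lemma cell_eq_iff: "cell s x = cell s y \<longleftrightarrow> (\<forall>b\<in>Basis. \<lfloor>2 ^ s * (x \<bullet> b)\<rfloor> = \<lfloor>2 ^ s * (y \<bullet> b)\<rfloor>)"
  by (auto simp: euclidean_eq_iff[of "cell s x"] cell_inner)

text \<open>Nesting of the cells: the floor at the coarser scale is an integer quotient of the floor
  at the finer one.\<close>

lemma cell_coarser:
  assumes "t <= s" "cell s x = cell s y" shows "cell t x = cell t y"
proof -
  have "\<lfloor>2 ^ t * c\<rfloor> = \<lfloor>2 ^ s * c\<rfloor> div 2 ^ (s - t)" for c :: real
  proof -
    have "(2::real) ^ s = 2 ^ t * 2 ^ (s - t)" using assms(1) by (simp flip: power_add)
    then have "2 ^ t * c = 2 ^ s * c / real_of_int (2 ^ (s - t))" by simp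
    then show ?thesis using floor_divide_real_eq_div[of "2 ^ (s - t)" "2 ^ s * c"] by simp
  qed
  then show ?thesis using assms(2) by (auto simp: cell_eq_iff)
qed

lemma cell_dist: "norm (x - cell s (x::'a::euclidean_space)) <= DIM('a) / 2 ^ s"
proof -
  have "norm (x - cell s x) <= (\<Sum>b\<in>Basis. \<bar>(x - cell s x) \<bullet> b\<bar>)" by (rule norm_le_l1)
  also have "\<dots> <= (\<Sum>b\<in>(Basis::'a set). 1 / 2 ^ s)"
  proof (rule sum_mono)
    fix b :: 'a assume b: "b \<in> Basis"
    define c where "c = 2 ^ s * (x \<bullet> b)"
    have "(x - cell s x) \<bullet> b = (c - real_of_int \<lfloor>c\<rfloor>) / 2 ^ s"
      using b by (simp add: inner_diff_left cell_inner c_def diff_divide_distrib)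
    moreover have "\<bar>c - real_of_int \<lfloor>c\<rfloor>\<bar> <= 1" by linarith
    ultimately show "\<bar>(x - cell s x) \<bullet> b\<bar> <= 1 / 2 ^ s" by (simp add: divide_right_mono)
  qed
  finally show ?thesis by simp
qed

lemma borel_measurable_cell [measurable]: "cell s \<in> borel_measurable borel"
  unfolding cell_def by measurable

text \<open>Integral kernel of the conditional expectation onto the cells of scale s. Below,
  \<open>inv_cell\<close> singles out the functions constant on cells, and \<open>cav\<close> and
  \<open>cavg\<close> are the expectation of nonnegative and of complex functions.\<close>

definition ck :: "nat => 'a::euclidean_space => 'a => real" where
  "ck s x y = (if cell s x = cell s y then 2 ^ (s * DIM('a)) else 0)"

lemma ck_sym: "ck s x y = ck s y x" by (simp add: ck_def)
lemma ck_nonneg [simp]: "0 <= ck s x y" by (simp add: ck_def)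

lemma borel_measurable_ck [measurable (raw)]:
  fixes f g :: "'m => 'a::euclidean_space"
  assumes [measurable]: "f \<in> borel_measurable M" "g \<in> borel_measurable M"
  shows "(%x. ck s (f x) (g x)) \<in> borel_measurable M"
  unfolding ck_def by measurable

lemma ck_integral: "(\<integral>\<^sup>+x. ennreal (ck s x (y::'a::euclidean_space)) \<partial>lborel) = 1"
proof -
  define n where "n = DIM('a)"
  define l u where "l = cell s y" and "u = cell s y + (1 / 2 ^ s) *\<^sub>R One"
  define Q where "Q = {x. cell s x = cell s y}"
  have [measurable]: "Q \<in> sets borel" unfolding Q_def by measurable
  have ub: "u \<bullet> b = (real_of_int \<lfloor>2 ^ s * (y \<bullet> b)\<rfloor> + 1) / 2 ^ s" if "b \<in> Basis" for b
    using that by (simp add: u_def inner_add_left cell_inner add_divide_distrib)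
  have Q: "x \<in> Q \<longleftrightarrow> (\<forall>b\<in>Basis. l \<bullet> b <= x \<bullet> b \<and> x \<bullet> b < u \<bullet> b)" for x
  proof -
    have "\<lfloor>2 ^ s * (x \<bullet> b)\<rfloor> = \<lfloor>2 ^ s * (y \<bullet> b)\<rfloor> \<longleftrightarrow> l \<bullet> b <= x \<bullet> b \<and> x \<bullet> b < u \<bullet> b" if "b \<in> Basis" for b
      unfolding floor_eq_iff ub[OF that] l_def cell_inner[OF that] by (simp add: field_simps)
    then show ?thesis by (simp add: Q_def cell_eq_iff)
  qed
  have lu: "\<And>b. b \<in> Basis ==> l \<bullet> b <= u \<bullet> b" by (simp add: l_def u_def inner_add_left)
  have pr: "(\<Prod>b\<in>Basis. (u - l) \<bullet> b) = 1 / 2 ^ (s * n)"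
    by (simp add: l_def u_def n_def power_one_over power_mult)
  have "emeasure lborel (box l u) <= emeasure lborel Q"
    by (rule emeasure_mono) (auto simp: Q mem_box less_imp_le)
  moreover have "emeasure lborel Q <= emeasure lborel (cbox l u)"
    by (rule emeasure_mono) (auto simp: Q mem_box less_imp_le)
  ultimately have em: "emeasure lborel Q = ennreal (1 / 2 ^ (s * n))"
    using emeasure_lborel_box[OF lu] emeasure_lborel_cbox[OF lu] pr by simp
  have "(\<integral>\<^sup>+x. ennreal (ck s x y) \<partial>lborel) = (\<integral>\<^sup>+x. ennreal (2 ^ (s * n)) * indicator Q x \<partial>lborel)"
    by (intro nn_integral_cong) (simp add: ck_def Q_def n_def)
  also have "\<dots> = ennreal (2 ^ (s * n)) * ennreal (1 / 2 ^ (s * n))" by (simp add: nn_integral_cmult em)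
  also have "\<dots> = 1" by (simp add: ennreal_mult[symmetric])
  finally show ?thesis .
qed

lemma ck_integral': "(\<integral>\<^sup>+y. ennreal (ck s x (y::'a::euclidean_space)) \<partial>lborel) = 1"
  using ck_integral[of s x] by (simp add: ck_sym)

definition inv_cell :: "nat => ('a::euclidean_space => 'b) => bool" where
  "inv_cell s \<psi> \<longleftrightarrow> (\<forall>x y. cell s x = cell s y --> \<psi> x = \<psi> y)"

lemma inv_cellD: "inv_cell s \<psi> ==> cell s x = cell s y ==> \<psi> x = \<psi> y"
  unfolding inv_cell_def by blast

definition cav :: "nat => ('a::euclidean_space => ennreal) => 'a => ennreal" where
  "cav s g x = (\<integral>\<^sup>+y. ennreal (ck s x y) * g y \<partial>lborel)"

definition cavg :: "nat => ('a::euclidean_space => complex) => 'a => complex" where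
  "cavg s u x = (LINT y|lborel. of_real (ck s x y) * u y)"

lemma borel_measurable_cav [measurable]:
  assumes [measurable]: "g \<in> borel_measurable borel" shows "cav s g \<in> borel_measurable borel"
  unfolding cav_def by measurable

lemma borel_measurable_cavg [measurable]:
  assumes [measurable]: "u \<in> borel_measurable borel" shows "cavg s u \<in> borel_measurable borel"
  unfolding cavg_def by measurable

lemma ck_cong: "cell s x = cell s x' ==> ck s x y = ck s x' y"
  by (simp add: ck_def)

lemma inv_cell_cav: assumes "t <= s" shows "inv_cell s (cav t g)"
  unfolding inv_cell_def
proof (intro allI impI)
  fix x y :: 'a assume "cell s x = cell s y"
  then have "ck t x = ck t y" using ck_cong[OF cell_coarser[OF assms]] by blast
  then show "cav t g x = cav t g y" by (simp add: cav_def)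
qed

lemma inv_cell_cavg: "inv_cell s (cavg s g)"
  unfolding inv_cell_def
proof (intro allI impI)
  fix x y :: 'a assume "cell s x = cell s y"
  then have "ck s x = ck s y" using ck_cong by blast
  then show "cavg s g x = cavg s g y" by (simp add: cavg_def)
qed

text \<open>The expectation can be moved to \<psi>, which it fixes: \<open>ck\<close> is symmetric,
  has integral 1 and vanishes unless both arguments lie in one cell, where \<psi> is
  constant.\<close>

lemma cav_invariant:
  assumes [measurable]: "g \<in> borel_measurable borel" "\<psi> \<in> borel_measurable borel" and i: "inv_cell s \<psi>"
  shows "(\<integral>\<^sup>+x. cav s g x * \<psi> x \<partial>lborel) = (\<integral>\<^sup>+y. g y * \<psi> y \<partial>lborel)"
proof -
  have "(\<integral>\<^sup>+x. cav s g x * \<psi> x \<partial>lborel) = (\<integral>\<^sup>+x. \<integral>\<^sup>+y. ennreal (ck s x y) * g y * \<psi> x \<partial>lborel \<partial>lborel)"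
    by (simp add: cav_def nn_integral_multc)
  also have "\<dots> = (\<integral>\<^sup>+x. \<integral>\<^sup>+y. ennreal (ck s x y) * (g y * \<psi> y) \<partial>lborel \<partial>lborel)"
  proof (intro nn_integral_cong)
    fix x y show "ennreal (ck s x y) * g y * \<psi> x = ennreal (ck s x y) * (g y * \<psi> y)"
      using inv_cellD[OF i, of x y] by (simp add: ck_def mult.assoc)
  qed
  also have "\<dots> = (\<integral>\<^sup>+y. \<integral>\<^sup>+x. ennreal (ck s x y) * (g y * \<psi> y) \<partial>lborel \<partial>lborel)"
    by (rule lborel_pair.Fubini'[symmetric]) measurable
  also have "\<dots> = (\<integral>\<^sup>+y. g y * \<psi> y \<partial>lborel)" by (simp add: nn_integral_multc ck_integral)
  finally show ?thesis .
qed

lemma norm_cavg_le: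
  "ennreal (norm (cavg s u x)) <= cav s (%y. ennreal (norm (u y))) x"
proof -
  have "ennreal (norm (cavg s u x)) <= (\<integral>\<^sup>+y. ennreal (norm (of_real (ck s x y) * u y)) \<partial>lborel)"
    unfolding cavg_def
    by (cases "integrable lborel (%y. of_real (ck s x y) * u y)")
      (auto intro!: integral_norm_bound_ennreal simp: not_integrable_integral_eq)
  then show ?thesis by (simp add: cav_def norm_mult ennreal_mult)
qed

lemma cavg_L1:
  assumes [measurable]: "u \<in> borel_measurable borel" "S \<in> sets borel" and i: "inv_cell s (%x. indicator S x :: ennreal)"
  shows "(\<integral>\<^sup>+x. ennreal (norm (cavg s u x)) * indicator S x \<partial>lborel) <= (\<integral>\<^sup>+x. ennreal (norm (u x)) * indicator S x \<partial>lborel)"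
proof -
  have "(\<integral>\<^sup>+x. ennreal (norm (cavg s u x)) * indicator S x \<partial>lborel) <= (\<integral>\<^sup>+x. cav s (%y. ennreal (norm (u y))) x * indicator S x \<partial>lborel)"
    by (intro nn_integral_mono mult_right_mono norm_cavg_le) auto
  also have "\<dots> = (\<integral>\<^sup>+x. ennreal (norm (u x)) * indicator S x \<partial>lborel)"
    by (rule cav_invariant[OF _ _ i]) measurable
  finally show ?thesis .
qed

lemma integrable_cavg:
  assumes u: "integrable lborel u" shows "integrable lborel (cavg s u)"
proof (rule integrableI_bounded)
  have [measurable]: "u \<in> borel_measurable borel" using borel_measurable_integrable[OF u] by simp
  show "cavg s u \<in> borel_measurable lborel" by simp
  have "(\<integral>\<^sup>+x. ennreal (norm (cavg s u x)) \<partial>lborel) <= (\<integral>\<^sup>+x. ennreal (norm (u x)) \<partial>lborel)"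
    using cavg_L1[of u UNIV s] unfolding inv_cell_def by simp
  also have "\<dots> < \<infinity>" using u by (simp add: integrable_iff_bounded)
  finally show "(\<integral>\<^sup>+x. ennreal (norm (cavg s u x)) \<partial>lborel) < \<infinity>" .
qed

lemma cavg_invariant:
  fixes u \<psi> :: "'a::euclidean_space => complex"
  assumes u: "integrable lborel u" and p[measurable]: "\<psi> \<in> borel_measurable borel" and b: "\<And>x. norm (\<psi> x) <= B" and i: "inv_cell s \<psi>"
  shows "(LINT x|lborel. cavg s u x * \<psi> x) = (LINT y|lborel. u y * \<psi> y)"
proof -
  have [measurable]: "u \<in> borel_measurable borel" using borel_measurable_integrable[OF u] by simp
  define P where "P y x = of_real (ck s x y) * (u y * \<psi> y)" for x y
  have ckr: "(LINT x|lborel. ck s x y) = 1" "integrable lborel (%x. ck s x y)" for y :: 'a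
  proof -
    show "integrable lborel (%x. ck s x y)" by (rule integrableI_nonneg) (auto simp: ck_integral)
    show "(LINT x|lborel. ck s x y) = 1"
      by (subst integral_eq_nn_integral) (auto simp: ck_integral)
  qed
  have iu: "integrable lborel (%y. u y * \<psi> y)"
  proof (rule Bochner_Integration.integrable_bound)
    show "integrable lborel (%y. of_real B * u y)" using u by simp
    have "norm (u y) * norm (\<psi> y) <= \<bar>B\<bar> * norm (u y)" for y
      using mult_left_mono[OF order_trans[OF b[of y] abs_ge_self] norm_ge_zero[of "u y"]] by (simp add: mult.commute)
    then show "AE y in lborel. norm (u y * \<psi> y) <= norm (of_real B * u y)" by (simp add: norm_mult)
  qed simp
  have iP: "integrable (lborel \<Otimes>\<^sub>M lborel) (%(y, x). P y x)"
  proof (rule lborel_pair.Fubini_integrable)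
    show "(%(y, x). P y x) \<in> borel_measurable (lborel \<Otimes>\<^sub>M lborel)" unfolding P_def by measurable
    have "(%y. LINT x|lborel. norm (P y x)) = (%y. norm (u y * \<psi> y))"
      by (simp add: P_def norm_mult ckr)
    then show "integrable lborel (%y. LINT x|lborel. norm (case (y, x) of (y, x) => P y x))" using iu by simp
    show "AE y in lborel. integrable lborel (%x. case (y, x) of (y, x) => P y x)"
      using ckr(2) by (simp add: P_def)
  qed
  have "(LINT x|lborel. cavg s u x * \<psi> x) = (LINT x|lborel. LINT y|lborel. P y x)"
  proof (intro Bochner_Integration.integral_cong refl)
    fix x
    have "P y x = of_real (ck s x y) * u y * \<psi> x" for y
      using inv_cellD[OF i, of x y] by (simp add: P_def ck_def)
    then show "cavg s u x * \<psi> x = (LINT y|lborel. P y x)" by (simp only: cavg_def integral_mult_left_zero)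
  qed
  also have "\<dots> = (LINT y|lborel. LINT x|lborel. P y x)" using lborel_pair.Fubini_integral[where f=P] iP by simp
  also have "\<dots> = (LINT y|lborel. u y * \<psi> y)"
    unfolding P_def by (simp add: ckr)
  finally show ?thesis .
qed

section \<open>Potentials of functions with bounded cell averages\<close>

lemma jw_shift:
  fixes z w :: "'a::euclidean_space"
  assumes "norm w <= d" shows "jw K (z + w) <= (2 + 2 * d\<^sup>2) ^ K * jw K z"
proof -
  have d: "0 <= d" using order_trans[OF norm_ge_zero assms] .
  have w2: "(norm w)\<^sup>2 <= d\<^sup>2" using assms by (intro power_mono) auto
  have "norm z <= norm (z + w) + norm w" using norm_triangle_ineq4[of "z + w" w] by simp
  then have "(norm z)\<^sup>2 <= (norm (z + w) + norm w)\<^sup>2" by (intro power_mono) auto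
  also have "\<dots> <= 2 * (norm (z + w))\<^sup>2 + 2 * (norm w)\<^sup>2"
    using sum_squares_bound[of "norm (z + w)" "norm w"] by (simp add: power2_sum)
  finally have "1 + (norm z)\<^sup>2 <= 1 + 2 * (norm (z + w))\<^sup>2 + 2 * d\<^sup>2" using w2 by linarith
  also have "\<dots> <= (2 + 2 * d\<^sup>2) * (1 + (norm (z + w))\<^sup>2)"
    using mult_nonneg_nonneg[of "d\<^sup>2" "(norm (z + w))\<^sup>2"] by (simp add: algebra_simps)
  finally have "(1 + (norm z)\<^sup>2) ^ K <= ((2 + 2 * d\<^sup>2) * (1 + (norm (z + w))\<^sup>2)) ^ K"
    by (intro power_mono) auto
  then have "(1 + (norm z)\<^sup>2) ^ K <= (2 + 2 * d\<^sup>2) ^ K * (1 + (norm (z + w))\<^sup>2) ^ K"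
    by (simp only: power_mult_distrib)
  moreover have "0 < (1 + (norm z)\<^sup>2) ^ K" "0 < (1 + (norm (z + w))\<^sup>2) ^ K"
    by (intro zero_less_power add_pos_nonneg; simp)+
  moreover have "1 / b <= c * (1 / a)" if "a <= c * b" "0 < a" "0 < b" for a b c :: real
    using that by (simp add: field_simps)
  ultimately show ?thesis unfolding jw_def by blast
qed

text \<open>As R >= 2^s, the weight at scale R is at most the one at scale 2^s, which by Peetre's
  inequality \<open>jw_shift\<close> varies little on a cell. So y' can be moved to the corner of
  its cell, \<beta> replaced by its average, and the corner moved back; the two moves give the
  square in the constant. Lowering R to 2^s in the weight but not in R^n is where (R/2^s)^n is
  lost.\<close>

lemma cell_potential_bound:
  fixes \<beta> :: "'a::euclidean_space => ennreal"
  assumes [measurable]: "\<beta> \<in> borel_measurable borel" and c: "\<And>x. cav s \<beta> x <= ennreal \<Lambda>" and \<Lambda>: "0 <= \<Lambda>" and R: "2 ^ s <= R"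
  shows "(\<integral>\<^sup>+y'. \<beta> y' * ennreal (R ^ DIM('a) * jw DIM('a) (R *\<^sub>R (y - y'))) \<partial>lborel) <=
     ennreal (((2 + 2 * (real DIM('a))\<^sup>2) ^ DIM('a))\<^sup>2 * (LINT z|lborel. jw DIM('a) (z::'a)) * \<Lambda> * (R ^ DIM('a) / 2 ^ (s * DIM('a))))"
proof -
  define n where "n = DIM('a)"
  define P where "P = (2 + 2 * (real n)\<^sup>2) ^ n"
  have P: "0 <= P" by (simp add: P_def)
  define Jr where "Jr = (LINT z|lborel. jw n (z::'a))"
  have Jr: "0 <= Jr" unfolding Jr_def by (rule integral_nonneg_AE) simp
  have R0: "0 < R" using R zero_less_power[of "2::real" s] by linarith
  define \<phi> where "\<phi> y' = jw n (2 ^ s *\<^sub>R (y - cell s y'))" for y'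
  have sh: "norm (2 ^ s *\<^sub>R (y' - cell s y')) <= real n" for y' :: 'a
    using cell_dist[of y' s] unfolding norm_scaleR by (simp add: n_def field_simps)
  have "jw n (R *\<^sub>R (y - y')) <= P * \<phi> y'" for y'
  proof -
    have "norm (2 ^ s *\<^sub>R (y - y')) <= norm (R *\<^sub>R (y - y'))" using R R0 by (simp add: mult_right_mono)
    then have "jw n (R *\<^sub>R (y - y')) <= jw n (2 ^ s *\<^sub>R (y - y'))" by (rule jw_mono)
    also have "2 ^ s *\<^sub>R (y - y') = 2 ^ s *\<^sub>R (y - cell s y') + - (2 ^ s *\<^sub>R (y' - cell s y'))"
      by (simp add: scaleR_diff_right)
    also have "jw n \<dots> <= P * \<phi> y'" unfolding P_def \<phi>_def by (rule jw_shift) (use sh in simp)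
    finally show ?thesis .
  qed
  then have "ennreal (R ^ n * jw n (R *\<^sub>R (y - y'))) <= ennreal (R ^ n * P) * ennreal (\<phi> y')" for y'
    using R0 P by (subst ennreal_mult[symmetric]) (auto simp: \<phi>_def mult.assoc intro!: ennreal_leI mult_left_mono)
  then have "(\<integral>\<^sup>+y'. \<beta> y' * ennreal (R ^ n * jw n (R *\<^sub>R (y - y'))) \<partial>lborel) <= (\<integral>\<^sup>+y'. \<beta> y' * (ennreal (R ^ n * P) * ennreal (\<phi> y')) \<partial>lborel)"
    by (intro nn_integral_mono mult_left_mono) auto
  also have "\<dots> = (\<integral>\<^sup>+y'. cav s \<beta> y' * (ennreal (R ^ n * P) * ennreal (\<phi> y')) \<partial>lborel)"
    by (rule cav_invariant[symmetric]) (auto simp: inv_cell_def \<phi>_def)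
  also have "\<dots> <= (\<integral>\<^sup>+y'. ennreal \<Lambda> * (ennreal (R ^ n * P) * (ennreal P * ennreal (jw n (2 ^ s *\<^sub>R (y - y'))))) \<partial>lborel)"
  proof (intro nn_integral_mono mult_mono c mult_left_mono)
    fix y'
    have e: "2 ^ s *\<^sub>R (y - cell s y') = 2 ^ s *\<^sub>R (y - y') + 2 ^ s *\<^sub>R (y' - cell s y')" by (simp add: scaleR_diff_right)
    have "\<phi> y' <= P * jw n (2 ^ s *\<^sub>R (y - y'))"
      unfolding \<phi>_def e P_def by (rule jw_shift) (rule sh)
    then show "ennreal (\<phi> y') <= ennreal P * ennreal (jw n (2 ^ s *\<^sub>R (y - y')))"
      using P by (simp add: ennreal_mult[symmetric] ennreal_leI)
  qed auto
  also have "\<dots> = ennreal \<Lambda> * (ennreal (R ^ n * P) * (ennreal P * (\<integral>\<^sup>+y'. ennreal (jw n (2 ^ s *\<^sub>R (y - y'))) \<partial>lborel)))"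
    by (simp add: nn_integral_cmult)
  also have "(\<integral>\<^sup>+y'. ennreal (jw n (2 ^ s *\<^sub>R (y - y'))) \<partial>lborel) = ennreal (1 / (2 ^ s) ^ n * Jr)"
    unfolding Jr_def n_def by (rule nn_integral_jw_affine) auto
  also have "ennreal \<Lambda> * (ennreal (R ^ n * P) * (ennreal P * ennreal (1 / (2 ^ s) ^ n * Jr))) = ennreal (\<Lambda> * (R ^ n * P * (P * (1 / (2 ^ s) ^ n * Jr))))"
    using \<Lambda> R0 P Jr by (simp add: ennreal_mult[symmetric])
  also have "\<Lambda> * (R ^ n * P * (P * (1 / (2 ^ s) ^ n * Jr))) = P\<^sup>2 * Jr * \<Lambda> * (R ^ n / 2 ^ (s * n))"
    by (simp add: power2_eq_square power_mult)
  finally show ?thesis by (simp add: n_def P_def Jr_def)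
qed

text \<open>As \<rho> >= 1/2, consecutive exponents give the ratio 2^(-\<rho>) <= 2^(-1/2) <= 3/4,
  and 1/(1 - 3/4) = 4. The series is started at the extreme element of \<open>A\<close>, whose own
  term is at most 1.\<close>

lemma sum_powr_le:
  fixes \<rho> c :: real
  assumes \<rho>: "1 / 2 <= \<rho>" and A: "finite A"
  shows "(\<And>l. l \<in> A ==> \<rho> * real l <= c) ==> (\<Sum>l\<in>A. 2 powr (\<rho> * real l - c)) <= 4"
    and "(\<And>l. l \<in> A ==> c <= \<rho> * real l) ==> (\<Sum>l\<in>A. 2 powr (c - \<rho> * real l)) <= 4"
proof -
  have t: "2 powr (- \<rho> * real m) <= (3 / 4) ^ m" for m
  proof -
    have "4 / 3 <= sqrt 2" by (rule real_le_rsqrt) (simp add: power2_eq_square)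
    then have "2 powr (- (1 / 2)) <= (3 / 4 :: real)" by (simp add: powr_minus_divide powr_half_sqrt field_simps)
    then have "(2 powr (- (1 / 2))) ^ m <= (3 / 4 :: real) ^ m" by (intro power_mono) auto
    moreover have "2 powr (- \<rho> * real m) <= 2 powr (- (1 / 2) * real m)" using \<rho> by (intro powr_mono mult_right_mono) auto
    moreover have "2 powr (- (1 / 2) * real m) = (2 powr (- (1 / 2))) ^ m" by (simp add: powr_realpow[symmetric] powr_powr)
    ultimately show ?thesis by linarith
  qed
  have s: "(\<Sum>l\<in>A. (3 / 4 :: real) ^ g l) <= 4" if "inj_on g A" for g :: "nat => nat"
  proof -
    have "(\<Sum>l\<in>A. (3 / 4 :: real) ^ g l) = (\<Sum>i\<in>g ` A. (3 / 4) ^ i)" by (simp add: sum.reindex[OF that])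
    also have "\<dots> <= (\<Sum>i. (3 / 4) ^ i)" using A by (intro sum_le_suminf) (auto intro: summable_geometric)
    also have "\<dots> = 4" by (subst suminf_geometric) auto
    finally show ?thesis .
  qed
  show "(\<Sum>l\<in>A. 2 powr (\<rho> * real l - c)) <= 4" if c: "\<And>l. l \<in> A ==> \<rho> * real l <= c"
  proof (cases "A = {}")
    case False
    define L where "L = Max A"
    have L: "L \<in> A" "\<And>l. l \<in> A ==> l <= L" using A False by (auto simp: L_def)
    have "2 powr (\<rho> * real l - c) <= (3 / 4) ^ (L - l)" if "l \<in> A" for l
    proof -
      have "\<rho> * real l - c <= - \<rho> * real (L - l)"
        using c[OF L(1)] L(2)[OF that] by (simp add: of_nat_diff algebra_simps)
      then have "2 powr (\<rho> * real l - c) <= 2 powr (- \<rho> * real (L - l))" by (intro powr_mono) auto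
      then show ?thesis using t[of "L - l"] by linarith
    qed
    then have "(\<Sum>l\<in>A. 2 powr (\<rho> * real l - c)) <= (\<Sum>l\<in>A. (3 / 4) ^ (L - l))" by (rule sum_mono)
    also have "\<dots> <= 4" by (rule s) (auto simp: inj_on_def dest!: L(2))
    finally show ?thesis .
  qed simp
  show "(\<Sum>l\<in>A. 2 powr (c - \<rho> * real l)) <= 4" if c: "\<And>l. l \<in> A ==> c <= \<rho> * real l"
  proof (cases "A = {}")
    case False
    define L where "L = Min A"
    have L: "L \<in> A" "\<And>l. l \<in> A ==> L <= l" using A False by (auto simp: L_def)
    have "2 powr (c - \<rho> * real l) <= (3 / 4) ^ (l - L)" if "l \<in> A" for l
    proof -
      have "c - \<rho> * real l <= - \<rho> * real (l - L)"
        using c[OF L(1)] L(2)[OF that] by (simp add: of_nat_diff algebra_simps)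
      then have "2 powr (c - \<rho> * real l) <= 2 powr (- \<rho> * real (l - L))" by (intro powr_mono) auto
      then show ?thesis using t[of "l - L"] by linarith
    qed
    then have "(\<Sum>l\<in>A. 2 powr (c - \<rho> * real l)) <= (\<Sum>l\<in>A. (3 / 4) ^ (l - L))" by (rule sum_mono)
    also have "\<dots> <= 4" by (rule s) (auto simp: inj_on_def dest!: L(2))
    finally show ?thesis .
  qed simp
qed

section \<open>L^1 bounds for the dyadic operators\<close>

definition L1n :: "('a::euclidean_space => complex) => ennreal" where
  "L1n f = (\<integral>\<^sup>+x. ennreal (norm (f x)) \<partial>lborel)"

text \<open>Mean zero on every cell of scale s, tested against all bounded functions that are
  constant on cells. In this form the kernel evaluated at the corner of the cell is itself a test
  function, and no sum over cells occurs.\<close>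

definition mean_zero :: "nat => ('a::euclidean_space => complex) => bool" where
  "mean_zero s g \<longleftrightarrow> integrable lborel g \<and> (\<forall>\<psi> B. \<psi> \<in> borel_measurable borel --> (\<forall>x. norm (\<psi> x) <= B) --> inv_cell s \<psi> -->
     (LINT y|lborel. g y * \<psi> y) = 0)"

context sing
begin

text \<open>The column bounds integrated against the input: size, tail off the support,
  cancellation. For the third the kernel at the cell corner is subtracted, which does not change the
  integral for an input of mean zero; the distance to the corner is at most n 2^(-s).\<close>

lemma Tl_L1_bounds:
  "\<exists>C\<ge>0. (\<forall>l f. integrable lborel f --> L1n (Tl l f) <= ennreal C * L1n f) \<and>
    (\<forall>l f E r. integrable lborel f --> E \<in> sets borel --> 0 < r --> (\<forall>x\<in>E. \<forall>y. f y \<noteq> 0 --> r <= norm (x - y)) -->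
       (\<integral>\<^sup>+x. indicator E x * ennreal (norm (Tl l f x)) \<partial>lborel) <= ennreal (C / (2 powr (\<rho> * real l) * r)) * L1n f) \<and>
    (\<forall>l s f. mean_zero s f --> L1n (Tl l f) <= ennreal (C * 2 ^ l / 2 ^ s) * L1n f)"
proof -
  obtain C1 where C1: "0 <= C1" "\<And>l y. (\<integral>\<^sup>+x. ennreal (norm (ker (a l) x y)) \<partial>lborel) <= ennreal C1"
    "\<And>l y r. 0 < r ==> (\<integral>\<^sup>+x. indicator {x. r <= norm (x - y)} x * ennreal (norm (ker (a l) x y)) \<partial>lborel) <= ennreal (C1 / (2 powr (\<rho> * real l) * r))"
    using kernel_L1[OF amp \<rho> \<mu>] by auto
  obtain C2 where C2: "0 <= C2" "\<And>l y y'. (\<integral>\<^sup>+x. ennreal (norm (ker (a l) x y - ker (a l) x y')) \<partial>lborel) <= ennreal (C2 * 2 ^ l * norm (y - y'))"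
    using kernel_difference[OF amp \<rho> \<mu>] by blast
  note mk[measurable] = measurable_ker[OF smooth_a]
  define C where "C = max C1 (C2 * DIM('a))"
  have C0: "0 <= C" using C1(1) by (simp add: C_def)
  show ?thesis
  proof (intro exI[of _ C] conjI allI impI C0)
    fix l and f :: "'a => complex" assume f: "integrable lborel f"
    have "L1n (Tl l f) <= ennreal C1 * L1n f"
      using Tl_L1_gen[OF f mk, of UNIV "Tl l f" l C1] Tl_ker[OF f] C1(2) by (simp add: L1n_def)
    also have "\<dots> <= ennreal C * L1n f" by (intro mult_right_mono ennreal_leI) (auto simp: C_def)
    finally show "L1n (Tl l f) <= ennreal C * L1n f" .
  next
    fix l and f :: "'a => complex" and E and r :: real
    assume f: "integrable lborel f" and E[measurable]: "E \<in> sets borel" and r: "0 < r"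
      and d: "\<forall>x\<in>E. \<forall>y. f y \<noteq> 0 --> r <= norm (x - y)"
    have "(\<integral>\<^sup>+x. indicator E x * ennreal (norm (Tl l f x)) \<partial>lborel) <= ennreal (C1 / (2 powr (\<rho> * real l) * r)) * L1n f"
      unfolding L1n_def
    proof (rule Tl_L1_gen[OF f mk E Tl_ker[OF f]])
      fix y assume y: "f y \<noteq> 0"
      have "(\<integral>\<^sup>+x. indicator E x * ennreal (norm (ker (a l) x y)) \<partial>lborel) <= (\<integral>\<^sup>+x. indicator {x. r <= norm (x - y)} x * ennreal (norm (ker (a l) x y)) \<partial>lborel)"
        using d y by (intro nn_integral_mono mult_right_mono) (auto simp: indicator_def)
      also have "\<dots> <= ennreal (C1 / (2 powr (\<rho> * real l) * r))" by (rule C1(3)[OF r])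
      finally show "(\<integral>\<^sup>+x. indicator E x * ennreal (norm (ker (a l) x y)) \<partial>lborel) <= ennreal (C1 / (2 powr (\<rho> * real l) * r))" .
    qed
    also have "\<dots> <= ennreal (C / (2 powr (\<rho> * real l) * r)) * L1n f"
      using r by (intro mult_right_mono ennreal_leI divide_right_mono) (auto simp: C_def)
    finally show "(\<integral>\<^sup>+x. indicator E x * ennreal (norm (Tl l f x)) \<partial>lborel) <= ennreal (C / (2 powr (\<rho> * real l) * r)) * L1n f" .
  next
    fix l s and f :: "'a => complex" assume mz: "mean_zero s f"
    then have f: "integrable lborel f" by (simp add: mean_zero_def)
    define k where "k x y = ker (a l) x y - ker (a l) x (cell s y)" for x y
    have mk2: "(%(x, y). ker (a l) x (cell s y)) \<in> borel_measurable (lborel \<Otimes>\<^sub>M lborel)"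
      using measurable_compose[of "%(x, y). (x, cell s y)" "lborel \<Otimes>\<^sub>M lborel" "lborel \<Otimes>\<^sub>M lborel", OF _ mk]
      by (simp add: case_prod_beta)
    have k[measurable]: "(%(x, y). k x y) \<in> borel_measurable (lborel \<Otimes>\<^sub>M lborel)"
      unfolding k_def using mk mk2 by (simp add: case_prod_beta)
    have Tk: "Tl l f x = (LINT y|lborel. f y * k x y)" for x
    proof -
      define B where "B = (LINT \<xi>|lborel. norm (a l (x, \<xi>)))"
      have kb: "norm (ker (a l) x y) <= B" for y
        unfolding ker_def B_def by (rule order_trans[OF integral_norm_bound]) (simp add: norm_mult)
      have m1[measurable]: "(%y. ker (a l) x y) \<in> borel_measurable borel"
        using measurable_compose[OF _ mk, of "%y. (x, y)" borel] by simp
      have m2[measurable]: "(%y. ker (a l) x (cell s y)) \<in> borel_measurable borel" by measurable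
      have z: "(LINT y|lborel. f y * ker (a l) x (cell s y)) = 0"
      proof -
        have "inv_cell s (%y. ker (a l) x (cell s y))"
          unfolding inv_cell_def by (intro allI impI) (simp only:)
        moreover have "\<forall>y. norm (ker (a l) x (cell s y)) <= B" using kb by blast
        ultimately show ?thesis using mz m2 unfolding mean_zero_def by blast
      qed
      have i: "integrable lborel (%y. f y * g y)" if [measurable]: "g \<in> borel_measurable borel" and gb: "\<And>y. norm (g y) <= B" for g :: "'a => complex"
      proof (rule Bochner_Integration.integrable_bound)
        have [measurable]: "f \<in> borel_measurable borel" using borel_measurable_integrable[OF f] by simp
        show "integrable lborel (%y. of_real B * f y)" using f by simp
        have "norm (f y) * norm (g y) <= \<bar>B\<bar> * norm (f y)" for y
          using mult_left_mono[OF order_trans[OF gb[of y] abs_ge_self] norm_ge_zero[of "f y"]] by (simp add: mult.commute)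
        then show "AE y in lborel. norm (f y * g y) <= norm (of_real B * f y)" by (simp add: norm_mult)
        show "(%y. f y * g y) \<in> borel_measurable lborel" by simp
      qed
      have "(LINT y|lborel. f y * k x y) = (LINT y|lborel. f y * ker (a l) x y) - (LINT y|lborel. f y * ker (a l) x (cell s y))"
        unfolding k_def right_diff_distrib by (intro Bochner_Integration.integral_diff i m1 m2 kb)
      then show ?thesis using z Tl_ker[OF f] by simp
    qed
    have "(\<integral>\<^sup>+x. indicator UNIV x * ennreal (norm (Tl l f x)) \<partial>lborel) <= ennreal (C * 2 ^ l / 2 ^ s) * (\<integral>\<^sup>+x. ennreal (norm (f x)) \<partial>lborel)"
    proof (rule Tl_L1_gen[OF f k _ Tk])
      fix y
      have "(\<integral>\<^sup>+x. indicator UNIV x * ennreal (norm (k x y)) \<partial>lborel) <= ennreal (C2 * 2 ^ l * norm (y - cell s y))"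
        using C2(2)[of l y "cell s y"] by (simp add: k_def)
      also have "\<dots> <= ennreal (C2 * 2 ^ l * (DIM('a) / 2 ^ s))"
        using C2(1) by (intro ennreal_leI mult_left_mono cell_dist) auto
      also have "\<dots> <= ennreal (C * 2 ^ l / 2 ^ s)"
      proof (rule ennreal_leI)
        have "C2 * DIM('a) * (2 ^ l / 2 ^ s) <= C * (2 ^ l / 2 ^ s)" by (intro mult_right_mono) (auto simp: C_def)
        then show "C2 * 2 ^ l * (DIM('a) / 2 ^ s) <= C * 2 ^ l / 2 ^ s" by (simp add: mult_ac)
      qed
      finally show "(\<integral>\<^sup>+x. indicator UNIV x * ennreal (norm (k x y)) \<partial>lborel) <= ennreal (C * 2 ^ l / 2 ^ s)" .
    qed simp
    then show "L1n (Tl l f) <= ennreal (C * 2 ^ l / 2 ^ s) * L1n f" by (simp add: L1n_def)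
  qed
qed

end

section \<open>The Calderon-Zygmund decomposition\<close>

lemma inv_cell_indicator:
  "inv_cell s (%x. x \<in> S) ==> inv_cell s (%x. indicator S x :: 'b::zero_neq_one)"
  unfolding inv_cell_def indicator_def by (intro allI impI arg_cong[where f=of_bool]) blast

lemma L1n_sum:
  assumes "\<And>s. s \<in> A ==> f s \<in> borel_measurable borel"
  shows "L1n (%x. \<Sum>s\<in>A. f s x) <= (\<Sum>s\<in>A. L1n (f s))"
proof -
  have "L1n (%x. \<Sum>s\<in>A. f s x) <= (\<integral>\<^sup>+x. (\<Sum>s\<in>A. ennreal (norm (f s x))) \<partial>lborel)"
    unfolding L1n_def by (intro nn_integral_mono) (simp add: norm_sum ennreal_leI)
  also have "\<dots> = (\<Sum>s\<in>A. L1n (f s))" unfolding L1n_def by (rule nn_integral_sum) (use assms in simp)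
  finally show ?thesis .
qed

lemma ennreal_le_divide:
  assumes "0 < l" "0 <= c" "ennreal l * X <= ennreal c * I" shows "X <= ennreal (c / l) * I"
proof -
  have "X = ennreal (1 / l) * (ennreal l * X)"
    using assms(1) by (simp add: mult.assoc[symmetric] ennreal_mult[symmetric])
  also have "\<dots> <= ennreal (1 / l) * (ennreal c * I)" by (intro mult_left_mono assms) auto
  also have "\<dots> = ennreal (c / l) * I"
    using assms(1,2) by (simp add: mult.assoc[symmetric] ennreal_mult[symmetric])
  finally show ?thesis .
qed

lemma markov_bound:
  assumes [measurable]: "P \<in> borel_measurable borel" "E \<in> sets borel" and l: "0 < l" "0 <= c"
    and h: "(\<integral>\<^sup>+x. indicator E x * ennreal (norm (P x)) \<partial>lborel) <= ennreal c * I"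
  shows "emeasure lborel {x \<in> E. l < norm (P x)} <= ennreal (c / l) * I"
proof (rule ennreal_le_divide[OF l])
  have "ennreal l * emeasure lborel {x \<in> E. l < norm (P x)} = (\<integral>\<^sup>+x. ennreal l * indicator {x \<in> E. l < norm (P x)} x \<partial>lborel)"
    by (simp add: nn_integral_cmult)
  also have "\<dots> <= (\<integral>\<^sup>+x. indicator E x * ennreal (norm (P x)) \<partial>lborel)"
    by (intro nn_integral_mono) (auto simp: indicator_def ennreal_leI)
  finally show "ennreal l * emeasure lborel {x \<in> E. l < norm (P x)} <= ennreal c * I" using h by simp
qed

lemma markov_bound_L1:
  assumes "P \<in> borel_measurable borel" "0 < l" "0 <= c" "L1n P <= ennreal c * I"
  shows "emeasure lborel {x. l < norm (P x)} <= ennreal (c / l) * I"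
  using markov_bound[of P UNIV l c I] assms by (simp add: L1n_def)

text \<open>The factor l on the right of the hypothesis is the threshold that a Calderon-Zygmund
  decomposition puts into L^2 bounds; with it Chebyshev's inequality has the same form c/l as in
  L^1.\<close>

lemma markov_bound_L2:
  assumes [measurable]: "P \<in> borel_measurable borel" and l: "0 < l" "0 <= c"
    and h: "(\<integral>\<^sup>+x. ennreal ((norm (P x))\<^sup>2) \<partial>lborel) <= ennreal (c * l) * I"
  shows "emeasure lborel {x. l < norm (P x)} <= ennreal (c / l) * I"
proof -
  have "ennreal (l\<^sup>2) * emeasure lborel {x. l < norm (P x)} = (\<integral>\<^sup>+x. ennreal (l\<^sup>2) * indicator {x. l < norm (P x)} x \<partial>lborel)"
    by (simp add: nn_integral_cmult)
  also have "\<dots> <= (\<integral>\<^sup>+x. ennreal ((norm (P x))\<^sup>2) \<partial>lborel)"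
    using l by (intro nn_integral_mono) (auto simp: indicator_def intro!: ennreal_leI power_mono)
  finally have "emeasure lborel {x. l < norm (P x)} <= ennreal (c * l / l\<^sup>2) * I"
    using h l by (intro ennreal_le_divide) auto
  then show ?thesis using l by (simp add: power2_eq_square)
qed

text \<open>The parent cell has 2^n times the volume. This keeps the averages on a freshly selected
  cell comparable to the threshold.\<close>

lemma cav_Suc:
  assumes [measurable]: "g \<in> borel_measurable borel"
  shows "cav (Suc s) g x <= ennreal (2 ^ DIM('a)) * cav s g (x::'a::euclidean_space)"
proof -
  have "ennreal (ck (Suc s) x y) * g y <= ennreal (2 ^ DIM('a)) * (ennreal (ck s x y) * g y)" for y
  proof -
    have "ck (Suc s) x y <= 2 ^ DIM('a) * ck s x y"
      using cell_coarser[of s "Suc s" x y] by (simp add: ck_def power_add)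
    then have "ennreal (ck (Suc s) x y) <= ennreal (2 ^ DIM('a)) * ennreal (ck s x y)"
      by (subst ennreal_mult[symmetric]) (auto intro: ennreal_leI)
    then show ?thesis unfolding mult.assoc[symmetric] by (rule mult_right_mono) simp
  qed
  then have "cav (Suc s) g x <= (\<integral>\<^sup>+y. ennreal (2 ^ DIM('a)) * (ennreal (ck s x y) * g y) \<partial>lborel)"
    unfolding cav_def by (intro nn_integral_mono)
  also have "\<dots> <= ennreal (2 ^ DIM('a)) * cav s g x"
    by (simp add: cav_def nn_integral_cmult)
  finally show ?thesis .
qed

lemma mean_zero_cavg:
  fixes f :: "'a::euclidean_space => complex"
  assumes f: "integrable lborel f" and S[measurable]: "S \<in> sets borel" and i: "inv_cell s (%x. x \<in> S)"
  shows "mean_zero s (%x. (f x - cavg s f x) * indicator S x)"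
  unfolding mean_zero_def
proof (intro conjI allI impI)
  have iS: "integrable lborel (%x. h x * indicator S x * \<psi> x)" if h: "integrable lborel h" and [measurable]: "\<psi> \<in> borel_measurable borel" and b: "\<And>x. norm (\<psi> x) <= B" for h \<psi> :: "'a => complex" and B
  proof (rule Bochner_Integration.integrable_bound)
    have [measurable]: "h \<in> borel_measurable borel" using borel_measurable_integrable[OF h] by simp
    show "integrable lborel (%x. of_real B * h x)" using h by simp
    have "norm (h x) * norm (\<psi> x) <= \<bar>B\<bar> * norm (h x)" for x
      using mult_left_mono[OF order_trans[OF b[of x] abs_ge_self] norm_ge_zero[of "h x"]] by (simp add: mult.commute)
    then show "AE x in lborel. norm (h x * indicator S x * \<psi> x) <= norm (of_real B * h x)"
      by (simp add: norm_mult indicator_def)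
    show "(%x. h x * indicator S x * \<psi> x) \<in> borel_measurable lborel" by simp
  qed
  have c: "integrable lborel (cavg s f)" by (rule integrable_cavg[OF f])
  show "integrable lborel (%x. (f x - cavg s f x) * indicator S x)"
    using iS[OF Bochner_Integration.integrable_diff[OF f c], of "%_. 1" 1] by simp
  fix \<psi> :: "'a => complex" and B
  assume [measurable]: "\<psi> \<in> borel_measurable borel" and b: "\<forall>x. norm (\<psi> x) <= B" and p: "inv_cell s \<psi>"
  have i': "inv_cell s (%x. indicator S x * \<psi> x)"
    unfolding inv_cell_def
  proof (intro allI impI)
    fix x y :: 'a assume c: "cell s x = cell s y"
    have "(x \<in> S) = (y \<in> S)" using inv_cellD[OF i c] .
    then show "indicator S x * \<psi> x = indicator S y * \<psi> y" using inv_cellD[OF p c] by (simp add: indicator_def)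
  qed
  have b': "norm (indicator S x * \<psi> x) <= B" for x
    using b[rule_format, of x] order_trans[OF norm_ge_zero b[rule_format, of x]] by (simp add: indicator_def)
  have "(LINT x|lborel. (f x - cavg s f x) * indicator S x * \<psi> x) = (LINT x|lborel. f x * indicator S x * \<psi> x) - (LINT x|lborel. cavg s f x * indicator S x * \<psi> x)"
    unfolding left_diff_distrib using b by (intro Bochner_Integration.integral_diff iS f c) auto
  also have "(LINT x|lborel. cavg s f x * indicator S x * \<psi> x) = (LINT x|lborel. f x * indicator S x * \<psi> x)"
    using cavg_invariant[OF f _ b' i'] by (simp add: mult.assoc)
  finally show "(LINT x|lborel. (f x - cavg s f x) * indicator S x * \<psi> x) = 0" by simp
qed

section \<open>Stopping scales and the decomposition\<close>

definition stop :: "('a::euclidean_space => ennreal) => ennreal => nat => 'a set" where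
  "stop g \<eta> s = {x. \<eta> < cav s g x \<and> (\<forall>t<s. cav t g x <= \<eta>)}"

definition never :: "('a::euclidean_space => ennreal) => ennreal => nat => 'a set" where
  "never g \<eta> J = {x. \<forall>t\<le>J. cav t g x <= \<eta>}"

lemma stop_partition:
  "(\<Sum>s\<le>J. indicator (stop g \<eta> s) x) + indicator (never g \<eta> J) x = (1::'b::semiring_1)"
proof (induction J)
  case 0
  show ?case by (simp add: stop_def never_def indicator_def not_less[symmetric])
next
  case (Suc J)
  have "indicator (stop g \<eta> (Suc J)) x + indicator (never g \<eta> (Suc J)) x = (indicator (never g \<eta> J) x :: 'b)"
    by (auto simp: stop_def never_def indicator_def less_Suc_eq_le le_Suc_eq not_le)
  then show ?case using Suc by (simp add: add.assoc)
qed

lemma inv_cell_stop: "inv_cell s (%x. x \<in> stop g \<eta> s)"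
  unfolding inv_cell_def
proof (intro allI impI)
  fix x y :: 'a assume "cell s x = cell s y"
  then have "\<And>t. t <= s ==> cav t g x = cav t g y" using inv_cellD[OF inv_cell_cav] by blast
  then show "(x \<in> stop g \<eta> s) = (y \<in> stop g \<eta> s)" by (auto simp: stop_def)
qed

lemma inv_cell_never: "inv_cell s (%x. x \<in> never g \<eta> s)"
  unfolding inv_cell_def
proof (intro allI impI)
  fix x y :: 'a assume "cell s x = cell s y"
  then have "\<And>t. t <= s ==> cav t g x = cav t g y" using inv_cellD[OF inv_cell_cav] by blast
  then show "(x \<in> never g \<eta> s) = (y \<in> never g \<eta> s)" by (auto simp: never_def)
qed

lemma sets_stop:
  assumes [measurable]: "g \<in> borel_measurable borel"
  shows "stop g \<eta> s \<in> sets borel" "never g \<eta> s \<in> sets borel"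
  unfolding stop_def never_def by measurable

text \<open>Stopping time over the scales 0 to J. For s >= 1 the parent of a selected cell was not
  selected, so averages there are at most 2^n \<eta>. Cells selected at scale 0 have no parent:
  nothing is subtracted, \<open>b 0\<close> is f itself on \<open>\<Omega> 0\<close>, and
  cancellation and the bound on averages are claimed for s >= 1 only. Stopping at J leaves the
  remainder \<open>w\<close>, of mean zero at scale J, where a passage to the limit would use the
  differentiation theorem.\<close>

lemma Calderon_Zygmund_decomposition:
  fixes f :: "'a::euclidean_space => complex"
  assumes f: "integrable lborel f" and l: "0 < \<eta>"
  obtains \<Omega> :: "nat => 'a set" and b g w where
    "\<And>s. \<Omega> s \<in> sets borel" "\<And>s. inv_cell s (%x. x \<in> \<Omega> s)" "(\<Sum>s\<le>J. emeasure lborel (\<Omega> s)) <= ennreal (1 / \<eta>) * L1n f"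
    "\<And>s. integrable lborel (b s)" "\<And>s. 1 <= s ==> mean_zero s (b s)" "\<And>s y. b s y \<noteq> 0 ==> y \<in> \<Omega> s"
    "\<And>s x. 1 <= s ==> cav s (%y. ennreal (norm (b s y))) x <= ennreal (2 * 2 ^ DIM('a) * \<eta>)"
    "(\<Sum>s\<le>J. L1n (b s)) <= 2 * L1n f"
    "mean_zero J w" "L1n w <= 2 * L1n f"
    "integrable lborel g" "(\<integral>\<^sup>+x. ennreal ((norm (g x))\<^sup>2) \<partial>lborel) <= ennreal (2 ^ DIM('a) * \<eta>) * L1n f"
    "\<And>x. f x = g x + (\<Sum>s\<le>J. b s x) + w x"
proof -
  have fm[measurable]: "f \<in> borel_measurable borel" using borel_measurable_integrable[OF f] by simp
  define \<Phi> where "\<Phi> y = ennreal (norm (f y))" for y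
  have [measurable]: "\<Phi> \<in> borel_measurable borel" unfolding \<Phi>_def by measurable
  define \<Omega> where "\<Omega> s = stop \<Phi> (ennreal \<eta>) s" for s
  define N where "N = never \<Phi> (ennreal \<eta>) J"
  have Om[measurable]: "\<Omega> s \<in> sets borel" for s by (simp add: \<Omega>_def sets_stop)
  have Nm[measurable]: "N \<in> sets borel" by (simp add: N_def sets_stop)
  have Oi: "inv_cell s (%x. x \<in> \<Omega> s)" for s unfolding \<Omega>_def by (rule inv_cell_stop)
  have Ni: "inv_cell J (%x. x \<in> N)" unfolding N_def by (rule inv_cell_never)
  have part: "(\<Sum>s\<le>J. indicator (\<Omega> s) x) + indicator N x = (1::ennreal)"
    "(\<Sum>s\<le>J. indicator (\<Omega> s) x) + indicator N x = (1::real)"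
    "(\<Sum>s\<le>J. indicator (\<Omega> s) x) + indicator N x = (1::complex)" for x
    unfolding \<Omega>_def N_def by (rule stop_partition)+
  define F where "F S = (\<integral>\<^sup>+x. ennreal (norm (f x)) * indicator S x \<partial>lborel)" for S
  have F: "(\<Sum>s\<le>J. F (\<Omega> s)) + F N = L1n f"
  proof -
    have "(\<Sum>s\<le>J. F (\<Omega> s)) = (\<integral>\<^sup>+x. (\<Sum>s\<le>J. ennreal (norm (f x)) * indicator (\<Omega> s) x) \<partial>lborel)"
      unfolding F_def by (rule nn_integral_sum[symmetric]) measurable
    moreover have "(\<integral>\<^sup>+x. (\<Sum>s\<le>J. ennreal (norm (f x)) * indicator (\<Omega> s) x) \<partial>lborel) + F N = (\<integral>\<^sup>+x. (\<Sum>s\<le>J. ennreal (norm (f x)) * indicator (\<Omega> s) x) + ennreal (norm (f x)) * indicator N x \<partial>lborel)"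
      unfolding F_def by (rule nn_integral_add[symmetric]) measurable
    ultimately have "(\<Sum>s\<le>J. F (\<Omega> s)) + F N = (\<integral>\<^sup>+x. (\<Sum>s\<le>J. ennreal (norm (f x)) * indicator (\<Omega> s) x) + ennreal (norm (f x)) * indicator N x \<partial>lborel)"
      by simp
    also have "\<dots> = L1n f"
      unfolding L1n_def sum_distrib_left[symmetric] distrib_left[symmetric] part(1) by simp
    finally show ?thesis .
  qed
  have F1: "(\<Sum>s\<le>J. F (\<Omega> s)) <= L1n f" "F N <= L1n f"
    unfolding F[symmetric] by auto
  define u where "u s = (if s = 0 then (%x. 0) else cavg s f)" for s
  have um[measurable]: "u s \<in> borel_measurable borel" for s by (simp add: u_def)
  define b where "b s x = (f x - u s x) * indicator (\<Omega> s) x" for s x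
  define g where "g x = (\<Sum>s\<le>J. u s x * indicator (\<Omega> s) x) + cavg J f x * indicator N x" for x
  define w where "w x = (f x - cavg J f x) * indicator N x" for x
  have cL: "(\<integral>\<^sup>+x. ennreal (norm (cavg s f x)) * indicator S x \<partial>lborel) <= F S" if [measurable]: "S \<in> sets borel" and "inv_cell s (%x. x \<in> S)" for s S
    unfolding F_def by (rule cavg_L1[OF _ _ inv_cell_indicator[OF that(2)]]) auto
  have uL: "(\<integral>\<^sup>+x. ennreal (norm (u s x)) * indicator (\<Omega> s) x \<partial>lborel) <= F (\<Omega> s)" for s
    using cL[OF Om Oi, of s] by (simp add: u_def)
  have iu: "integrable lborel (u s)" for s using integrable_cavg[OF f] by (simp add: u_def)
  have iS: "integrable lborel (%x. h x * indicator S x)" if "integrable lborel h" "S \<in> sets borel" for h :: "'a => complex" and S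
  proof -
    have "(%x. indicator S x *\<^sub>R h x) = (%x. h x * indicator S x)" by (auto simp: indicator_def fun_eq_iff)
    then show ?thesis using integrable_mult_indicator[of S lborel h] that by simp
  qed
  have small: "cav s \<Phi> x <= ennreal (2 ^ DIM('a) * \<eta>)" if "1 <= s" "x \<in> \<Omega> s" for s x
  proof -
    obtain t where t: "s = Suc t" using \<open>1 <= s\<close> by (cases s) auto
    have "cav s \<Phi> x <= ennreal (2 ^ DIM('a)) * cav t \<Phi> x" unfolding t by (rule cav_Suc) simp
    also have "\<dots> <= ennreal (2 ^ DIM('a)) * ennreal \<eta>"
      using that(2) by (intro mult_left_mono) (auto simp: \<Omega>_def stop_def t)
    finally show ?thesis using l by (simp add: ennreal_mult)
  qed
  have small2: "norm (u s x) <= 2 ^ DIM('a) * \<eta>" if "x \<in> \<Omega> s" for s x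
  proof (cases "s = 0")
    case False
    have "ennreal (norm (u s x)) <= ennreal (2 ^ DIM('a) * \<eta>)"
      using order_trans[OF norm_cavg_le[of s f x] small[of s x, unfolded \<Phi>_def]] False that by (simp add: u_def)
    then show ?thesis using l by (subst (asm) ennreal_le_iff) auto
  qed (use l in \<open>simp add: u_def\<close>)
  have small3: "norm (cavg J f x) <= 2 ^ DIM('a) * \<eta>" if "x \<in> N" for x
  proof -
    have "ennreal (norm (cavg J f x)) <= ennreal \<eta>"
    proof (rule order_trans[OF norm_cavg_le[of J f x]])
      show "cav J (%y. ennreal (norm (f y))) x <= ennreal \<eta>"
        using that unfolding N_def never_def \<Phi>_def by blast
    qed
    then have "norm (cavg J f x) <= \<eta>" using l by (subst (asm) ennreal_le_iff) auto
    also have "1 * \<eta> <= 2 ^ DIM('a) * \<eta>" using l by (intro mult_right_mono) auto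
    finally show ?thesis by simp
  qed
  have bL: "L1n (b s) <= 2 * F (\<Omega> s)" for s
  proof -
    have "L1n (b s) <= (\<integral>\<^sup>+x. ennreal (norm (f x)) * indicator (\<Omega> s) x + ennreal (norm (u s x)) * indicator (\<Omega> s) x \<partial>lborel)"
      unfolding L1n_def b_def
      by (intro nn_integral_mono) (auto simp: indicator_def ennreal_plus[symmetric] norm_triangle_ineq4 simp del: ennreal_plus intro!: ennreal_leI)
    also have "\<dots> = F (\<Omega> s) + (\<integral>\<^sup>+x. ennreal (norm (u s x)) * indicator (\<Omega> s) x \<partial>lborel)"
      by (simp add: nn_integral_add F_def)
    also have "\<dots> <= F (\<Omega> s) + F (\<Omega> s)" by (intro add_left_mono uL)
    finally show ?thesis by (simp add: mult_2)
  qed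
  have wL: "L1n w <= 2 * F N"
  proof -
    have "L1n w <= (\<integral>\<^sup>+x. ennreal (norm (f x)) * indicator N x + ennreal (norm (cavg J f x)) * indicator N x \<partial>lborel)"
      unfolding L1n_def w_def
      by (intro nn_integral_mono) (auto simp: indicator_def ennreal_plus[symmetric] norm_triangle_ineq4 simp del: ennreal_plus intro!: ennreal_leI)
    also have "\<dots> = F N + (\<integral>\<^sup>+x. ennreal (norm (cavg J f x)) * indicator N x \<partial>lborel)"
      by (simp add: nn_integral_add F_def)
    also have "\<dots> <= F N + F N" by (intro add_left_mono cL Nm Ni)
    finally show ?thesis by (simp add: mult_2)
  qed
  have gsum: "norm (g x) <= (\<Sum>s\<le>J. norm (u s x) * indicator (\<Omega> s) x) + norm (cavg J f x) * indicator N x" for x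
  proof -
    have "norm (g x) <= norm (\<Sum>s\<le>J. u s x * indicator (\<Omega> s) x) + norm (cavg J f x * indicator N x)"
      unfolding g_def by (rule norm_triangle_ineq)
    also have "norm (\<Sum>s\<le>J. u s x * indicator (\<Omega> s) x) <= (\<Sum>s\<le>J. norm (u s x * indicator (\<Omega> s) x))" by (rule norm_sum)
    also have "(\<Sum>s\<le>J. norm (u s x * indicator (\<Omega> s) x)) = (\<Sum>s\<le>J. norm (u s x) * indicator (\<Omega> s) x)"
      by (intro sum.cong) (auto simp: indicator_def)
    also have "norm (cavg J f x * indicator N x) = norm (cavg J f x) * indicator N x" by (auto simp: indicator_def)
    finally show ?thesis by simp
  qed
  have gbd: "norm (g x) <= 2 ^ DIM('a) * \<eta>" for x
  proof -
    note gsum[of x]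
    also have "(\<Sum>s\<le>J. norm (u s x) * indicator (\<Omega> s) x) + norm (cavg J f x) * indicator N x <=
      (\<Sum>s\<le>J. 2 ^ DIM('a) * \<eta> * indicator (\<Omega> s) x) + 2 ^ DIM('a) * \<eta> * indicator N x"
      using small2 small3 by (intro add_mono sum_mono) (auto simp: indicator_def)
    also have "\<dots> = 2 ^ DIM('a) * \<eta>" unfolding sum_distrib_left[symmetric] distrib_left[symmetric] part(2) by simp
    finally show ?thesis .
  qed
  have gL: "L1n g <= L1n f"
  proof -
    have "ennreal (norm (g x)) <= (\<Sum>s\<le>J. ennreal (norm (u s x)) * indicator (\<Omega> s) x) + ennreal (norm (cavg J f x)) * indicator N x" for x
    proof -
      have "(\<Sum>s\<le>J. ennreal (norm (u s x)) * indicator (\<Omega> s) x) + ennreal (norm (cavg J f x)) * indicator N x =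
        ennreal ((\<Sum>s\<le>J. norm (u s x) * indicator (\<Omega> s) x) + norm (cavg J f x) * indicator N x)"
      proof -
        have t: "ennreal (norm z) * indicator S x = ennreal (norm z * indicator S x)" for z :: complex and S
          by (simp add: indicator_def)
        have p: "0 <= norm z * indicator S x" for z :: complex and S by (simp add: indicator_def)
        show ?thesis unfolding t sum_ennreal[OF p] by (rule ennreal_plus[symmetric]) (intro sum_nonneg p)+
      qed
      then show ?thesis using gsum[of x] by (simp add: ennreal_leI)
    qed
    then have "L1n g <= (\<integral>\<^sup>+x. (\<Sum>s\<le>J. ennreal (norm (u s x)) * indicator (\<Omega> s) x) + ennreal (norm (cavg J f x)) * indicator N x \<partial>lborel)"
      unfolding L1n_def by (intro nn_integral_mono)
    also have "\<dots> = (\<integral>\<^sup>+x. (\<Sum>s\<le>J. ennreal (norm (u s x)) * indicator (\<Omega> s) x) \<partial>lborel) + (\<integral>\<^sup>+x. ennreal (norm (cavg J f x)) * indicator N x \<partial>lborel)"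
      by (rule nn_integral_add) measurable
    also have "(\<integral>\<^sup>+x. (\<Sum>s\<le>J. ennreal (norm (u s x)) * indicator (\<Omega> s) x) \<partial>lborel) = (\<Sum>s\<le>J. \<integral>\<^sup>+x. ennreal (norm (u s x)) * indicator (\<Omega> s) x \<partial>lborel)"
      by (rule nn_integral_sum) measurable
    also have "\<dots> + (\<integral>\<^sup>+x. ennreal (norm (cavg J f x)) * indicator N x \<partial>lborel) <= (\<Sum>s\<le>J. F (\<Omega> s)) + F N" by (intro add_mono sum_mono uL cL Nm Ni)
    finally show ?thesis by (simp add: F)
  qed
  have gS: "(\<integral>\<^sup>+x. ennreal ((norm (g x))\<^sup>2) \<partial>lborel) <= ennreal (2 ^ DIM('a) * \<eta>) * L1n f"
  proof -
    have [measurable]: "g \<in> borel_measurable borel" unfolding g_def by measurable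
    have "(norm (g x))\<^sup>2 <= 2 ^ DIM('a) * \<eta> * norm (g x)" for x
      using mult_right_mono[OF gbd[of x] norm_ge_zero[of "g x"]] by (simp add: power2_eq_square)
    then have "(\<integral>\<^sup>+x. ennreal ((norm (g x))\<^sup>2) \<partial>lborel) <= (\<integral>\<^sup>+x. ennreal (2 ^ DIM('a) * \<eta>) * ennreal (norm (g x)) \<partial>lborel)"
      using l by (intro nn_integral_mono) (auto simp: ennreal_mult[symmetric] intro!: ennreal_leI)
    also have "\<dots> = ennreal (2 ^ DIM('a) * \<eta>) * L1n g" by (simp add: nn_integral_cmult L1n_def)
    also have "\<dots> <= ennreal (2 ^ DIM('a) * \<eta>) * L1n f" by (intro mult_left_mono gL) simp
    finally show ?thesis .
  qed
  show thesis
  proof (rule that[of \<Omega> b w g, OF Om Oi])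
    \<comment> \<open>On the selected set the average exceeds \<eta>, and over a union of cells the
      average has the same integral as |f|.\<close>
    have "ennreal \<eta> * emeasure lborel (\<Omega> s) <= F (\<Omega> s)" for s
    proof -
      have "ennreal \<eta> * emeasure lborel (\<Omega> s) = (\<integral>\<^sup>+x. ennreal \<eta> * indicator (\<Omega> s) x \<partial>lborel)" by (simp add: nn_integral_cmult)
      also have "\<dots> <= (\<integral>\<^sup>+x. cav s \<Phi> x * indicator (\<Omega> s) x \<partial>lborel)"
        by (intro nn_integral_mono) (auto simp: indicator_def \<Omega>_def stop_def)
      also have "\<dots> = F (\<Omega> s)"
        using cav_invariant[OF _ _ inv_cell_indicator[OF Oi], of \<Phi> s] by (simp add: F_def \<Phi>_def)
      finally show ?thesis .
    qed
    then have "ennreal \<eta> * (\<Sum>s\<le>J. emeasure lborel (\<Omega> s)) <= (\<Sum>s\<le>J. F (\<Omega> s))"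
      unfolding sum_distrib_left by (rule sum_mono)
    then show "(\<Sum>s\<le>J. emeasure lborel (\<Omega> s)) <= ennreal (1 / \<eta>) * L1n f"
      using F1(1) l by (intro ennreal_le_divide) auto
    show "integrable lborel (b s)" for s
      unfolding b_def by (intro iS Bochner_Integration.integrable_diff f iu Om)
    show "mean_zero s (b s)" if "1 <= s" for s
    proof -
      have "b s = (%x. (f x - cavg s f x) * indicator (\<Omega> s) x)" using that by (auto simp: b_def u_def)
      then show ?thesis using mean_zero_cavg[OF f Om Oi, of s] by simp
    qed
    show "y \<in> \<Omega> s" if "b s y \<noteq> 0" for s y using that by (auto simp: b_def indicator_def split: if_splits)
    show "cav s (%y. ennreal (norm (b s y))) x <= ennreal (2 * 2 ^ DIM('a) * \<eta>)" if s: "1 <= s" for s x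
    proof (cases "x \<in> \<Omega> s")
      case True
      have cu: "u s = cavg s f" using s by (simp add: u_def)
      have "ennreal (ck s x y) * ennreal (norm (b s y)) <= ennreal (ck s x y) * \<Phi> y + ennreal (ck s x y) * ennreal (norm (cavg s f x))" for y
      proof (cases "cell s x = cell s y")
        case c: True
        have "norm (b s y) <= norm (f y) + norm (cavg s f x)"
          using norm_triangle_ineq4[of "f y" "cavg s f y"] inv_cellD[OF inv_cell_cavg c, of f] by (simp add: b_def cu indicator_def)
        then have "ennreal (norm (b s y)) <= \<Phi> y + ennreal (norm (cavg s f x))"
          unfolding \<Phi>_def by (simp add: ennreal_plus[symmetric] ennreal_leI del: ennreal_plus)
        then show ?thesis unfolding distrib_left[symmetric] by (rule mult_left_mono) simp
      qed (simp add: ck_def)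
      then have "cav s (%y. ennreal (norm (b s y))) x <= (\<integral>\<^sup>+y. ennreal (ck s x y) * \<Phi> y + ennreal (ck s x y) * ennreal (norm (cavg s f x)) \<partial>lborel)"
        unfolding cav_def by (intro nn_integral_mono)
      also have "\<dots> = cav s \<Phi> x + ennreal (norm (cavg s f x))"
        unfolding cav_def by (subst nn_integral_add) (simp_all add: nn_integral_multc ck_integral')
      also have "\<dots> <= ennreal (2 ^ DIM('a) * \<eta>) + ennreal (2 ^ DIM('a) * \<eta>)"
        using small[OF s True] small2[OF True] unfolding cu by (intro add_mono ennreal_leI)
      finally show ?thesis using l by (simp add: ennreal_plus[symmetric] mult_ac del: ennreal_plus)
    next
      case False
      have z: "ennreal (ck s x y) * ennreal (norm (b s y)) = 0" for y
        using False inv_cellD[OF Oi, of s x y] by (simp add: ck_def b_def indicator_def)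
      have "cav s (%y. ennreal (norm (b s y))) x = 0" by (simp only: cav_def z nn_integral_const mult_zero_left)
      then show ?thesis by simp
    qed
    have "(\<Sum>s\<le>J. L1n (b s)) <= (\<Sum>s\<le>J. 2 * F (\<Omega> s))" by (intro sum_mono bL)
    also have "\<dots> <= 2 * L1n f" unfolding sum_distrib_left[symmetric] by (intro mult_left_mono F1) simp
    finally show "(\<Sum>s\<le>J. L1n (b s)) <= 2 * L1n f" .
    show "mean_zero J w" unfolding w_def by (rule mean_zero_cavg[OF f Nm Ni])
    show "L1n w <= 2 * L1n f" by (rule order_trans[OF wL]) (intro mult_left_mono F1, simp)
    show "integrable lborel g"
      unfolding g_def by (intro Bochner_Integration.integrable_add Bochner_Integration.integrable_sum iS iu integrable_cavg f Om Nm)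
    show "(\<integral>\<^sup>+x. ennreal ((norm (g x))\<^sup>2) \<partial>lborel) <= ennreal (2 ^ DIM('a) * \<eta>) * L1n f" by (rule gS)
    show "f x = g x + (\<Sum>s\<le>J. b s x) + w x" for x
    proof -
      have "g x + (\<Sum>s\<le>J. b s x) + w x = (\<Sum>s\<le>J. u s x * indicator (\<Omega> s) x + b s x) + f x * indicator N x"
        by (simp add: g_def w_def sum.distrib algebra_simps)
      also have "(\<Sum>s\<le>J. u s x * indicator (\<Omega> s) x + b s x) = (\<Sum>s\<le>J. f x * indicator (\<Omega> s) x)"
        by (intro sum.cong) (auto simp: b_def algebra_simps)
      also have "\<dots> + f x * indicator N x = f x"
        unfolding sum_distrib_left[symmetric] distrib_left[symmetric] part(3) by simp
      finally show ?thesis by simp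
    qed
  qed
qed

text \<open>The enlargement is a superlevel set of a convolution in place of a union of dilated
  cubes. If x is within 2^(-s) of a point y of \<Omega>, then the whole cell of y lies in \<Omega>
  and within r = (1 + 2n) 2^(-s) of x, so the convolution at x is at least 1. Markov's inequality
  bounds the measure, and \<open>C\<close> is 2^(sn) times the volume of a ball of radius r.\<close>

lemma enlarged_set:
  "\<exists>C\<ge>0. \<forall>s. \<forall>\<Omega> \<in> sets (borel :: 'a::euclidean_space measure). inv_cell s (%x. x \<in> \<Omega>) -->
    (\<exists>\<Omega>'\<in>sets borel. emeasure lborel \<Omega>' <= ennreal C * emeasure lborel \<Omega> \<and> (\<forall>x y. x \<notin> \<Omega>' --> y \<in> \<Omega> --> 1 / 2 ^ s <= norm (x - y)))"
proof -
  define n where "n = DIM('a)"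
  define C where "C = unit_ball_vol (real n) * (1 + 2 * real n) ^ n"
  have C: "0 <= C" by (simp add: C_def)
  show ?thesis
  proof (intro exI[of _ C] conjI C allI ballI impI)
    fix s and \<Omega> :: "'a set" assume [measurable]: "\<Omega> \<in> sets borel" and i: "inv_cell s (%x. x \<in> \<Omega>)"
    define r where "r = (1 + 2 * real n) / 2 ^ s"
    have r: "0 <= r" by (simp add: r_def)
    define k where "k x y = (if norm (x - y) <= r then ennreal (2 ^ (s * n)) else 0)" for x y :: 'a
    have [measurable]: "(%(x, y). k x y) \<in> borel_measurable (borel \<Otimes>\<^sub>M borel)" unfolding k_def by measurable
    have ki: "(\<integral>\<^sup>+x. k x y \<partial>lborel) = ennreal C" for y
    proof -
      have "(\<integral>\<^sup>+x. k x y \<partial>lborel) = (\<integral>\<^sup>+x. ennreal (2 ^ (s * n)) * indicator (cball y r) x \<partial>lborel)"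
        by (intro nn_integral_cong) (auto simp: k_def indicator_def dist_norm norm_minus_commute)
      also have "\<dots> = ennreal (2 ^ (s * n)) * ennreal (unit_ball_vol (real n) * r ^ n)"
        by (subst nn_integral_cmult_indicator) (auto simp: emeasure_cball[OF r] n_def)
      also have "\<dots> = ennreal C"
        using r by (simp add: ennreal_mult[symmetric] C_def r_def power_divide power_mult)
      finally show ?thesis .
    qed
    define h where "h x = (\<integral>\<^sup>+y. k x y * indicator \<Omega> y \<partial>lborel)" for x
    have [measurable]: "h \<in> borel_measurable borel" unfolding h_def by measurable
    have hI: "(\<integral>\<^sup>+x. h x \<partial>lborel) = ennreal C * emeasure lborel \<Omega>"
    proof -
      have "(\<integral>\<^sup>+x. h x \<partial>lborel) = (\<integral>\<^sup>+y. \<integral>\<^sup>+x. k x y * indicator \<Omega> y \<partial>lborel \<partial>lborel)"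
        unfolding h_def by (rule lborel_pair.Fubini'[symmetric]) measurable
      then show ?thesis by (simp add: nn_integral_multc ki nn_integral_cmult)
    qed
    show "\<exists>\<Omega>'\<in>sets borel. emeasure lborel \<Omega>' <= ennreal C * emeasure lborel \<Omega> \<and> (\<forall>x y. x \<notin> \<Omega>' --> y \<in> \<Omega> --> 1 / 2 ^ s <= norm (x - y))"
    proof (intro bexI[of _ "{x. 1 <= h x}"] conjI allI impI)
      have "emeasure lborel {x. 1 <= h x} = (\<integral>\<^sup>+x. indicator {x. 1 <= h x} x \<partial>lborel)" by simp
      also have "\<dots> <= (\<integral>\<^sup>+x. h x \<partial>lborel)" by (intro nn_integral_mono) (auto simp: indicator_def)
      finally show "emeasure lborel {x. 1 <= h x} <= ennreal C * emeasure lborel \<Omega>" by (simp add: hI)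
      fix x y assume x: "x \<notin> {x. 1 <= h x}" and y: "y \<in> \<Omega>"
      show "1 / 2 ^ s <= norm (x - y)"
      proof (rule ccontr)
        assume "\<not> ?thesis"
        then have xy: "norm (x - y) <= 1 / 2 ^ s" by simp
        have "ennreal (ck s z y) <= k x z * indicator \<Omega> z" for z
        proof (cases "cell s z = cell s y")
          case True
          have "norm (x - z) <= norm (x - y) + (norm (y - cell s y) + norm (z - cell s z))"
            using norm_triangle_ineq[of "x - y" "y - z"] norm_triangle_ineq4[of "y - cell s y" "z - cell s z"] True by simp
          also have "\<dots> <= 1 / 2 ^ s + (n / 2 ^ s + n / 2 ^ s)"
            using xy cell_dist[of y s] cell_dist[of z s] by (intro add_mono) (auto simp: n_def)
          also have "\<dots> = r" by (simp add: r_def add_divide_distrib)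
          finally have "norm (x - z) <= r" .
          moreover have "z \<in> \<Omega>" using y inv_cellD[OF i True] by simp
          ultimately show ?thesis by (simp add: k_def ck_def n_def True)
        qed (simp add: ck_def)
        then have "(\<integral>\<^sup>+z. ennreal (ck s z y) \<partial>lborel) <= h x" unfolding h_def by (rule nn_integral_mono)
        then show False using x by (simp add: ck_integral)
      qed
    qed measurable
  qed
qed

section \<open>Low, middle and high frequencies\<close>

lemma geometric_half_le:
  fixes g :: "'b => nat"
  assumes "finite A" "inj_on g A" shows "(\<Sum>l\<in>A. (1 / 2 :: real) ^ g l) <= 2"
proof -
  have "(\<Sum>l\<in>A. (1 / 2 :: real) ^ g l) = (\<Sum>i\<in>g ` A. (1 / 2) ^ i)" by (simp add: sum.reindex[OF assms(2)])
  also have "\<dots> <= (\<Sum>i. (1 / 2) ^ i)" using assms(1) by (intro sum_le_suminf) (auto intro: summable_geometric)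
  also have "\<dots> = 2" by (subst suminf_geometric) auto
  finally show ?thesis .
qed

lemma nn_integral_norm_sum_le:
  fixes f :: "'s => 'a::euclidean_space => complex"
  assumes [measurable]: "E \<in> sets borel" and "\<And>s. s \<in> A ==> f s \<in> borel_measurable borel"
  shows "(\<integral>\<^sup>+x. indicator E x * ennreal (norm (\<Sum>s\<in>A. f s x)) \<partial>lborel) <= (\<Sum>s\<in>A. \<integral>\<^sup>+x. indicator E x * ennreal (norm (f s x)) \<partial>lborel)"
proof -
  have "(\<integral>\<^sup>+x. indicator E x * ennreal (norm (\<Sum>s\<in>A. f s x)) \<partial>lborel) <= (\<integral>\<^sup>+x. (\<Sum>s\<in>A. indicator E x * ennreal (norm (f s x))) \<partial>lborel)"
  proof (rule nn_integral_mono)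
    fix x
    have "ennreal (norm (\<Sum>s\<in>A. f s x)) <= (\<Sum>s\<in>A. ennreal (norm (f s x)))"
      unfolding sum_ennreal[OF norm_ge_zero] by (intro ennreal_leI norm_sum)
    then show "indicator E x * ennreal (norm (\<Sum>s\<in>A. f s x)) <= (\<Sum>s\<in>A. indicator E x * ennreal (norm (f s x)))"
      unfolding sum_distrib_left[symmetric] by (rule mult_left_mono) simp
  qed
  also have "\<dots> = (\<Sum>s\<in>A. \<integral>\<^sup>+x. indicator E x * ennreal (norm (f s x)) \<partial>lborel)"
    by (rule nn_integral_sum) (use assms in simp)
  finally show ?thesis .
qed

text \<open>Bad parts of different scales interact. For s <= t the mass of the coarser part is
  paired with the potential of the finer one, whose bound is smaller by 2^(-(t - s)n); the double
  sum is then controlled by its diagonal. The symmetry of the form leaves the choice free. The 4 is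
  2 for the two orderings times 2 for the geometric series.\<close>

lemma EE_sum_bound:
  fixes b :: "nat => 'a::euclidean_space => complex"
  assumes S: "finite S" and bm: "\<And>s. s \<in> S ==> b s \<in> borel_measurable borel"
    and c: "\<And>s x. s \<in> S ==> cav s (%y. ennreal (norm (b s y))) x <= ennreal \<Lambda>" and \<Lambda>: "0 <= \<Lambda>"
    and R: "\<And>s. s \<in> S ==> 2 ^ s <= R" "0 < R"
    and m: "\<And>s. s \<in> S ==> L1n (b s) = ennreal (m s)" "\<And>s. s \<in> S ==> 0 <= m s"
    and K: "K = ((2 + 2 * (real DIM('a))\<^sup>2) ^ DIM('a))\<^sup>2 * (LINT z|lborel. jw DIM('a) (z::'a))"
  shows "EE DIM('a) lborel (%y. y) (%y. \<Sum>s\<in>S. b s y) R <= ennreal (4 * K * \<Lambda> * (\<Sum>s\<in>S. m s * (R ^ DIM('a) / 2 ^ (s * DIM('a)))))"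
proof -
  define n where "n = DIM('a)"
  have n: "1 <= n" using DIM_positive[where 'a='a] by (simp add: n_def Suc_le_eq)
  have K0: "0 <= K" unfolding K by (intro mult_nonneg_nonneg integral_nonneg_AE) auto
  define k where "k z = R ^ n * jw n (R *\<^sub>R (z::'a))" for z
  have k0: "0 <= k z" for z using R(2) by (simp add: k_def)
  have km[measurable]: "k \<in> borel_measurable borel" unfolding k_def by measurable
  have ks: "k (y - y') = k (y' - y)" for y y' by (simp add: k_def jw_def norm_minus_commute)
  define P where "P s t = (\<integral>\<^sup>+y'. \<integral>\<^sup>+y. ennreal (norm (b s y') * norm (b t y) * k (y' - y)) \<partial>lborel \<partial>lborel)" for s t
  define Y where "Y s = K * \<Lambda> * (R ^ n / 2 ^ (s * n))" for s
  have Y0: "0 <= Y s" for s using K0 \<Lambda> R(2) by (simp add: Y_def)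
  have P1: "P s t <= ennreal (m s * Y t)" if s: "s \<in> S" and t: "t \<in> S" for s t
  proof -
    note [measurable] = bm[OF s] bm[OF t]
    have "(\<integral>\<^sup>+y. ennreal (norm (b s y') * norm (b t y) * k (y' - y)) \<partial>lborel) <= ennreal (norm (b s y')) * ennreal (Y t)" for y'
    proof -
      have "(\<integral>\<^sup>+y. ennreal (norm (b s y') * norm (b t y) * k (y' - y)) \<partial>lborel) = (\<integral>\<^sup>+y. ennreal (norm (b s y')) * (ennreal (norm (b t y)) * ennreal (k (y' - y))) \<partial>lborel)"
        using k0 by (intro nn_integral_cong) (simp add: ennreal_mult[symmetric] mult.assoc)
      also have "\<dots> = ennreal (norm (b s y')) * (\<integral>\<^sup>+y. ennreal (norm (b t y)) * ennreal (k (y' - y)) \<partial>lborel)"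
        by (rule nn_integral_cmult) measurable
      also have "\<dots> <= ennreal (norm (b s y')) * ennreal (Y t)"
      proof (rule mult_left_mono)
        show "(\<integral>\<^sup>+y. ennreal (norm (b t y)) * ennreal (k (y' - y)) \<partial>lborel) <= ennreal (Y t)"
          using cell_potential_bound[OF _ c[OF t] \<Lambda> R(1)[OF t], of y'] unfolding k_def n_def Y_def K by simp
      qed simp
      finally show ?thesis .
    qed
    then have "P s t <= (\<integral>\<^sup>+y'. ennreal (norm (b s y')) * ennreal (Y t) \<partial>lborel)"
      unfolding P_def by (rule nn_integral_mono)
    also have "\<dots> = L1n (b s) * ennreal (Y t)" unfolding L1n_def by (rule nn_integral_multc) measurable
    also have "\<dots> = ennreal (m s * Y t)" using m(1)[OF s] m(2)[OF s] Y0 by (simp add: ennreal_mult)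
    finally show ?thesis .
  qed
  have Psym: "P s t = P t s" if s: "s \<in> S" and t: "t \<in> S" for s t
  proof -
    note [measurable] = bm[OF s] bm[OF t]
    have "P s t = (\<integral>\<^sup>+y. \<integral>\<^sup>+y'. ennreal (norm (b s y') * norm (b t y) * k (y' - y)) \<partial>lborel \<partial>lborel)"
      unfolding P_def by (rule lborel_pair.Fubini') measurable
    also have "\<dots> = P t s"
      unfolding P_def
    proof (intro nn_integral_cong arg_cong[where f=ennreal])
      fix x y show "norm (b s x) * norm (b t y) * k (x - y) = norm (b t y) * norm (b s x) * k (y - x)"
        using ks[of x y] by simp
    qed
    finally show ?thesis .
  qed
  \<comment> \<open>The bound for a pair is charged to its coarser member, with a factor 1/2 per
    scale of difference.\<close>
  define W where "W s t = (if s <= t then m s * Y s * (1 / 2) ^ (t - s) else 0)" for s t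
  have W0: "0 <= W s t" if "s \<in> S" for s t using m(2)[OF that] Y0 by (simp add: W_def)
  have mY: "m s * Y t <= W s t" if s: "s \<in> S" and st: "s <= t" for s t
  proof -
    obtain d where d: "t = s + d" using st le_Suc_ex by blast
    have "Y t = Y s / 2 ^ (d * n)" by (simp add: Y_def d add_mult_distrib power_add)
    also have "\<dots> <= Y s / 2 ^ d"
      using n Y0 by (intro divide_left_mono power_increasing mult_pos_pos) auto
    finally have "m s * Y t <= m s * (Y s / 2 ^ d)" using m(2)[OF s] by (rule mult_left_mono)
    then show ?thesis by (simp add: W_def d power_one_over)
  qed
  have PW: "P s t <= ennreal (W s t + W t s)" if s: "s \<in> S" and t: "t \<in> S" for s t
  proof (cases "s <= t")
    case True
    have "m s * Y t <= W s t + W t s" using mY[OF s True] W0[OF t, of s] by simp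
    then show ?thesis using P1[OF s t] ennreal_leI order_trans by blast
  next
    case False
    then have "t <= s" by simp
    then have "m t * Y s <= W s t + W t s" using mY[OF t] W0[OF s, of t] by (simp add: add_increasing)
    then show ?thesis using P1[OF t s] unfolding Psym[OF s t] using ennreal_leI order_trans by blast
  qed
  have "EE n lborel (%y. y) (%y. \<Sum>s\<in>S. b s y) R <= (\<integral>\<^sup>+y'. \<integral>\<^sup>+y. (\<Sum>s\<in>S. \<Sum>t\<in>S. ennreal (norm (b s y') * norm (b t y) * k (y' - y))) \<partial>lborel \<partial>lborel)"
    unfolding EE_def
  proof (intro nn_integral_mono)
    fix y' y
    have "norm (\<Sum>s\<in>S. b s y') * norm (\<Sum>s\<in>S. b s y) * k (y' - y) <= (\<Sum>s\<in>S. norm (b s y')) * (\<Sum>t\<in>S. norm (b t y)) * k (y' - y)"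
      using k0 by (intro mult_right_mono mult_mono norm_sum sum_nonneg) auto
    also have "\<dots> = (\<Sum>s\<in>S. \<Sum>t\<in>S. norm (b s y') * norm (b t y) * k (y' - y))"
      unfolding sum_product by (simp only: sum_distrib_right)
    finally have "ennreal (norm (\<Sum>s\<in>S. b s y') * norm (\<Sum>s\<in>S. b s y) * k (y' - y)) <= ennreal (\<Sum>s\<in>S. \<Sum>t\<in>S. norm (b s y') * norm (b t y) * k (y' - y))"
      by (rule ennreal_leI)
    also have "\<dots> = (\<Sum>s\<in>S. \<Sum>t\<in>S. ennreal (norm (b s y') * norm (b t y) * k (y' - y)))"
      using k0 by (simp add: sum_nonneg flip: sum_ennreal)
    finally show "ennreal (norm (\<Sum>s\<in>S. b s y') * norm (\<Sum>s\<in>S. b s y) * (R ^ DIM('a) * jw n (R *\<^sub>R (y' - y)))) <= (\<Sum>s\<in>S. \<Sum>t\<in>S. ennreal (norm (b s y') * norm (b t y) * k (y' - y)))"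
      by (simp add: k_def n_def)
  qed
  also have "\<dots> = (\<Sum>s\<in>S. \<Sum>t\<in>S. P s t)"
  proof -
    have m2: "(%(y', y). ennreal (norm (b s y') * norm (b t y) * k (y' - y))) \<in> borel_measurable (lborel \<Otimes>\<^sub>M lborel)" if s: "s \<in> S" and t: "t \<in> S" for s t
    proof -
      note [measurable] = bm[OF s] bm[OF t]
      show ?thesis by measurable
    qed
    have m1: "(%y. ennreal (norm (b s y') * norm (b t y) * k (y' - y))) \<in> borel_measurable lborel" if "s \<in> S" "t \<in> S" for s t y'
      using measurable_Pair2[OF m2[OF that], of y'] by simp
    have m3: "(%y'. \<integral>\<^sup>+y. ennreal (norm (b s y') * norm (b t y) * k (y' - y)) \<partial>lborel) \<in> borel_measurable lborel" if "s \<in> S" "t \<in> S" for s t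
      using lborel.borel_measurable_nn_integral_fst[OF m2[OF that]] by simp
    have "(\<integral>\<^sup>+y. (\<Sum>s\<in>S. \<Sum>t\<in>S. ennreal (norm (b s y') * norm (b t y) * k (y' - y))) \<partial>lborel) = (\<Sum>s\<in>S. \<Sum>t\<in>S. \<integral>\<^sup>+y. ennreal (norm (b s y') * norm (b t y) * k (y' - y)) \<partial>lborel)" for y'
      using m1 by (subst nn_integral_sum) (auto intro!: borel_measurable_sum sum.cong nn_integral_sum)
    then show ?thesis
      unfolding P_def using m3 by (simp only:) (subst nn_integral_sum, auto intro!: borel_measurable_sum sum.cong nn_integral_sum)
  qed
  also have "\<dots> <= (\<Sum>s\<in>S. \<Sum>t\<in>S. ennreal (W s t + W t s))" by (intro sum_mono PW)
  also have "\<dots> = ennreal (\<Sum>s\<in>S. \<Sum>t\<in>S. W s t + W t s)"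
    using W0 by (simp add: sum_nonneg flip: sum_ennreal)
  also have "(\<Sum>s\<in>S. \<Sum>t\<in>S. W s t + W t s) = 2 * (\<Sum>s\<in>S. \<Sum>t\<in>S. W s t)"
    using sum.swap[of "%s t. W t s" S S] by (simp add: sum.distrib)
  also have "ennreal (2 * (\<Sum>s\<in>S. \<Sum>t\<in>S. W s t)) <= ennreal (2 * (\<Sum>s\<in>S. 2 * (m s * Y s)))"
  proof (intro ennreal_leI mult_left_mono sum_mono)
    fix s assume s: "s \<in> S"
    have "(\<Sum>t\<in>S. W s t) = m s * Y s * (\<Sum>t\<in>{t\<in>S. s <= t}. (1 / 2) ^ (t - s))"
      unfolding sum_distrib_left using S by (simp add: W_def sum.inter_filter)
    also have "\<dots> <= m s * Y s * 2"
      using S m(2)[OF s] Y0 by (intro mult_left_mono geometric_half_le) (auto simp: inj_on_def)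
    finally show "(\<Sum>t\<in>S. W s t) <= 2 * (m s * Y s)" by simp
  qed simp
  also have "2 * (\<Sum>s\<in>S. 2 * (m s * Y s)) = 4 * K * \<Lambda> * (\<Sum>s\<in>S. m s * (R ^ n / 2 ^ (s * n)))"
    unfolding sum_distrib_left by (intro sum.cong) (auto simp: Y_def mult_ac)
  finally show ?thesis by (simp add: n_def)
qed

context sing
begin

text \<open>Cancellation at scale s yields 2^(l - s), a geometric series over l <= s.\<close>

lemma low_part:
  "\<exists>C\<ge>0. \<forall>s f A. mean_zero s f --> A \<subseteq> {..s} --> L1n (%x. \<Sum>l\<in>A. Tl l f x) <= ennreal C * L1n f"
proof -
  obtain C where C: "0 <= C" "\<And>l s f. mean_zero s f ==> L1n (Tl l f) <= ennreal (C * 2 ^ l / 2 ^ s) * L1n f"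
    using Tl_L1_bounds by blast
  show ?thesis
  proof (intro exI[of _ "C * 2"] conjI allI impI)
    fix s A and f :: "'a => complex" assume f: "mean_zero s f" and A: "A \<subseteq> {..s::nat}"
    have fin: "finite A" using A finite_subset by blast
    have i: "integrable lborel f" using f by (simp add: mean_zero_def)
    have inj: "inj_on (%l. s - l) A"
    proof (rule inj_onI)
      fix x y assume "x \<in> A" "y \<in> A" and e: "s - x = s - y"
      then have "x <= s" "y <= s" using A by auto
      then show "x = y" using e by simp
    qed
    have "L1n (%x. \<Sum>l\<in>A. Tl l f x) <= (\<Sum>l\<in>A. L1n (Tl l f))" by (rule L1n_sum) (rule Tl_measurable[OF i])
    also have "\<dots> <= (\<Sum>l\<in>A. ennreal (C * (1 / 2) ^ (s - l)) * L1n f)"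
    proof (rule sum_mono)
      fix l assume l: "l \<in> A"
      then have "(2::real) ^ s = 2 ^ l * 2 ^ (s - l)" using A by (auto simp flip: power_add)
      then have "C * 2 ^ l / 2 ^ s = C * (1 / 2) ^ (s - l)" by (simp add: power_one_over field_simps)
      then show "L1n (Tl l f) <= ennreal (C * (1 / 2) ^ (s - l)) * L1n f" using C(2)[OF f, of l] by simp
    qed
    also have "\<dots> = ennreal (C * (\<Sum>l\<in>A. (1 / 2) ^ (s - l))) * L1n f"
      using C(1) by (simp add: sum_distrib_left flip: sum_distrib_right)
    also have "\<dots> <= ennreal (C * 2) * L1n f"
      using C(1) by (intro mult_right_mono ennreal_leI mult_left_mono geometric_half_le[OF fin inj]) auto
    finally show "L1n (%x. \<Sum>l\<in>A. Tl l f x) <= ennreal (C * 2) * L1n f" .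
  qed (use C in simp)
qed

text \<open>At distance 2^(-s) from the support the tail bound is 2^(s - \<rho> l), a geometric
  series over \<rho> l >= s.\<close>

lemma high_part:
  "\<exists>C\<ge>0. \<forall>s f A E. integrable lborel f --> finite A --> (\<forall>l\<in>A. real s <= \<rho> * real l) --> E \<in> sets borel -->
     (\<forall>x\<in>E. \<forall>y. f y \<noteq> 0 --> 1 / 2 ^ s <= norm (x - y)) -->
     (\<integral>\<^sup>+x. indicator E x * ennreal (norm (\<Sum>l\<in>A. Tl l f x)) \<partial>lborel) <= ennreal C * L1n f"
proof -
  obtain C where C: "0 <= C" "\<forall>l f E r. integrable lborel f --> E \<in> sets borel --> 0 < r --> (\<forall>x\<in>E. \<forall>y. f y \<noteq> 0 --> r <= norm (x - y)) -->
       (\<integral>\<^sup>+x. indicator E x * ennreal (norm (Tl l f x)) \<partial>lborel) <= ennreal (C / (2 powr (\<rho> * real l) * r)) * L1n f"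
    using Tl_L1_bounds by (elim exE conjE)
  show ?thesis
  proof (intro exI[of _ "C * 4"] conjI allI impI)
    fix s A E and f :: "'a => complex" assume f: "integrable lborel f" and fin: "finite A" and A: "\<forall>l\<in>A. real s <= \<rho> * real l" and E: "E \<in> sets borel"
      and d: "\<forall>x\<in>E. \<forall>y. f y \<noteq> 0 --> 1 / 2 ^ s <= norm (x - y)"
    have "(\<integral>\<^sup>+x. indicator E x * ennreal (norm (\<Sum>l\<in>A. Tl l f x)) \<partial>lborel) <= (\<Sum>l\<in>A. \<integral>\<^sup>+x. indicator E x * ennreal (norm (Tl l f x)) \<partial>lborel)"
      by (rule nn_integral_norm_sum_le[OF E Tl_measurable[OF f]])
    also have "\<dots> <= (\<Sum>l\<in>A. ennreal (C * 2 powr (real s - \<rho> * real l)) * L1n f)"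
    proof (rule sum_mono)
      fix l
      have "C / (2 powr (\<rho> * real l) * (1 / 2 ^ s)) = C * 2 powr (real s - \<rho> * real l)"
        by (simp add: powr_diff powr_realpow)
      then show "(\<integral>\<^sup>+x. indicator E x * ennreal (norm (Tl l f x)) \<partial>lborel) <= ennreal (C * 2 powr (real s - \<rho> * real l)) * L1n f"
        using C(2)[THEN spec, THEN spec, THEN spec, THEN spec, THEN mp, OF f, THEN mp, OF E, THEN mp, OF _ , THEN mp, OF _ d, of l] by simp
    qed
    also have "\<dots> = ennreal (C * (\<Sum>l\<in>A. 2 powr (real s - \<rho> * real l))) * L1n f"
      using C(1) by (simp add: sum_distrib_left flip: sum_distrib_right)
    also have "\<dots> <= ennreal (C * 4) * L1n f"
      using C(1) A by (intro mult_right_mono ennreal_leI mult_left_mono sum_powr_le(2)[OF \<rho>(1) fin]) auto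
    finally show "(\<integral>\<^sup>+x. indicator E x * ennreal (norm (\<Sum>l\<in>A. Tl l f x)) \<partial>lborel) <= ennreal (C * 4) * L1n f" .
  qed (use C in simp)
qed

text \<open>Here the critical order is spent: 2^(-2\<mu>l) times the loss (2^l/2^s)^n of the
  potentials equals 2^(n(\<rho> l - s)). For fixed s this is summable over \<rho> l <= s, exactly up
  to where the tail bound takes over. The condition s <= l supplies 2^s <= 2 * 2^l for
  \<open>EE_sum_bound\<close>. Only averages of the bad parts are used, not their
  cancellation.\<close>

lemma mid_part:
  "\<exists>C\<ge>0. \<forall>J b \<Lambda>. 0 <= \<Lambda> --> (\<forall>s. integrable lborel (b s)) --> (\<forall>s\<ge>1. \<forall>x. cav s (%y. ennreal (norm (b s y))) x <= ennreal \<Lambda>) -->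
     (\<integral>\<^sup>+x. ennreal ((norm (\<Sum>l\<le>J. Tl l (%y. \<Sum>s\<in>{s\<in>{..J}. 1 <= s \<and> s <= l \<and> \<rho> * real l <= real s}. b s y) x))\<^sup>2) \<partial>lborel) <= ennreal (C * \<Lambda>) * (\<Sum>s\<le>J. L1n (b s))"
proof -
  define n where "n = DIM('a)"
  have n: "1 <= n" using DIM_positive[where 'a='a] by (simp add: n_def Suc_le_eq)
  define K where "K = ((2 + 2 * (real DIM('a))\<^sup>2) ^ DIM('a))\<^sup>2 * (LINT z|lborel. jw DIM('a) (z::'a))"
  have K0: "0 <= K" unfolding K_def by (intro mult_nonneg_nonneg integral_nonneg_AE) auto
  obtain C where C: "0 <= C" "\<forall>A (u :: nat => 'a => complex) e. finite A --> (\<forall>l\<in>A. integrable lborel (u l)) --> (\<forall>l\<in>A. 0 <= e l) -->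
     (\<forall>l\<in>A. ennreal (2 powr (- 2 * \<mu> * l)) * EE n lborel (%y. y) (u l) (2 * 2 ^ l) <= ennreal (e l)) -->
     (\<integral>\<^sup>+x. ennreal ((norm (\<Sum>l\<in>A. Tl l (u l) x))\<^sup>2) \<partial>lborel) <= ennreal (C * (\<Sum>l\<in>A. e l))"
    using orthogonality_EE[of n] by (elim exE conjE)
  define D where "D = 4 * K * 2 ^ n"
  have D: "0 <= D" using K0 by (simp add: D_def)
  show ?thesis
  proof (intro exI[of _ "C * D * 4"] conjI allI impI)
    fix J \<Lambda> and b :: "nat => 'a => complex" assume \<Lambda>: "0 <= \<Lambda>" and b: "\<forall>s. integrable lborel (b s)"
      and c: "\<forall>s\<ge>1. \<forall>x. cav s (%y. ennreal (norm (b s y))) x <= ennreal \<Lambda>"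
    define m where "m s = enn2real (L1n (b s))" for s
    have m: "L1n (b s) = ennreal (m s)" "0 <= m s" for s
    proof -
      have "L1n (b s) < \<infinity>" using b[rule_format, of s] by (simp add: L1n_def integrable_iff_bounded)
      then show "L1n (b s) = ennreal (m s)" by (simp add: m_def)
    qed (simp add: m_def)
    define S where "S l = {s\<in>{..J}. 1 <= s \<and> s <= l \<and> \<rho> * real l <= real s}" for l
    define e where "e l = D * \<Lambda> * (\<Sum>s\<in>S l. m s * 2 powr (n * (\<rho> * real l - real s)))" for l
    have e0: "0 <= e l" for l using D \<Lambda> m(2) by (simp add: e_def sum_nonneg)
    have eb: "ennreal (2 powr (- 2 * \<mu> * l)) * EE n lborel (%y. y) (%y. \<Sum>s\<in>S l. b s y) (2 * 2 ^ l) <= ennreal (e l)" for l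
    proof -
      have bm: "b s \<in> borel_measurable borel" for s using borel_measurable_integrable[OF b[rule_format, of s]] by simp
      have "EE n lborel (%y. y) (%y. \<Sum>s\<in>S l. b s y) (2 * 2 ^ l) <= ennreal (4 * K * \<Lambda> * (\<Sum>s\<in>S l. m s * ((2 * 2 ^ l) ^ n / 2 ^ (s * n))))"
        unfolding n_def
      proof (rule EE_sum_bound[OF _ bm _ \<Lambda> _ _ m K_def])
        show "finite (S l)" by (simp add: S_def)
        show "cav s (%y. ennreal (norm (b s y))) x <= ennreal \<Lambda>" if "s \<in> S l" for s x
          using c that by (simp add: S_def)
        show "(2::real) ^ s <= 2 * 2 ^ l" if "s \<in> S l" for s
        proof -
          have "(2::real) ^ s <= 2 ^ l" using that by (intro power_increasing) (auto simp: S_def)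
          then show ?thesis using zero_le_power[of "2::real" l] by linarith
        qed
      qed simp
      then have "ennreal (2 powr (- 2 * \<mu> * l)) * EE n lborel (%y. y) (%y. \<Sum>s\<in>S l. b s y) (2 * 2 ^ l) <=
        ennreal (2 powr (- 2 * \<mu> * l)) * ennreal (4 * K * \<Lambda> * (\<Sum>s\<in>S l. m s * ((2 * 2 ^ l) ^ n / 2 ^ (s * n))))"
        by (rule mult_left_mono) simp
      also have "\<dots> = ennreal (2 powr (- 2 * \<mu> * l) * (4 * K * \<Lambda> * (\<Sum>s\<in>S l. m s * ((2 * 2 ^ l) ^ n / 2 ^ (s * n)))))"
        by (rule ennreal_mult'[symmetric]) simp
      also have "2 powr (- 2 * \<mu> * l) * (4 * K * \<Lambda> * (\<Sum>s\<in>S l. m s * ((2 * 2 ^ l) ^ n / 2 ^ (s * n)))) = e l"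
      proof -
        have "2 powr (- 2 * \<mu> * l) * ((2 * 2 ^ l) ^ n / 2 ^ (s * n)) = 2 ^ n * 2 powr (n * (\<rho> * real l - real s))" for s
        proof -
          have h1: "(2 * 2 ^ l) ^ n = 2 ^ n * (2::real) powr (real l * n)"
            by (simp add: power_mult_distrib powr_realpow flip: power_mult of_nat_mult)
          have h2: "(2::real) ^ (s * n) = 2 powr (real s * n)" by (simp add: powr_realpow flip: of_nat_mult)
          have h3: "- 2 * \<mu> * l + real l * n - real s * n = n * (\<rho> * real l - real s)"
            unfolding \<mu> n_def by (simp add: field_simps)
          have h4: "2 powr (- 2 * \<mu> * l) * ((2::real) powr (real l * n) / 2 powr (real s * n)) = 2 powr (- 2 * \<mu> * l + real l * n - real s * n)"
            by (simp only: powr_diff powr_add times_divide_eq_right)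
          have "2 powr (- 2 * \<mu> * l) * ((2 * 2 ^ l) ^ n / 2 ^ (s * n)) = 2 ^ n * (2 powr (- 2 * \<mu> * l) * (2 powr (real l * n) / 2 powr (real s * n)))"
            unfolding h1 h2 by simp
          then show ?thesis unfolding h4 h3 .
        qed
        note h = this
        have gen: "A * (4 * K * \<Lambda> * (t * r)) = 4 * K * p * \<Lambda> * (t * Z)" if "A * r = p * Z" for A r p Z t :: real
          using that by algebra
        have q: "2 powr (- 2 * \<mu> * l) * (4 * K * \<Lambda> * (m s * ((2 * 2 ^ l) ^ n / 2 ^ (s * n)))) = D * \<Lambda> * (m s * 2 powr (n * (\<rho> * real l - real s)))" for s
          unfolding D_def by (rule gen[OF h])
        show ?thesis unfolding e_def sum_distrib_left q ..
      qed
      finally show ?thesis .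
    qed
    have "(\<integral>\<^sup>+x. ennreal ((norm (\<Sum>l\<le>J. Tl l (%y. \<Sum>s\<in>S l. b s y) x))\<^sup>2) \<partial>lborel) <= ennreal (C * (\<Sum>l\<le>J. e l))"
      by (rule C(2)[THEN spec, THEN spec, THEN spec, THEN mp, THEN mp, THEN mp, THEN mp]) (use b e0 eb in auto)
    also have "\<dots> <= ennreal (C * (D * \<Lambda> * (4 * (\<Sum>s\<le>J. m s))))"
    proof (intro ennreal_leI mult_left_mono C(1))
      have e: "(\<Sum>l\<le>J. e l) = D * \<Lambda> * (\<Sum>l\<le>J. \<Sum>s\<in>S l. m s * 2 powr (n * (\<rho> * real l - real s)))"
        by (simp add: e_def sum_distrib_left)
      \<comment> \<open>Orthogonality needs the bad parts grouped by frequency; their energies are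
        regrouped by scale, where the series in l can be summed.\<close>
      have "(\<Sum>l\<le>J. \<Sum>s\<in>S l. m s * 2 powr (n * (\<rho> * real l - real s))) = (\<Sum>s\<le>J. \<Sum>l\<in>{l\<in>{..J}. 1 <= s \<and> s <= l \<and> \<rho> * real l <= real s}. m s * 2 powr (n * (\<rho> * real l - real s)))"
        unfolding S_def by (rule sum.swap_restrict) auto
      also have "\<dots> <= (\<Sum>s\<le>J. m s * 4)"
      proof (rule sum_mono)
        fix s
        let ?A = "{l\<in>{..J}. 1 <= s \<and> s <= l \<and> \<rho> * real l <= real s}"
        have "(\<Sum>l\<in>?A. 2 powr (n * (\<rho> * real l - real s))) <= (\<Sum>l\<in>?A. 2 powr (\<rho> * real l - real s))"
        proof (intro sum_mono powr_mono)
          fix l assume "l \<in> ?A"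
          then have "\<rho> * real l - real s <= 0" by simp
          then show "n * (\<rho> * real l - real s) <= \<rho> * real l - real s"
            using mult_right_mono_neg[of 1 "real n" "\<rho> * real l - real s"] n by simp
        qed simp
        also have "\<dots> <= 4" by (rule sum_powr_le(1)[OF \<rho>(1)]) auto
        finally show "(\<Sum>l\<in>?A. m s * 2 powr (n * (\<rho> * real l - real s))) <= m s * 4"
          unfolding sum_distrib_left[symmetric] by (rule mult_left_mono) (rule m(2))
      qed
      also have "\<dots> = 4 * (\<Sum>s\<le>J. m s)" by (simp flip: sum_distrib_right)
      finally show "(\<Sum>l\<le>J. e l) <= D * \<Lambda> * (4 * (\<Sum>s\<le>J. m s))"
        unfolding e by (rule mult_left_mono) (simp add: D \<Lambda>)
    qed
    also have "\<dots> = ennreal (C * D * 4 * \<Lambda>) * (\<Sum>s\<le>J. L1n (b s))"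
    proof -
      have "C * (D * \<Lambda> * (4 * (\<Sum>s\<le>J. m s))) = C * D * 4 * \<Lambda> * (\<Sum>s\<le>J. m s)" by simp
      then show ?thesis using C(1) D \<Lambda> m by (simp only: m(1) sum_ennreal) (simp add: ennreal_mult'[symmetric])
    qed
    finally show "(\<integral>\<^sup>+x. ennreal ((norm (\<Sum>l\<le>J. Tl l (%y. \<Sum>s\<in>{s\<in>{..J}. 1 <= s \<and> s <= l \<and> \<rho> * real l <= real s}. b s y) x))\<^sup>2) \<partial>lborel) <= ennreal (C * D * 4 * \<Lambda>) * (\<Sum>s\<le>J. L1n (b s))"
      by (simp only: S_def)
  qed (use C D in simp)
qed

end

section \<open>The weak type bound and convergence in measure\<close>

lemma emeasure_Un_le:
  assumes "A \<in> sets M" "B \<in> sets M" "emeasure M A <= a" "emeasure M B <= b"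
  shows "emeasure M (A \<union> B) <= a + b"
  by (rule order_trans[OF emeasure_subadditive[OF assms(1,2)] add_mono[OF assms(3,4)]])

section \<open>Convergence in measure\<close>

definition limm :: "(nat => 'a::euclidean_space => complex) => ('a => complex) => bool" where
  "limm F u \<longleftrightarrow> (\<forall>J. F J \<in> borel_measurable borel) \<and> u \<in> borel_measurable borel \<and>
     (\<forall>\<epsilon>>0. \<forall>\<delta>>0. \<exists>N. \<forall>J\<ge>N. emeasure lborel {x. \<epsilon> < norm (F J x - u x)} <= ennreal \<delta>)"

lemma limmD:
  assumes "limm F u" "0 < \<epsilon>" "0 < \<delta>"
  obtains N where "\<And>J. N <= J ==> emeasure lborel {x. \<epsilon> < norm (F J x - u x)} <= ennreal \<delta>"
  using assms unfolding limm_def by blast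

lemma limm_measurable:
  assumes "limm F u" shows "F J \<in> borel_measurable borel" "u \<in> borel_measurable borel"
  using assms by (auto simp: limm_def)

lemma limm_add:
  assumes F: "limm F u" and G: "limm G v"
  shows "limm (%J x. F J x + G J x) (%x. u x + v x)"
  unfolding limm_def
proof (intro conjI allI impI)
  note [measurable] = limm_measurable[OF F] limm_measurable[OF G]
  show "(%x. F J x + G J x) \<in> borel_measurable borel" for J by measurable
  show "(%x. u x + v x) \<in> borel_measurable borel" by measurable
  fix \<epsilon> \<delta> :: real assume e: "0 < \<epsilon>" and d: "0 < \<delta>"
  have e2: "0 < \<epsilon> / 2" and d2: "0 < \<delta> / 2" using e d by auto
  obtain N1 where N1: "\<And>J. N1 <= J ==> emeasure lborel {x. \<epsilon> / 2 < norm (F J x - u x)} <= ennreal (\<delta> / 2)" by (rule limmD[OF F e2 d2]) blast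
  obtain N2 where N2: "\<And>J. N2 <= J ==> emeasure lborel {x. \<epsilon> / 2 < norm (G J x - v x)} <= ennreal (\<delta> / 2)" by (rule limmD[OF G e2 d2]) blast
  show "\<exists>N. \<forall>J\<ge>N. emeasure lborel {x. \<epsilon> < norm (F J x + G J x - (u x + v x))} <= ennreal \<delta>"
  proof (intro exI[of _ "max N1 N2"] allI impI)
    fix J assume J: "max N1 N2 <= J"
    have "{x. \<epsilon> < norm (F J x + G J x - (u x + v x))} \<subseteq> {x. \<epsilon> / 2 < norm (F J x - u x)} \<union> {x. \<epsilon> / 2 < norm (G J x - v x)}"
    proof
      fix x assume "x \<in> {x. \<epsilon> < norm (F J x + G J x - (u x + v x))}"
      moreover have "norm (F J x + G J x - (u x + v x)) <= norm (F J x - u x) + norm (G J x - v x)"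
        unfolding add_diff_add by (rule norm_triangle_ineq)
      ultimately show "x \<in> {x. \<epsilon> / 2 < norm (F J x - u x)} \<union> {x. \<epsilon> / 2 < norm (G J x - v x)}" by auto
    qed
    then have "emeasure lborel {x. \<epsilon> < norm (F J x + G J x - (u x + v x))} <= emeasure lborel ({x. \<epsilon> / 2 < norm (F J x - u x)} \<union> {x. \<epsilon> / 2 < norm (G J x - v x)})"
      by (rule emeasure_mono) measurable
    also have "\<dots> <= ennreal (\<delta> / 2) + ennreal (\<delta> / 2)"
      by (intro emeasure_Un_le N1 N2) (use J in auto)
    also have "\<dots> = ennreal \<delta>" using d by (simp add: ennreal_plus[symmetric] del: ennreal_plus)
    finally show "emeasure lborel {x. \<epsilon> < norm (F J x + G J x - (u x + v x))} <= ennreal \<delta>" .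
  qed
qed

lemma limm_cmult:
  assumes F: "limm F u" shows "limm (%J x. c * F J x) (%x. c * u x)"
  unfolding limm_def
proof (intro conjI allI impI)
  note [measurable] = limm_measurable[OF F]
  show "(%x. c * F J x) \<in> borel_measurable borel" for J by measurable
  show "(%x. c * u x) \<in> borel_measurable borel" by measurable
  fix \<epsilon> \<delta> :: real assume e: "0 < \<epsilon>" and d: "0 < \<delta>"
  have e2: "0 < \<epsilon> / (norm c + 1)" using e by (intro divide_pos_pos add_nonneg_pos) auto
  obtain N where N: "\<And>J. N <= J ==> emeasure lborel {x. \<epsilon> / (norm c + 1) < norm (F J x - u x)} <= ennreal \<delta>" by (rule limmD[OF F e2 d]) blast
  show "\<exists>N. \<forall>J\<ge>N. emeasure lborel {x. \<epsilon> < norm (c * F J x - c * u x)} <= ennreal \<delta>"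
  proof (intro exI[of _ N] allI impI)
    fix J assume J: "N <= J"
    have "{x. \<epsilon> < norm (c * F J x - c * u x)} \<subseteq> {x. \<epsilon> / (norm c + 1) < norm (F J x - u x)}"
    proof
      fix x assume "x \<in> {x. \<epsilon> < norm (c * F J x - c * u x)}"
      then have "\<epsilon> < norm c * norm (F J x - u x)" by (simp add: right_diff_distrib[symmetric] norm_mult)
      also have "\<dots> <= (norm c + 1) * norm (F J x - u x)" by (intro mult_right_mono) auto
      finally show "x \<in> {x. \<epsilon> / (norm c + 1) < norm (F J x - u x)}"
        using norm_ge_zero[of c] by (simp add: pos_divide_less_eq mult.commute add_nonneg_pos)
    qed
    then have "emeasure lborel {x. \<epsilon> < norm (c * F J x - c * u x)} <= emeasure lborel {x. \<epsilon> / (norm c + 1) < norm (F J x - u x)}"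
      by (rule emeasure_mono) measurable
    then show "emeasure lborel {x. \<epsilon> < norm (c * F J x - c * u x)} <= ennreal \<delta>" using N[OF J] by simp
  qed
qed

lemma ennreal_le_all_pos:
  assumes "\<And>\<delta>::real. 0 < \<delta> ==> X <= Y + ennreal \<delta>" shows "X <= Y"
  by (rule ennreal_le_epsilon) (use assms in auto)

lemma AE_zero_of_emeasure:
  fixes w :: "'a::euclidean_space => complex"
  assumes [measurable]: "w \<in> borel_measurable borel" and z: "\<And>\<epsilon>. 0 < \<epsilon> ==> emeasure lborel {x. \<epsilon> < norm (w x)} = 0"
  shows "AE x in lborel. w x = 0"
proof -
  have "AE x in lborel. norm (w x) <= 1 / real (Suc k)" for k
    using z[of "1 / real (Suc k)"] by (intro AE_I[of _ _ "{x. 1 / real (Suc k) < norm (w x)}"]) (auto simp: not_le)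
  then have "AE x in lborel. \<forall>k. norm (w x) <= 1 / real (Suc k)" by (simp add: AE_all_countable)
  then show ?thesis
  proof (rule AE_mp, intro AE_I2 impI)
    fix x assume h: "\<forall>k. norm (w x) <= 1 / real (Suc k)"
    show "w x = 0"
    proof (rule ccontr)
      assume "w x \<noteq> 0"
      then obtain k where "inverse (real (Suc k)) < norm (w x)" using reals_Archimedean[of "norm (w x)"] by auto
      then show False using h[rule_format, of k] by (simp add: inverse_eq_divide)
    qed
  qed
qed

text \<open>Where the limit lies strictly above the level, so do all late terms; Fatou's lemma for
  the indicators passes the bound to the limit.\<close>

lemma fatou_emeasure:
  fixes G :: "nat => 'a::euclidean_space => complex"
  assumes [measurable]: "\<And>k. G k \<in> borel_measurable borel" "g \<in> borel_measurable borel"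
    and lim: "AE x in lborel. (%k. G k x) \<longlonglongrightarrow> g x" and N: "\<And>k. N <= k ==> emeasure lborel {x. \<epsilon> < norm (G k x)} <= c"
  shows "emeasure lborel {x. \<epsilon> < norm (g x)} <= c"
proof -
  let ?i = "%k x. indicator {x. \<epsilon> < norm (G (k + N) x)} x :: ennreal"
  have "emeasure lborel {x. \<epsilon> < norm (g x)} = (\<integral>\<^sup>+x. indicator {x. \<epsilon> < norm (g x)} x \<partial>lborel)" by simp
  also have "\<dots> <= (\<integral>\<^sup>+x. liminf (%k. ?i k x) \<partial>lborel)"
  proof (rule nn_integral_mono_AE, rule AE_mp[OF lim], intro AE_I2 impI)
    fix x assume l: "(%k. G k x) \<longlonglongrightarrow> g x"
    show "indicator {x. \<epsilon> < norm (g x)} x <= liminf (%k. ?i k x)"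
    proof (cases "\<epsilon> < norm (g x)")
      case True
      have "(%k. norm (G (k + N) x)) \<longlonglongrightarrow> norm (g x)" by (intro tendsto_norm LIMSEQ_ignore_initial_segment l)
      then have "eventually (%k. \<epsilon> < norm (G (k + N) x)) sequentially" using True by (rule order_tendstoD)
      then have "eventually (%k. 1 <= ?i k x) sequentially" by (rule eventually_mono) simp
      then have "1 <= liminf (%k. ?i k x)" by (rule Liminf_bounded)
      then show ?thesis using True by simp
    qed simp
  qed
  also have "\<dots> <= liminf (%k. \<integral>\<^sup>+x. ?i k x \<partial>lborel)" by (rule nn_integral_liminf) measurable
  also have "\<dots> <= limsup (%k. \<integral>\<^sup>+x. ?i k x \<partial>lborel)" by (rule Liminf_le_Limsup) simp
  also have "\<dots> <= c" by (rule Limsup_bounded) (use N in \<open>auto intro!: always_eventually\<close>)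
  finally show ?thesis .
qed

text \<open>Fatou along the sequence shows that the two limits differ by more than \<epsilon> only
  on a null set. This later identifies the extension on Schwartz functions.\<close>

lemma limm_pointwise:
  assumes F: "limm F u" and p: "\<And>x. (%J. F J x) \<longlonglongrightarrow> p x"
  shows "AE x in lborel. u x = p x"
proof -
  note [measurable] = limm_measurable[OF F]
  have [measurable]: "p \<in> borel_measurable borel"
    by (rule borel_measurable_LIMSEQ_metric[where f=F]) (use p in auto)
  have "AE x in lborel. p x - u x = 0"
  proof (rule AE_zero_of_emeasure)
    fix \<epsilon> :: real assume e: "0 < \<epsilon>"
    have "emeasure lborel {x. \<epsilon> < norm (p x - u x)} <= 0"
    proof (rule ennreal_le_all_pos)
      fix \<delta> :: real assume d: "0 < \<delta>"
      obtain N where N: "\<And>J. N <= J ==> emeasure lborel {x. \<epsilon> < norm (F J x - u x)} <= ennreal \<delta>" by (rule limmD[OF F e d]) blast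
      have "emeasure lborel {x. \<epsilon> < norm (p x - u x)} <= ennreal \<delta>"
        by (rule fatou_emeasure[where G="%J x. F J x - u x", OF _ _ _ N]) (auto intro!: tendsto_diff p)
      then show "emeasure lborel {x. \<epsilon> < norm (p x - u x)} <= 0 + ennreal \<delta>" by simp
    qed
    then show "emeasure lborel {x. \<epsilon> < norm (p x - u x)} = 0" by simp
  qed measurable
  then show ?thesis by (rule AE_mp) (auto intro!: AE_I2)
qed

text \<open>The sequence minus itself is constantly 0 and tends in measure to the difference of the
  two limits.\<close>

lemma limm_unique:
  assumes F: "limm F u" and G: "limm F v" shows "AE x in lborel. u x = v x"
proof -
  have "limm (%J x. F J x + - 1 * F J x) (%x. u x + - 1 * v x)" by (rule limm_add[OF F limm_cmult[OF G]])
  then have "AE x in lborel. u x + - 1 * v x = 0" by (rule limm_pointwise) simp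
  then show ?thesis by (rule AE_mp) (auto intro!: AE_I2)
qed

text \<open>Riesz' argument: along a subsequence the exceptional sets have summable measure, so it
  converges almost everywhere by Borel-Cantelli; Fatou along it compares the whole sequence with the
  limit.\<close>

lemma limm_exists:
  fixes F :: "nat => 'a::euclidean_space => complex"
  assumes Fm[measurable]: "\<And>J. F J \<in> borel_measurable borel"
    and C: "\<And>\<epsilon> \<delta>. 0 < \<epsilon> ==> 0 < \<delta> ==> \<exists>N. \<forall>i\<ge>N. \<forall>j\<ge>N. emeasure lborel {x. \<epsilon> < norm (F i x - F j x)} <= ennreal \<delta>"
  shows "\<exists>u. limm F u"
proof -
  have "\<forall>k. \<exists>N. \<forall>i\<ge>N. \<forall>j\<ge>N. emeasure lborel {x. (1 / 2) ^ k < norm (F i x - F j x)} <= ennreal ((1 / 2) ^ k)"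
    by (intro allI C) auto
  from choice[OF this] obtain N where N: "\<forall>k. \<forall>i\<ge>N k. \<forall>j\<ge>N k. emeasure lborel {x. (1 / 2) ^ k < norm (F i x - F j x)} <= ennreal ((1 / 2) ^ k)"
    by blast
  \<comment> \<open>Adding k and all earlier bounds gives N k <= M k, N k <= M (k + 1) and k <= M k
    at once.\<close>
  define M where "M k = k + (\<Sum>i\<le>k. N i)" for k
  have M: "N k <= M k" "N k <= M (Suc k)" "k <= M k" for k
  proof -
    have "N k <= (\<Sum>i\<le>k. N i)" by (rule member_le_sum) auto
    then show "N k <= M k" "N k <= M (Suc k)" "k <= M k" by (simp_all add: M_def)
  qed
  define A where "A k = {x. (1 / 2) ^ k < norm (F (M (Suc k)) x - F (M k) x)}" for k
  have Am: "A k \<in> sets lborel" for k unfolding A_def by measurable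
  have Ab: "emeasure lborel (A k) <= ennreal ((1 / 2) ^ k)" for k using N M unfolding A_def by blast
  have "AE x in lborel. eventually (%k. x \<in> space lborel - A k) sequentially"
  proof (rule borel_cantelli_AE1[OF Am])
    show "emeasure lborel (A k) < \<infinity>" for k using Ab[of k] by (rule le_less_trans) simp
    have "measure lborel (A k) <= (1 / 2) ^ k" for k
      using Ab[of k] by (simp add: measure_def enn2real_leI)
    then show "summable (%k. measure lborel (A k))"
      by (intro summable_comparison_test[OF _ summable_geometric[of "1 / 2 :: real"]]) auto
  qed
  then have cv: "AE x in lborel. convergent (%k. F (M k) x)"
  proof (rule AE_mp, intro AE_I2 impI)
    fix x assume "eventually (%k. x \<in> space lborel - A k) sequentially"
    then have "eventually (%k. norm (F (M (Suc k)) x - F (M k) x) <= (1 / 2) ^ k) sequentially"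
      by (rule eventually_mono) (auto simp: A_def)
    then obtain K where K: "\<forall>k\<ge>K. norm (F (M (Suc k)) x - F (M k) x) <= (1 / 2) ^ k" unfolding eventually_sequentially by blast
    have "summable (%k. F (M (Suc k)) x - F (M k) x)"
      using K by (intro summable_comparison_test[OF _ summable_geometric[of "1 / 2 :: real"]]) auto
    then have "convergent (%m. \<Sum>k<m. F (M (Suc k)) x - F (M k) x)" by (simp add: summable_iff_convergent)
    then have "convergent (%m. F (M m) x - F (M 0) x)" by (simp only: sum_lessThan_telescope[of "%k. F (M k) x"])
    then show "convergent (%m. F (M m) x)" using convergent_add[OF _ convergent_const[of "F (M 0) x"]] by fastforce
  qed
  define u where "u x = lim (%k. F (M k) x)" for x
  have [measurable]: "u \<in> borel_measurable borel" unfolding u_def by (rule borel_measurable_lim_metric) simp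
  have lim: "AE x in lborel. (%k. F (M k) x) \<longlonglongrightarrow> u x"
    using cv by (rule AE_mp) (auto simp: u_def convergent_LIMSEQ_iff)
  have "limm F u"
    unfolding limm_def
  proof (intro conjI allI impI Fm)
    fix \<epsilon> \<delta> :: real assume "0 < \<epsilon>" "0 < \<delta>"
    then obtain N' where N': "\<forall>i\<ge>N'. \<forall>j\<ge>N'. emeasure lborel {x. \<epsilon> < norm (F i x - F j x)} <= ennreal \<delta>" using C by blast
    show "\<exists>N. \<forall>J\<ge>N. emeasure lborel {x. \<epsilon> < norm (F J x - u x)} <= ennreal \<delta>"
    proof (intro exI[of _ N'] allI impI)
      fix J assume J: "N' <= J"
      show "emeasure lborel {x. \<epsilon> < norm (F J x - u x)} <= ennreal \<delta>"
      proof (rule fatou_emeasure[where G="%k x. F J x - F (M k) x" and N=N'])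
        show "AE x in lborel. (%k. F J x - F (M k) x) \<longlonglongrightarrow> F J x - u x"
          using lim by (rule AE_mp) (auto intro!: AE_I2 tendsto_diff)
        show "emeasure lborel {x. \<epsilon> < norm (F J x - F (M k) x)} <= ennreal \<delta>" if "N' <= k" for k
          using N' J order_trans[OF that M(3)] by blast
      qed measurable
    qed
  qed measurable
  then show ?thesis by blast
qed

lemma truncation_small:
  fixes f :: "'a::euclidean_space => complex"
  assumes f: "integrable lborel f" and d: "0 < \<delta>"
  shows "\<exists>R. 0 <= R \<and> L1n (%x. f x * indicator {x. R < norm (f x)} x) <= ennreal \<delta>"
proof -
  have [measurable]: "f \<in> borel_measurable borel" using borel_measurable_integrable[OF f] by simp
  let ?s = "%(k::nat) x. norm (f x) * indicator {x. real k < norm (f x)} x"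
  have "(%k. LINT x|lborel. ?s k x) \<longlonglongrightarrow> (LINT x|(lborel::'a measure). (0::real))"
  proof (rule integral_dominated_convergence[where w="%x. norm (f x)"])
    show "AE x in lborel. (%k. ?s k x) \<longlonglongrightarrow> 0"
    proof (rule AE_I2)
      fix x
      obtain K where K: "norm (f x) <= real K" using real_arch_simple by blast
      have "eventually (%k. ?s k x = 0) sequentially"
        using eventually_ge_at_top[of K] by (rule eventually_mono) (use K in \<open>auto simp: indicator_def\<close>)
      then show "(%k. ?s k x) \<longlonglongrightarrow> 0" by (rule tendsto_eventually)
    qed
  qed (use f in \<open>auto simp: indicator_def\<close>)
  then have "eventually (%k. (LINT x|lborel. ?s k x) < \<delta>) sequentially" using d by (intro order_tendstoD(2)) auto
  then obtain k where k: "(LINT x|lborel. ?s k x) < \<delta>" unfolding eventually_sequentially by blast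
  have "integrable lborel (?s k)" by (rule Bochner_Integration.integrable_bound[of _ "%x. norm (f x)"]) (use f in \<open>auto simp: indicator_def\<close>)
  then have "(\<integral>\<^sup>+x. ennreal (?s k x) \<partial>lborel) = ennreal (LINT x|lborel. ?s k x)"
    by (rule nn_integral_eq_integral) (simp add: indicator_def)
  moreover have "L1n (%x. f x * indicator {x. real k < norm (f x)} x) = (\<integral>\<^sup>+x. ennreal (?s k x) \<partial>lborel)"
    unfolding L1n_def by (intro nn_integral_cong) (auto simp: indicator_def)
  ultimately have "L1n (%x. f x * indicator {x. real k < norm (f x)} x) <= ennreal \<delta>" using k by (simp add: ennreal_leI)
  then show ?thesis by (intro exI[of _ "real k"]) simp
qed

section \<open>The weak type bound and the extension to L^1\<close>

context sing
begin

text \<open>Five pieces, each compared with \<eta>, and one exceptional set. The good function is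
  treated in L^2; the remainder and the low frequencies of the bad parts in L^1 by cancellation; the
  middle frequencies in L^2; the high frequencies in L^1 off the union \<open>U\<close> of the
  enlarged sets. No constant depends on J.\<close>

lemma weak_type:
  "\<exists>C\<ge>0. \<forall>J f \<eta>. integrable lborel f --> 0 < \<eta> --> emeasure lborel {x. 5 * \<eta> < norm (\<Sum>l\<le>J. Tl l f x)} <= ennreal (C / \<eta>) * L1n f"
proof -
  define n where "n = DIM('a)"
  obtain CL where CL: "0 <= CL" and L2: "\<forall>f. integrable lborel f --> Sq f < \<infinity> --> (\<exists>e. (\<forall>l. 0 <= e l) \<and>
     (\<forall>A. finite A --> (\<Sum>l\<in>A. e l) <= CL * enn2real (Sq f)) \<and>
     (\<forall>A. finite A --> Sq (%x. \<Sum>l\<in>A. Tl l f x) <= ennreal (CL * (\<Sum>l\<in>A. e l))))"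
    using L2_dyadic by (elim exE conjE)
  obtain Cl where Cl: "0 <= Cl" and low: "\<And>s f A. mean_zero s f ==> A \<subseteq> {..s} ==> L1n (%x. \<Sum>l\<in>A. Tl l f x) <= ennreal Cl * L1n f"
    using low_part by blast
  obtain Ch where Ch: "0 <= Ch" and high: "\<And>s f A E. integrable lborel f ==> finite A ==> (\<forall>l\<in>A. real s <= \<rho> * real l) ==> E \<in> sets borel ==>
     (\<forall>x\<in>E. \<forall>y. f y \<noteq> 0 --> 1 / 2 ^ s <= norm (x - y)) ==>
     (\<integral>\<^sup>+x. indicator E x * ennreal (norm (\<Sum>l\<in>A. Tl l f x)) \<partial>lborel) <= ennreal Ch * L1n f"
    using high_part by blast
  obtain Cm where Cm: "0 <= Cm" and mid: "\<And>J b \<Lambda>. 0 <= \<Lambda> ==> (\<forall>s. integrable lborel (b s)) ==> (\<forall>s\<ge>1. \<forall>x. cav s (%y. ennreal (norm (b s y))) x <= ennreal \<Lambda>) ==>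
     (\<integral>\<^sup>+x. ennreal ((norm (\<Sum>l\<le>J. Tl l (%y. \<Sum>s\<in>{s\<in>{..J}. 1 <= s \<and> s <= l \<and> \<rho> * real l <= real s}. b s y) x))\<^sup>2) \<partial>lborel) <= ennreal (Cm * \<Lambda>) * (\<Sum>s\<le>J. L1n (b s))"
    using mid_part by blast
  obtain Co where Co: "0 <= Co" and enl: "\<forall>s. \<forall>\<Omega>\<in>sets (borel :: 'a measure). inv_cell s (%x. x \<in> \<Omega>) -->
    (\<exists>\<Omega>'\<in>sets borel. emeasure lborel \<Omega>' <= ennreal Co * emeasure lborel \<Omega> \<and> (\<forall>x y. x \<notin> \<Omega>' --> y \<in> \<Omega> --> 1 / 2 ^ s <= norm (x - y)))"
    using enlarged_set[where 'a='a] by (elim exE conjE)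
  define c1 c2 c4 c5 where "c1 = CL * CL * 2 ^ n" and "c2 = Cl * 2" and "c4 = Cm * (2 * 2 ^ n) * 2" and "c5 = Ch * 2"
  have c: "0 <= c1" "0 <= c2" "0 <= c4" "0 <= c5" using CL Cl Ch Cm by (simp_all add: c1_def c2_def c4_def c5_def)
  show ?thesis
  proof (intro exI[of _ "c1 + c2 + c2 + c4 + c5 + Co"] conjI allI impI)
    show "0 <= c1 + c2 + c2 + c4 + c5 + Co" using c Co by simp
    fix J \<eta> and f :: "'a => complex" assume f: "integrable lborel f" and \<eta>: "(0::real) < \<eta>"
    obtain \<Omega> :: "nat => 'a set" and b g w where
      Om: "\<And>s. \<Omega> s \<in> sets borel" "\<And>s. inv_cell s (%x. x \<in> \<Omega> s)" "(\<Sum>s\<le>J. emeasure lborel (\<Omega> s)) <= ennreal (1 / \<eta>) * L1n f"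
      and b: "\<And>s. integrable lborel (b s)" "\<And>s. 1 <= s ==> mean_zero s (b s)" "\<And>s y. b s y \<noteq> 0 ==> y \<in> \<Omega> s"
        "\<And>s x. 1 <= s ==> cav s (%y. ennreal (norm (b s y))) x <= ennreal (2 * 2 ^ DIM('a) * \<eta>)"
        "(\<Sum>s\<le>J. L1n (b s)) <= 2 * L1n f"
      and w: "mean_zero J w" "L1n w <= 2 * L1n f"
      and g: "integrable lborel g" "(\<integral>\<^sup>+x. ennreal ((norm (g x))\<^sup>2) \<partial>lborel) <= ennreal (2 ^ DIM('a) * \<eta>) * L1n f"
      and dec: "\<And>x. f x = g x + (\<Sum>s\<le>J. b s x) + w x"
      by (rule Calderon_Zygmund_decomposition[OF f \<eta>, where J=J], rule that, assumption+)
    have wi: "integrable lborel w" using w(1) by (simp add: mean_zero_def)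
    have "\<forall>s. \<exists>\<Omega>'. \<Omega>' \<in> sets borel \<and> emeasure lborel \<Omega>' <= ennreal Co * emeasure lborel (\<Omega> s) \<and> (\<forall>x y. x \<notin> \<Omega>' --> y \<in> \<Omega> s --> 1 / 2 ^ s <= norm (x - y))"
      using enl[THEN spec, THEN bspec, OF Om(1), THEN mp, OF Om(2)] unfolding Bex_def by (intro allI)
    from choice[OF this] obtain \<Omega>' where Om': "\<forall>s. \<Omega>' s \<in> sets borel \<and> emeasure lborel (\<Omega>' s) <= ennreal Co * emeasure lborel (\<Omega> s) \<and> (\<forall>x y. x \<notin> \<Omega>' s --> y \<in> \<Omega> s --> 1 / 2 ^ s <= norm (x - y))"
      by blast
    have Om'm[measurable]: "\<Omega>' s \<in> sets borel" for s using Om' by blast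
    define U where "U = (\<Union>s\<le>J. \<Omega>' s)"
    have [measurable]: "U \<in> sets borel" unfolding U_def by measurable
    define E where "E = - U"
    have E[measurable]: "E \<in> sets borel" unfolding E_def by measurable
    define t where "t s l x = Tl l (b s) x" for s l x
    have tm[measurable]: "t s l \<in> borel_measurable borel" for s l unfolding t_def using Tl_measurable[OF b(1)] by simp
    \<comment> \<open>For s = 0 all frequencies count as high: there is no cancellation on cells of
      side 1, but the tail bound 2^(-\<rho> l) is summable from l = 0 on.\<close>
    define Lo Mi Hi where "Lo s = {l\<in>{..J}. 1 <= s \<and> l < s}" and "Mi s = {l\<in>{..J}. 1 <= s \<and> s <= l \<and> \<rho> * real l <= real s}"
      and "Hi s = {l\<in>{..J}. s = 0 \<or> real s < \<rho> * real l}" for s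
    define S where "S l = {s\<in>{..J}. 1 <= s \<and> s <= l \<and> \<rho> * real l <= real s}" for l
    define P1 P2 P3 P4 P5 where "P1 x = (\<Sum>l\<le>J. Tl l g x)" and "P2 x = (\<Sum>l\<le>J. Tl l w x)"
      and "P3 x = (\<Sum>s\<le>J. \<Sum>l\<in>Lo s. t s l x)" and "P4 x = (\<Sum>l\<le>J. Tl l (%y. \<Sum>s\<in>S l. b s y) x)"
      and "P5 x = (\<Sum>s\<le>J. \<Sum>l\<in>Hi s. t s l x)" for x
    have iS: "integrable lborel (%y. \<Sum>s\<in>A. b s y)" for A using b(1) by simp
    have Pm: "P1 \<in> borel_measurable borel" "P2 \<in> borel_measurable borel" "P3 \<in> borel_measurable borel"
      "P4 \<in> borel_measurable borel" "P5 \<in> borel_measurable borel"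
      unfolding P1_def P2_def P3_def P4_def P5_def
      by (intro borel_measurable_sum tm Tl_measurable g(1) wi iS)+
    have sum: "(\<Sum>l\<le>J. Tl l f x) = P1 x + P2 x + P3 x + P4 x + P5 x" for x
    proof -
      have Tf: "Tl l f x = Tl l g x + (\<Sum>s\<le>J. t s l x) + Tl l w x" for l
      proof -
        have "f = (%x. (g x + (\<Sum>s\<le>J. b s x)) + w x)" using dec by (simp add: fun_eq_iff)
        then have "Tl l f x = Tl l (%x. (g x + (\<Sum>s\<le>J. b s x)) + w x) x" by simp
        also have "\<dots> = Tl l (%x. g x + (\<Sum>s\<le>J. b s x)) x + Tl l w x"
          by (rule Tl_add[OF Bochner_Integration.integrable_add[OF g(1) iS] wi])
        also have "Tl l (%x. g x + (\<Sum>s\<le>J. b s x)) x = Tl l g x + Tl l (%x. \<Sum>s\<le>J. b s x) x"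
          by (rule Tl_add[OF g(1) iS])
        also have "Tl l (%x. \<Sum>s\<le>J. b s x) x = (\<Sum>s\<le>J. t s l x)"
          unfolding t_def by (rule Tl_sum) (auto intro: b)
        finally show ?thesis .
      qed
      have "P4 x = (\<Sum>l\<le>J. \<Sum>s\<in>S l. t s l x)"
        unfolding P4_def t_def by (intro sum.cong refl Tl_sum) (auto simp: S_def b)
      also have "\<dots> = (\<Sum>s\<le>J. \<Sum>l\<in>Mi s. t s l x)"
        unfolding S_def Mi_def by (rule sum.swap_restrict) auto
      finally have P4: "P4 x = (\<Sum>s\<le>J. \<Sum>l\<in>Mi s. t s l x)" .
      have split: "(\<Sum>l\<le>J. t s l x) = (\<Sum>l\<in>Lo s. t s l x) + (\<Sum>l\<in>Mi s. t s l x) + (\<Sum>l\<in>Hi s. t s l x)" for s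
      proof -
        have r: "\<rho> * real l <= real l" for l using mult_right_mono[OF \<rho>(2), of "real l"] by simp
        have "l \<in> Lo s \<union> Mi s \<union> Hi s" if "l <= J" for l
          using that by (cases "s = 0") (auto simp: Lo_def Mi_def Hi_def not_less)
        then have u: "{..J} = (Lo s \<union> Mi s) \<union> Hi s" by (auto simp: Lo_def Mi_def Hi_def)
        have d1: "Lo s \<inter> Mi s = {}" by (auto simp: Lo_def Mi_def)
        have d2: "(Lo s \<union> Mi s) \<inter> Hi s = {}"
        proof -
          have "l \<notin> Hi s" if "l \<in> Lo s \<union> Mi s" for l
            using that r[of l] by (auto simp: Lo_def Mi_def Hi_def)
          then show ?thesis by blast
        qed
        have fin: "finite (Lo s)" "finite (Mi s)" "finite (Hi s)" by (auto simp: Lo_def Mi_def Hi_def)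
        show ?thesis unfolding u using fin d1 d2 by (simp add: sum.union_disjoint)
      qed
      have "(\<Sum>l\<le>J. Tl l f x) = P1 x + (\<Sum>l\<le>J. \<Sum>s\<le>J. t s l x) + P2 x"
        by (simp add: Tf sum.distrib P1_def P2_def)
      also have "(\<Sum>l\<le>J. \<Sum>s\<le>J. t s l x) = (\<Sum>s\<le>J. \<Sum>l\<le>J. t s l x)" by (rule sum.swap)
      also have "\<dots> = P3 x + P4 x + P5 x" by (simp add: split sum.distrib P3_def P4 P5_def)
      finally show ?thesis by simp
    qed
    have B1: "emeasure lborel {x. \<eta> < norm (P1 x)} <= ennreal (c1 / \<eta>) * L1n f"
    proof (rule markov_bound_L2[OF Pm(1) \<eta> c(1)])
      have Lf: "L1n f < \<infinity>" using f by (simp add: L1n_def integrable_iff_bounded)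
      have sg: "Sq g <= ennreal (2 ^ n * \<eta>) * L1n f" using g(2) by (simp add: Sq_def n_def)
      then have sg': "Sq g < \<infinity>" using Lf by (auto simp: ennreal_mult_less_top intro: le_less_trans)
      obtain e where e: "\<And>A. finite A ==> (\<Sum>l\<in>A. e l) <= CL * enn2real (Sq g)"
        "\<And>A. finite A ==> Sq (%x. \<Sum>l\<in>A. Tl l g x) <= ennreal (CL * (\<Sum>l\<in>A. e l))"
        using L2[rule_format, OF g(1) sg'] by blast
      have "Sq P1 <= ennreal (CL * (\<Sum>l\<le>J. e l))" unfolding P1_def by (rule e(2)) simp
      also have "\<dots> <= ennreal (CL * (CL * enn2real (Sq g)))" by (intro ennreal_leI mult_left_mono e(1) CL) simp
      also have "\<dots> = ennreal (CL * CL) * Sq g" using CL sg' by (simp add: ennreal_mult mult.assoc)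
      also have "\<dots> <= ennreal (CL * CL) * (ennreal (2 ^ n * \<eta>) * L1n f)" by (intro mult_left_mono sg) simp
      also have "\<dots> = ennreal (c1 * \<eta>) * L1n f" using CL \<eta> by (simp add: c1_def ennreal_mult mult_ac)
      finally show "(\<integral>\<^sup>+x. ennreal ((norm (P1 x))\<^sup>2) \<partial>lborel) <= ennreal (c1 * \<eta>) * L1n f" by (simp add: Sq_def)
    qed
    have two: "ennreal C * (2 * L1n f) = ennreal (C * 2) * L1n f" if "0 <= C" for C
      using that by (simp add: ennreal_mult mult.assoc)
    have B2: "emeasure lborel {x. \<eta> < norm (P2 x)} <= ennreal (c2 / \<eta>) * L1n f"
    proof (rule markov_bound_L1[OF Pm(2) \<eta> c(2)])
      have "L1n P2 <= ennreal Cl * L1n w" unfolding P2_def by (rule low[OF w(1)]) simp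
      also have "\<dots> <= ennreal Cl * (2 * L1n f)" by (intro mult_left_mono w) simp
      finally show "L1n P2 <= ennreal c2 * L1n f" by (simp add: two[OF Cl] c2_def)
    qed
    have B3: "emeasure lborel {x. \<eta> < norm (P3 x)} <= ennreal (c2 / \<eta>) * L1n f"
    proof (rule markov_bound_L1[OF Pm(3) \<eta> c(2)])
      have "L1n P3 <= (\<Sum>s\<le>J. L1n (%x. \<Sum>l\<in>Lo s. t s l x))"
        unfolding P3_def by (rule L1n_sum) measurable
      also have "\<dots> <= (\<Sum>s\<le>J. ennreal Cl * L1n (b s))"
      proof (rule sum_mono)
        fix s
        show "L1n (%x. \<Sum>l\<in>Lo s. t s l x) <= ennreal Cl * L1n (b s)"
        proof (cases "s = 0")
          case False
          then have "1 <= s" by simp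
          moreover have "Lo s \<subseteq> {..s}" by (auto simp: Lo_def)
          ultimately show ?thesis unfolding t_def by (intro low[OF b(2)])
        qed (simp add: Lo_def L1n_def)
      qed
      also have "\<dots> <= ennreal Cl * (2 * L1n f)" unfolding sum_distrib_left[symmetric] by (intro mult_left_mono b) simp
      finally show "L1n P3 <= ennreal c2 * L1n f" by (simp add: two[OF Cl] c2_def)
    qed
    have B4: "emeasure lborel {x. \<eta> < norm (P4 x)} <= ennreal (c4 / \<eta>) * L1n f"
    proof (rule markov_bound_L2[OF Pm(4) \<eta> c(3)])
      have "(\<integral>\<^sup>+x. ennreal ((norm (P4 x))\<^sup>2) \<partial>lborel) <= ennreal (Cm * (2 * 2 ^ n * \<eta>)) * (\<Sum>s\<le>J. L1n (b s))"
        unfolding P4_def S_def by (rule mid) (use b \<eta> in \<open>auto simp: n_def\<close>)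
      also have "\<dots> <= ennreal (Cm * (2 * 2 ^ n * \<eta>)) * (2 * L1n f)" by (intro mult_left_mono b) simp
      also have "\<dots> = ennreal (Cm * (2 * 2 ^ n * \<eta>) * 2) * L1n f" using Cm \<eta> by (intro two) simp
      also have "Cm * (2 * 2 ^ n * \<eta>) * 2 = c4 * \<eta>" by (simp add: c4_def)
      finally show "(\<integral>\<^sup>+x. ennreal ((norm (P4 x))\<^sup>2) \<partial>lborel) <= ennreal (c4 * \<eta>) * L1n f" .
    qed
    have B5: "emeasure lborel {x \<in> E. \<eta> < norm (P5 x)} <= ennreal (c5 / \<eta>) * L1n f"
    proof (rule markov_bound[OF Pm(5) E \<eta> c(4)])
      have "(\<integral>\<^sup>+x. indicator E x * ennreal (norm (P5 x)) \<partial>lborel) <= (\<Sum>s\<le>J. \<integral>\<^sup>+x. indicator E x * ennreal (norm (\<Sum>l\<in>Hi s. t s l x)) \<partial>lborel)"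
        unfolding P5_def by (rule nn_integral_norm_sum_le) measurable
      also have "\<dots> <= (\<Sum>s\<le>J. ennreal Ch * L1n (b s))"
      proof (rule sum_mono)
        fix s assume s: "s \<in> {..J}"
        show "(\<integral>\<^sup>+x. indicator E x * ennreal (norm (\<Sum>l\<in>Hi s. t s l x)) \<partial>lborel) <= ennreal Ch * L1n (b s)"
          unfolding t_def
        proof (rule high[OF b(1) _ _ E])
          show "finite (Hi s)" by (simp add: Hi_def)
          show "\<forall>l\<in>Hi s. real s <= \<rho> * real l" using \<rho> by (auto simp: Hi_def)
          show "\<forall>x\<in>E. \<forall>y. b s y \<noteq> 0 --> 1 / 2 ^ s <= norm (x - y)"
          proof (intro ballI allI impI)
            fix x y assume "x \<in> E" and y: "b s y \<noteq> 0"
            then have "x \<notin> \<Omega>' s" using s by (auto simp: E_def U_def)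
            then show "1 / 2 ^ s <= norm (x - y)" using Om' b(3)[OF y] by blast
          qed
        qed
      qed
      also have "\<dots> <= ennreal Ch * (2 * L1n f)" unfolding sum_distrib_left[symmetric] by (intro mult_left_mono b) simp
      finally show "(\<integral>\<^sup>+x. indicator E x * ennreal (norm (P5 x)) \<partial>lborel) <= ennreal c5 * L1n f" by (simp add: two[OF Ch] c5_def)
    qed
    have B6: "emeasure lborel U <= ennreal (Co / \<eta>) * L1n f"
    proof -
      have "emeasure lborel U <= (\<Sum>s\<le>J. emeasure lborel (\<Omega>' s))"
        unfolding U_def by (rule emeasure_subadditive_finite) (use Om'm in auto)
      also have "\<dots> <= (\<Sum>s\<le>J. ennreal Co * emeasure lborel (\<Omega> s))" using Om' by (intro sum_mono) blast
      also have "\<dots> <= ennreal Co * (ennreal (1 / \<eta>) * L1n f)"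
        unfolding sum_distrib_left[symmetric] by (intro mult_left_mono Om) simp
      also have "\<dots> = ennreal (Co / \<eta>) * L1n f"
        using Co \<eta> by (simp add: mult.assoc[symmetric] ennreal_mult'[symmetric])
      finally show ?thesis .
    qed
    let ?A1 = "{x. \<eta> < norm (P1 x)}" and ?A2 = "{x. \<eta> < norm (P2 x)}" and ?A3 = "{x. \<eta> < norm (P3 x)}"
      and ?A4 = "{x. \<eta> < norm (P4 x)}" and ?A5 = "{x \<in> E. \<eta> < norm (P5 x)}"
    note [measurable] = Pm
    have "{x. 5 * \<eta> < norm (\<Sum>l\<le>J. Tl l f x)} \<subseteq> ?A1 \<union> ?A2 \<union> ?A3 \<union> ?A4 \<union> ?A5 \<union> U"
    proof
      fix x assume "x \<in> {x. 5 * \<eta> < norm (\<Sum>l\<le>J. Tl l f x)}"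
      then have "5 * \<eta> < norm (P1 x + P2 x + P3 x + P4 x + P5 x)" by (simp add: sum)
      also have "\<dots> <= norm (P1 x) + norm (P2 x) + norm (P3 x) + norm (P4 x) + norm (P5 x)"
        by (intro order_trans[OF norm_triangle_ineq] add_right_mono order_refl)
      finally have "\<eta> < norm (P1 x) \<or> \<eta> < norm (P2 x) \<or> \<eta> < norm (P3 x) \<or> \<eta> < norm (P4 x) \<or> \<eta> < norm (P5 x)" by linarith
      then show "x \<in> ?A1 \<union> ?A2 \<union> ?A3 \<union> ?A4 \<union> ?A5 \<union> U" by (auto simp: E_def)
    qed
    then have "emeasure lborel {x. 5 * \<eta> < norm (\<Sum>l\<le>J. Tl l f x)} <= emeasure lborel (?A1 \<union> ?A2 \<union> ?A3 \<union> ?A4 \<union> ?A5 \<union> U)"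
      by (rule emeasure_mono) measurable
    also have "\<dots> <= ennreal (c1 / \<eta>) * L1n f + ennreal (c2 / \<eta>) * L1n f + ennreal (c2 / \<eta>) * L1n f + ennreal (c4 / \<eta>) * L1n f + ennreal (c5 / \<eta>) * L1n f + ennreal (Co / \<eta>) * L1n f"
      by (intro emeasure_Un_le B1 B2 B3 B4 B5 B6) measurable
    also have "\<dots> = ennreal ((c1 + c2 + c2 + c4 + c5 + Co) / \<eta>) * L1n f"
    proof -
      have "ennreal (a / \<eta>) * L1n f + ennreal (a' / \<eta>) * L1n f = ennreal ((a + a') / \<eta>) * L1n f" if "0 <= a" "0 <= a'" for a a'
        unfolding add_divide_distrib using that \<eta> by (subst ennreal_plus) (auto simp: distrib_right)
      then show ?thesis using c Co by (simp only: add_nonneg_nonneg)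
    qed
    finally show "emeasure lborel {x. 5 * \<eta> < norm (\<Sum>l\<le>J. Tl l f x)} <= ennreal ((c1 + c2 + c2 + c4 + c5 + Co) / \<eta>) * L1n f" .
  qed
qed

text \<open>The function is split at a height R. The bounded part lies in L^2, where the tails of
  the summable majorant of \<open>L2_dyadic\<close> control the increments; the rest is small in
  L^1, and the weak type bound applies to each partial sum separately.\<close>

lemma Cauchy_in_measure:
  assumes f: "integrable lborel f" and e: "0 < \<epsilon>" and d: "0 < (\<delta>::real)"
  shows "\<exists>N. \<forall>i\<ge>N. \<forall>j\<ge>N. emeasure lborel {x. \<epsilon> < norm ((\<Sum>l\<le>i. Tl l f x) - (\<Sum>l\<le>j. Tl l f x))} <= ennreal \<delta>"
proof -
  have [measurable]: "f \<in> borel_measurable borel" using borel_measurable_integrable[OF f] by simp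
  obtain C where C: "0 <= C" and wt: "\<And>J f \<eta>. integrable lborel f ==> 0 < \<eta> ==> emeasure lborel {x. 5 * \<eta> < norm (\<Sum>l\<le>J. Tl l f x)} <= ennreal (C / \<eta>) * L1n f"
    using weak_type by blast
  \<comment> \<open>Three sets contribute, one for the increment of the bounded part and one for
    each partial sum of the small part; each is taken at the level 5\<eta> of
    \<open>weak_type\<close>, whence 15.\<close>
  define \<eta> where "\<eta> = \<epsilon> / 15"
  have \<eta>: "0 < \<eta>" using e by (simp add: \<eta>_def)
  \<comment> \<open>Chosen so that C/\<eta> times it is at most \<delta>/3; C + 1 covers the case C
    = 0.\<close>
  define \<delta>' where "\<delta>' = \<delta> / 3 * \<eta> / (C + 1)"
  have d': "0 < \<delta>'" using d \<eta> C by (simp add: \<delta>'_def)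
  obtain R where R: "0 <= R" "L1n (%x. f x * indicator {x. R < norm (f x)} x) <= ennreal \<delta>'"
    using truncation_small[OF f d'] by blast
  define h where "h x = f x * indicator {x. R < norm (f x)} x" for x
  define g where "g x = f x * indicator {x. norm (f x) <= R} x" for x
  have h: "integrable lborel h" unfolding h_def by (rule Bochner_Integration.integrable_bound[OF f]) (auto simp: indicator_def)
  have g: "integrable lborel g" unfolding g_def by (rule Bochner_Integration.integrable_bound[OF f]) (auto simp: indicator_def)
  have fgh: "f = (%x. g x + h x)" by (auto simp: g_def h_def indicator_def fun_eq_iff)
  have gS: "Sq g < \<infinity>"
  proof -
    have "Sq g <= (\<integral>\<^sup>+x. ennreal R * ennreal (norm (f x)) \<partial>lborel)"
      unfolding Sq_def
    proof (rule nn_integral_mono)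
      fix x
      have "(norm (g x))\<^sup>2 <= R * norm (f x)"
        using R(1) by (auto simp: g_def indicator_def power2_eq_square intro!: mult_right_mono)
      then show "ennreal ((norm (g x))\<^sup>2) <= ennreal R * ennreal (norm (f x))"
        using R(1) by (simp add: ennreal_mult[symmetric] ennreal_leI)
    qed
    also have "\<dots> = ennreal R * (\<integral>\<^sup>+x. ennreal (norm (f x)) \<partial>lborel)" by (rule nn_integral_cmult) measurable
    also have "\<dots> < \<infinity>" using f by (simp add: integrable_iff_bounded ennreal_mult_less_top)
    finally show ?thesis .
  qed
  obtain CL where CL: "0 <= CL" and L2: "\<forall>f. integrable lborel f --> Sq f < \<infinity> --> (\<exists>e. (\<forall>l. 0 <= e l) \<and>
     (\<forall>A. finite A --> (\<Sum>l\<in>A. e l) <= CL * enn2real (Sq f)) \<and>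
     (\<forall>A. finite A --> Sq (%x. \<Sum>l\<in>A. Tl l f x) <= ennreal (CL * (\<Sum>l\<in>A. e l))))"
    using L2_dyadic by (elim exE conjE)
  obtain q where q: "\<And>l. 0 <= q l" "\<And>A. finite A ==> (\<Sum>l\<in>A. q l) <= CL * enn2real (Sq g)"
    "\<And>A. finite A ==> Sq (%x. \<Sum>l\<in>A. Tl l g x) <= ennreal (CL * (\<Sum>l\<in>A. q l))"
    using L2[rule_format, OF g gS] by blast
  have sq: "summable q"
    by (rule bounded_imp_summable[where B="CL * enn2real (Sq g)"]) (auto simp: q)
  define \<theta> where "\<theta> = \<delta> / 3 * (5 * \<eta>)\<^sup>2 / (CL + 1)"
  have th: "0 < \<theta>" using d \<eta> CL by (simp add: \<theta>_def)
  obtain N where N: "\<And>m k. N <= m ==> norm (sum q {m..<k}) < \<theta>"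
    using sq th unfolding summable_Cauchy by blast
  define S where "S i f x = (\<Sum>l\<le>i. Tl l f x)" for i f x
  have Sm[measurable]: "S i u \<in> borel_measurable borel" if "integrable lborel u" for i u
    unfolding S_def by (intro borel_measurable_sum Tl_measurable that)
  note [measurable] = Sm[OF g] Sm[OF h]
  have hb: "emeasure lborel {x. 5 * \<eta> < norm (S i h x)} <= ennreal (\<delta> / 3)" for i
  proof -
    have "emeasure lborel {x. 5 * \<eta> < norm (S i h x)} <= ennreal (C / \<eta>) * L1n h"
      unfolding S_def by (rule wt[OF h \<eta>])
    also have "\<dots> <= ennreal (C / \<eta>) * ennreal \<delta>'" using R(2) unfolding h_def by (intro mult_left_mono) auto
    also have "\<dots> = ennreal (C / \<eta> * \<delta>')" by (rule ennreal_mult[symmetric]) (use C \<eta> d' in auto)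
    also have "\<dots> <= ennreal (\<delta> / 3)"
    proof (rule ennreal_leI)
      have "C / \<eta> * \<delta>' = \<delta> / 3 * (C / (C + 1))" using \<eta> by (simp add: \<delta>'_def)
      also have "\<dots> <= \<delta> / 3 * 1" using C d by (intro mult_left_mono) auto
      finally show "C / \<eta> * \<delta>' <= \<delta> / 3" by simp
    qed
    finally show ?thesis .
  qed
  have gb: "emeasure lborel {x. 5 * \<eta> < norm (S i g x - S j g x)} <= ennreal (\<delta> / 3)" if ij: "N <= j" "j <= i" for i j
  proof -
    have df: "S i g x - S j g x = (\<Sum>l\<in>{Suc j..<Suc i}. Tl l g x)" for x
    proof -
      have "{..i} = {..j} \<union> {Suc j..<Suc i}" using ij by auto
      then have "S i g x = S j g x + (\<Sum>l\<in>{Suc j..<Suc i}. Tl l g x)"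
        unfolding S_def by (simp only:) (rule sum.union_disjoint, auto)
      then show ?thesis by simp
    qed
    have "(\<integral>\<^sup>+x. ennreal ((norm (S i g x - S j g x))\<^sup>2) \<partial>lborel) <= ennreal (CL * (\<Sum>l\<in>{Suc j..<Suc i}. q l))"
      unfolding df using q(3)[of "{Suc j..<Suc i}"] by (simp add: Sq_def)
    also have "\<dots> <= ennreal (CL * \<theta>)"
      using N[of "Suc j" "Suc i"] ij CL by (intro ennreal_leI mult_left_mono) auto
    also have "\<dots> <= ennreal (\<delta> / 3 * (5 * \<eta>)\<^sup>2)"
    proof (rule ennreal_leI)
      have "CL * \<theta> = \<delta> / 3 * (5 * \<eta>)\<^sup>2 * (CL / (CL + 1))" by (simp add: \<theta>_def)
      also have "\<dots> <= \<delta> / 3 * (5 * \<eta>)\<^sup>2 * 1" using CL d by (intro mult_left_mono) auto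
      finally show "CL * \<theta> <= \<delta> / 3 * (5 * \<eta>)\<^sup>2" by simp
    qed
    also have "\<dots> = ennreal (\<delta> / 3 * (5 * \<eta>) * (5 * \<eta>)) * 1" by (simp add: power2_eq_square mult_ac)
    finally have "emeasure lborel {x. 5 * \<eta> < norm (S i g x - S j g x)} <= ennreal (\<delta> / 3 * (5 * \<eta>) / (5 * \<eta>)) * 1"
      using \<eta> d by (intro markov_bound_L2) auto
    then show ?thesis using \<eta> by simp
  qed
  have main: "emeasure lborel {x. \<epsilon> < norm (S i f x - S j f x)} <= ennreal \<delta>" if ij: "N <= j" "j <= i" for i j
  proof -
    have Sf: "S i f x = S i g x + S i h x" for i x
      unfolding S_def sum.distrib[symmetric] by (intro sum.cong refl) (subst fgh, rule Tl_add[OF g h])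
    let ?A = "{x. 5 * \<eta> < norm (S i g x - S j g x)}" and ?B = "{x. 5 * \<eta> < norm (S i h x)}" and ?D = "{x. 5 * \<eta> < norm (S j h x)}"
    have "{x. \<epsilon> < norm (S i f x - S j f x)} \<subseteq> ?A \<union> ?B \<union> ?D"
    proof
      fix x assume "x \<in> {x. \<epsilon> < norm (S i f x - S j f x)}"
      then have "\<epsilon> < norm ((S i g x - S j g x) + S i h x - S j h x)" by (simp add: Sf algebra_simps)
      also have "\<dots> <= norm (S i g x - S j g x) + norm (S i h x) + norm (S j h x)"
        by (intro order_trans[OF norm_triangle_ineq4] add_right_mono norm_triangle_ineq)
      finally have "5 * \<eta> < norm (S i g x - S j g x) \<or> 5 * \<eta> < norm (S i h x) \<or> 5 * \<eta> < norm (S j h x)"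
        unfolding \<eta>_def by linarith
      then show "x \<in> ?A \<union> ?B \<union> ?D" by auto
    qed
    then have "emeasure lborel {x. \<epsilon> < norm (S i f x - S j f x)} <= emeasure lborel (?A \<union> ?B \<union> ?D)"
      by (rule emeasure_mono) measurable
    also have "\<dots> <= ennreal (\<delta> / 3) + ennreal (\<delta> / 3) + ennreal (\<delta> / 3)"
      by (intro emeasure_Un_le gb[OF ij] hb) measurable
    also have "\<dots> = ennreal \<delta>" using d by (simp add: ennreal_plus[symmetric] del: ennreal_plus)
    finally show ?thesis .
  qed
  show ?thesis
  proof (intro exI[of _ N] allI impI)
    fix i j assume i: "N <= i" and j: "N <= j"
    have "emeasure lborel {x. \<epsilon> < norm (S i f x - S j f x)} <= ennreal \<delta>"
    proof (cases "j <= i")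
      case False
      have "{x. \<epsilon> < norm (S i f x - S j f x)} = {x. \<epsilon> < norm (S j f x - S i f x)}"
        by (simp only: norm_minus_commute)
      then show ?thesis using main[OF i, of j] False by simp
    qed (rule main[OF j])
    then show "emeasure lborel {x. \<epsilon> < norm ((\<Sum>l\<le>i. Tl l f x) - (\<Sum>l\<le>j. Tl l f x))} <= ennreal \<delta>"
      by (simp only: S_def)
  qed
qed

text \<open>The operator on L^1 is a limit in measure of the partial sums, picked by
  \<open>SOME\<close>; uniqueness almost everywhere makes it linear in the sense required. The
  original operator enters through the pointwise limit of the partial sums on Schwartz
  functions.\<close>

lemma bounded_extension:
  fixes P :: "('a => complex) => 'a => complex"
  assumes P: "\<And>f::'a => complex. schwartz f ==> integrable lborel f" "\<And>f x. schwartz f ==> (%J. \<Sum>l\<le>J. Tl l f x) \<longlonglongrightarrow> P f x"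
  shows "bounded_L1_weak_L1 P"
proof -
  define S where "S f J x = (\<Sum>l\<le>J. Tl l f x)" for f J x
  define T where "T f = (SOME u. limm (S f) u)" for f
  have T: "limm (S f) (T f)" if f: "integrable lborel f" for f
  proof -
    have "\<exists>u. limm (S f) u"
    proof (rule limm_exists)
    show "S f J \<in> borel_measurable borel" for J unfolding S_def by (intro borel_measurable_sum Tl_measurable f)
    show "\<exists>N. \<forall>i\<ge>N. \<forall>j\<ge>N. emeasure lborel {x. \<epsilon> < norm (S f i x - S f j x)} <= ennreal \<delta>" if "0 < \<epsilon>" "0 < \<delta>" for \<epsilon> \<delta>
      unfolding S_def by (rule Cauchy_in_measure[OF f that])
    qed
    then show ?thesis unfolding T_def by (rule someI_ex)
  qed
  obtain C where C: "0 <= C" and wt: "\<And>J f \<eta>. integrable lborel f ==> 0 < \<eta> ==> emeasure lborel {x. 5 * \<eta> < norm (\<Sum>l\<le>J. Tl l f x)} <= ennreal (C / \<eta>) * L1n f"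
    using weak_type by blast
  show ?thesis
    unfolding bounded_L1_weak_L1_def
  proof (intro exI[of _ T] exI[of _ "10 * C"] conjI allI impI)
    fix f :: "'a => complex" assume f: "schwartz f"
    show "AE x in lborel. T f x = P f x"
      using limm_pointwise[OF T[OF P(1)[OF f]], of "P f"] P(2)[OF f] unfolding S_def by blast
  next
    fix f h :: "'a => complex" assume f: "integrable lborel f" and h: "integrable lborel h"
    have "S (%y. f y + h y) = (%J x. S f J x + S h J x)"
      by (simp add: S_def fun_eq_iff Tl_add[OF f h] sum.distrib)
    then have "limm (S (%y. f y + h y)) (%x. T f x + T h x)" using limm_add[OF T[OF f] T[OF h]] by simp
    then show "AE x in lborel. T (%y. f y + h y) x = T f x + T h x"
      using limm_unique[OF T[OF Bochner_Integration.integrable_add[OF f h]]] by blast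
  next
    fix f :: "'a => complex" and c assume f: "integrable lborel f"
    have "S (%y. c * f y) = (%J x. c * S f J x)"
      by (simp add: S_def fun_eq_iff Tl_cmult sum_distrib_left)
    then have "limm (S (%y. c * f y)) (%x. c * T f x)" using limm_cmult[OF T[OF f]] by simp
    moreover have "integrable lborel (%y. c * f y)" using f by simp
    ultimately show "AE x in lborel. T (%y. c * f y) x = c * T f x"
      using limm_unique[OF T] by blast
  next
    fix f :: "'a => complex" assume f: "integrable lborel f"
    then show "T f \<in> borel_measurable lborel" using limm_measurable(2)[OF T[OF f]] by simp
  next
    fix f :: "'a => complex" assume f: "integrable lborel f"
    note [measurable] = limm_measurable[OF T[OF f]]
    have Lf: "L1n f = ennreal (LINT x|lborel. norm (f x))"
      unfolding L1n_def by (rule nn_integral_eq_integral) (use f in auto)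
    have I0: "0 <= (LINT x|lborel. norm (f x))" by (rule integral_nonneg_AE) simp
    show "weak_L1_qnorm (T f) <= ennreal (10 * C * (LINT x|lborel. norm (f x)))"
      unfolding weak_L1_qnorm_def
    proof (rule SUP_least)
      fix s :: real assume "s \<in> {0<..}"
      then have s: "0 < s" by simp
      \<comment> \<open>Half of the level s goes to a partial sum and half to its distance from the
        limit, whose measure is arbitrarily small. From s/2 = 5(s/10) comes the constant 10
        C.\<close>
      have "emeasure lborel {x. s < norm (T f x)} <= ennreal (C / (s / 10)) * L1n f"
      proof (rule ennreal_le_all_pos)
        fix \<delta> :: real assume d: "0 < \<delta>"
        have s2: "0 < s / 2" using s by simp
        obtain N where N: "\<And>J. N <= J ==> emeasure lborel {x. s / 2 < norm (S f J x - T f x)} <= ennreal \<delta>" by (rule limmD[OF T[OF f] s2 d]) blast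
        have "{x. s < norm (T f x)} \<subseteq> {x. 5 * (s / 10) < norm (S f N x)} \<union> {x. s / 2 < norm (S f N x - T f x)}"
        proof
          fix x assume "x \<in> {x. s < norm (T f x)}"
          moreover have "norm (T f x) <= norm (S f N x) + norm (S f N x - T f x)"
            using norm_triangle_ineq4[of "S f N x" "S f N x - T f x"] by simp
          ultimately show "x \<in> {x. 5 * (s / 10) < norm (S f N x)} \<union> {x. s / 2 < norm (S f N x - T f x)}" by auto
        qed
        then have "emeasure lborel {x. s < norm (T f x)} <= emeasure lborel ({x. 5 * (s / 10) < norm (S f N x)} \<union> {x. s / 2 < norm (S f N x - T f x)})"
          by (rule emeasure_mono) measurable
        also have "\<dots> <= ennreal (C / (s / 10)) * L1n f + ennreal \<delta>"
        proof (rule emeasure_Un_le)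
          show "emeasure lborel {x. 5 * (s / 10) < norm (S f N x)} <= ennreal (C / (s / 10)) * L1n f"
            unfolding S_def by (rule wt[OF f]) (use s in simp)
        qed (use N in measurable)
        finally show "emeasure lborel {x. s < norm (T f x)} <= ennreal (C / (s / 10)) * L1n f + ennreal \<delta>" .
      qed
      then have "ennreal s * emeasure lborel {x. s < norm (T f x)} <= ennreal s * (ennreal (C / (s / 10)) * L1n f)"
        by (rule mult_left_mono) simp
      also have "\<dots> = ennreal (10 * C * (LINT x|lborel. norm (f x)))"
        using s C I0 by (simp add: Lf ennreal_mult[symmetric] del: ennreal_mult'')
      finally show "ennreal s * emeasure lborel {x. s < norm (T f x)} <= ennreal (10 * C * (LINT x|lborel. norm (f x)))" .
    qed
  qed
qed

end

section \<open>Schwartz functions and the theorem\<close>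

lemma schwartz_jw_bound:
  fixes f :: "'a::euclidean_space => complex"
  assumes f: "schwartz f" obtains B where "\<And>x. norm (iter_deriv f vs x) <= B * jw DIM('a) x"
proof -
  define n where "n = DIM('a)"
  have "bounded (range (%x. (1 + norm x) ^ (2 * n) *\<^sub>R iter_deriv f vs x))" using f by (simp add: schwartz_def)
  then obtain B where B: "\<And>x. norm ((1 + norm x) ^ (2 * n) *\<^sub>R iter_deriv f vs x) <= B"
    unfolding bounded_iff by blast
  have "norm (iter_deriv f vs x) <= B * jw n x" for x
  proof -
    have "1 + (norm x)\<^sup>2 <= (1 + norm x)\<^sup>2" by (simp add: power2_eq_square algebra_simps)
    then have "(1 + (norm x)\<^sup>2) ^ n <= ((1 + norm x)\<^sup>2) ^ n" by (intro power_mono) auto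
    then have "(1 + (norm x)\<^sup>2) ^ n <= (1 + norm x) ^ (2 * n)" by (simp add: power_mult)
    then have "(1 + (norm x)\<^sup>2) ^ n * norm (iter_deriv f vs x) <= (1 + norm x) ^ (2 * n) * norm (iter_deriv f vs x)"
      by (rule mult_right_mono) simp
    also have "\<dots> <= B" using B[of x] by simp
    finally have h: "(1 + (norm x)\<^sup>2) ^ n * norm (iter_deriv f vs x) <= B" .
    have "0 < (1 + (norm x)\<^sup>2) ^ n" by (intro zero_less_power add_pos_nonneg) auto
    then show ?thesis using h by (simp add: jw_def pos_le_divide_eq mult.commute)
  qed
  then show thesis using that unfolding n_def by blast
qed

lemma schwartz_integrable:
  fixes f :: "'a::euclidean_space => complex"
  assumes f: "schwartz f" shows "integrable lborel (iter_deriv f vs)"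
proof -
  obtain B where B: "\<And>x. norm (iter_deriv f vs x) <= B * jw DIM('a) x" using schwartz_jw_bound[OF f] by blast
  show ?thesis
  proof (rule Bochner_Integration.integrable_bound)
    show "integrable lborel (%x. B * jw DIM('a) (x::'a))" by (intro integrable_mult_right jw_integrable) simp
    have "iter_deriv f vs \<in> borel_measurable borel"
      using f by (intro borel_measurable_smooth smooth_iter_deriv) (simp add: schwartz_def)
    then show "iter_deriv f vs \<in> borel_measurable lborel" by simp
    show "AE x in lborel. norm (iter_deriv f vs x) <= norm (B * jw DIM('a) x)"
      using B by (intro AE_I2) (simp add: order_trans[OF _ abs_ge_self])
  qed
qed

lemma ft_iter_deriv_schwartz:
  fixes f :: "'a::euclidean_space => complex"
  assumes f: "schwartz f"
  shows "ft lborel (%y. y) (iter_deriv f (replicate k v)) \<xi> = (\<i> * of_real (\<xi> \<bullet> v)) ^ k * ft lborel (%y. y) f \<xi>"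
proof (induction k)
  case (Suc k)
  let ?g = "iter_deriv f (replicate k v)"
  have e: "ee (- y) \<xi> = ee (- \<xi>) y" for y by (simp add: ee_def inner_commute)
  have s: "smooth ?g" using f by (intro smooth_iter_deriv) (simp add: schwartz_def)
  have i: "integrable lborel (dird v ?g)" using schwartz_integrable[OF f, of "v # replicate k v"] by (simp add: iter_deriv_Cons)
  have "ft lborel (%y. y) (iter_deriv f (replicate (Suc k) v)) \<xi> = (LINT y|lborel. ee (- \<xi>) y * dird v ?g y)"
    by (simp add: ft_def e iter_deriv_Cons)
  also have "\<dots> = \<i> * of_real (\<xi> \<bullet> v) * (LINT y|lborel. ee (- \<xi>) y * ?g y)"
    by (subst fourier_dird[OF s schwartz_integrable[OF f] i]) simp
  also have "(LINT y|lborel. ee (- \<xi>) y * ?g y) = ft lborel (%y. y) ?g \<xi>" by (simp add: ft_def e)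
  finally show ?case using Suc by (simp add: mult.assoc)
qed simp

text \<open>Integration by parts along basis vectors bounds pure powers of single coordinates, so
  the weight is compared with the largest coordinate.\<close>

lemma japanese_power_le_coordinates:
  fixes \<xi> :: "'a::euclidean_space"
  shows "(1 + (norm \<xi>)\<^sup>2) ^ n <= (1 + real DIM('a)) ^ n * (1 + (\<Sum>b\<in>Basis. \<bar>\<xi> \<bullet> b\<bar> ^ (2 * n)))"
proof -
  define m where "m = Max ((%b. \<bar>\<xi> \<bullet> b\<bar>) ` Basis)"
  have "m \<in> (%b. \<bar>\<xi> \<bullet> b\<bar>) ` Basis" unfolding m_def by (rule Max_in) auto
  then obtain c where c: "c \<in> Basis" "m = \<bar>\<xi> \<bullet> c\<bar>" by blast
  have mb: "\<bar>\<xi> \<bullet> b\<bar> <= m" if "b \<in> Basis" for b unfolding m_def using that by (intro Max_ge) auto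
  have "(norm \<xi>)\<^sup>2 = (\<Sum>b\<in>Basis. (\<xi> \<bullet> b)\<^sup>2)"
    unfolding power2_norm_eq_inner by (subst euclidean_inner) (simp add: power2_eq_square)
  also have "\<dots> <= (\<Sum>b\<in>(Basis::'a set). m\<^sup>2)"
    by (intro sum_mono abs_le_square_iff[THEN iffD1]) (use mb c(2) in auto)
  finally have N: "(norm \<xi>)\<^sup>2 <= DIM('a) * m\<^sup>2" by simp
  have S: "m ^ (2 * n) <= (\<Sum>b\<in>Basis. \<bar>\<xi> \<bullet> b\<bar> ^ (2 * n))"
    unfolding c(2) by (rule member_le_sum[where f="%b. \<bar>\<xi> \<bullet> b\<bar> ^ (2 * n)"]) (use c(1) in auto)
  have "1 + (norm \<xi>)\<^sup>2 <= (1 + real DIM('a)) * max 1 (m\<^sup>2)"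
  proof -
    have "DIM('a) * m\<^sup>2 <= DIM('a) * max 1 (m\<^sup>2)" by (intro mult_left_mono) auto
    moreover have "1 <= max 1 (m\<^sup>2)" by simp
    ultimately show ?thesis using N by (simp only: distrib_right)
  qed
  then have "(1 + (norm \<xi>)\<^sup>2) ^ n <= ((1 + real DIM('a)) * max 1 (m\<^sup>2)) ^ n" by (intro power_mono) auto
  also have "\<dots> = (1 + real DIM('a)) ^ n * (max 1 (m\<^sup>2)) ^ n" by (rule power_mult_distrib)
  also have "\<dots> <= (1 + real DIM('a)) ^ n * (1 + (\<Sum>b\<in>Basis. \<bar>\<xi> \<bullet> b\<bar> ^ (2 * n)))"
  proof (rule mult_left_mono)
    have "(max 1 (m\<^sup>2)) ^ n <= 1 + m ^ (2 * n)" by (auto simp: max_def power_mult)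
    then show "(max 1 (m\<^sup>2)) ^ n <= 1 + (\<Sum>b\<in>Basis. \<bar>\<xi> \<bullet> b\<bar> ^ (2 * n))" using S by linarith
  qed simp
  finally show ?thesis .
qed

text \<open>A derivative of order 2n along a basis vector multiplies the transform by the 2n-th
  power of a coordinate. Decay of order n in 1 + |\<xi>|^2 is enough to make the transform
  integrable.\<close>

lemma schwartz_ft_bound:
  fixes f :: "'a::euclidean_space => complex"
  assumes f: "schwartz f" obtains B where "\<And>\<xi>. norm (ft lborel (%y. y) f \<xi>) <= B * jw DIM('a) \<xi>"
proof -
  define n where "n = DIM('a)"
  define I where "I b = (LINT y|lborel. norm (iter_deriv f (replicate (2 * n) b) y))" for b
  have Ib: "\<bar>\<xi> \<bullet> b\<bar> ^ (2 * n) * norm (ft lborel (%y. y) f \<xi>) <= I b" for \<xi> b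
  proof -
    have "norm (ft lborel (%y. y) (iter_deriv f (replicate (2 * n) b)) \<xi>) <= I b"
      unfolding I_def by (rule ft_bound[OF datum_lborel[OF schwartz_integrable[OF f]]])
    then show ?thesis unfolding ft_iter_deriv_schwartz[OF f] by (simp add: norm_mult norm_power)
  qed
  define I0 where "I0 = (LINT y|lborel. norm (f y))"
  have fi: "integrable lborel f" using schwartz_integrable[OF f, of "[]"] by simp
  have I0: "norm (ft lborel (%y. y) f \<xi>) <= I0" for \<xi>
    unfolding I0_def by (rule ft_bound[OF datum_lborel[OF fi]])
  define B where "B = (1 + real n) ^ n * (I0 + (\<Sum>b\<in>Basis. I b))"
  have "norm (ft lborel (%y. y) f \<xi>) <= B * jw n \<xi>" for \<xi>
  proof -
    let ?F = "norm (ft lborel (%y. y) f \<xi>)"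
    have "(1 + (norm \<xi>)\<^sup>2) ^ n * ?F <= (1 + real n) ^ n * (1 + (\<Sum>b\<in>Basis. \<bar>\<xi> \<bullet> b\<bar> ^ (2 * n))) * ?F"
      unfolding n_def by (intro mult_right_mono japanese_power_le_coordinates) auto
    also have "\<dots> = (1 + real n) ^ n * (?F + (\<Sum>b\<in>Basis. \<bar>\<xi> \<bullet> b\<bar> ^ (2 * n) * ?F))"
      by (simp add: distrib_right sum_distrib_right mult.assoc)
    also have "\<dots> <= B" unfolding B_def by (intro mult_left_mono add_mono sum_mono I0 Ib) auto
    finally have h: "(1 + (norm \<xi>)\<^sup>2) ^ n * ?F <= B" .
    have "0 < (1 + (norm \<xi>)\<^sup>2) ^ n" by (intro zero_less_power add_pos_nonneg) auto
    then show ?thesis using h by (simp add: jw_def pos_le_divide_eq mult.commute)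
  qed
  then show thesis using that unfolding n_def by blast
qed

lemma pseudo_diff_eq_opT: "pseudo_diff \<sigma> f x = opT \<sigma> (ft lborel (%y. y) f) x"
proof -
  have e: "exp (\<i> * of_real ((x - y) \<bullet> \<xi>)) * \<sigma> (x, \<xi>) * f y = ee x \<xi> * \<sigma> (x, \<xi>) * (ee (- y) \<xi> * f y)" for y \<xi>
  proof -
    have "exp (\<i> * of_real ((x - y) \<bullet> \<xi>)) = cis ((x - y) \<bullet> \<xi>)" by (rule cis_conv_exp[symmetric])
    also have "\<dots> = ee x \<xi> * ee (- y) \<xi>" by (simp add: ee_def inner_diff_left cis_mult)
    finally have "exp (\<i> * of_real ((x - y) \<bullet> \<xi>)) = ee x \<xi> * ee (- y) \<xi>" .
    then show ?thesis by simp
  qed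
  show ?thesis unfolding pseudo_diff_def opT_def ft_def e by (simp only: integral_mult_right_zero)
qed

text \<open>The pieces telescope, so a partial sum is the operator with the symbol cut off at
  |\<xi>| of order 2^J. For a Schwartz input the transform has an integrable majorant and the symbol
  is bounded, hence the partial sums converge pointwise.\<close>

lemma bounded_L1_weak_L1_symb:
  fixes \<sigma> :: "(real^'n) \<times> (real^'n) => complex" and \<rho> \<mu> :: real
  assumes \<sigma>: "symb \<rho> \<mu> \<sigma>" and \<rho>: "1 / 2 <= \<rho>" "\<rho> <= 1" and \<mu>: "\<mu> = CARD('n) * (1 - \<rho>) / 2"
  shows "bounded_L1_weak_L1 (pseudo_diff \<sigma>)"
proof -
  have \<mu>0: "0 <= \<mu>" using \<rho> by (simp add: \<mu>)
  interpret sing \<rho> \<mu> "piece \<sigma>"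
  proof unfold_locales
    show "amp \<rho> \<mu> UNIV (%l. l) (piece \<sigma>)" using amp_piece[OF \<sigma> _ \<rho>(2) \<mu>0] \<rho>(1) by simp
  qed (use \<rho> \<mu> in simp_all)
  have sm: "smooth \<sigma>" using \<sigma> by (simp add: symb_def)
  have [measurable]: "\<sigma> \<in> borel_measurable (borel \<Otimes>\<^sub>M borel)"
    using borel_measurable_smooth[OF sm] by (simp add: borel_prod)
  obtain C where C: "\<forall>p vs. length vs = 0 --> norm (iter_deriv \<sigma> vs p) <= C * japanese (snd p) powr (- \<mu>) *
     (\<Prod>v\<leftarrow>vs. japanese (snd p) powr (- \<rho>) * sqrt ((japanese (snd p))\<^sup>2 * (norm (fst v))\<^sup>2 + (norm (snd v))\<^sup>2))"
    using conjunct2[OF \<sigma>[unfolded symb_def], THEN spec, of 0] by (elim exE)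
  have \<sigma>b: "norm (\<sigma> p) <= \<bar>C\<bar>" for p
  proof -
    have "norm (\<sigma> p) <= C * japanese (snd p) powr (- \<mu>)" using C[rule_format, of "[]" p] by simp
    also have "\<dots> <= \<bar>C\<bar> * 1"
    proof (intro mult_mono)
      have "japanese (snd p) powr (- \<mu>) <= japanese (snd p) powr 0" using \<mu>0 japanese_ge_1[of "snd p"] by (intro powr_mono) auto
      then show "japanese (snd p) powr (- \<mu>) <= 1" using japanese_ge_1[of "snd p"] by simp
    qed auto
    finally show ?thesis by simp
  qed
  show ?thesis
  proof (rule bounded_extension)
    fix f :: "real^'n => complex" assume f: "schwartz f"
    show fi: "integrable lborel f" using schwartz_integrable[OF f, of "[]"] by simp
    fix x
    let ?F = "ft lborel (%y. y) f"
    have [measurable]: "?F \<in> borel_measurable borel" by (rule ft_measurable[OF datum_lborel[OF fi]])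
    obtain B where B: "\<And>\<xi>. norm (?F \<xi>) <= B * jw DIM(real^'n) \<xi>" using schwartz_ft_bound[OF f] by blast
    have S: "(\<Sum>l\<le>J. Tl l f x) = (LINT \<xi>|lborel. ee x \<xi> * \<sigma> (x, \<xi>) * of_real (bump (\<xi> /\<^sub>R 2 ^ J)) * ?F \<xi>)" for J
    proof -
      have "(\<Sum>l\<le>J. Tl l f x) = (LINT \<xi>|lborel. (\<Sum>l\<le>J. ee x \<xi> * piece \<sigma> l (x, \<xi>) * ?F \<xi>))"
        unfolding Tl_def opT_def by (rule Bochner_Integration.integral_sum[symmetric]) (rule integrable_Tl_integrand[OF fi])
      also have "(%\<xi>. \<Sum>l\<le>J. ee x \<xi> * piece \<sigma> l (x, \<xi>) * ?F \<xi>) = (%\<xi>. ee x \<xi> * \<sigma> (x, \<xi>) * of_real (bump (\<xi> /\<^sub>R 2 ^ J)) * ?F \<xi>)"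
        unfolding sum_dyadic[symmetric] by (simp add: piece_def sum_distrib_left sum_distrib_right mult.assoc)
      finally show ?thesis .
    qed
    show "(%J. \<Sum>l\<le>J. Tl l f x) \<longlonglongrightarrow> pseudo_diff \<sigma> f x"
      unfolding S pseudo_diff_eq_opT opT_def
    proof (rule integral_dominated_convergence[where w="%\<xi>. \<bar>C\<bar> * (B * jw DIM(real^'n) \<xi>)"])
      have [measurable]: "(%\<xi>::real^'n. bump (\<xi> /\<^sub>R 2 ^ J)) \<in> borel_measurable borel" for J
        using measurable_compose[OF _ borel_measurable_smooth[OF smooth_bump], of "%\<xi>. \<xi> /\<^sub>R 2 ^ J" borel] by simp
      show "(%\<xi>. ee x \<xi> * \<sigma> (x, \<xi>) * of_real (bump (\<xi> /\<^sub>R 2 ^ J)) * ?F \<xi>) \<in> borel_measurable lborel" for J by measurable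
      show "(%\<xi>. ee x \<xi> * \<sigma> (x, \<xi>) * ?F \<xi>) \<in> borel_measurable lborel" by measurable
      show "integrable lborel (%\<xi>. \<bar>C\<bar> * (B * jw DIM(real^'n) (\<xi>::real^'n)))"
        by (intro integrable_mult_right jw_integrable) simp
      show "AE \<xi> in lborel. (%J. ee x \<xi> * \<sigma> (x, \<xi>) * of_real (bump (\<xi> /\<^sub>R 2 ^ J)) * ?F \<xi>) \<longlonglongrightarrow> ee x \<xi> * \<sigma> (x, \<xi>) * ?F \<xi>"
      proof (rule AE_I2)
        fix \<xi> :: "real^'n"
        obtain K where K: "norm \<xi> <= 2 ^ K" using real_arch_pow[of 2 "norm \<xi>"] by (auto intro: less_imp_le)
        have "bump (\<xi> /\<^sub>R 2 ^ J) = 1" if "K <= J" for J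
        proof (rule bump_eq_1)
          have "norm \<xi> <= 2 ^ J" using order_trans[OF K power_increasing[OF that, of "2::real"]] by simp
          then show "norm (\<xi> /\<^sub>R 2 ^ J) <= 1" by (simp add: field_simps)
        qed
        then have "eventually (%J. ee x \<xi> * \<sigma> (x, \<xi>) * of_real (bump (\<xi> /\<^sub>R 2 ^ J)) * ?F \<xi> = ee x \<xi> * \<sigma> (x, \<xi>) * ?F \<xi>) sequentially"
          unfolding eventually_sequentially by (intro exI[of _ K]) simp
        then show "(%J. ee x \<xi> * \<sigma> (x, \<xi>) * of_real (bump (\<xi> /\<^sub>R 2 ^ J)) * ?F \<xi>) \<longlonglongrightarrow> ee x \<xi> * \<sigma> (x, \<xi>) * ?F \<xi>"
          by (rule tendsto_eventually)
      qed
      show "AE \<xi> in lborel. norm (ee x \<xi> * \<sigma> (x, \<xi>) * of_real (bump (\<xi> /\<^sub>R 2 ^ J)) * ?F \<xi>) <= \<bar>C\<bar> * (B * jw DIM(real^'n) \<xi>)" for J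
      proof (rule AE_I2)
        fix \<xi> :: "real^'n"
        have "norm (ee x \<xi> * \<sigma> (x, \<xi>) * of_real (bump (\<xi> /\<^sub>R 2 ^ J)) * ?F \<xi>) = norm (\<sigma> (x, \<xi>)) * bump (\<xi> /\<^sub>R 2 ^ J) * norm (?F \<xi>)"
          using bump_range(1)[of "\<xi> /\<^sub>R 2 ^ J"] by (simp add: norm_mult)
        also have "\<dots> <= \<bar>C\<bar> * 1 * (B * jw DIM(real^'n) \<xi>)"
          by (intro mult_mono \<sigma>b B bump_range mult_nonneg_nonneg) auto
        finally show "norm (ee x \<xi> * \<sigma> (x, \<xi>) * of_real (bump (\<xi> /\<^sub>R 2 ^ J)) * ?F \<xi>) <= \<bar>C\<bar> * (B * jw DIM(real^'n) \<xi>)" by simp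
      qed
    qed
  qed
qed

section \<open>From the weighted symbol class to the Hoermander class\<close>

lemma prod_list_scaled_le:
  fixes c :: real
  assumes "\<And>v. v \<in> set vs ==> 0 <= f v \<and> f v <= c * g v"
  shows "(\<Prod>v\<leftarrow>vs. f v) <= c ^ length vs * (\<Prod>v\<leftarrow>vs. g v) \<and> 0 <= (\<Prod>v\<leftarrow>vs. f v)"
  using assms
proof (induction vs)
  case (Cons v vs)
  then have ih: "(\<Prod>v\<leftarrow>vs. f v) <= c ^ length vs * (\<Prod>v\<leftarrow>vs. g v)" "0 <= (\<Prod>v\<leftarrow>vs. f v)" by auto
  have v: "0 <= f v" "f v <= c * g v" using Cons.prems[of v] by auto
  have "f v * (\<Prod>v\<leftarrow>vs. f v) <= (c * g v) * (c ^ length vs * (\<Prod>v\<leftarrow>vs. g v))"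
    by (rule mult_mono[OF v(2) ih(1) order_trans[OF v] ih(2)])
  then show ?case using v ih by (simp add: mult_ac)
qed simp

text \<open>The bound 1/m <= C <\<xi>>^(-\<rho>) is used twice: in each factor g^(1/2), where it
  produces the factor of \<open>symb\<close> and altogether C^k, and to the power \<tau> in the
  size, where \<rho>\<tau> >= \<mu> finishes.\<close>

lemma symb_of_symbol_class:
  fixes \<sigma> :: "(real^'n) \<times> (real^'n) => complex" and A :: "real^'n => real^'n^'n" and \<rho> \<mu> \<tau> C :: real
  assumes \<sigma>: "\<sigma> \<in> symbol_class (%p. weight A p powr (- \<tau>)) (phase_metric A)"
    and C: "0 < C" and w: "\<And>(x::real^'n) (\<xi>::real^'n). japanese \<xi> powr \<rho> <= C * weight A (x, \<xi>)"
    and \<tau>: "0 <= \<tau>" "\<mu> <= \<rho> * \<tau>"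
  shows "symb \<rho> \<mu> \<sigma>"
  unfolding symb_def
proof (intro conjI allI)
  show "smooth \<sigma>" using \<sigma> by (simp add: symbol_class_def)
  fix k
  obtain D where D: "0 < D" "\<And>p ts. length ts = k ==> norm (iter_deriv \<sigma> ts p) <= D * weight A p powr (- \<tau>) * (\<Prod>t\<leftarrow>ts. sqrt (phase_metric A p t))"
    using \<sigma> unfolding symbol_class_def by blast
  show "\<exists>C. \<forall>p vs. length vs = k --> norm (iter_deriv \<sigma> vs p) <= C * japanese (snd p) powr (- \<mu>) *
     (\<Prod>v\<leftarrow>vs. japanese (snd p) powr (- \<rho>) * sqrt ((japanese (snd p))\<^sup>2 * (norm (fst v))\<^sup>2 + (norm (snd v))\<^sup>2))"
  proof (intro exI[of _ "D * C powr \<tau> * C ^ k"] allI impI)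
    fix p :: "(real^'n) \<times> (real^'n)" and vs :: "((real^'n) \<times> (real^'n)) list" assume k: "length vs = k"
    obtain x \<xi> where p: "p = (x, \<xi>)" by (cases p)
    define j where "j = japanese \<xi>"
    define W where "W = weight A (x, \<xi>)"
    have j1: "1 <= j" unfolding j_def by (rule japanese_ge_1)
    have jr: "0 < j powr \<rho>" using j1 by simp
    have W: "j powr \<rho> <= C * W" unfolding j_def W_def by (rule w)
    have "0 < C * W" using jr W by linarith
    then have W0: "0 < W" using C by (rule zero_less_mult_pos)
    have inv: "1 / b <= c * (1 / a)" if "a <= c * b" "0 < a" "0 < b" for a b c :: real
      using that by (simp add: field_simps)
    have iW: "1 / W <= C * j powr (- \<rho>)"
      unfolding powr_minus_divide by (rule inv[OF W jr W0])
    have b1: "W powr (- \<tau>) <= C powr \<tau> * j powr (- \<mu>)"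
    proof -
      have "W powr (- \<tau>) = (1 / W) powr \<tau>" using W0 by (simp add: powr_minus_divide powr_divide)
      also have "\<dots> <= (C * j powr (- \<rho>)) powr \<tau>" using \<tau>(1) W0 iW by (intro powr_mono2) auto
      also have "\<dots> = C powr \<tau> * j powr (- (\<rho> * \<tau>))" using C j1 by (simp add: powr_mult powr_powr)
      also have "\<dots> <= C powr \<tau> * j powr (- \<mu>)" using \<tau>(2) j1 by (intro mult_left_mono powr_mono) auto
      finally show ?thesis .
    qed
    let ?q = "%v::(real^'n) \<times> (real^'n). sqrt (j\<^sup>2 * (norm (fst v))\<^sup>2 + (norm (snd v))\<^sup>2)"
    have b2: "(\<Prod>t\<leftarrow>vs. sqrt (phase_metric A p t)) <= C ^ length vs * (\<Prod>v\<leftarrow>vs. j powr (- \<rho>) * ?q v) \<and> 0 <= (\<Prod>t\<leftarrow>vs. sqrt (phase_metric A p t))"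
    proof (rule prod_list_scaled_le)
      fix v :: "(real^'n) \<times> (real^'n)"
      have e: "sqrt (phase_metric A p v) = 1 / W * ?q v"
        using W0 by (simp add: phase_metric_def p W_def j_def case_prod_beta real_sqrt_divide)
      have "1 / W * ?q v <= C * j powr (- \<rho>) * ?q v" by (intro mult_right_mono iW) auto
      then show "0 <= sqrt (phase_metric A p v) \<and> sqrt (phase_metric A p v) <= C * (j powr (- \<rho>) * ?q v)"
        unfolding e using W0 by (simp add: mult.assoc)
    qed
    have "norm (iter_deriv \<sigma> vs p) <= D * W powr (- \<tau>) * (\<Prod>t\<leftarrow>vs. sqrt (phase_metric A p t))"
      using D(2)[OF k, of p] by (simp add: W_def p)
    also have "\<dots> <= (D * (C powr \<tau> * j powr (- \<mu>))) * (C ^ length vs * (\<Prod>v\<leftarrow>vs. j powr (- \<rho>) * ?q v))"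
      using b2 b1 D(1) by (intro mult_mono mult_left_mono) auto
    also have "\<dots> = D * C powr \<tau> * C ^ k * j powr (- \<mu>) * (\<Prod>v\<leftarrow>vs. j powr (- \<rho>) * ?q v)" by (simp add: k)
    finally show "norm (iter_deriv \<sigma> vs p) <= D * C powr \<tau> * C ^ k * japanese (snd p) powr (- \<mu>) *
       (\<Prod>v\<leftarrow>vs. japanese (snd p) powr (- \<rho>) * sqrt ((japanese (snd p))\<^sup>2 * (norm (fst v))\<^sup>2 + (norm (snd v))\<^sup>2))"
      by (simp add: p j_def)
  qed
qed

theorem theorem1p3:
  fixes A :: "real^'n \<Rightarrow> real^'n^'n"
    and X :: "nat \<Rightarrow> real^'n \<Rightarrow> real^'n"
    and \<sigma> :: "(real^'n) \<times> (real^'n) \<Rightarrow> complex"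
    and \<tau> \<kappa> C :: real
    and r\<^sub>0 k r :: nat
  assumes A_psd: "\<And>x. pos_semidef (A x)"
    and A_smooth: "\<And>i j. smooth (\<lambda>x. A x $ i $ j)"
    and A_bounded: "\<And>i j. bounded_with_derivatives (\<lambda>x. A x $ i $ j)"
    and r0: "1 \<le> r\<^sub>0"
    and A_rank: "\<And>x. r\<^sub>0 \<le> rank (A x)"
    and X_smooth: "\<And>j. j \<in> {1..k} \<Longrightarrow> smooth (X j)"
    and X_bounded: "\<And>j. j \<in> {1..k} \<Longrightarrow> bounded (range (X j))"
    and A_X: "\<And>x. A x =
      (\<Sum>j=1..k. transpose (rowvector (X j x) :: real^'n^1) ** (rowvector (X j x) :: real^'n^1))"
    and \<sigma>_symbol: "\<sigma> \<in> symbol_class (\<lambda>p. weight A p powr (- \<tau>)) (phase_metric A)"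
    and \<kappa>_range: "\<kappa> \<in> {1..2}"
    and C_pos: "0 < C"
    and weight_lower: "\<And>x \<xi>. japanese \<xi> powr (\<kappa> / 2) \<le> C * weight A (x, \<xi>)"
    and r_pos: "1 \<le> r"
    and UHC: "uniform_hoermander X k r"
    and \<tau>_lower: "\<tau> \<ge> max
      ((real CARD('n) * (4 - \<kappa>\<^sup>2) - real r\<^sub>0 * (4 - 2 * \<kappa>)) / (2 * \<kappa>\<^sup>2))
      (real CARD('n) / \<kappa> * (1 - \<kappa> / (2 * real r)))"
  shows "bounded_L1_weak_L1 (pseudo_diff \<sigma>)"
proof -
  define n where "n = real CARD('n)"
  have n: "0 <= n" by (simp add: n_def)
  have \<kappa>: "1 <= \<kappa>" "\<kappa> <= 2" using \<kappa>_range by auto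
  \<comment> \<open>As r >= 1, replacing it by 1 can only lower the second entry of the maximum, so
    \<tau> dominates the resulting value.\<close>
  have r: "\<kappa> / (2 * real r) <= \<kappa> / 2" using r_pos \<kappa> by (intro divide_left_mono) auto
  have "n / \<kappa> * (1 - \<kappa> / 2) <= n / \<kappa> * (1 - \<kappa> / (2 * real r))"
    using n \<kappa> r by (intro mult_left_mono) auto
  also have "\<dots> <= \<tau>" using \<tau>_lower by (simp add: n_def)
  finally have \<tau>: "n / \<kappa> * (1 - \<kappa> / 2) <= \<tau>" .
  have "0 <= n / \<kappa> * (1 - \<kappa> / 2)" using n \<kappa> by (intro mult_nonneg_nonneg) auto
  then have \<tau>0: "0 <= \<tau>" using \<tau> by linarith
  \<comment> \<open>With \<rho> = \<kappa>/2 this is \<mu> <= \<rho>\<tau>: the factor \<kappa>/2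
    converts the order measured in m into the order measured in <\<xi>>.\<close>
  have "\<kappa> / 2 * (n / \<kappa> * (1 - \<kappa> / 2)) <= \<kappa> / 2 * \<tau>" using \<tau> \<kappa> by (intro mult_left_mono) auto
  moreover have "\<kappa> / 2 * (n / \<kappa> * (1 - \<kappa> / 2)) = CARD('n) * (1 - \<kappa> / 2) / 2" using \<kappa> by (simp add: n_def)
  ultimately have "CARD('n) * (1 - \<kappa> / 2) / 2 <= \<kappa> / 2 * \<tau>" by simp
  then have "symb (\<kappa> / 2) (CARD('n) * (1 - \<kappa> / 2) / 2) \<sigma>"
    by (rule symb_of_symbol_class[OF \<sigma>_symbol C_pos weight_lower \<tau>0])
  then show ?thesis by (rule bounded_L1_weak_L1_symb) (use \<kappa> in auto)
qed

end
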